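(* Let $\alpha\in(0,2)$ and let $\widetilde T_\alpha>0$ be the number defined in the context. There exists $\varepsilon_0\in(0,1)$ with the following property: for every $T>\widetilde T_\alpha$ there exists a constant $C=C(T,\alpha)>0$ such that, for every $(v^0,v^1)\in L^2(0,1)\times H^{-1}_\alpha$, the solution by transposition $v$ of the homogeneous problem $$v_{tt}-(x^\alpha v_x)_x=0 \text{ in } (0,T)\times(0,1),\quad v(t,1)=0,\quad v(0,\cdot)=v^0,\ v_t(0,\cdot)=v^1,$$ with $v(t,0)=0$ if $\alpha\in(0,1)$, or $\lim_{x\to0^+}(x^\alpha v_x)(t,x)=0$ if $\alpha\in[1,2)$, satisfies $$\|v^0\|_{L^2(0,1)}^2+\|v^1\|_{H^{-1}_\alpha}^2\le \frac{C}{\varepsilon^3}\int_0^T\int_{1-\varepsilon}^1|v(t,x)|^2\,dx\,dt\qquad\text{for all }\varepsilon\in(0,\varepsilon_0).$$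
   Context: Let $Q=(0,T)\times(0,1)$. Spaces. If $\alpha\in(0,1)$, $H^1_\alpha$ is the set of $u\in L^2(0,1)$ that are absolutely continuous on $[0,1]$ with $x^{\alpha/2}u_x\in L^2(0,1)$ and $u(0)=u(1)=0$. If $\alpha\in[1,2)$, $H^1_\alpha$ is the set of $u\in L^2(0,1)$ that are locally absolutely continuous on $(0,1]$ with $x^{\alpha/2}u_x\in L^2(0,1)$ and $u(1)=0$. In both cases $\|u\|_{H^1_\alpha}=(\|u\|_{L^2}^2+\|x^{\alpha/2}u_x\|_{L^2}^2)^{1/2}$, which is equivalent to $\|x^{\alpha/2}u_x\|_{L^2}$. $H^{-1}_\alpha$ is the dual of $H^1_\alpha$, $L^2(0,1)\hookrightarrow H^{-1}_\alpha$ through the $L^2$ inner product, and $\|\xi\|_{H^{-1}_\alpha}$ is the dual norm with respect to $\|x^{\alpha/2}u_x\|_{L^2}$. Weak solution. For $f\in L^1(0,T;L^2(0,1))$ and $(y^0,y^1)\in H^1_\alpha\times L^2(0,1)$, a weak solution of $y_{tt}-(x^\alpha y_x)_x=f$ in $Q$ with boundary conditions $y(t,1)=0$ for $t\in(0,T)$, together with $y(t,0)=0$ if $\alpha\in(0,1)$ or $\lim_{x\to0^+}(x^\alpha y_x)(t,x)=0$ if $\alpha\in[1,2)$, and initial data $(y^0,y^1)$ is $y\in C^0([0,T];H^1_\alpha)\cap C^1([0,T];L^2(0,1))$ with $y(0,\cdot)=y^0$, $y_t(0,\cdot)=y^1$ and $\int_0^T\int_0^1(-y_t w\phi'+x^\alpha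 y_xw_x\phi)\,dx\,dt=\int_0^T\int_0^1 fw\phi\,dx\,dt$ for all $w\in H^1_\alpha$, $\phi\in C_c^\infty(0,T)$. Weak solutions of the backward problem with $\theta(T,\cdot)=\theta_t(T,\cdot)=0$ are defined via $t\mapsto T-t$. Solution by transposition of the homogeneous problem with data $(v^0,v^1)\in L^2(0,1)\times H^{-1}_\alpha$: $v\in L^\infty(0,T;L^2(0,1))$ such that for every $F\in L^1(0,T;L^2(0,1))$, $\int_0^T\int_0^1 vF\,dx\,dt=-(v^0,\theta_t(0,\cdot))_{L^2(0,1)}+\langle v^1,\theta(0,\cdot)\rangle_{H^{-1}_\alpha,H^1_\alpha}$, where $\theta$ is the weak solution of $\theta_{tt}-(x^\alpha\theta_x)_x=F$ in $Q$ with boundary conditions $\theta(t,1)=0$, together with $\theta(t,0)=0$ if $\alpha\in(0,1)$ or $\lim_{x\to0^+}(x^\alpha\theta_x)(t,x)=0$ if $\alpha\in[1,2)$, and $\theta(T,\cdot)=\theta_t(T,\cdot)=0$. It exists and is unique. The time $\widetilde T_\alpha$. Put $\nu=\frac{|1-\alpha|}{2-\alpha}$ and let $0<j_{\nu,1}<j_{\nu,2}<\dots$ be the positive zeros of the Bessel function of the first kind $J_\nu$. Then $\widetilde T_\alpha=\frac{4\pi}{(2-\alpha)(j_{\nu,2}-j_{\nu,1})}$ if $\alpha\le\frac43$, and $\widetilde T_\alpha=\frac{4}{2-\alpha}$ if $\frac43<\alpha<2$. *)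

theory Defs
  imports "HOL-Analysis.Analysis"
begin

section \<open>The space of square-integrable functions on the unit interval\<close>

text \<open>
  Elements of function spaces are represented by functions on the whole line; only their
  restrictions to the interval (up to null sets) matter.
\<close>

definition L2 :: "(real \<Rightarrow> real) set" where
  "L2 = {u. u \<in> borel_measurable (lebesgue_on {0<..<1}) \<and>
            integrable (lebesgue_on {0<..<1}) (\<lambda>x. (u x)\<^sup>2)}"

definition L2_norm :: "(real \<Rightarrow> real) \<Rightarrow> real" where
  "L2_norm u = sqrt (LINT x|lebesgue_on {0<..<1}. (u x)\<^sup>2)"

definition L2_inner :: "(real \<Rightarrow> real) \<Rightarrow> (real \<Rightarrow> real) \<Rightarrow> real" where
  "L2_inner u w = (LINT x|lebesgue_on {0<..<1}. u x * w x)"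

section \<open>The weighted spaces and the dual space\<close>

definition absolutely_cont_on :: "real set \<Rightarrow> (real \<Rightarrow> real) \<Rightarrow> bool" where
  "absolutely_cont_on S u \<longleftrightarrow>
     (\<forall>e>0. \<exists>d>0. \<forall>\<D>. \<D> division_of \<Union>\<D> \<and> \<Union>\<D> \<subseteq> S \<and> (\<Sum>k\<in>\<D>. measure lborel k) < d \<longrightarrow>
        (\<Sum>k\<in>\<D>. \<bar>u (Sup k) - u (Inf k)\<bar>) < e)"

text \<open>
  The derivative \<open>u\<^sub>x\<close> is the pointwise one, which exists almost everywhere for (locally)
  absolutely continuous functions; the junk value of \<open>deriv u\<close> elsewhere is immaterial.
\<close>

definition H1 :: "real \<Rightarrow> (real \<Rightarrow> real) set" where
  "H1 \<alpha> =
     (if \<alpha> < 1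
      then {u. u \<in> L2 \<and> absolutely_cont_on {0..1} u \<and>
               (\<lambda>x. x powr (\<alpha>/2) * deriv u x) \<in> L2 \<and> u 0 = 0 \<and> u 1 = 0}
      else {u. u \<in> L2 \<and> (\<forall>\<delta>. 0 < \<delta> \<and> \<delta> < 1 \<longrightarrow> absolutely_cont_on {\<delta>..1} u) \<and>
               (\<lambda>x. x powr (\<alpha>/2) * deriv u x) \<in> L2 \<and> u 1 = 0})"

definition H1_seminorm :: "real \<Rightarrow> (real \<Rightarrow> real) \<Rightarrow> real" where
  "H1_seminorm \<alpha> u = L2_norm (\<lambda>x. x powr (\<alpha>/2) * deriv u x)"

definition H1_norm :: "real \<Rightarrow> (real \<Rightarrow> real) \<Rightarrow> real" where
  "H1_norm \<alpha> u = sqrt ((L2_norm u)\<^sup>2 + (H1_seminorm \<alpha> u)\<^sup>2)"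

text \<open>
  Bounded linear functionals on \<open>H1 \<alpha>\<close>. Boundedness makes them invariant under the choice of
  representative; their values outside \<open>H1 \<alpha>\<close> are unconstrained and irrelevant.
\<close>

definition Hm1 :: "real \<Rightarrow> ((real \<Rightarrow> real) \<Rightarrow> real) set" where
  "Hm1 \<alpha> = {\<xi>.
     (\<forall>u\<in>H1 \<alpha>. \<forall>w\<in>H1 \<alpha>. \<xi> (\<lambda>x. u x + w x) = \<xi> u + \<xi> w) \<and>
     (\<forall>c. \<forall>u\<in>H1 \<alpha>. \<xi> (\<lambda>x. c * u x) = c * \<xi> u) \<and>
     (\<exists>K. \<forall>u\<in>H1 \<alpha>. \<bar>\<xi> u\<bar> \<le> K * H1_norm \<alpha> u)}"

definition Hm1_norm :: "real \<Rightarrow> ((real \<Rightarrow> real) \<Rightarrow> real) \<Rightarrow> real" where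
  "Hm1_norm \<alpha> \<xi> = (SUP u\<in>{u \<in> H1 \<alpha>. H1_seminorm \<alpha> u \<le> 1}. \<bar>\<xi> u\<bar>)"

section \<open>Functions of time and space\<close>

text \<open>
  The Bochner spaces \<open>L\<^sup>1(0,T;L\<^sup>2(0,1))\<close> and \<open>L\<^sup>\<infinity>(0,T;L\<^sup>2(0,1))\<close>: since \<open>L\<^sup>2(0,1)\<close> is separable,
  their elements are the classes of jointly measurable functions with the indicated mixed norm.
\<close>

definition L1_L2 :: "real \<Rightarrow> (real \<Rightarrow> real \<Rightarrow> real) set" where
  "L1_L2 T = {f.
     (\<lambda>(t, x). f t x) \<in> borel_measurable (lebesgue_on ({0<..<T} \<times> {0<..<1})) \<and>
     (AE t in lebesgue_on {0<..<T}. f t \<in> L2) \<and>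
     integrable (lebesgue_on {0<..<T}) (\<lambda>t. L2_norm (f t))}"

definition Linf_L2 :: "real \<Rightarrow> (real \<Rightarrow> real \<Rightarrow> real) set" where
  "Linf_L2 T = {f.
     (\<lambda>(t, x). f t x) \<in> borel_measurable (lebesgue_on ({0<..<T} \<times> {0<..<1})) \<and>
     (\<exists>M. AE t in lebesgue_on {0<..<T}. f t \<in> L2 \<and> L2_norm (f t) \<le> M)}"

definition C0_H1 :: "real \<Rightarrow> real \<Rightarrow> (real \<Rightarrow> real \<Rightarrow> real) set" where
  "C0_H1 \<alpha> T = {y.
     (\<forall>t\<in>{0..T}. y t \<in> H1 \<alpha>) \<and>
     (\<forall>t\<in>{0..T}. ((\<lambda>s. H1_norm \<alpha> (\<lambda>x. y s x - y t x)) \<longlongrightarrow> 0) (at t within {0..T}))}"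

definition C0_L2 :: "real \<Rightarrow> (real \<Rightarrow> real \<Rightarrow> real) set" where
  "C0_L2 T = {y.
     (\<forall>t\<in>{0..T}. y t \<in> L2) \<and>
     (\<forall>t\<in>{0..T}. ((\<lambda>s. L2_norm (\<lambda>x. y s x - y t x)) \<longlongrightarrow> 0) (at t within {0..T}))}"

text \<open>\<open>y \<in> C\<^sup>1([0,T];L\<^sup>2(0,1))\<close> with time derivative \<open>y'\<close>.\<close>

definition C1_L2_with :: "real \<Rightarrow> (real \<Rightarrow> real \<Rightarrow> real) \<Rightarrow> (real \<Rightarrow> real \<Rightarrow> real) \<Rightarrow> bool" where
  "C1_L2_with T y y' \<longleftrightarrow> y \<in> C0_L2 T \<and> y' \<in> C0_L2 T \<and>
     (\<forall>t\<in>{0..T}. ((\<lambda>s. L2_norm (\<lambda>x. (y s x - y t x) / (s - t) - y' t x)) \<longlongrightarrow> 0)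
        (at t within {0..T}))"

definition test_functions :: "real \<Rightarrow> (real \<Rightarrow> real) set" where
  "test_functions T = {\<phi>.
     (\<forall>n t. (deriv ^^ n) \<phi> field_differentiable at t) \<and>
     (\<exists>K. compact K \<and> K \<subseteq> {0<..<T} \<and> (\<forall>t. t \<notin> K \<longrightarrow> \<phi> t = 0))}"

section \<open>Weak solutions and solutions by transposition\<close>

text \<open>
  \<open>y\<close> is a weak solution of \<open>y\<^sub>t\<^sub>t - (x\<^sup>\<alpha> y\<^sub>x)\<^sub>x = f\<close> with initial data \<open>(y0, y1)\<close>, and \<open>y'\<close> is its time
  derivative. The Dirichlet conditions are part of the membership in \<open>H1 \<alpha>\<close>, and the condition
  on \<open>x\<^sup>\<alpha> y\<^sub>x\<close> at \<open>0\<close> for \<open>\<alpha> \<ge> 1\<close> is the natural one, encoded in the variational identity.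
\<close>

definition weak_solution ::
  "real \<Rightarrow> real \<Rightarrow> (real \<Rightarrow> real \<Rightarrow> real) \<Rightarrow> (real \<Rightarrow> real) \<Rightarrow> (real \<Rightarrow> real) \<Rightarrow>
   (real \<Rightarrow> real \<Rightarrow> real) \<Rightarrow> (real \<Rightarrow> real \<Rightarrow> real) \<Rightarrow> bool" where
  "weak_solution \<alpha> T f y0 y1 y y' \<longleftrightarrow>
     y \<in> C0_H1 \<alpha> T \<and> C1_L2_with T y y' \<and>
     (AE x in lebesgue_on {0<..<1}. y 0 x = y0 x) \<and>
     (AE x in lebesgue_on {0<..<1}. y' 0 x = y1 x) \<and>
     (\<forall>w\<in>H1 \<alpha>. \<forall>\<phi>\<in>test_functions T.
        (LINT t|lebesgue_on {0<..<T}. LINT x|lebesgue_on {0<..<1}.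
            - y' t x * w x * deriv \<phi> t + x powr \<alpha> * deriv (y t) x * deriv w x * \<phi> t)
        = (LINT t|lebesgue_on {0<..<T}. LINT x|lebesgue_on {0<..<1}. f t x * w x * \<phi> t))"

text \<open>The backward problem with zero data at time \<open>T\<close>, by time reversal.\<close>

definition backward_weak_solution ::
  "real \<Rightarrow> real \<Rightarrow> (real \<Rightarrow> real \<Rightarrow> real) \<Rightarrow>
   (real \<Rightarrow> real \<Rightarrow> real) \<Rightarrow> (real \<Rightarrow> real \<Rightarrow> real) \<Rightarrow> bool" where
  "backward_weak_solution \<alpha> T F \<theta> \<theta>' \<longleftrightarrow>
     weak_solution \<alpha> T (\<lambda>t. F (T - t)) (\<lambda>x. 0) (\<lambda>x. 0)
       (\<lambda>t. \<theta> (T - t)) (\<lambda>t x. - \<theta>' (T - t) x)"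

definition transposition_solution ::
  "real \<Rightarrow> real \<Rightarrow> (real \<Rightarrow> real) \<Rightarrow> ((real \<Rightarrow> real) \<Rightarrow> real) \<Rightarrow>
   (real \<Rightarrow> real \<Rightarrow> real) \<Rightarrow> bool" where
  "transposition_solution \<alpha> T v0 v1 v \<longleftrightarrow>
     v \<in> Linf_L2 T \<and>
     (\<forall>F\<in>L1_L2 T. \<forall>\<theta> \<theta>'. backward_weak_solution \<alpha> T F \<theta> \<theta>' \<longrightarrow>
        (LINT t|lebesgue_on {0<..<T}. LINT x|lebesgue_on {0<..<1}. v t x * F t x)
        = - L2_inner v0 (\<theta>' 0) + v1 (\<theta> 0))"

section \<open>Bessel zeros and the critical time\<close>

definition Bessel_J :: "real \<Rightarrow> real \<Rightarrow> real" where
  "Bessel_J \<nu> x =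
     (\<Sum>m. (-1) ^ m / (fact m * Gamma (real m + \<nu> + 1)) * (x / 2) powr (2 * real m + \<nu>))"

text \<open>The \<open>k\<close>-th positive zero in increasing order, for \<open>k \<ge> 1\<close>.\<close>

definition Bessel_zero :: "real \<Rightarrow> nat \<Rightarrow> real" where
  "Bessel_zero \<nu> k =
     (THE x. 0 < x \<and> Bessel_J \<nu> x = 0 \<and> card {z. 0 < z \<and> z \<le> x \<and> Bessel_J \<nu> z = 0} = k)"

definition critical_time :: "real \<Rightarrow> real" where
  "critical_time \<alpha> =
     (let \<nu> = \<bar>1 - \<alpha>\<bar> / (2 - \<alpha>)
      in if \<alpha> \<le> 4/3 then 4 * pi / ((2 - \<alpha>) * (Bessel_zero \<nu> 2 - Bessel_zero \<nu> 1))
         else 4 / (2 - \<alpha>))"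

end

theory Submission
 imports Defs "HOL-Complex_Analysis.Complex_Analysis"
begin

text \<open>
  The proof uses multipliers and no spectral expansion. Sturm comparison for \<open>\<surd>x J\<^sub>\<nu>\<close> shows that
  the first Bessel gap is at most \<open>\<pi>\<close> when \<open>\<alpha> \<le> 4/3\<close>, so \<open>T\<close> always exceeds \<open>4/(2-\<alpha>)\<close>, and beyond this
  time the multiplier \<open>x z\<^sub>x + \<alpha>/4 z\<close> controls the energy of a classical solution by its flux at \<open>x = 1\<close>.
  Cutoff multipliers bound that flux by integrals over the strip. The term in \<open>z\<close> is removed by
  splitting off a time average of \<open>z\<close>.

  Let \<open>S\<close> invert \<open>u \<mapsto> -(x\<^sup>\<alpha> u\<^sub>x)\<^sub>x\<close>. Testing the definition of \<open>v\<close> with \<open>\<theta> = g(t) S f\<close> shows that averages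
  of \<open>S v\<close> in time against a smooth kernel of width \<open>\<eta>\<close> are classical solutions, so they satisfy the
  estimate, with a constant independent of \<open>\<eta>\<close>. As \<open>\<eta> \<rightarrow> 0\<close> their initial data, tested with \<open>S f\<close>, tend
  to \<open>(v0, S f)\<close> and \<open>v1 (S f)\<close>; since the range of \<open>S\<close> is dense, both norms follow by duality.
\<close>

text \<open>The norms to be bounded lie one order below the energy, so the energy method is applied
  to a time primitive \<open>z\<close> of the mollified \<open>v\<close>. Then \<open>z_t\<close> is
  the mollified \<open>v\<close> itself, and the energy of \<open>z\<close> measures it in
  \<open>L2\<close> and its time derivative in the dual norm. The equation gives primitives without
  constants of integration: \<open>z = - S v_t\<close>, and once more \<open>Z = - S v\<close>. The
  degenerate end \<open>x = 0\<close> is the obstacle. Every identity is taken on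
  \<open>[a, 1]\<close>, and its terms at \<open>a\<close> are bounded by explicit functions of
  \<open>a\<close> that tend to 0. This limit is taken with the kernel width \<eta> fixed, so that
  the growth of the kernels as \<eta> shrinks multiplies only vanishing terms; hence the constant
  does not depend on \<eta>. The time \<open>4/(2-\<alpha>)\<close> arises because the multiplier
  integral is at most one energy at each end of the time interval, a loss of 2 against a gain of
  \<open>(2-\<alpha>)/2\<close> per unit of time. In the power 3, one factor comes from the cutoff
  in the flux multiplier, and two more from the cutoff in the multiplier that removes the interior
  flux.\<close>

abbreviation "Borel \<equiv> borel_measurable borel"

section \<open>Gaps between Bessel zeros\<close>

definition bessel_coeff :: "real => nat => real" where
 "bessel_coeff \<nu> m = (-1) ^ m / (fact m * Gamma (real m + \<nu> + 1))"

lemma bessel_coeff_Suc: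
 assumes "0 <= \<nu>"
 shows "(real m + 1) * (real m + 1 + \<nu>) * bessel_coeff \<nu> (Suc m) = - bessel_coeff \<nu> m"
proof -
 define n g k where "n = real m + 1 + \<nu>" and "g = Gamma n" and "k = real m + 1"
 have pos: "0 < n" "0 < k" using assms by (auto simp: n_def k_def)
 have g: "0 < g" unfolding g_def by (rule Gamma_real_pos[OF pos(1)])
 have "Gamma (n + 1) = n * g"
  unfolding g_def using pos by (intro Gamma_plus1) (auto simp: nonpos_Ints_def)
 moreover have "real (Suc m) + \<nu> + 1 = n + 1" by (simp add: n_def)
 ultimately have G1: "Gamma (real (Suc m) + \<nu> + 1) = n * g" by (simp only:)
 have "real m + \<nu> + 1 = n" by (simp add: n_def)
 then have G0: "Gamma (real m + \<nu> + 1) = g" unfolding g_def by (simp only:)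
 have f: "fact (Suc m) = k * fact m" by (simp add: k_def)
 have "bessel_coeff \<nu> (Suc m) = - ((-1) ^ m) / (k * fact m * (n * g))"
  unfolding bessel_coeff_def G1 f by simp
 moreover have "bessel_coeff \<nu> m = (-1) ^ m / (fact m * g)"
  unfolding bessel_coeff_def G0 by simp
 ultimately show ?thesis unfolding n_def[symmetric] unfolding k_def[symmetric] using pos g by simp
qed

lemma bessel_coeff_bound:
 assumes "0 <= \<nu>"
 shows "\<bar>bessel_coeff \<nu> m\<bar> <= \<bar>bessel_coeff \<nu> 0\<bar> / fact m"
proof (induction m)
 case (Suc m)
 have p: "0 < (real m + 1) * (real m + 1 + \<nu>)" using assms by simp
 have "(real m + 1) * \<bar>bessel_coeff \<nu> (Suc m)\<bar> <= (real m + 1) * (real m + 1 + \<nu>) * \<bar>bessel_coeff \<nu> (Suc m)\<bar>"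
  using assms by (intro mult_right_mono) (auto simp: algebra_simps)
 also have "... = \<bar>(real m + 1) * (real m + 1 + \<nu>) * bessel_coeff \<nu> (Suc m)\<bar>"
  using p unfolding abs_mult[of "_ * _"] by simp
 also have "... = \<bar>bessel_coeff \<nu> m\<bar>" using bessel_coeff_Suc[OF assms] by simp
 also have "... <= \<bar>bessel_coeff \<nu> 0\<bar> / fact m" by (rule Suc)
 finally have "\<bar>bessel_coeff \<nu> (Suc m)\<bar> <= \<bar>bessel_coeff \<nu> 0\<bar> / fact m / (real m + 1)"
  by (simp add: pos_le_divide_eq mult_ac)
 then show ?case by (simp add: add.commute mult.commute)
qed simp

text \<open>Both scalar fields are used: the real series yields the differential equation, the
  complex one the isolation of the zeros.\<close>

lemma bessel_coeff_summable:
 assumes "0 <= \<nu>"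
 shows "summable (%m. of_real (bessel_coeff \<nu> m) * z ^ m :: 'a :: {banach, real_normed_field})"
proof (rule summable_comparison_test)
 have "summable (%m. \<bar>bessel_coeff \<nu> 0\<bar> * (inverse (fact m) * norm z ^ m))"
  by (intro summable_mult summable_exp)
 then show "summable (%m. \<bar>bessel_coeff \<nu> 0\<bar> / fact m * norm z ^ m)"
  by (simp add: field_simps)
 show "\<exists>N. \<forall>m\<ge>N. norm (of_real (bessel_coeff \<nu> m) * z ^ m) <= \<bar>bessel_coeff \<nu> 0\<bar> / fact m * norm z ^ m"
  using mult_right_mono[OF bessel_coeff_bound[OF assms], of "norm z ^ _"] by (auto simp: norm_mult norm_power)
qed

text \<open>\<open>J\<^sub>\<nu>(x) = (x/2)\<^sup>\<nu> F(x\<^sup>2/4)\<close> with \<open>F\<close> entire.\<close>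

definition bessel_entire :: "real => real => real" where
 "bessel_entire \<nu> s = (\<Sum>m. bessel_coeff \<nu> m * s ^ m)"

lemma Bessel_J_eq:
 assumes "0 <= \<nu>" "0 < x"
 shows "Bessel_J \<nu> x = (x/2) powr \<nu> * bessel_entire \<nu> (x^2 / 4)"
proof -
 have eq: "(-1) ^ m / (fact m * Gamma (real m + \<nu> + 1)) * (x / 2) powr (2 * real m + \<nu>)
   = (x/2) powr \<nu> * (bessel_coeff \<nu> m * (x^2 / 4) ^ m)" for m
 proof -
  have "(x/2) powr (2 * real m + \<nu>) = (x/2) powr \<nu> * (x/2) powr (real (2 * m))"
   by (simp add: powr_add[symmetric] add.commute)
  also have "(x/2) powr (real (2 * m)) = (x/2) ^ (2 * m)" using assms by (intro powr_realpow) auto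
  also have "... = (x^2/4) ^ m" by (simp add: power_mult power_divide)
  finally show ?thesis unfolding bessel_coeff_def by (simp add: mult_ac)
 qed
 show ?thesis unfolding Bessel_J_def bessel_entire_def eq
  using bessel_coeff_summable[OF assms(1), of "x^2/4"] by (intro suminf_mult) simp
qed

text \<open>This is the recursion of the coefficients read off power by power. In the variable
  \<open>s = x^2/4\<close> Bessel's equation loses its fractional powers.\<close>

lemma bessel_entire_ode:
 assumes "0 <= \<nu>"
 obtains F1 F2 where "!!s. (bessel_entire \<nu> has_real_derivative F1 s) (at s)"
  "!!s. (F1 has_real_derivative F2 s) (at s)"
  "!!s. s * F2 s + (\<nu> + 1) * F1 s + bessel_entire \<nu> s = 0"
proof -
 let ?c = "bessel_coeff \<nu>"
 have s0: "summable (%m. ?c m * s ^ m)" for s :: real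
  using bessel_coeff_summable[OF assms, of s] by simp
 have s1: "summable (%m. diffs ?c m * s ^ m)" for s by (rule termdiff_converges_all[OF s0])
 have s2: "summable (%m. diffs (diffs ?c) m * s ^ m)" for s by (rule termdiff_converges_all[OF s1])
 show thesis
 proof (rule that)
  show "(bessel_entire \<nu> has_real_derivative (\<Sum>m. diffs ?c m * s ^ m)) (at s)" for s
   unfolding bessel_entire_def[abs_def] by (rule termdiffs_strong_converges_everywhere[OF s0])
  show "((%s. \<Sum>m. diffs ?c m * s ^ m) has_real_derivative (\<Sum>m. diffs (diffs ?c) m * s ^ m)) (at s)" for s
   by (rule termdiffs_strong_converges_everywhere[OF s1])
  fix s :: real
  have "(%m. s * (diffs (diffs ?c) m * s ^ m)) sums (s * (\<Sum>m. diffs (diffs ?c) m * s ^ m))"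
   by (intro sums_mult summable_sums s2)
  then have "(%m. real (Suc m) * diffs ?c (Suc m) * s ^ Suc m) sums (s * (\<Sum>m. diffs (diffs ?c) m * s ^ m))"
   by (simp add: diffs_def[of "diffs ?c"] mult_ac)
  \<comment> \<open>The index shift is free, since the factor \<open>real m\<close> kills the term
    at 0.\<close>
  then have "(%m. real m * diffs ?c m * s ^ m) sums (s * (\<Sum>m. diffs (diffs ?c) m * s ^ m))"
   using sums_Suc_iff[of "%m. real m * diffs ?c m * s ^ m"] by simp
  moreover have "(%m. (\<nu> + 1) * (diffs ?c m * s ^ m)) sums ((\<nu> + 1) * (\<Sum>m. diffs ?c m * s ^ m))"
   by (intro sums_mult summable_sums s1)
  moreover have "(%m. ?c m * s ^ m) sums bessel_entire \<nu> s"
   unfolding bessel_entire_def by (intro summable_sums s0)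
  ultimately have "(%m. real m * diffs ?c m * s ^ m + (\<nu> + 1) * (diffs ?c m * s ^ m) + ?c m * s ^ m) sums
   (s * (\<Sum>m. diffs (diffs ?c) m * s ^ m) + (\<nu> + 1) * (\<Sum>m. diffs ?c m * s ^ m) + bessel_entire \<nu> s)"
   by (intro sums_add)
  moreover have "real m * diffs ?c m * s ^ m + (\<nu> + 1) * (diffs ?c m * s ^ m) + ?c m * s ^ m = 0" for m
  proof -
   have "real m * diffs ?c m + (\<nu> + 1) * diffs ?c m + ?c m = 0"
    using bessel_coeff_Suc[OF assms, of m] by (simp add: diffs_def algebra_simps)
   then have "(real m * diffs ?c m + (\<nu> + 1) * diffs ?c m + ?c m) * s ^ m = 0" by simp
   then show ?thesis by (simp only: distrib_right mult.assoc)
  qed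
  ultimately show "s * (\<Sum>m. diffs (diffs ?c) m * s ^ m) + (\<nu> + 1) * (\<Sum>m. diffs ?c m * s ^ m) + bessel_entire \<nu> s = 0"
   by (simp add: sums_unique2[OF _ sums_zero])
 qed
qed

text \<open>Liouville normal form: \<open>u = \<surd>x J\<^sub>\<nu>\<close> solves \<open>u'' + (1 + (1/4 - \<nu>\<^sup>2)/x\<^sup>2) u = 0\<close>.\<close>

lemma bessel_normal_form:
 assumes "0 <= \<nu>"
 obtains u u1 where "!!x. 0 < x ==> (u has_real_derivative u1 x) (at x)"
  "!!x. 0 < x ==> (u1 has_real_derivative ((\<nu>\<^sup>2 - 1/4) / x^2 - 1) * u x) (at x)"
  "!!x. 0 < x ==> u x = 0 \<longleftrightarrow> Bessel_J \<nu> x = 0"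
proof -
 obtain F1 F2 where F: "!!s. (bessel_entire \<nu> has_real_derivative F1 s) (at s)"
  "!!s. (F1 has_real_derivative F2 s) (at s)"
  "!!s. s * F2 s + (\<nu> + 1) * F1 s + bessel_entire \<nu> s = 0"
  using bessel_entire_ode[OF assms] by blast
 define u where "u x = x powr (\<nu> + 1/2) * bessel_entire \<nu> (x^2/4)" for x
 define u1 where "u1 x = (\<nu> + 1/2) * x powr (\<nu> - 1/2) * bessel_entire \<nu> (x^2/4) + x powr (\<nu> + 3/2) * F1 (x^2/4) / 2" for x
 have chain: "((%x. f (x^2/4)) has_real_derivative f' (x^2/4) * (x / 2)) (at x)"
  if "!!s. (f has_real_derivative f' s) (at s)" for f f' :: "real => real" and x
  by (rule DERIV_chain2[OF that]) (auto intro!: derivative_eq_intros)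
 have pw: "x powr s = x * x powr r" if "0 < x" "s = r + 1" for x r s :: real using that by (simp add: powr_add)
 show thesis
 proof (rule that)
  fix x :: real assume x: "0 < x"
  have e1: "x powr (\<nu> + 1/2) = x * x powr (\<nu> - 1/2)" by (rule pw[OF x]) simp
  have e2: "x powr (\<nu> + 3/2) = x * (x * x powr (\<nu> - 1/2))" unfolding e1[symmetric] by (rule pw[OF x]) simp
  have e3: "x powr (\<nu> - 1/2) = x * x powr (\<nu> - 3/2)" by (rule pw[OF x]) simp
  have P: "((%x. x powr r) has_real_derivative r * x powr (r - 1)) (at x)" for r
   by (rule has_real_derivative_powr[OF x])
  show "(u has_real_derivative u1 x) (at x)"
   unfolding u_def[abs_def] u1_def
   by (rule DERIV_cong[OF DERIV_mult[OF P chain[OF F(1)]]]) (simp add: e1 e2 algebra_simps)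
  have "(u1 has_real_derivative (\<nu> + 1/2) * ((\<nu> - 1/2) * x powr (\<nu> - 3/2) * bessel_entire \<nu> (x^2/4)
     + F1 (x^2/4) * (x / 2) * x powr (\<nu> - 1/2))
    + ((\<nu> + 3/2) * x powr (\<nu> + 1/2) * F1 (x^2/4) + F2 (x^2/4) * (x / 2) * x powr (\<nu> + 3/2)) / 2) (at x)"
  proof -
   have "(u1 has_real_derivative (\<nu> + 1/2) * ((\<nu> - 1/2) * x powr (\<nu> - 1/2 - 1) * bessel_entire \<nu> (x^2/4)
      + F1 (x^2/4) * (x / 2) * x powr (\<nu> - 1/2))
     + ((\<nu> + 3/2) * x powr (\<nu> + 3/2 - 1) * F1 (x^2/4) + F2 (x^2/4) * (x / 2) * x powr (\<nu> + 3/2)) / 2) (at x)"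
    unfolding u1_def[abs_def] mult.assoc[of "\<nu> + 1/2"]
    by (intro DERIV_add DERIV_cmult DERIV_cdivide DERIV_mult P chain F)
   moreover have "\<nu> - 1/2 - 1 = \<nu> - 3/2" "\<nu> + 3/2 - 1 = \<nu> + 1/2" by simp_all
   ultimately show ?thesis by (simp only:)
  qed
  moreover have "(\<nu> + 1/2) * ((\<nu> - 1/2) * x powr (\<nu> - 3/2) * bessel_entire \<nu> (x^2/4)
     + F1 (x^2/4) * (x / 2) * x powr (\<nu> - 1/2))
    + ((\<nu> + 3/2) * x powr (\<nu> + 1/2) * F1 (x^2/4) + F2 (x^2/4) * (x / 2) * x powr (\<nu> + 3/2)) / 2
   = ((\<nu>\<^sup>2 - 1/4) / x^2 - 1) * u x"
  proof -
   define p where "p = x powr (\<nu> - 3/2)"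
   define B where "B = bessel_entire \<nu> (x^2/4)"
   define f where "f = F1 (x^2/4)"
   define g where "g = F2 (x^2/4)"
   have ode: "x * x / 4 * g + (\<nu> + 1) * f + B = 0"
    using F(3)[of "x^2/4"] by (simp add: B_def f_def g_def power2_eq_square)
   have "((\<nu>\<^sup>2 - 1/4) / x^2 - 1) * (x * (x * p) * B) = (\<nu> * \<nu> - 1/4) * p * B - x * x * p * B"
   proof -
    have "c / x^2 * (x * (x * p) * B) = c * p * B" for c using x by (simp add: power2_eq_square)
    then show ?thesis by (simp add: left_diff_distrib[of "_ / _" 1] power2_eq_square[of \<nu>])
   qed
   moreover have "(\<nu> + 1/2) * ((\<nu> - 1/2) * p * B + f * (x / 2) * (x * p))
     + ((\<nu> + 3/2) * (x * (x * p)) * f + g * (x / 2) * (x * (x * (x * p)))) / 2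
     - ((\<nu> * \<nu> - 1/4) * p * B - x * x * p * B) = p * x * x * (x * x / 4 * g + (\<nu> + 1) * f + B)"
    by (simp add: algebra_simps add_divide_distrib diff_divide_distrib)
   ultimately show ?thesis
    unfolding u_def e2 e1 unfolding e3 p_def[symmetric] B_def[symmetric] f_def[symmetric] g_def[symmetric] ode
    by simp
  qed
  ultimately show "(u1 has_real_derivative ((\<nu>\<^sup>2 - 1/4) / x^2 - 1) * u x) (at x)" by simp
  show "u x = 0 \<longleftrightarrow> Bessel_J \<nu> x = 0"
   unfolding u_def Bessel_J_eq[OF assms x] using x by simp
 qed
qed

text \<open>Sturm comparison with \<open>sin (x - a)\<close>: for \<nu> at most 1/2 the potential in
  the normal form is at least 1. The interval is open at \<open>a\<close> because the gap is
  obtained by starting at a zero.\<close>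

lemma bessel_zero_in_interval:
 assumes \<nu>: "0 <= \<nu>" "\<nu> <= 1/2" and a: "0 < a"
 shows "\<exists>x. a < x & x <= a + pi & Bessel_J \<nu> x = 0"
proof (rule ccontr)
 assume no: "\<not> ?thesis"
 obtain u u1 where u: "!!x. 0 < x ==> (u has_real_derivative u1 x) (at x)"
  "!!x. 0 < x ==> (u1 has_real_derivative ((\<nu>\<^sup>2 - 1/4) / x^2 - 1) * u x) (at x)"
  "!!x. 0 < x ==> u x = 0 \<longleftrightarrow> Bessel_J \<nu> x = 0"
  using bessel_normal_form[OF \<nu>(1)] by blast
 have nz: "u x ~= 0" if "a < x" "x <= a + pi" for x using no u(3)[of x] that a by auto
 have cont: "isCont u x" if "0 < x" for x using u(1)[OF that] by (rule DERIV_isCont)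
 \<comment> \<open>Without zeros \<open>u\<close> keeps the sign that it has at the right end;
   multiplication by this sign makes it positive.\<close>
 define \<sigma> where "\<sigma> = sgn (u (a + pi))"
 have pos: "0 < \<sigma> * u x" if x: "a < x" "x <= a + pi" for x
 proof (rule ccontr)
  assume "\<not> 0 < \<sigma> * u x"
  then have le: "\<sigma> * u x <= 0" by simp
  have end_pos: "0 <= \<sigma> * u (a + pi)" unfolding \<sigma>_def by (simp add: sgn_if)
  have "\<exists>y. x <= y & y <= a + pi & \<sigma> * u y = 0"
   by (rule IVT[OF le end_pos x(2)]) (use x a in "auto intro!: continuous_intros cont")
  then obtain y where y: "x <= y" "y <= a + pi" "\<sigma> * u y = 0" by blast
  moreover have "\<sigma> ~= 0" using nz[of "a + pi"] pi_gt_zero by (simp add: \<sigma>_def sgn_if)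
  ultimately show False using nz[of y] x by simp
 qed
 have pos_a: "0 <= \<sigma> * u a"
 proof (rule tendsto_lowerbound)
  show "((%x. \<sigma> * u x) \<longlongrightarrow> \<sigma> * u a) (at_right a)"
   using cont[OF a] by (intro tendsto_intros) (simp add: isCont_def filterlim_at_split)
  have "eventually (%x. a < x & x < a + pi) (at_right a)"
   using eventually_at_right_real[of a "a + pi"] pi_gt_zero by (auto elim: eventually_mono)
  then show "eventually (%x. 0 <= \<sigma> * u x) (at_right a)"
   by eventually_elim (auto intro!: less_imp_le pos)
 qed simp
 \<comment> \<open>Wronskian of \<open>u\<close> and \<open>sin (x - a)\<close>: it does not
   increase, yet it starts at a nonpositive value and ends at a positive one.\<close>
 define W where "W x = \<sigma> * (u1 x * sin (x - a) - u x * cos (x - a))" for x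
 have "W (a + pi) <= W a"
 proof (rule DERIV_nonpos_imp_nonincreasing[of a "a + pi" W])
  fix x assume x: "a <= x" "x <= a + pi"
  then have x0: "0 < x" using a by simp
  have "(W has_real_derivative \<sigma> * ((((\<nu>\<^sup>2 - 1/4) / x^2 - 1) * u x) * sin (x - a) + cos (x - a) * u1 x
    - (u1 x * cos (x - a) + - sin (x - a) * u x))) (at x)"
   unfolding W_def[abs_def]
   by (rule derivative_eq_intros u(1)[OF x0] u(2)[OF x0] refl)+ (simp add: algebra_simps)
  moreover have "\<sigma> * ((((\<nu>\<^sup>2 - 1/4) / x^2 - 1) * u x) * sin (x - a) + cos (x - a) * u1 x
    - (u1 x * cos (x - a) + - sin (x - a) * u x)) = (\<nu>\<^sup>2 - 1/4) / x^2 * ((\<sigma> * u x) * sin (x - a))"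
   by (simp add: algebra_simps)
  moreover have "(\<nu>\<^sup>2 - 1/4) / x^2 * ((\<sigma> * u x) * sin (x - a)) <= 0"
  proof (rule mult_nonpos_nonneg)
   have "\<nu>\<^sup>2 <= (1/2)^2" using \<nu> by (intro power_mono) auto
   then show "(\<nu>\<^sup>2 - 1/4) / x^2 <= 0" by (simp add: power_divide divide_nonpos_nonneg)
   have "0 <= \<sigma> * u x" using x pos[of x] pos_a by (cases "x = a") auto
   moreover have "0 <= sin (x - a)" using x by (intro sin_ge_zero) auto
   ultimately show "0 <= (\<sigma> * u x) * sin (x - a)" by simp
  qed
  ultimately show "\<exists>y. (W has_real_derivative y) (at x) & y <= 0" by auto
 qed simp
 moreover have "W a = - (\<sigma> * u a)" "W (a + pi) = \<sigma> * u (a + pi)" by (simp_all add: W_def)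
 ultimately show False using pos_a pos[of "a + pi"] pi_gt_zero by simp
qed

text \<open>\<open>Bessel_zero\<close> counts zeros with \<open>card\<close>, which is 0 on infinite
  sets, so finiteness must come first. In the variable \<open>x^2/4\<close> the origin lies in the
  domain of an entire function, whose value there is \<open>1 / Gamma (\<nu> + 1)\<close>; an
  accumulation of zeros would force this value to be 0.\<close>

lemma bessel_zeros_locally_finite:
 assumes "0 <= \<nu>"
 shows "finite {x. 0 < x & x <= b & Bessel_J \<nu> x = 0}"
proof -
 define G where "G z = (\<Sum>m. of_real (bessel_coeff \<nu> m) * z ^ m)" for z :: complex
 have "(G has_field_derivative (\<Sum>m. diffs (%m. of_real (bessel_coeff \<nu> m)) m * z ^ m)) (at z)" for z
  unfolding G_def[abs_def] by (rule termdiffs_strong_converges_everywhere) (rule bessel_coeff_summable[OF assms])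
 then have hol: "G holomorphic_on UNIV" by (auto simp: holomorphic_on_def field_differentiable_def)
 have G_real: "G (of_real s) = of_real (bessel_entire \<nu> s)" for s
 proof -
  have "summable (%m. bessel_coeff \<nu> m * s ^ m)" using bessel_coeff_summable[OF assms, of s] by simp
  then show ?thesis unfolding G_def bessel_entire_def by (simp add: suminf_of_real)
 qed
 define S where "S = {s. 0 <= s & s <= b^2/4 & bessel_entire \<nu> s = 0}"
 have "finite S"
 proof (rule ccontr)
  assume "infinite S"
  then have "infinite ((of_real :: real => complex) ` S)"
   by (simp add: finite_image_iff inj_on_def)
  moreover have "(of_real :: real => complex) ` S <= cball 0 (b^2/4)" by (auto simp: S_def)
  ultimately obtain \<xi> where "\<xi> islimpt (of_real :: real => complex) ` S"
   using compact_eq_Bolzano_Weierstrass compact_cball by metis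
  then have "G 0 = 0"
   by (rule analytic_continuation[OF hol, of "of_real ` S" \<xi>, rotated 4]) (auto simp: S_def G_real)
  then have "bessel_entire \<nu> 0 = 0" using G_real[of 0] by simp
  moreover have "bessel_entire \<nu> 0 = bessel_coeff \<nu> 0"
   unfolding bessel_entire_def using powser_zero[of "bessel_coeff \<nu>"] by simp
  moreover have "0 < Gamma (\<nu> + 1)" using assms by (intro Gamma_real_pos) auto
  ultimately show False by (simp add: bessel_coeff_def)
 qed
 moreover have "inj_on (%x. x^2/4) {x. 0 < x & x <= b & Bessel_J \<nu> x = 0}"
  by (auto simp: inj_on_def)
 moreover have "(%x. x^2/4) ` {x. 0 < x & x <= b & Bessel_J \<nu> x = 0} <= S"
  by (auto simp: S_def Bessel_J_eq[OF assms] intro!: divide_right_mono power_mono)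
 ultimately show ?thesis using inj_on_finite by blast
qed

text \<open>The number of zeros up to a zero increases strictly from one zero to the next, hence the
  definite description is unique.\<close>

lemma Bessel_zero_eqI:
 assumes "0 <= \<nu>" "0 < x" "Bessel_J \<nu> x = 0" "card {z. 0 < z & z <= x & Bessel_J \<nu> z = 0} = k"
 shows "Bessel_zero \<nu> k = x"
 unfolding Bessel_zero_def
proof (rule the_equality)
 have less: "card {z. 0 < z & z <= v & Bessel_J \<nu> z = 0} < card {z. 0 < z & z <= w & Bessel_J \<nu> z = 0}"
  if "v < w" "0 < w" "Bessel_J \<nu> w = 0" for v w
 proof (rule psubset_card_mono[OF bessel_zeros_locally_finite[OF assms(1)]])
  have "w \<in> {z. 0 < z & z <= w & Bessel_J \<nu> z = 0}" "w \<notin> {z. 0 < z & z <= v & Bessel_J \<nu> z = 0}"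
   using that by simp_all
  moreover have "{z. 0 < z & z <= v & Bessel_J \<nu> z = 0} <= {z. 0 < z & z <= w & Bessel_J \<nu> z = 0}"
   using \<open>v < w\<close> by (intro Collect_mono) linarith
  ultimately show "{z. 0 < z & z <= v & Bessel_J \<nu> z = 0} \<subset> {z. 0 < z & z <= w & Bessel_J \<nu> z = 0}"
   by blast
 qed
 show "y = x" if "0 < y & Bessel_J \<nu> y = 0 & card {z. 0 < z & z <= y & Bessel_J \<nu> z = 0} = k" for y
  using less[of x y] less[of y x] that assms by (cases rule: linorder_cases[of x y]) auto
qed (use assms in auto)

text \<open>Both zeros are minima of finite nonempty sets; the second set is nonempty because the
  comparison, started at \<open>j1\<close>, finds a zero within \<pi>.\<close>

lemma bessel_zeros_gap:
 assumes \<nu>: "0 <= \<nu>" "\<nu> <= 1/2"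
 shows "0 < Bessel_zero \<nu> 2 - Bessel_zero \<nu> 1" "Bessel_zero \<nu> 2 - Bessel_zero \<nu> 1 <= pi"
proof -
 let ?Z = "%b. {z. 0 < z & z <= b & Bessel_J \<nu> z = 0}"
 note fin = bessel_zeros_locally_finite[OF \<nu>(1)]
 obtain b where b: "1 < b" "Bessel_J \<nu> b = 0" using bessel_zero_in_interval[OF \<nu>, of 1] by auto
 define j1 where "j1 = Min (?Z b)"
 have "?Z b ~= {}" using b by auto
 then have j1: "j1 \<in> ?Z b" "!!z. z \<in> ?Z b ==> j1 <= z"
  unfolding j1_def using fin Min_in by (blast, simp)
 obtain c where c: "j1 < c" "c <= j1 + pi" "Bessel_J \<nu> c = 0"
  using bessel_zero_in_interval[OF \<nu>, of j1] j1 by auto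
 define j2 where "j2 = Min {z \<in> ?Z c. j1 < z}"
 have fin2: "finite {z \<in> ?Z c. j1 < z}" by (rule finite_subset[OF _ fin[of c]]) blast
 have "{z \<in> ?Z c. j1 < z} ~= {}" using c j1(1) by auto
 then have j2: "j2 \<in> {z \<in> ?Z c. j1 < z}" "!!z. z \<in> {z \<in> ?Z c. j1 < z} ==> j2 <= z"
  unfolding j2_def using fin2 Min_in by (blast, simp)
 have "?Z j1 = {j1}" using j1 by force
 then have 1: "Bessel_zero \<nu> 1 = j1" using j1 by (intro Bessel_zero_eqI \<nu>) auto
 have "?Z j2 = {j1, j2}"
 proof
  show "?Z j2 <= {j1, j2}"
  proof
   fix z assume z: "z \<in> ?Z j2"
   have "j1 <= z" using j1 z by (cases "z <= b") auto
   then show "z \<in> {j1, j2}" using z j2(1) j2(2)[of z] by force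
  qed
 qed (use j1 j2 in auto)
 then have 2: "Bessel_zero \<nu> 2 = j2" using j2 by (intro Bessel_zero_eqI \<nu>) auto
 show "0 < Bessel_zero \<nu> 2 - Bessel_zero \<nu> 1" "Bessel_zero \<nu> 2 - Bessel_zero \<nu> 1 <= pi"
  unfolding 1 2 using j2(1) c by auto
qed

text \<open>\<open>4/(2-\<alpha>)\<close> is twice the travel time from \<open>x = 0\<close> to \<open>x = 1\<close>; it suffices for observability.\<close>

theorem critical_time_ge:
 assumes "0 < \<alpha>" "\<alpha> < 2"
 shows "4 / (2 - \<alpha>) <= critical_time \<alpha>"
proof (cases "\<alpha> <= 4/3")
 case True
 define \<nu> where "\<nu> = \<bar>1 - \<alpha>\<bar> / (2 - \<alpha>)"
 \<comment> \<open>The condition \<open>\<alpha> <= 4/3\<close> describes exactly the range in which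
   the order is at most 1/2.\<close>
 have \<nu>: "0 <= \<nu>" "\<nu> <= 1/2" using assms True by (auto simp: \<nu>_def field_simps abs_if)
 define d where "d = Bessel_zero \<nu> 2 - Bessel_zero \<nu> 1"
 have d: "0 < d" "d <= pi" unfolding d_def by (rule bessel_zeros_gap[OF \<nu>])+
 have "critical_time \<alpha> = 4 * pi / ((2 - \<alpha>) * d)"
  unfolding critical_time_def Let_def \<nu>_def[symmetric] d_def[symmetric] using True by simp
 also have "... \<ge> 4 * d / ((2 - \<alpha>) * d)"
  using d assms by (intro divide_right_mono) auto
 finally show ?thesis using d by simp
qed (simp add: critical_time_def)

section \<open>Absolutely continuous functions\<close>

text \<open>Tagging each piece with its left endpoint reduces this to tagged divisions.\<close>

lemma additive_division_1:
 fixes f :: "real => real"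
 assumes "a <= b" and q: "q division_of {a..b}"
 shows "(\<Sum>K\<in>q. f (Sup K) - f (Inf K)) = f b - f a"
proof -
 have Inf_in: "Inf K \<in> K" if "K \<in> q" for K
 proof -
  obtain c d where "K = cbox c d" using division_ofD(4)[OF q \<open>K \<in> q\<close>] by blast
  then show ?thesis using division_ofD(3)[OF q \<open>K \<in> q\<close>] by auto
 qed
 have iv: "\<exists>c d. K = {c..d}" if "K \<in> q" for K
  using division_ofD(4)[OF q that] by simp
 let ?p = "(%K. (Inf K, K)) ` q"
 have "?p tagged_division_of {a..b}"
 proof (rule tagged_division_ofI)
  show "finite ?p" using q by blast
  show "\<Union>{K. \<exists>x. (x, K) \<in> ?p} = {a..b}" unfolding division_ofD(6)[OF q, symmetric] by auto
 qed (use q Inf_in iv in "auto dest: division_ofD")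
 from additive_tagged_division_1[OF \<open>a <= b\<close> this, of f]
 show ?thesis by (subst (asm) sum.reindex) (auto intro: inj_onI)
qed

text \<open>The covering intervals are not centred at the points they cover, so pairs
  \<open>(u, v)\<close> index closed balls by midpoint and half-length. Vitali's theorem leaves a
  null set uncovered, and finitely many members of the countable family already capture all but
  \<mu> of the measure.\<close>

lemma vitali_finite:
 fixes P :: "real => real => bool"
 assumes E: "E \<in> lmeasurable" and "0 < \<mu>"
  and cov: "!!x d. x \<in> E ==> 0 < d ==> \<exists>u v. u < x & x < v & v - u < d & P u v"
 obtains \<D> where "finite \<D>" "!!K. K \<in> \<D> ==> \<exists>u v. K = {u..v} & u < v & P u v"
  "disjoint \<D>" "measure lebesgue E - \<mu> < measure lebesgue (E \<inter> \<Union>\<D>)"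
proof -
 define I where "I = {(u, v). u < v & P u v}"
 define c where "c = (%(u::real, v::real). (u + v) / 2)"
 define r where "r = (%(u::real, v::real). (v - u) / 2)"
 have cb: "cball (c i) (r i) = {fst i..snd i}" for i
  unfolding c_def r_def cball_eq_atLeastAtMost by (auto simp: case_prod_unfold field_simps)
 have r_pos: "0 < r i" if "i \<in> I" for i using that unfolding I_def r_def by auto
 have vit: "\<exists>i. i \<in> I & x \<in> cball (c i) (r i) & r i < d" if x: "x \<in> E" and d: "0 < d" for x d
 proof -
  obtain u v where "u < x" "x < v" "v - u < d" "P u v" using cov[OF x d] by blast
  then show ?thesis unfolding cb by (intro exI[of _ "(u, v)"]) (auto simp: I_def r_def)
 qed
 obtain C where C: "countable C" "C <= I"
  and disj: "pairwise (%i j. disjnt (cball (c i) (r i)) (cball (c j) (r j))) C"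
  and neg: "negligible (E - (\<Union>i\<in>C. cball (c i) (r i)))"
  by (rule Vitali_covering_theorem_cballs[of I r E c, OF r_pos vit])
 let ?F = "%i. E \<inter> cball (c i) (r i)"
 have meas: "?F i \<in> lmeasurable" for i using E by (intro fmeasurable_Int_fmeasurable) auto
 have bd: "measure lebesgue (\<Union>D') <= measure lebesgue E" if "D' <= ?F ` C" "finite D'" for D'
  using that E meas by (intro measure_mono_fmeasurable fmeasurableD) (auto intro!: fmeasurable.finite_Union)
 obtain D' where D': "D' <= ?F ` C" "finite D'"
   "measure lebesgue (\<Union>(?F ` C)) - \<mu> < measure lebesgue (\<Union>D')"
  by (rule measure_countable_Union_approachable[of "?F ` C" \<mu> "measure lebesgue E"])
    (use C(1) meas bd \<open>0 < \<mu>\<close> in auto)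
 then obtain C' where C': "C' <= C" "finite C'" "D' = ?F ` C'"
  by (meson finite_subset_image)
 have eq: "measure lebesgue (\<Union>(?F ` C)) = measure lebesgue E"
 proof (rule measure_negligible_symdiff)
  show "E \<in> lmeasurable" by (rule E)
  have "E - \<Union> (?F ` C) \<union> (\<Union> (?F ` C) - E) = E - (\<Union>i\<in>C. cball (c i) (r i))" by auto
  then show "negligible (E - \<Union> (?F ` C) \<union> (\<Union> (?F ` C) - E))" using neg by simp
 qed
 show thesis
 proof (rule that[of "(%i. cball (c i) (r i)) ` C'"])
  show "finite ((%i. cball (c i) (r i)) ` C')" using C' by auto
  show "\<exists>u v. K = {u..v} & u < v & P u v" if "K \<in> (%i. cball (c i) (r i)) ` C'" for K
   using that C' C(2) unfolding cb I_def by fastforce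
  show "disjoint ((%i. cball (c i) (r i)) ` C')"
   using disj C'(1) unfolding disjoint_def pairwise_def disjnt_def by (smt (verit) image_iff subsetD)
  have "\<Union>D' = E \<inter> \<Union>((%i. cball (c i) (r i)) ` C')" using C'(3) by auto
  then show "measure lebesgue E - \<mu> < measure lebesgue (E \<inter> \<Union>((%i. cball (c i) (r i)) ` C'))"
   using D'(3) eq by simp
 qed
qed

lemma disjoint_intervals_division:
 fixes \<D> :: "real set set"
 assumes "finite \<D>" "!!K. K \<in> \<D> ==> \<exists>u v. K = {u..v} & u < v" "disjoint \<D>"
 shows "\<D> division_of \<Union>\<D>"
proof (rule division_ofI)
 show "!!K1 K2. K1 \<in> \<D> ==> K2 \<in> \<D> ==> K1 ~= K2 ==> interior K1 \<inter> interior K2 = {}"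
  using assms(3) interior_subset unfolding disjoint_def by blast
 show "K ~= {}" if "K \<in> \<D>" for K
  using assms(2)[OF that] by auto
 show "\<exists>a b. K = cbox a b" if "K \<in> \<D>" for K
  using assms(2)[OF that] by auto
qed (use assms in auto)

lemma disjoint_intervals_measure:
 fixes \<D> :: "real set set"
 assumes "finite \<D>" "!!K. K \<in> \<D> ==> \<exists>u v. K = {u..v} & u < v" "disjoint \<D>"
 shows "(\<Sum>K\<in>\<D>. Sup K - Inf K) = measure lebesgue (\<Union>\<D>)"
proof -
 have K: "Sup K - Inf K = measure lebesgue K & K \<in> lmeasurable" if "K \<in> \<D>" for K
  using assms(2)[OF that] by auto
 have "measure lebesgue (\<Union>\<D>) = (\<Sum>K\<in>\<D>. measure lebesgue K)"
  using assms K by (intro measure_Union') (auto simp: disjoint_def pairwise_def disjnt_def)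
 then show ?thesis using K by simp
qed

text \<open>Each member of \<open>\<D>1\<close> is divided so that the members of
  \<open>\<D>2\<close> inside it appear among the pieces; the other pieces are the gaps. Applied to
  the identity, the same splitting accounts for the lengths.\<close>

lemma division_gaps:
 fixes \<D>1 \<D>2 :: "real set set"
 assumes fin: "finite \<D>1" "finite \<D>2"
  and iv1: "!!K. K \<in> \<D>1 ==> \<exists>u v. K = {u..v} & u < v" and dis1: "disjoint \<D>1"
  and iv2: "!!K. K \<in> \<D>2 ==> \<exists>u v. K = {u..v} & u < v" and dis2: "disjoint \<D>2"
  and sub: "!!K. K \<in> \<D>2 ==> \<exists>J\<in>\<D>1. K <= J"
 obtains \<G> where "\<G> division_of \<Union>\<G>" "\<Union>\<G> <= \<Union>\<D>1"
  "!!f :: real => real. (\<Sum>K\<in>\<D>1. f (Sup K) - f (Inf K))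
    = (\<Sum>K\<in>\<D>2. f (Sup K) - f (Inf K)) + (\<Sum>K\<in>\<G>. f (Sup K) - f (Inf K))"
proof -
 define S where "S J = {K \<in> \<D>2. K <= J}" for J
 have "\<exists>q. S J <= q & q division_of J" if J: "J \<in> \<D>1" for J
 proof -
  obtain u v where uv: "J = cbox u v" using iv1[OF J] by auto
  have "S J division_of \<Union>(S J)"
   using fin iv2 dis2 unfolding S_def
   by (intro disjoint_intervals_division) (auto simp: disjoint_def)
  moreover have "\<Union>(S J) <= cbox u v" unfolding S_def uv by auto
  ultimately show ?thesis unfolding uv by (metis partial_division_extend_interval)
 qed
 then obtain q where q: "!!J. J \<in> \<D>1 ==> S J <= q J & q J division_of J" by metis
 define \<G> where "\<G> = (\<Union>J\<in>\<D>1. q J - S J)"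
 have qd: "K <= J" "K ~= {}" "\<exists>a b. K = cbox a b" if "J \<in> \<D>1" "K \<in> q J" for K J
  using division_ofD(2,3,4)[of "q J" J K] q[OF that(1)] that by auto
 have J_eq: "J1 = J2" if "J1 \<in> \<D>1" "J2 \<in> \<D>1" "K \<in> q J1" "K \<in> q J2" for J1 J2 K
 proof -
  have "K <= J1 \<inter> J2" "K ~= {}" using qd that by blast+
  then show ?thesis using that dis1 unfolding disjoint_def by blast
 qed
 have S_eq: "J1 = J2" if "J1 \<in> \<D>1" "J2 \<in> \<D>1" "K \<in> S J1" "K \<in> S J2" for J1 J2 K
  using J_eq q that by blast
 have finq: "finite (q J)" if "J \<in> \<D>1" for J using q[OF that] by blast
 show thesis
 proof (rule that[of \<G>])
  show "\<G> division_of \<Union>\<G>"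
  proof (rule division_ofI)
   show "finite \<G>" unfolding \<G>_def using fin finq by auto
   show "interior K1 \<inter> interior K2 = {}" if K: "K1 \<in> \<G>" "K2 \<in> \<G>" "K1 ~= K2" for K1 K2
   proof -
    obtain J1 J2 where J: "J1 \<in> \<D>1" "K1 \<in> q J1" "J2 \<in> \<D>1" "K2 \<in> q J2"
     using K unfolding \<G>_def by auto
    show ?thesis
    proof (cases "J1 = J2")
     case True
     then show ?thesis using J K(3) q division_ofD(5) by metis
    next
     case False
     then have "K1 \<inter> K2 = {}" using dis1 J qd(1) unfolding disjoint_def by blast
     then show ?thesis using interior_subset by blast
    qed
   qed
  qed (use qd in "auto simp: \<G>_def")
  show "\<Union>\<G> <= \<Union>\<D>1" unfolding \<G>_def using qd by blast
  fix f :: "real => real"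
  let ?g = "%K. f (Sup K) - f (Inf K)"
  have one: "?g J = sum ?g (S J) + sum ?g (q J - S J)" if J: "J \<in> \<D>1" for J
  proof -
   obtain u v where uv: "J = {u..v}" "u < v" using iv1[OF J] by auto
   have "sum ?g (q J) = f v - f u"
    using additive_division_1[of u v "q J" f] q[OF J] uv by simp
   then have "?g J = sum ?g (q J)" using uv by simp
   also have "... = sum ?g (S J) + sum ?g (q J - S J)"
    using sum.subset_diff[of "S J" "q J" ?g] q[OF J] finq[OF J] by simp
   finally show ?thesis .
  qed
  have "sum ?g \<D>1 = (\<Sum>J\<in>\<D>1. sum ?g (S J)) + (\<Sum>J\<in>\<D>1. sum ?g (q J - S J))"
   using one by (simp add: sum.distrib[symmetric])
  also have "(\<Sum>J\<in>\<D>1. sum ?g (S J)) = sum ?g (\<Union>J\<in>\<D>1. S J)"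
   by (rule sum.UNION_disjoint[symmetric]) (use fin S_eq in "auto simp: S_def")
  also have "(\<Union>J\<in>\<D>1. S J) = \<D>2" unfolding S_def using sub by auto
  also have "(\<Sum>J\<in>\<D>1. sum ?g (q J - S J)) = sum ?g \<G>" unfolding \<G>_def
   by (rule sum.UNION_disjoint[symmetric]) (use fin J_eq finq in auto)
  finally show "sum ?g \<D>1 = sum ?g \<D>2 + sum ?g \<G>" .
 qed
qed

section \<open>Slopes of absolutely continuous functions and differentiability almost
  everywhere\<close>

lemma absolutely_cont_onD:
 assumes "absolutely_cont_on S F" "0 < e"
 obtains d where "0 < d"
  "!!\<D>. \<D> division_of \<Union>\<D> ==> \<Union>\<D> <= S ==> (\<Sum>K\<in>\<D>. Sup K - Inf K) < d ==>
    (\<Sum>K\<in>\<D>. \<bar>F (Sup K) - F (Inf K)\<bar>) < e"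
proof -
 obtain d where d: "0 < d" "\<forall>\<D>. \<D> division_of \<Union>\<D> & \<Union>\<D> <= S & (\<Sum>k\<in>\<D>. measure lborel k) < d
   --> (\<Sum>k\<in>\<D>. \<bar>F (Sup k) - F (Inf k)\<bar>) < e"
  using assms unfolding absolutely_cont_on_def by blast
 show thesis
 proof (rule that[OF d(1)])
  fix \<D> :: "real set set"
  assume \<D>: "\<D> division_of \<Union>\<D>" "\<Union>\<D> <= S" "(\<Sum>K\<in>\<D>. Sup K - Inf K) < d"
  have "measure lborel K = Sup K - Inf K" if K: "K \<in> \<D>" for K
  proof -
   obtain u v where "K = cbox u v" using division_ofD(4)[OF \<D>(1) K] by blast
   then show ?thesis using division_ofD(3)[OF \<D>(1) K] by simp
  qed
  then show "(\<Sum>K\<in>\<D>. \<bar>F (Sup K) - F (Inf K)\<bar>) < e" using d(2) \<D> by simp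
 qed
qed

lemma absolutely_cont_on_dist:
 assumes "absolutely_cont_on {a..b} F" "0 < e"
 obtains d where "0 < d" "!!x y. x \<in> {a..b} ==> y \<in> {a..b} ==> \<bar>x - y\<bar> < d ==> \<bar>F x - F y\<bar> < e"
proof -
 obtain d where d: "0 < d" "!!\<D>. \<D> division_of \<Union>\<D> ==> \<Union>\<D> <= {a..b} ==>
   (\<Sum>K\<in>\<D>. Sup K - Inf K) < d ==> (\<Sum>K\<in>\<D>. \<bar>F (Sup K) - F (Inf K)\<bar>) < e"
  using absolutely_cont_onD[OF assms] by blast
 have le: "\<bar>F y - F x\<bar> < e" if "x \<in> {a..b}" "y \<in> {a..b}" "y - x < d" "x <= y" for x y
  using d(2)[of "{{x..y}}"] division_of_self[of x y] that by auto
 show thesis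
 proof (rule that[OF d(1)])
  fix x y assume "x \<in> {a..b}" "y \<in> {a..b}" "\<bar>x - y\<bar> < d"
  then show "\<bar>F x - F y\<bar> < e" using le[of x y] le[of y x] by (cases "x <= y") auto
 qed
qed

lemma absolutely_cont_on_imp_continuous_on:
 assumes "absolutely_cont_on {a..b} F"
 shows "continuous_on {a..b} F"
proof (unfold continuous_on_iff dist_real_def, intro ballI allI impI)
 fix x e :: real assume x: "x \<in> {a..b}" and "0 < e"
 with absolutely_cont_on_dist[OF assms, of e] obtain d where d: "0 < d"
  "!!x y. x \<in> {a..b} ==> y \<in> {a..b} ==> \<bar>x - y\<bar> < d ==> \<bar>F x - F y\<bar> < e" by metis
 then show "\<exists>d>0. \<forall>x'\<in>{a..b}. \<bar>x' - x\<bar> < d --> \<bar>F x' - F x\<bar> < e" using x by metis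
qed

lemma absolutely_cont_on_subset:
 "absolutely_cont_on S F ==> T <= S ==> absolutely_cont_on T F"
 unfolding absolutely_cont_on_def by (meson subset_trans)

lemma absolutely_cont_on_uminus:
 "absolutely_cont_on S F ==> absolutely_cont_on S (%x. - F x)"
 unfolding absolutely_cont_on_def by (simp add: abs_minus_commute)

lemma shrink_to_open:
 fixes x :: real
 assumes "open U" "x \<in> U"
 obtains d where "0 < d" "!!u v. u < x ==> x < v ==> v - u < d ==> {u..v} <= U"
proof -
 obtain d where "0 < d" "!!y. \<bar>y - x\<bar> < d ==> y \<in> U"
  using assms unfolding open_dist dist_real_def by blast
 then show thesis by (intro that[of d]) (auto simp: abs_if)
qed

text \<open>
  The two Vitali families below sit inside each other; absolute continuity makes the increments
  over the gaps negligible, so no monotonicity is needed.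
\<close>

lemma absolutely_cont_on_slopes_negligible:
 assumes AC: "absolutely_cont_on {a..b} F"
  and E: "E \<in> sets lebesgue" "E <= {a<..<b}" and "s < r"
  and below: "!!x d. x \<in> E ==> 0 < d ==> \<exists>u v. u < x & x < v & v - u < d & F v - F u < s * (v - u)"
  and above: "!!x d. x \<in> E ==> 0 < d ==> \<exists>u v. u < x & x < v & v - u < d & F v - F u > r * (v - u)"
 shows "negligible E"
proof -
 have Em: "E \<in> lmeasurable"
  using E by (metis bounded_Ioo bounded_set_imp_lmeasurable bounded_subset box_real(1) bounded_box)
 define m where "m = measure lebesgue E"
 have False if m: "0 < m"
 proof -
  define c where "c = r - s"
  have c: "0 < c" using \<open>s < r\<close> by (simp add: c_def)
  \<comment> \<open>Slopes below \<open>s\<close> and slopes above \<open>r\<close> over nearly the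
    whole of \<open>E\<close> are incompatible by the amount \<open>c * m\<close>, up to errors. The
    choices of \<open>e\<close> and \<mu> keep these errors below 5/8 of that amount.\<close>
  define e where "e = c * m / 4"
  have "0 < e" using c m by (simp add: e_def)
  obtain \<delta> where \<delta>: "0 < \<delta>" "!!\<D>. \<D> division_of \<Union>\<D> ==> \<Union>\<D> <= {a..b} ==>
   (\<Sum>K\<in>\<D>. Sup K - Inf K) < \<delta> ==> (\<Sum>K\<in>\<D>. \<bar>F (Sup K) - F (Inf K)\<bar>) < e"
   by (rule absolutely_cont_onD[OF AC \<open>0 < e\<close>]) blast
  define \<mu> where "\<mu> = min (\<delta> / 4) (c * m / (8 * (\<bar>s\<bar> + c + 1)))"
  have \<mu>: "0 < \<mu>" using \<delta>(1) c m by (simp add: \<mu>_def)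
  have \<mu>\<delta>: "3 * \<mu> < \<delta>" using \<delta>(1) by (simp add: \<mu>_def)
  have "\<mu> * (8 * (\<bar>s\<bar> + c + 1)) <= c * m / (8 * (\<bar>s\<bar> + c + 1)) * (8 * (\<bar>s\<bar> + c + 1))"
   using c by (intro mult_right_mono) (auto simp: \<mu>_def)
  also have "... = c * m" using c by (simp add: field_simps)
  finally have \<mu>c: "8 * \<mu> * \<bar>s\<bar> + 8 * \<mu> * c <= c * m" using \<mu> by (simp add: algebra_simps)
  obtain U where U: "open U" "E <= U" "U - E \<in> lmeasurable" "emeasure lebesgue (U - E) < ennreal \<mu>"
   using sets_lebesgue_outer_open[OF E(1) \<mu>] by blast
  define V where "V = U \<inter> {a<..<b}"
  have V: "open V" "E <= V" using U E unfolding V_def by auto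
  have "bounded V" unfolding V_def using bounded_box[of a b] by (auto intro: bounded_subset)
  with V have V: "open V" "E <= V" "V \<in> lmeasurable" by (auto intro: lmeasurable_open)
  have "measure lebesgue V <= measure lebesgue (E \<union> (U - E))"
   using V fmeasurable.Un[OF Em U(3)] by (intro measure_mono_fmeasurable) (auto simp: V_def)
  also have "... <= m + measure lebesgue (U - E)"
   using measure_Un_le[of E lebesgue "U - E"] E U unfolding m_def by auto
  also have "measure lebesgue (U - E) < \<mu>"
   using U(3,4) \<mu> by (metis emeasure_eq_measure2 ennreal_less_iff less_eq_real_def measure_nonneg)
  finally have mV: "measure lebesgue V < m + \<mu>" by simp
  obtain \<D>1 where D1: "finite \<D>1"
   "!!K. K \<in> \<D>1 ==> \<exists>u v. K = {u..v} & u < v & (F v - F u < s * (v - u) & {u..v} <= V)"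
   "disjoint \<D>1" "measure lebesgue E - \<mu> < measure lebesgue (E \<inter> \<Union>\<D>1)"
  proof (rule vitali_finite[OF Em \<mu>, of "%u v. F v - F u < s * (v - u) & {u..v} <= V"])
   fix x d :: real assume x: "x \<in> E" and d: "0 < d"
   obtain d' where d': "0 < d'" "!!u v. u < x ==> x < v ==> v - u < d' ==> {u..v} <= V"
    using shrink_to_open[OF V(1)] V(2) x by blast
   show "\<exists>u v. u < x & x < v & v - u < d & F v - F u < s * (v - u) & {u..v} <= V"
    using below[OF x, of "min d d'"] d d' by (metis min_less_iff_conj)
  qed blast
  define N where "N = Inf ` \<D>1 \<union> Sup ` \<D>1"
  \<comment> \<open>Without the finitely many endpoints, each remaining point is interior to its
    member of \<open>\<D>1\<close>, so the steep intervals can be chosen inside these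
    members.\<close>
  define E2 where "E2 = E \<inter> \<Union>\<D>1 - N"
  have "finite N" using D1(1) by (simp add: N_def)
  have UD1: "\<Union>\<D>1 \<in> lmeasurable" using D1(1,2) by (fastforce intro!: fmeasurable.finite_Union)
  have E2m: "E2 \<in> lmeasurable" unfolding E2_def
   using Em UD1 \<open>finite N\<close> by (intro fmeasurable_Diff fmeasurable_Int_fmeasurable)
    (auto intro: negligible_imp_sets negligible_finite dest: fmeasurableD)
  have mE2: "measure lebesgue E2 = measure lebesgue (E \<inter> \<Union>\<D>1)" unfolding E2_def
   by (rule measure_negligible_symdiff[symmetric])
    (use E2m[unfolded E2_def] \<open>finite N\<close> in "auto intro: negligible_subset[of N] negligible_finite dest: fmeasurableD")
  obtain \<D>2 where D2: "finite \<D>2"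
   "!!K. K \<in> \<D>2 ==> \<exists>u v. K = {u..v} & u < v & (F v - F u > r * (v - u) & (\<exists>J\<in>\<D>1. {u..v} <= J))"
   "disjoint \<D>2" "measure lebesgue E2 - \<mu> < measure lebesgue (E2 \<inter> \<Union>\<D>2)"
  proof (rule vitali_finite[OF E2m \<mu>, of "%u v. F v - F u > r * (v - u) & (\<exists>J\<in>\<D>1. {u..v} <= J)"])
   fix x d :: real assume x: "x \<in> E2" and d: "0 < d"
   obtain J where J: "J \<in> \<D>1" "x \<in> J" using x unfolding E2_def by blast
   obtain p q where pq: "J = {p..q}" "p < q" using D1(2)[OF J(1)] by blast
   have "p \<in> N" "q \<in> N" using J(1) pq unfolding N_def
    by (metis UnI1 UnI2 cInf_atLeastAtMost cSup_atLeastAtMost image_eqI less_imp_le)+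
   then have "x \<in> {p<..<q}" using x J pq unfolding E2_def by (auto simp: less_le)
   then obtain d' where d': "0 < d'" "!!u v. u < x ==> x < v ==> v - u < d' ==> {u..v} <= {p<..<q}"
    using shrink_to_open[of "{p<..<q}" x] by auto
   have "x \<in> E" using x by (simp add: E2_def)
   then obtain u v where "u < x" "x < v" "v - u < min d d'" "F v - F u > r * (v - u)"
    using above[of x "min d d'"] d d' by auto
   moreover from this have "{u..v} <= J" using d'(2)[of u v] pq by fastforce
   ultimately show "\<exists>u v. u < x & x < v & v - u < d & F v - F u > r * (v - u) & (\<exists>J\<in>\<D>1. {u..v} <= J)"
    using J(1) by auto
  qed blast
  have UD2: "\<Union>\<D>2 \<in> lmeasurable" using D2(1,2) by (fastforce intro!: fmeasurable.finite_Union)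
  have UD1V: "\<Union>\<D>1 <= V" using D1(2) by blast
  obtain \<G> where G: "\<G> division_of \<Union>\<G>" "\<Union>\<G> <= \<Union>\<D>1"
   "!!f :: real => real. (\<Sum>K\<in>\<D>1. f (Sup K) - f (Inf K))
    = (\<Sum>K\<in>\<D>2. f (Sup K) - f (Inf K)) + (\<Sum>K\<in>\<G>. f (Sup K) - f (Inf K))"
   by (rule division_gaps[OF D1(1) D2(1) _ D1(3) _ D2(3)]) (use D1(2) D2(2) in blast)+
  define L1 where "L1 = (\<Sum>K\<in>\<D>1. Sup K - Inf K)"
  define L2 where "L2 = (\<Sum>K\<in>\<D>2. Sup K - Inf K)"
  define LG where "LG = (\<Sum>K\<in>\<G>. Sup K - Inf K)"
  have L: "L1 = L2 + LG" using G(3)[of "%x. x"] unfolding L1_def L2_def LG_def by simp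
  have "L1 = measure lebesgue (\<Union>\<D>1)" unfolding L1_def
   by (rule disjoint_intervals_measure[OF D1(1) _ D1(3)]) (use D1(2) in blast)
  also have "... <= measure lebesgue V" using UD1V UD1 V(3)
   by (intro measure_mono_fmeasurable) (auto dest: fmeasurableD)
  finally have L1: "L1 < m + \<mu>" using mV by simp
  have "measure lebesgue (E2 \<inter> \<Union>\<D>2) <= measure lebesgue (\<Union>\<D>2)" using UD2 E2m
   by (intro measure_mono_fmeasurable) (auto dest: fmeasurableD)
  also have "... = L2" unfolding L2_def
   by (rule disjoint_intervals_measure[symmetric, OF D2(1) _ D2(3)]) (use D2(2) in blast)
  finally have L2: "m - 2 * \<mu> < L2" using D2(4) D1(4) mE2 unfolding m_def by simp
  \<comment> \<open>The gaps have total length \<open>L1 - L2\<close>, which is below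
    \<open>3 * \<mu>\<close> and hence below \<delta>.\<close>
  have "(\<Sum>K\<in>\<G>. \<bar>F (Sup K) - F (Inf K)\<bar>) < e"
  proof (rule \<delta>(2)[OF G(1)])
   show "\<Union>\<G> <= {a..b}" using G(2) UD1V unfolding V_def by fastforce
   show "(\<Sum>K\<in>\<G>. Sup K - Inf K) < \<delta>" using L L1 L2 \<mu>\<delta> unfolding LG_def by simp
  qed
  then have gap: "(\<Sum>K\<in>\<G>. F (Sup K) - F (Inf K)) > - e"
   using sum_abs[of "%K. F (Sup K) - F (Inf K)" \<G>] by linarith
  have "(\<Sum>K\<in>\<D>1. F (Sup K) - F (Inf K)) <= (\<Sum>K\<in>\<D>1. s * (Sup K - Inf K))"
   using D1(2) by (intro sum_mono) fastforce
  then have up: "(\<Sum>K\<in>\<D>1. F (Sup K) - F (Inf K)) <= s * L1"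
   by (simp add: L1_def sum_distrib_left)
  have "(\<Sum>K\<in>\<D>2. F (Sup K) - F (Inf K)) \<ge> (\<Sum>K\<in>\<D>2. r * (Sup K - Inf K))"
   using D2(2) by (intro sum_mono) fastforce
  then have lo: "(\<Sum>K\<in>\<D>2. F (Sup K) - F (Inf K)) \<ge> r * L2"
   by (simp add: L2_def sum_distrib_left)
  have "r * L2 - e < s * L1" using G(3)[of F] up lo gap by linarith
  then have "c * L2 < e + s * LG" unfolding L c_def by (simp add: algebra_simps)
  moreover have "s * LG <= \<bar>s\<bar> * (3 * \<mu>)"
  proof -
   have "0 <= Sup K - Inf K" if K: "K \<in> \<G>" for K
   proof -
    obtain u v where "K = cbox u v" using division_ofD(4)[OF G(1) K] by blast
    then show ?thesis using division_ofD(3)[OF G(1) K] by simp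
   qed
   then have "0 <= LG" unfolding LG_def by (intro sum_nonneg)
   then have "s * LG <= \<bar>s\<bar> * LG" by (intro mult_right_mono) auto
   also have "... <= \<bar>s\<bar> * (3 * \<mu>)" using L L1 L2 by (intro mult_left_mono) auto
   finally show ?thesis .
  qed
  moreover have "c * (m - 2 * \<mu>) <= c * L2" using L2 c by (intro mult_left_mono) auto
  moreover have "0 < c * m" using c m by simp
  moreover have "0 <= \<mu> * \<bar>s\<bar>" "0 <= \<mu> * c" using \<mu> c by simp_all
  ultimately show False using \<mu>c unfolding e_def by (simp add: algebra_simps)
 qed
 then have "\<not> 0 < m" by blast
 then have "m = 0" using measure_nonneg[of lebesgue E] unfolding m_def by linarith
 then show ?thesis using Em unfolding m_def by (simp add: negligible_iff_measure0)
qed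

text \<open>Disjoint intervals of total length above \<open>m / 2\<close> with slopes above
  \<open>2 / m\<close> have total increment above 1, against absolute continuity. Windows of length
  \<open>2 * \<delta> / 3\<close> keep the total length of such a family below \<delta>; countably
  many of them cover the set.\<close>

lemma absolutely_cont_on_infinite_slope_negligible:
 assumes AC: "absolutely_cont_on {a..b} F"
  and E: "E \<in> sets lebesgue" "E <= {a<..<b}"
  and above: "!!x d B. x \<in> E ==> 0 < d ==> \<exists>u v. u < x & x < v & v - u < d & F v - F u > B * (v - u)"
 shows "negligible E"
proof -
 obtain \<delta> where \<delta>: "0 < \<delta>" "!!\<D>. \<D> division_of \<Union>\<D> ==> \<Union>\<D> <= {a..b} ==>
   (\<Sum>K\<in>\<D>. Sup K - Inf K) < \<delta> ==> (\<Sum>K\<in>\<D>. \<bar>F (Sup K) - F (Inf K)\<bar>) < 1"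
  by (rule absolutely_cont_onD[OF AC zero_less_one]) blast
 have loc: "negligible (E \<inter> {c - \<delta>/3<..<c + \<delta>/3})" for c
 proof -
  define V where "V = {a<..<b} \<inter> {c - \<delta>/3<..<c + \<delta>/3}"
  define E' where "E' = E \<inter> {c - \<delta>/3<..<c + \<delta>/3}"
  have V: "open V" "E' <= V" using E(2) by (auto simp: V_def E'_def)
  have Em: "E' \<in> lmeasurable" unfolding E'_def
   using E(1) by (metis bounded_Int bounded_box box_real(1) bounded_set_imp_lmeasurable sets.Int lmeasurable_box fmeasurableD)
  define m where "m = measure lebesgue E'"
  have False if m: "0 < m"
  proof -
   obtain \<D> where D: "finite \<D>"
    "!!K. K \<in> \<D> ==> \<exists>u v. K = {u..v} & u < v & (F v - F u > 2 / m * (v - u) & {u..v} <= V)"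
    "disjoint \<D>" "measure lebesgue E' - m / 2 < measure lebesgue (E' \<inter> \<Union>\<D>)"
   proof (rule vitali_finite[OF Em, of "m / 2" "%u v. F v - F u > 2 / m * (v - u) & {u..v} <= V"])
    fix x d :: real assume x: "x \<in> E'" and d: "0 < d"
    obtain d' where d': "0 < d'" "!!u v. u < x ==> x < v ==> v - u < d' ==> {u..v} <= V"
     using shrink_to_open[OF V(1)] V(2) x by blast
    have "x \<in> E" using x by (simp add: E'_def)
    then show "\<exists>u v. u < x & x < v & v - u < d & F v - F u > 2 / m * (v - u) & {u..v} <= V"
     using above[of x "min d d'" "2/m"] d d' by (metis min_less_iff_conj)
   qed (use m in auto)
   have UD: "\<Union>\<D> \<in> lmeasurable" using D(1,2) by (fastforce intro!: fmeasurable.finite_Union)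
   define L where "L = (\<Sum>K\<in>\<D>. Sup K - Inf K)"
   have Lm: "L = measure lebesgue (\<Union>\<D>)" unfolding L_def
    by (rule disjoint_intervals_measure[OF D(1) _ D(3)]) (use D(2) in blast)
   have UDV: "\<Union>\<D> <= V" using D(2) by blast
   have "\<Union>\<D> <= cbox (c - \<delta>/3) (c + \<delta>/3)" using UDV unfolding V_def by fastforce
   then have "L <= measure lebesgue (cbox (c - \<delta>/3) (c + \<delta>/3))" unfolding Lm
    by (rule measure_mono_fmeasurable[OF _ fmeasurableD[OF UD] lmeasurable_cbox])
   then have L1: "L < \<delta>" using \<delta>(1) by simp
   have "measure lebesgue (E' \<inter> \<Union>\<D>) <= L" unfolding Lm using UD Em
    by (intro measure_mono_fmeasurable) (auto dest: fmeasurableD)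
   then have L2: "m / 2 < L" using D(4) unfolding m_def by simp
   have "(\<Sum>K\<in>\<D>. \<bar>F (Sup K) - F (Inf K)\<bar>) < 1"
   proof (rule \<delta>(2))
    show "\<D> division_of \<Union>\<D>"
     by (rule disjoint_intervals_division[OF D(1) _ D(3)]) (use D(2) in blast)
    show "\<Union>\<D> <= {a..b}" using UDV unfolding V_def by fastforce
   qed (use L1 L_def in simp)
   moreover have "(\<Sum>K\<in>\<D>. 2 / m * (Sup K - Inf K)) <= (\<Sum>K\<in>\<D>. \<bar>F (Sup K) - F (Inf K)\<bar>)"
    using D(2) by (intro sum_mono) fastforce
   ultimately have "2 / m * L < 1" by (simp add: L_def sum_distrib_left)
   then show False using L2 m by (simp add: field_simps)
  qed
  then have "\<not> 0 < m" by blast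
  then have "m = 0" using measure_nonneg[of lebesgue E'] unfolding m_def by linarith
  then show ?thesis using Em unfolding m_def E'_def by (simp add: negligible_iff_measure0)
 qed
 have "E <= (\<Union>c\<in>\<rat>. E \<inter> {c - \<delta>/3<..<c + \<delta>/3})"
 proof
  fix x assume "x \<in> E"
  moreover obtain c where "c \<in> \<rat>" "x - \<delta>/3 < c" "c < x + \<delta>/3"
   using Rats_dense_in_real[of "x - \<delta>/3" "x + \<delta>/3"] \<delta>(1) by auto
  ultimately show "x \<in> (\<Union>c\<in>\<rat>. E \<inter> {c - \<delta>/3<..<c + \<delta>/3})" by (intro UN_I[of c]) auto
 qed
 moreover have "negligible (\<Union>c\<in>\<rat>. E \<inter> {c - \<delta>/3<..<c + \<delta>/3})"
  using loc countable_rat by (intro negligible_countable_Union) auto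
 ultimately show ?thesis by (rule negligible_subset[rotated])
qed

text \<open>Slopes are taken over intervals straddling the point: the sets \<open>O1\<close> and
  \<open>O2\<close> are then unions of open intervals and measurability is immediate. Continuity of
  \<open>F\<close> converts straddling slopes into difference quotients at the end.\<close>

lemma absolutely_cont_on_AE_derivative:
 assumes AC: "absolutely_cont_on {a..b} F"
 obtains N where "negligible N" "!!x. x \<in> {a<..<b} - N ==> (F has_real_derivative deriv F x) (at x)"
proof -
 define O1 where "O1 s n = \<Union>{{u<..<v} |u v. v - u < 1 / real (Suc n) & F v - F u < s * (v - u)}" for s n
 define O2 where "O2 r n = \<Union>{{u<..<v} |u v. v - u < 1 / real (Suc n) & F v - F u > r * (v - u)}" for r n
 have op: "open (O1 s n)" "open (O2 s n)" for s n unfolding O1_def O2_def by auto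
 define E where "E s r = {a<..<b} \<inter> (\<Inter>n. O1 s n) \<inter> (\<Inter>n. O2 r n)" for s r
 define Ep where "Ep = {a<..<b} \<inter> (\<Inter>m. \<Inter>n. O2 (real m) n)"
 define Em where "Em = {a<..<b} \<inter> (\<Inter>m. \<Inter>n. O1 (- real m) n)"
 have meas: "E s r \<in> sets lebesgue" "Ep \<in> sets lebesgue" "Em \<in> sets lebesgue" for s r
  unfolding E_def Ep_def Em_def using op by (auto intro!: sets.Int sets.countable_INT'' simp: borel_open)
 have ex1: "\<exists>u v. u < x & x < v & v - u < d & F v - F u < s * (v - u)"
  if "!!n. x \<in> O1 s n" "0 < d" for x s d
 proof -
  obtain n where "1 / real (Suc n) < d" using \<open>0 < d\<close> reals_Archimedean by (auto simp: inverse_eq_divide)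
  then show ?thesis using that(1)[of n] unfolding O1_def by fastforce
 qed
 have ex2: "\<exists>u v. u < x & x < v & v - u < d & F v - F u > s * (v - u)"
  if "!!n. x \<in> O2 s n" "0 < d" for x s d
 proof -
  obtain n where "1 / real (Suc n) < d" using \<open>0 < d\<close> reals_Archimedean by (auto simp: inverse_eq_divide)
  then show ?thesis using that(1)[of n] unfolding O2_def by fastforce
 qed
 have nE: "negligible (E s r)" if "s < r" for s r
  by (rule absolutely_cont_on_slopes_negligible[OF AC meas(1) _ that])
    (use ex1 ex2 in "auto simp: E_def")
 have nEp: "negligible Ep"
 proof (rule absolutely_cont_on_infinite_slope_negligible[OF AC meas(2)])
  fix x d B :: real assume x: "x \<in> Ep" and d: "0 < d"
  obtain m where m: "B <= real m" using real_arch_simple by blast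
  have "!!n. x \<in> O2 (real m) n" using x by (simp add: Ep_def)
  then obtain u v where "u < x" "x < v" "v - u < d" "F v - F u > real m * (v - u)"
   using ex2 d by blast
  moreover from this have "B * (v - u) <= real m * (v - u)" using m by (intro mult_right_mono) auto
  ultimately show "\<exists>u v. u < x & x < v & v - u < d & F v - F u > B * (v - u)"
   by (intro exI[of _ u] exI[of _ v]) linarith
 qed (auto simp: Ep_def)
 have nEm: "negligible Em"
 proof (rule absolutely_cont_on_infinite_slope_negligible[OF absolutely_cont_on_uminus[OF AC] meas(3)])
  fix x d B :: real assume x: "x \<in> Em" and d: "0 < d"
  obtain m where m: "B <= real m" using real_arch_simple by blast
  have "!!n. x \<in> O1 (- real m) n" using x by (simp add: Em_def)
  then obtain u v where "u < x" "x < v" "v - u < d" "F v - F u < - real m * (v - u)"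
   using ex1 d by blast
  moreover from this have "B * (v - u) <= real m * (v - u)" using m by (intro mult_right_mono) auto
  ultimately show "\<exists>u v. u < x & x < v & v - u < d & - F v - - F u > B * (v - u)"
   by (intro exI[of _ u] exI[of _ v]) linarith
 qed (auto simp: Em_def)
 define N where "N = (\<Union>(s, r)\<in>{(s, r). s \<in> \<rat> & r \<in> \<rat> & s < r}. E s r) \<union> Ep \<union> Em"
 have "countable {(s::real, r). s \<in> \<rat> & r \<in> \<rat> & s < r}"
  by (rule countable_subset[of _ "\<rat> \<times> \<rat>"]) (auto intro: countable_rat)
 then have "negligible N" unfolding N_def using nE nEp nEm
  by (intro negligible_Un negligible_countable_Union) auto
 moreover have "(F has_real_derivative deriv F x) (at x)" if x: "x \<in> {a<..<b} - N" for x
 proof -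
  have xab: "a < x" "x < b" using x by auto
  obtain m1 n1 where mn1: "x \<notin> O2 (real m1) n1" using x unfolding N_def Ep_def by auto
  obtain m2 n2 where mn2: "x \<notin> O1 (- real m2) n2" using x unfolding N_def Em_def by auto
  have notO1: "F v - F u \<ge> s * (v - u)" if "x \<notin> O1 s n" "u < x" "x < v" "v - u < 1 / real (Suc n)" for s n u v
  proof (rule ccontr)
   assume "\<not> F v - F u \<ge> s * (v - u)"
   then have "{u<..<v} \<in> {{u<..<v} |u v. v - u < 1 / real (Suc n) & F v - F u < s * (v - u)}"
    using that(4) by (intro CollectI exI[of _ u] exI[of _ v]) auto
   then have "x \<in> O1 s n" unfolding O1_def by (rule UnionI) (use that(2,3) in auto)
   then show False using that(1) by contradiction
  qed
  have notO2: "F v - F u <= s * (v - u)" if "x \<notin> O2 s n" "u < x" "x < v" "v - u < 1 / real (Suc n)" for s n u v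
  proof (rule ccontr)
   assume "\<not> F v - F u <= s * (v - u)"
   then have "{u<..<v} \<in> {{u<..<v} |u v. v - u < 1 / real (Suc n) & F v - F u > s * (v - u)}"
    using that(4) by (intro CollectI exI[of _ u] exI[of _ v]) auto
   then have "x \<in> O2 s n" unfolding O2_def by (rule UnionI) (use that(2,3) in auto)
   then show False using that(1) by contradiction
  qed
  \<comment> \<open>The numbers that bound all sufficiently short straddling slopes from below;
    their supremum turns out to be the derivative.\<close>
  define Q where "Q = {q. \<exists>n. x \<notin> O1 q n}"
  have Qle: "q <= real m1" if "q \<in> Q" for q
  proof -
   obtain n where n: "x \<notin> O1 q n" using \<open>q \<in> Q\<close> unfolding Q_def by blast
   define h where "h = 1 / real (Suc (max n n1)) / 3"
   have h: "0 < h" unfolding h_def by simp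
   have "2 * h < 1 / real (Suc (max n n1))" unfolding h_def by (simp add: field_simps)
   also have "... <= 1 / real (Suc n)" by (simp add: field_simps)
   finally have h1: "2 * h < 1 / real (Suc n)" .
   have "2 * h < 1 / real (Suc (max n n1))" unfolding h_def by (simp add: field_simps)
   also have "... <= 1 / real (Suc n1)" by (simp add: field_simps)
   finally have h2: "2 * h < 1 / real (Suc n1)" .
   have le: "q * (2 * h) <= F (x + h) - F (x - h)" "F (x + h) - F (x - h) <= real m1 * (2 * h)"
    subgoal using notO1[OF n, of "x - h" "x + h"] h h1 by simp
    subgoal using notO2[OF mn1, of "x - h" "x + h"] h h2 by simp
    done
   from le(1) le(2) have "q * (2 * h) <= real m1 * (2 * h)" by (rule order_trans)
   then show ?thesis using h by simp
  qed
  have Qne: "- real m2 \<in> Q" using mn2 unfolding Q_def by blast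
  have bdd: "bdd_above Q" using Qle unfolding bdd_above_def by blast
  define L where "L = Sup Q"
  have key: "\<exists>n. \<forall>u v. u < x & x < v & v - u < 1 / real (Suc n) --> \<bar>F v - F u - L * (v - u)\<bar> <= e * (v - u)"
   if "0 < e" for e
  proof -
   obtain q where q: "q \<in> Q" "L - e < q"
    using less_cSupD[of Q "L - e"] Qne \<open>0 < e\<close> unfolding L_def by auto
   then obtain n where n: "x \<notin> O1 q n" unfolding Q_def by blast
   obtain s where s: "s \<in> \<rat>" "L < s" "s < L + e" using Rats_dense_in_real[of L "L + e"] \<open>0 < e\<close> by auto
   obtain r where r: "r \<in> \<rat>" "s < r" "r < L + e" using Rats_dense_in_real[of s "L + e"] s by auto
   \<comment> \<open>So slopes below \<open>s\<close> occur at every scale, and since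
     \<open>x\<close> avoids \<open>E s r\<close>, slopes above \<open>r\<close> do not.\<close>
   have "s \<notin> Q" using s(2) cSup_upper[OF _ bdd, of s] unfolding L_def by auto
   then have "!!n. x \<in> O1 s n" unfolding Q_def by blast
   moreover have "x \<notin> E s r" using x s r unfolding N_def by auto
   ultimately obtain n' where n': "x \<notin> O2 r n'" using xab unfolding E_def by auto
   show ?thesis
   proof (intro exI[of _ "max n n'"] allI impI)
    fix u v assume uv: "u < x & x < v & v - u < 1 / real (Suc (max n n'))"
    have "1 / real (Suc (max n n')) <= 1 / real (Suc n)" "1 / real (Suc (max n n')) <= 1 / real (Suc n')"
     by (simp_all add: field_simps)
    with uv have 1: "F v - F u \<ge> q * (v - u)" "F v - F u <= r * (v - u)"
     using notO1[OF n, of u v] notO2[OF n', of u v] by auto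
    have "(L - e) * (v - u) <= q * (v - u)" "r * (v - u) <= (L + e) * (v - u)"
     using q(2) r(3) uv by (auto intro!: mult_right_mono)
    with 1 show "\<bar>F v - F u - L * (v - u)\<bar> <= e * (v - u)" by (simp add: algebra_simps abs_le_iff)
   qed
  qed
  have cont: "isCont F x"
   using absolutely_cont_on_imp_continuous_on[OF AC] xab
   by (intro continuous_on_interior[of "{a..b}"]) auto
  \<comment> \<open>One endpoint of a straddling interval is moved to \<open>x\<close>; the estimate
    \<open>key\<close> survives by continuity of \<open>F\<close>.\<close>
  have "((%y. (F y - F x) / (y - x)) \<longlongrightarrow> L) (at x)"
  proof (rule LIM_I)
   fix e :: real assume e: "0 < e"
   obtain n where n: "!!u v. u < x ==> x < v ==> v - u < 1 / real (Suc n) ==> \<bar>F v - F u - L * (v - u)\<bar> <= e/2 * (v - u)"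
    using key[of "e/2"] e by auto
   have lim: "((%h. F (x + h)) \<longlongrightarrow> F x) (at_right 0)" "((%h. F (x - h)) \<longlongrightarrow> F x) (at_right 0)"
    using cont by (auto intro!: isCont_tendsto_compose[of x F] tendsto_eq_intros)
   show "\<exists>s>0. \<forall>y. y ~= x & norm (y - x) < s --> norm ((F y - F x) / (y - x) - L) < e"
   proof (intro exI[of _ "1 / real (Suc n)"] conjI allI impI)
    fix y assume y: "y ~= x & norm (y - x) < 1 / real (Suc n)"
    have pos: "eventually (%h::real. 0 < h & h < 1 / real (Suc n) - \<bar>y - x\<bar>) (at_right 0)"
     using y by (auto intro!: eventually_conj eventually_at_right_real simp: eventually_at_right_less)
       (auto simp: eventually_at_right_field intro!: exI[of _ "1 / real (Suc n) - \<bar>y - x\<bar>"])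
    have "\<bar>F y - F x - L * (y - x)\<bar> <= e/2 * \<bar>y - x\<bar>"
    proof (cases "x < y")
     case True
     have l1: "((%h. \<bar>F y - F (x - h) - L * (y - (x - h))\<bar>) \<longlongrightarrow> \<bar>F y - F x - L * (y - (x - 0))\<bar>) (at_right 0)"
      by (intro tendsto_intros lim)
     have l2: "((%h. e/2 * (y - (x - h))) \<longlongrightarrow> e/2 * (y - (x - 0))) (at_right 0)"
      by (intro tendsto_intros)
     have ev: "eventually (%h. \<bar>F y - F (x - h) - L * (y - (x - h))\<bar> <= e/2 * (y - (x - h))) (at_right 0)"
      using pos
     proof eventually_elim
      case (elim h)
      show ?case by (rule n) (use elim True in auto)
     qed
     have "\<bar>F y - F x - L * (y - (x - 0))\<bar> <= e/2 * (y - (x - 0))"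
      by (rule tendsto_le[OF _ l2 l1 ev]) simp
     then show ?thesis using True by simp
    next
     case False
     then have yx: "y < x" using y by simp
     have l1: "((%h. \<bar>F (x + h) - F y - L * (x + h - y)\<bar>) \<longlongrightarrow> \<bar>F x - F y - L * (x + 0 - y)\<bar>) (at_right 0)"
      by (intro tendsto_intros lim)
     have l2: "((%h. e/2 * (x + h - y)) \<longlongrightarrow> e/2 * (x + 0 - y)) (at_right 0)"
      by (intro tendsto_intros)
     have ev: "eventually (%h. \<bar>F (x + h) - F y - L * (x + h - y)\<bar> <= e/2 * (x + h - y)) (at_right 0)"
      using pos
     proof eventually_elim
      case (elim h)
      show ?case by (rule n) (use elim yx in auto)
     qed
     have "\<bar>F x - F y - L * (x + 0 - y)\<bar> <= e/2 * (x + 0 - y)"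
      by (rule tendsto_le[OF _ l2 l1 ev]) simp
     then show ?thesis using yx by (simp add: algebra_simps abs_if split: if_splits)
    qed
    also have "... < e * \<bar>y - x\<bar>" using e y by (simp add: field_simps)
    finally have "\<bar>F y - F x - L * (y - x)\<bar> / \<bar>y - x\<bar> < e" using y by (simp add: field_simps)
    moreover have "(F y - F x) / (y - x) - L = (F y - F x - L * (y - x)) / (y - x)"
     using y by (simp add: field_simps)
    ultimately show "norm ((F y - F x) / (y - x) - L) < e" by (simp add: abs_divide)
   qed simp
  qed
  then have "(F has_real_derivative L) (at x)" by (simp add: has_field_derivative_iff)
  then show ?thesis using DERIV_imp_deriv by blast
 qed
 ultimately show thesis by (rule that)
qed

text \<open>A direct gauge argument, in which integrability of \<open>deriv F\<close> is a result
  and not an input. At tags in the null set \<open>N\<close> the gauge confines the pieces to an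
  open set of measure below \<delta>, where absolute continuity controls the increments; at all
  other tags differentiability does.\<close>

theorem absolutely_cont_on_has_integral_deriv:
 assumes AC: "absolutely_cont_on {a..b} F" and "a <= b"
 shows "(deriv F has_integral F b - F a) {a..b}"
proof (cases "a = b")
 case True
 then show ?thesis by (auto intro: has_integral_refl)
next
 case False
 then have ab: "a < b" using \<open>a <= b\<close> by simp
 obtain N0 where N0: "negligible N0" "!!x. x \<in> {a<..<b} - N0 ==> (F has_real_derivative deriv F x) (at x)"
  using absolutely_cont_on_AE_derivative[OF AC] by blast
 define N where "N = N0 \<union> {a, b}"
 have N: "negligible N" using N0(1) by (simp add: N_def negligible_Un)
 \<comment> \<open>The value 0 on \<open>N\<close> makes the tags in \<open>N\<close> invisible to
   the Riemann sum, so only the increments of \<open>F\<close> over their pieces remain.\<close>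
 define g where "g x = (if x \<in> N then 0 else deriv F x)" for x
 have "(g has_integral F b - F a) (cbox a b)"
 proof (unfold has_integral, intro allI impI)
  fix e :: real assume e: "0 < e"
  \<comment> \<open>The good tags then contribute at most \<open>e / 4\<close>, the tags in
    \<open>N\<close> less than \<open>e / 2\<close>.\<close>
  define e' where "e' = e / (4 * (b - a))"
  have e': "0 < e'" using e ab by (simp add: e'_def)
  obtain \<delta> where \<delta>: "0 < \<delta>" "!!\<D>. \<D> division_of \<Union>\<D> ==> \<Union>\<D> <= {a..b} ==>
   (\<Sum>K\<in>\<D>. Sup K - Inf K) < \<delta> ==> (\<Sum>K\<in>\<D>. \<bar>F (Sup K) - F (Inf K)\<bar>) < e / 2"
   by (rule absolutely_cont_onD[OF AC half_gt_zero[OF e]]) blast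
  have "N \<in> sets lebesgue" using N by (rule negligible_imp_sets)
  then obtain U where U: "open U" "N <= U" "U - N \<in> lmeasurable" "emeasure lebesgue (U - N) < ennreal \<delta>"
   using sets_lebesgue_outer_open \<delta>(1) by blast
  have UU: "U = (U - N) \<union> N" using U(2) by auto
  have Um: "U \<in> lmeasurable" by (subst UU) (use U(3) N negligible_iff_measure fmeasurable.Un in blast)
  have "measure lebesgue U = measure lebesgue (U - N)"
   by (rule measure_negligible_symdiff) (use Um N U(2,3) in "auto intro: negligible_subset[of N] dest: fmeasurableD")
  also have "... < \<delta>"
   using U(3,4) \<delta>(1) by (metis emeasure_eq_measure2 ennreal_less_iff less_eq_real_def measure_nonneg)
  finally have mU: "measure lebesgue U < \<delta>" .
  have "\<exists>d>0. \<forall>u v. u <= x & x <= v & {u..v} <= ball x d & {u..v} <= {a..b} -->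
       (if x \<in> N then {u..v} <= U else \<bar>F v - F u - g x * (v - u)\<bar> <= e' * (v - u))" if x: "x \<in> {a..b}" for x
  proof (cases "x \<in> N")
   case True
   then obtain d where "0 < d" "ball x d <= U" using U(1,2) open_contains_ball by blast
   then show ?thesis using True by (intro exI[of _ d]) auto
  next
   case False
   then have "(F has_real_derivative g x) (at x)" using N0(2)[of x] x unfolding N_def g_def by auto
   then have "(F has_derivative (%h. h * g x)) (at x)" by (simp add: has_field_derivative_def mult_commute_abs)
   then obtain d where d: "0 < d" "!!y. \<bar>y - x\<bar> < d ==> \<bar>F y - F x - (y - x) * g x\<bar> <= e' * \<bar>y - x\<bar>"
    using e' unfolding has_derivative_at_alt by (auto simp: real_norm_def)
   show ?thesis
   proof (intro exI[of _ d] conjI allI impI)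
    fix u v assume uv: "u <= x & x <= v & {u..v} <= ball x d & {u..v} <= {a..b}"
    then have "u \<in> ball x d" "v \<in> ball x d"
     by (meson atLeastAtMost_iff order.refl order_trans subsetD)+
    then have "\<bar>F u - F x - (u - x) * g x\<bar> <= e' * (x - u)" "\<bar>F v - F x - (v - x) * g x\<bar> <= e' * (v - x)"
     using d(2)[of u] d(2)[of v] uv by (auto simp: dist_real_def abs_minus_commute)
    then have "\<bar>F v - F u - g x * (v - u)\<bar> <= e' * (v - u)"
     by (simp add: algebra_simps abs_le_iff)
    then show "if x \<in> N then {u..v} <= U else \<bar>F v - F u - g x * (v - u)\<bar> <= e' * (v - u)"
     using False by simp
   qed (rule d(1))
  qed
  then obtain d where d: "!!x. x \<in> {a..b} ==> 0 < d x"
   "!!x u v. x \<in> {a..b} ==> u <= x ==> x <= v ==> {u..v} <= ball x (d x) ==> {u..v} <= {a..b} ==>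
       (if x \<in> N then {u..v} <= U else \<bar>F v - F u - g x * (v - u)\<bar> <= e' * (v - u))" by metis
  define \<gamma> where "\<gamma> x = (if x \<in> {a..b} then ball x (d x) else ball x 1)" for x
  have gauge: "gauge \<gamma>" using d(1) unfolding gauge_def \<gamma>_def by auto
  show "\<exists>\<gamma>. gauge \<gamma> & (\<forall>\<D>. \<D> tagged_division_of cbox a b & \<gamma> fine \<D> -->
      norm ((\<Sum>(x,k)\<in>\<D>. measure lborel k *\<^sub>R g x) - (F b - F a)) < e)"
  proof (intro exI[of _ \<gamma>] conjI allI impI gauge)
   fix p assume "p tagged_division_of cbox a b & \<gamma> fine p"
   then have p: "p tagged_division_of {a..b}" and fine: "\<gamma> fine p" by auto
   have finp: "finite p" using p by blast
   have el: "x \<in> {a..b} & (if x \<in> N then K <= U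
      else \<bar>F (Sup K) - F (Inf K) - measure lborel K * g x\<bar> <= e' * measure lborel K) & measure lborel K = Sup K - Inf K & Inf K <= Sup K"
    if xK: "(x, K) \<in> p" for x K
   proof -
    note t = tagged_division_ofD[OF p]
    obtain u v where uv: "K = {u..v}" using t(4)[OF xK] by auto
    have xx: "x \<in> {a..b}" "u <= x" "x <= v" using t(2,3)[OF xK] uv by auto
    have "K <= \<gamma> x" using fine xK unfolding fine_def by auto
    then have "{u..v} <= ball x (d x)" using uv xx by (simp add: \<gamma>_def)
    then show ?thesis using d(2)[OF xx] t(3)[OF xK] uv xx by (auto simp: mult.commute)
   qed
   let ?r = "%(x, K). F (Sup K) - F (Inf K) - measure lborel K * g x"
   define pN where "pN = {xk \<in> p. fst xk \<in> N}"
   have "(\<Sum>(x,k)\<in>p. F (Sup k) - F (Inf k)) = F b - F a"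
    by (rule additive_tagged_division_1[OF \<open>a <= b\<close> p])
   then have "F b - F a - (\<Sum>(x,k)\<in>p. measure lborel k *\<^sub>R g x) = sum ?r p"
    by (simp add: sum_subtractf case_prod_unfold)
   moreover have "sum ?r p = sum ?r pN + sum ?r (p - pN)"
    using finp by (subst sum.subset_diff[of pN p]) (auto simp: pN_def)
   moreover have "\<bar>sum ?r (p - pN)\<bar> <= e / 4"
   proof -
    have "\<bar>sum ?r (p - pN)\<bar> <= (\<Sum>xk\<in>p - pN. \<bar>?r xk\<bar>)" by (rule sum_abs)
    also have "... <= (\<Sum>xk\<in>p - pN. e' * measure lborel (snd xk))"
     using el by (intro sum_mono) (fastforce simp: pN_def)
    also have "... <= (\<Sum>xk\<in>p. e' * measure lborel (snd xk))"
     using finp e' by (intro sum_mono2) auto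
    also have "... = e' * (b - a)"
     using additive_content_tagged_division[of p a b] p \<open>a <= b\<close>
     by (simp add: sum_distrib_left[symmetric] case_prod_unfold)
    also have "... = e / 4" using ab unfolding e'_def by (simp add: divide_simps)
    finally show ?thesis .
   qed
   moreover have "\<bar>sum ?r pN\<bar> < e / 2"
   proof -
    have pNp: "pN tagged_partial_division_of {a..b}"
     using p tagged_partial_division_subset[of p "{a..b}" pN] unfolding tagged_division_of_def pN_def by auto
    have div: "snd ` pN division_of \<Union>(snd ` pN)"
     by (rule partial_division_of_tagged_division[OF pNp])
    have tag: "pN tagged_division_of \<Union>(snd ` pN)"
     by (rule tagged_partial_division_of_Union_self[OF pNp])
    have finN: "finite (snd ` pN)" using div by blast
    have K_iv: "Sup K - Inf K = measure lebesgue K & K \<in> lmeasurable" if K: "K \<in> snd ` pN" for K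
    proof -
     obtain u v where "K = cbox u v" using division_ofD(4)[OF div K] by blast
     then show ?thesis using division_ofD(3)[OF div K] by simp
    qed
    have subU: "\<Union>(snd ` pN) <= U" using el unfolding pN_def by force
    have "(\<Sum>K\<in>snd ` pN. Sup K - Inf K) = (\<Sum>K\<in>snd ` pN. measure lebesgue K)"
     using K_iv by simp
    also have "... = measure lebesgue (\<Union>(snd ` pN))"
    proof (rule measure_negligible_finite_Union[symmetric, OF finN])
     show "pairwise (%S T. negligible (S \<inter> T)) (snd ` pN)"
     proof (rule pairwiseI)
      fix S T assume ST: "S \<in> snd ` pN" "T \<in> snd ` pN" "S ~= T"
      obtain u v where S: "S = cbox u v" using division_ofD(4)[OF div ST(1)] by blast
      obtain u' v' where T: "T = cbox u' v'" using division_ofD(4)[OF div ST(2)] by blast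
      have "interior S \<inter> interior T = {}" using division_ofD(5)[OF div ST] .
      then have "S \<inter> T <= {u, v, u', v'}" unfolding S T by (auto simp: interior_cbox)
      then show "negligible (S \<inter> T)" using finite_subset negligible_finite by (metis finite.emptyI finite.insertI)
     qed
    qed (use K_iv in auto)
    also have "... <= measure lebesgue U"
     using subU Um K_iv finN by (intro measure_mono_fmeasurable) (auto dest: fmeasurableD intro!: sets.finite_Union)
    finally have small: "(\<Sum>K\<in>snd ` pN. Sup K - Inf K) < \<delta>" using mU by simp
    have "\<bar>sum ?r pN\<bar> <= (\<Sum>xk\<in>pN. \<bar>?r xk\<bar>)" by (rule sum_abs)
    also have "... = (\<Sum>(x, K)\<in>pN. \<bar>F (Sup K) - F (Inf K)\<bar>)"
     by (rule sum.cong) (auto simp: pN_def g_def)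
    also have "... = (\<Sum>K\<in>snd ` pN. \<bar>F (Sup K) - F (Inf K)\<bar>)"
    proof -
     have "(\<Sum>(x, K)\<in>pN. if K = {} then 0 else \<bar>F (Sup K) - F (Inf K)\<bar>)
       = (\<Sum>K\<in>snd ` pN. if K = {} then 0 else \<bar>F (Sup K) - F (Inf K)\<bar>)"
      by (rule sum.over_tagged_division_lemma[OF tag]) (auto simp: box_real)
     moreover have "K ~= {}" if "(x, K) \<in> pN" for x K
      using that tagged_division_ofD(2)[OF p, of x K] unfolding pN_def by auto
     ultimately show ?thesis by (auto simp: case_prod_unfold cong: sum.cong)
       (smt (verit, ccfv_SIG) imageE prod.collapse sum.cong)
    qed
    also have "... < e / 2"
    proof (rule \<delta>(2)[OF div _ small])
     show "\<Union>(snd ` pN) <= {a..b}" using tagged_division_ofD(3)[OF p] unfolding pN_def by fastforce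
    qed
    finally show ?thesis .
   qed
   ultimately have "\<bar>F b - F a - (\<Sum>(x,k)\<in>p. measure lborel k *\<^sub>R g x)\<bar> < e" using e by linarith
   then show "norm ((\<Sum>(x,k)\<in>p. measure lborel k *\<^sub>R g x) - (F b - F a)) < e"
    by (simp add: abs_minus_commute)
  qed
 qed
 from has_integral_spike[OF N _ this, of "deriv F"] show ?thesis by (auto simp: g_def)
qed

section \<open>Multipliers for classical solutions\<close>

lemma has_derivative_integral_real:
 fixes f f' :: "real => real => real"
 assumes der: "!!t x. t \<in> {c..d} ==> x \<in> {a..b} ==> ((%t. f t x) has_real_derivative f' t x) (at t within {c..d})"
  and cont: "continuous_on ({c..d} \<times> {a..b}) (%(t, x). f t x)" "continuous_on ({c..d} \<times> {a..b}) (%(t, x). f' t x)"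
  and t: "t \<in> {c..d}"
 shows "((%t. integral {a..b} (f t)) has_real_derivative integral {a..b} (f' t)) (at t within {c..d})"
proof -
 have "f s integrable_on cbox a b" if s: "s \<in> {c..d}" for s
 proof -
  have "continuous_on {a..b} (%x. (%(t, x). f t x) (s, x))"
   by (rule continuous_on_compose2[OF cont(1)]) (auto intro!: continuous_intros simp: s[unfolded atLeastAtMost_iff])
  then show ?thesis by (auto intro: integrable_continuous_interval)
 qed
 then show ?thesis
  using leibniz_rule_field_derivative[of "{c..d}" a b f f' t] der cont(2) t by auto
qed

lemma has_integral_real_derivative:
 fixes G g :: "real => real"
 assumes "a <= b" "!!x. x \<in> {a..b} ==> (G has_real_derivative g x) (at x within {a..b})"
 shows "(g has_integral G b - G a) {a..b}"
 using assms fundamental_theorem_of_calculus[of a b G g]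
 by (auto simp: has_real_derivative_iff_has_vector_derivative)

lemma two_mult_le_sum_squares: "2 * u * v <= u^2 + (v::real)^2"
 using zero_le_power2[of "u - v"] by (simp add: power2_eq_square algebra_simps)

definition slab :: "(real => real => real) => real => real => real" where
 "slab f \<mu> t = integral {1-\<mu>..1} (%x. (f t x)^2)"

text \<open>
  A classical solution of the degenerate wave equation on \<open>(0,1]\<close>, recorded as a first-order system:
  \<open>y\<close> and \<open>w\<close> are the time derivatives of \<open>z\<close>, \<open>p = x\<^sup>\<alpha> z\<^sub>x\<close> is the flux and \<open>q\<close> its time derivative.
\<close>

locale classical_wave =
 fixes \<alpha> T :: real and z y w p q :: "real => real => real"
 assumes \<alpha>: "0 < \<alpha>" "\<alpha> < 2"
  and zt: "!!t x. t \<in> {0..T} ==> x \<in> {0<..1} ==> ((%t. z t x) has_real_derivative y t x) (at t within {0..T})"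
  and yt: "!!t x. t \<in> {0..T} ==> x \<in> {0<..1} ==> ((%t. y t x) has_real_derivative w t x) (at t within {0..T})"
  and pt: "!!t x. t \<in> {0..T} ==> x \<in> {0<..1} ==> ((%t. p t x) has_real_derivative q t x) (at t within {0..T})"
  and zx: "!!t x. t \<in> {0..T} ==> x \<in> {0<..1} ==> (z t has_real_derivative x powr - \<alpha> * p t x) (at x within {0<..1})"
  and yx: "!!t x. t \<in> {0..T} ==> x \<in> {0<..1} ==> (y t has_real_derivative x powr - \<alpha> * q t x) (at x within {0<..1})"
  and px: "!!t x. t \<in> {0..T} ==> x \<in> {0<..1} ==> (p t has_real_derivative w t x) (at x within {0<..1})"
  and cz: "continuous_on ({0..T} \<times> {0<..1}) (%(t, x). z t x)"
  and cy: "continuous_on ({0..T} \<times> {0<..1}) (%(t, x). y t x)"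
  and cw: "continuous_on ({0..T} \<times> {0<..1}) (%(t, x). w t x)"
  and cp: "continuous_on ({0..T} \<times> {0<..1}) (%(t, x). p t x)"
  and cq: "continuous_on ({0..T} \<times> {0<..1}) (%(t, x). q t x)"
  and z1: "!!t. t \<in> {0..T} ==> z t 1 = 0"
  and y1: "!!t. t \<in> {0..T} ==> y t 1 = 0"
begin

definition r :: "real => real" where "r x = x powr - \<alpha>"

lemma r_nonneg [simp]: "0 <= r x" by (simp add: r_def)

lemma r_one [simp]: "r 1 = 1" by (simp add: r_def)

lemma r_pos: "0 < x ==> 0 < r x" by (simp add: r_def)

lemma r_deriv: "0 < x ==> (r has_real_derivative - \<alpha> * r x / x) (at x within S)"
proof -
 assume x: "0 < x"
 have "(r has_real_derivative - \<alpha> * x powr (- \<alpha> - 1)) (at x)"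
  using has_real_derivative_powr[OF x, of "- \<alpha>"] unfolding r_def[abs_def] by simp
 moreover have "x powr (- \<alpha> - 1) = r x / x" using x by (simp add: powr_diff r_def)
 ultimately show ?thesis by (simp add: has_field_derivative_at_within)
qed

lemma r_bound: "1/2 <= x ==> r x <= 4"
proof -
 assume x: "1/2 <= x"
 have "r x <= (1/2) powr - \<alpha>" unfolding r_def using x \<alpha> by (intro powr_mono2') auto
 also have "... = 2 powr \<alpha>" by (simp add: powr_minus_divide powr_divide)
 also have "... <= 2 powr 2" using \<alpha> by (intro powr_mono) auto
 finally show ?thesis by simp
qed

text \<open>Since \<open>z_x = r x * p\<close>, this bounds the square of \<open>x z_x\<close> by
  the density of potential energy. It amounts to \<open>x powr (2 - \<alpha>) <= 1\<close>.\<close>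

lemma r_square: "0 < x ==> x <= 1 ==> (x * r x)\<^sup>2 <= r x"
proof -
 assume x: "0 < x" "x <= 1"
 have "x^2 * r x = x powr 2 * x powr - \<alpha>" using x by (simp add: powr_numeral r_def)
 also have "... = x powr (2 - \<alpha>)" using x by (simp add: powr_diff powr_minus_divide)
 also have "... <= 1" using x \<alpha> by (simp add: powr_le1)
 finally have "x^2 * r x * r x <= 1 * r x" by (intro mult_right_mono) auto
 then show ?thesis by (simp add: power2_eq_square mult_ac)
qed

lemma cont_r: "continuous_on {0<..1} r"
 unfolding r_def[abs_def] by (intro continuous_intros) auto

lemma rect: "0 < a ==> {0..T} \<times> {a..1} <= {0..T} \<times> {0<..(1::real)}" by auto

lemma cont_rect:
 assumes "0 < a"
 shows "continuous_on ({0..T} \<times> {a..1}) (%u. z (fst u) (snd u))"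
  "continuous_on ({0..T} \<times> {a..1}) (%u. y (fst u) (snd u))"
  "continuous_on ({0..T} \<times> {a..1}) (%u. w (fst u) (snd u))"
  "continuous_on ({0..T} \<times> {a..1}) (%u. p (fst u) (snd u))"
  "continuous_on ({0..T} \<times> {a..1}) (%u. q (fst u) (snd u))"
  "continuous_on ({0..T} \<times> {a..1}) (%u. r (snd u))"
  "continuous_on ({0..T} \<times> {a..1}) (%u. 1 / snd u)"
proof -
 show "continuous_on ({0..T} \<times> {a..1}) (%u. r (snd u))"
  by (rule continuous_on_compose2[OF cont_r]) (use assms in "auto intro!: continuous_intros")
qed (use cz cy cw cp cq assms in
 \<open>auto intro!: continuous_on_subset[OF _ rect] continuous_intros simp: case_prod_unfold\<close>)

lemma cont_slice:
 assumes "0 < a" "t \<in> {0..T}"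
 shows "continuous_on {a..1} (z t)" "continuous_on {a..1} (y t)" "continuous_on {a..1} (w t)"
  "continuous_on {a..1} (p t)" "continuous_on {a..1} (q t)" "continuous_on {a..1} r"
proof -
 have *: "continuous_on {a..1} (f t)" if "continuous_on ({0..T} \<times> {0<..1}) (%(t, x). f t x)" for f :: "real => real => real"
  by (rule continuous_on_compose2[OF that, of _ "%x. (t, x)", simplified]) (use assms in "auto intro!: continuous_intros")
 show "continuous_on {a..1} (z t)" "continuous_on {a..1} (y t)" "continuous_on {a..1} (w t)"
  "continuous_on {a..1} (p t)" "continuous_on {a..1} (q t)"
  using cz cy cw cp cq by (auto intro!: *)
 show "continuous_on {a..1} r" using assms by (intro continuous_on_subset[OF cont_r]) auto
qed

lemma x_derivs:
 assumes "0 < a" "t \<in> {0..T}" "x \<in> {a..1}"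
 shows "(z t has_real_derivative r x * p t x) (at x within {a..1})"
  "(y t has_real_derivative r x * q t x) (at x within {a..1})"
  "(p t has_real_derivative w t x) (at x within {a..1})"
  "(r has_real_derivative - \<alpha> * r x / x) (at x within {a..1})"
proof -
 have x: "x \<in> {0<..1}" and sub: "{a..1} <= {0<..1}" using assms by auto
 show "(z t has_real_derivative r x * p t x) (at x within {a..1})"
  unfolding r_def by (rule has_field_derivative_subset[OF zx[OF assms(2) x] sub])
 show "(y t has_real_derivative r x * q t x) (at x within {a..1})"
  unfolding r_def by (rule has_field_derivative_subset[OF yx[OF assms(2) x] sub])
 show "(p t has_real_derivative w t x) (at x within {a..1})"
  by (rule has_field_derivative_subset[OF px[OF assms(2) x] sub])
 show "(r has_real_derivative - \<alpha> * r x / x) (at x within {a..1})"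
  using x by (intro r_deriv) auto
qed

text \<open>The second term is \<open>x^\<alpha> z_x^2\<close> expressed through the flux. Starting
  the integral at \<open>a\<close> replaces the boundary condition at the degenerate end by explicit
  terms at \<open>a\<close>.\<close>

definition energy :: "real => real => real" where
 "energy a t = integral {a..1} (%x. (y t x)^2 + r x * (p t x)^2) / 2"

text \<open>Only the flow of energy through the artificial boundary \<open>a\<close> survives,
  because \<open>y\<close> vanishes at 1.\<close>

lemma energy_deriv:
 assumes "0 < a" "a <= 1" "t \<in> {0..T}"
 shows "(energy a has_real_derivative - (y t a * p t a)) (at t within {0..T})"
proof -
 have "((%t. integral {a..1} (%x. (y t x)^2 + r x * (p t x)^2)) has_real_derivative
   integral {a..1} (%x. 2 * y t x * w t x + r x * (2 * p t x * q t x))) (at t within {0..T})"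
 proof (rule has_derivative_integral_real)
  fix t x assume "t \<in> {0..T}" "x \<in> {a..1}"
  then show "((%t. (y t x)^2 + r x * (p t x)^2) has_real_derivative 2 * y t x * w t x + r x * (2 * p t x * q t x)) (at t within {0..T})"
   using assms by (auto intro!: derivative_eq_intros yt pt)
 qed (use assms in "auto simp: case_prod_unfold intro!: continuous_intros cont_rect")
 moreover have "((%x. y t x * w t x + r x * (p t x * q t x)) has_integral y t 1 * p t 1 - y t a * p t a) {a..1}"
  by (rule has_integral_real_derivative) (use assms in "auto intro!: derivative_eq_intros x_derivs")
 then have "((%x. 2 * (y t x * w t x + r x * (p t x * q t x))) has_integral 2 * (y t 1 * p t 1 - y t a * p t a)) {a..1}"
  by (rule has_integral_mult_right)
 then have "integral {a..1} (%x. 2 * y t x * w t x + r x * (2 * p t x * q t x)) = - 2 * (y t a * p t a)"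
  using y1[OF assms(3)] by (intro integral_unique) (simp add: algebra_simps)
 ultimately show ?thesis unfolding energy_def by (auto intro!: derivative_eq_intros)
qed

lemma energy_conservation:
 assumes a: "0 < a" "a <= 1" and \<xi>: "!!t. t \<in> {0..T} ==> \<bar>y t a * p t a\<bar> <= \<xi>" and t: "t \<in> {0..T}"
 shows "\<bar>energy a t - energy a 0\<bar> <= \<xi> * T"
proof -
 have "norm (energy a t - energy a 0) <= \<xi> * norm (t - 0)"
  by (rule field_differentiable_bound[OF convex_real_interval(5) energy_deriv[OF a]]) (use \<xi> t in auto)
 also have "... <= \<xi> * T" using t \<xi>[OF t] by (intro mult_left_mono) auto
 finally show ?thesis by simp
qed

text \<open>The factor \<open>\<alpha>/4\<close> is the one for which \<open>y^2\<close> and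
  \<open>x^\<alpha> z_x^2\<close> obtain the same coefficient, \<open>-(2 - \<alpha>)/4\<close>, in
  the time derivative; this is how the energy itself appears there.\<close>

definition multiplier :: "real => real => real" where
 "multiplier a t = integral {a..1} (%x. y t x * (x * r x * p t x + \<alpha>/4 * z t x))"

lemma multiplier_deriv:
 assumes "0 < a" "a <= 1" "t \<in> {0..T}"
 shows "(multiplier a has_real_derivative
   (p t 1)\<^sup>2 / 2 - (a * r a * (p t a)^2 / 2 + \<alpha>/4 * p t a * z t a + a * (y t a)^2 / 2)
    - (2 - \<alpha>) / 2 * energy a t) (at t within {0..T})"
proof -
 let ?f' = "%t x. w t x * (x * r x * p t x + \<alpha>/4 * z t x) + y t x * (x * r x * q t x + \<alpha>/4 * y t x)"
 let ?G = "%x. 1/2 * (x * r x * (p t x)^2) + \<alpha>/4 * p t x * z t x + 1/2 * (x * (y t x)^2)"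
 let ?E = "%x. (y t x)^2 + r x * (p t x)^2"
 have D: "(multiplier a has_real_derivative integral {a..1} (?f' t)) (at t within {0..T})"
  unfolding multiplier_def
 proof (rule has_derivative_integral_real)
  fix t x assume "t \<in> {0..T}" "x \<in> {a..1}"
  then show "((%t. y t x * (x * r x * p t x + \<alpha>/4 * z t x)) has_real_derivative ?f' t x) (at t within {0..T})"
   using assms by (auto intro!: derivative_eq_intros zt yt pt simp: algebra_simps)
 qed (use assms in "auto simp: case_prod_unfold intro!: continuous_intros cont_rect")
 have I1: "((%x. ?f' t x + (2 - \<alpha>) / 4 * ?E x) has_integral ?G 1 - ?G a) {a..1}"
 proof (rule has_integral_real_derivative)
  fix x assume x: "x \<in> {a..1}"
  show "(?G has_real_derivative ?f' t x + (2 - \<alpha>) / 4 * ?E x) (at x within {a..1})"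
   by (rule derivative_eq_intros x_derivs[OF assms(1,3) x] refl)+
    (use assms x in "simp add: field_simps power2_eq_square")
 qed (rule assms)
 have "(?E has_integral 2 * energy a t) {a..1}"
  unfolding energy_def using assms
  by (auto intro!: integrable_integral integrable_continuous_interval continuous_intros cont_slice)
 then have I2: "((%x. (2 - \<alpha>) / 4 * ?E x) has_integral (2 - \<alpha>) / 4 * (2 * energy a t)) {a..1}"
  by (rule has_integral_mult_right)
 have "integral {a..1} (?f' t) = ?G 1 - ?G a - (2 - \<alpha>) / 4 * (2 * energy a t)"
  using has_integral_diff[OF I1 I2] unfolding add_diff_cancel_right' by (rule integral_unique)
 with D have "(multiplier a has_real_derivative ?G 1 - ?G a - (2 - \<alpha>) / 4 * (2 * energy a t)) (at t within {0..T})"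
  by simp
 then show ?thesis
  by (rule DERIV_cong) (simp add: z1[OF assms(3)] y1[OF assms(3)] field_simps)
qed

text \<open>No constant is lost. The square of \<open>x z_x + \<alpha>/4 z\<close> is
  \<open>(x z_x)^2\<close> plus the derivative of \<open>\<alpha>/4 x z^2\<close> minus a
  nonnegative multiple of \<open>z^2\<close>, as \<open>\<alpha>/4 <= 1\<close>. The constant 1 is
  what makes every time beyond \<open>4/(2-\<alpha>)\<close> sufficient.\<close>

lemma multiplier_bound:
 assumes "0 < a" "a <= 1" "t \<in> {0..T}"
 shows "\<bar>multiplier a t\<bar> <= energy a t"
proof -
 let ?v = "%x. x * r x * p t x + \<alpha>/4 * z t x"
 let ?E = "%x. (y t x)^2 + r x * (p t x)^2"
 let ?H' = "%x. \<alpha>/4 * ((z t x)^2 + x * (2 * z t x * (r x * p t x)))"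
 have cont: "continuous_on {a..1} ?E" "continuous_on {a..1} (%x. y t x * ?v x)"
  using assms by (auto intro!: continuous_intros cont_slice)
 have H: "(?H' has_integral \<alpha>/4 * (1 * (z t 1)^2) - \<alpha>/4 * (a * (z t a)^2)) {a..1}"
 proof (rule has_integral_real_derivative)
  fix x assume x: "x \<in> {a..1}"
  show "((%x. \<alpha>/4 * (x * (z t x)^2)) has_real_derivative ?H' x) (at x within {a..1})"
   by (rule derivative_eq_intros x_derivs[OF assms(1,3) x] refl)+ simp
 qed (rule assms)
 have E: "(?E has_integral 2 * energy a t) {a..1}"
  unfolding energy_def using cont by (auto intro!: integrable_integral integrable_continuous_interval)
 have EH: "((%x. ?E x + ?H' x) has_integral 2 * energy a t - \<alpha>/4 * (a * (z t a)^2)) {a..1}"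
  using has_integral_add[OF E H] z1[OF assms(3)] by simp
 have I: "((%x. y t x * ?v x) has_integral multiplier a t) {a..1}"
  unfolding multiplier_def using cont by (auto intro!: integrable_integral integrable_continuous_interval)
 have v: "(?v x)^2 <= r x * (p t x)^2 + ?H' x" if x: "x \<in> {a..1}" for x
 proof -
  have "(x * r x)^2 * (p t x)^2 <= r x * (p t x)^2"
   using x assms by (intro mult_right_mono r_square) auto
  moreover have "(\<alpha>/4) * (\<alpha>/4) * (z t x)^2 <= (\<alpha>/4) * 1 * (z t x)^2"
   using \<alpha> by (intro mult_right_mono mult_left_mono) auto
  ultimately show ?thesis by (simp add: power2_eq_square algebra_simps)
 qed
 have "2 * multiplier a t <= 2 * energy a t - \<alpha>/4 * (a * (z t a)^2)"
 proof (rule has_integral_le[OF has_integral_mult_right[OF I] EH])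
  fix x assume x: "x \<in> {a..1}"
  show "2 * (y t x * ?v x) <= ?E x + ?H' x"
   using two_mult_le_sum_squares[of "y t x" "?v x"] v[OF x] by (simp add: mult.assoc)
 qed
 moreover have "(-2) * multiplier a t <= 2 * energy a t - \<alpha>/4 * (a * (z t a)^2)"
 proof (rule has_integral_le[OF has_integral_mult_right[OF I] EH])
  fix x assume x: "x \<in> {a..1}"
  show "(-2) * (y t x * ?v x) <= ?E x + ?H' x"
   using two_mult_le_sum_squares[of "- y t x" "?v x"] v[OF x] by (simp add: mult.assoc)
 qed
 moreover have "0 <= \<alpha>/4 * (a * (z t a)^2)" using assms \<alpha> by simp
 ultimately show ?thesis by linarith
qed

lemma cont_flux: "continuous_on {0..T} (%t. (p t 1)^2)"
proof -
 have "continuous_on {0..T} (%t. p t 1)"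
  by (intro DERIV_continuous_on[OF pt]) auto
 then show ?thesis by (intro continuous_intros)
qed

text \<open>Integrating the derivative of the multiplier gains \<open>(2 - \<alpha>)/2\<close>
  energies per unit of time and loses one energy at each of the two ends. All terms at
  \<open>a\<close>, including the drift of the truncated energy, are collected in \<xi>.\<close>

lemma boundary_observability:
 assumes a: "0 < a" "a <= 1"
  and \<xi>: "!!t. t \<in> {0..T} ==> \<bar>y t a * p t a\<bar> <= \<xi>" "!!t. t \<in> {0..T} ==> \<bar>p t a * z t a\<bar> <= \<xi>"
   "!!t. t \<in> {0..T} ==> a * (y t a)^2 <= \<xi>" "!!t. t \<in> {0..T} ==> a * r a * (p t a)^2 <= \<xi>"
  and t: "0 <= t1" "t1 <= t2" "t2 <= T"
 shows "((2 - \<alpha>) / 2 * (t2 - t1) - 2) * energy a 0 <= integral {t1..t2} (%t. (p t 1)^2) / 2 + \<xi> * (4 * T + T^2)"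
proof -
 have T0: "0 \<in> {0..T}" using t by auto
 have cons: "\<bar>energy a s - energy a 0\<bar> <= \<xi> * T" if "s \<in> {0..T}" for s
  by (rule energy_conservation[OF a \<xi>(1) that])
 have \<xi>0: "0 <= \<xi>" using \<xi>(1)[OF T0] by linarith
 let ?X' = "%t. (p t 1)^2 / 2 - (a * r a * (p t a)^2 / 2 + \<alpha>/4 * p t a * z t a + a * (y t a)^2 / 2)
    - (2 - \<alpha>) / 2 * energy a t"
 have X: "(?X' has_integral multiplier a t2 - multiplier a t1) {t1..t2}"
  by (rule has_integral_real_derivative[OF t(2)])
    (rule has_field_derivative_subset[OF multiplier_deriv[OF a]], use t in auto)
 have "(%t. (p t 1)^2) integrable_on {t1..t2}"
  using t by (intro integrable_continuous_interval continuous_on_subset[OF cont_flux]) auto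
 then have h: "((%t. (p t 1)^2 / 2) has_integral integral {t1..t2} (%t. (p t 1)^2) / 2) {t1..t2}"
  by (intro has_integral_divide integrable_integral)
 let ?c = "2 * \<xi> - (2 - \<alpha>) / 2 * (energy a 0 - \<xi> * T)"
 have c: "((%t. ?c) has_integral (t2 - t1) * ?c) {t1..t2}"
  using has_integral_const_real[of ?c t1 t2] t by simp
 have le: "multiplier a t2 - multiplier a t1 <= integral {t1..t2} (%t. (p t 1)^2) / 2 + (t2 - t1) * ?c"
 proof (rule has_integral_le[OF X has_integral_add[OF h c]])
  fix s assume "s \<in> {t1..t2}"
  then have s: "s \<in> {0..T}" using t by auto
  have "\<bar>\<alpha>/4 * (p s a * z s a)\<bar> <= 1 * \<xi>"
   unfolding abs_mult[of "\<alpha>/4"] using \<alpha> \<xi>(2)[OF s] by (intro mult_mono) auto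
  moreover have "0 <= a * r a * (p s a)^2" "0 <= a * (y s a)^2" using a by auto
  moreover have "(2 - \<alpha>) / 2 * (energy a 0 - \<xi> * T) <= (2 - \<alpha>) / 2 * energy a s"
   using cons[OF s] \<alpha> by (intro mult_left_mono) auto
  ultimately show "?X' s <= (p s 1)^2 / 2 + ?c"
   using \<xi>0 unfolding mult.assoc by linarith
 qed
 have t': "t1 \<in> {0..T}" "t2 \<in> {0..T}" using t by auto
 have "- 2 * (energy a 0 + \<xi> * T) <= multiplier a t2 - multiplier a t1"
  using multiplier_bound[OF a t'(1)] multiplier_bound[OF a t'(2)]
   cons[OF t'(1)] cons[OF t'(2)] unfolding abs_le_iff by (simp add: algebra_simps)
 moreover have "\<xi> * 2 * (t2 - t1) <= \<xi> * 2 * T" using t \<xi>0 by (intro mult_left_mono) auto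
 moreover have "\<xi> * ((2 - \<alpha>) / 2) * ((t2 - t1) * T) <= \<xi> * 1 * (T * T)"
  using t \<xi>0 \<alpha> by (intro mult_mono) auto
 moreover note le
 moreover define g where "g = (2 - \<alpha>) / 2"
 moreover define L where "L = t2 - t1"
 ultimately show ?thesis unfolding g_def[symmetric] L_def[symmetric]
  by (simp add: algebra_simps power2_eq_square)
qed

section \<open>Localised multipliers in a strip at x = 1\<close>

lemma slab_cont:
 assumes "0 < \<mu>" "\<mu> < 1"
 shows "continuous_on {0..T} (slab y \<mu>)" "continuous_on {0..T} (slab z \<mu>)"
proof -
 have b: "0 < 1 - \<mu>" using assms by simp
 have "(slab y \<mu> has_real_derivative integral {1-\<mu>..1} (%x. 2 * y t x * w t x)) (at t within {0..T})"
  if "t \<in> {0..T}" for t unfolding slab_def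
 proof (rule has_derivative_integral_real)
  fix t x assume "t \<in> {0..T}" "x \<in> {1-\<mu>..1}"
  then show "((%t. (y t x)^2) has_real_derivative 2 * y t x * w t x) (at t within {0..T})"
   using assms by (auto intro!: derivative_eq_intros yt)
 qed (use that b in "auto simp: case_prod_unfold intro!: continuous_intros cont_rect")
 then show "continuous_on {0..T} (slab y \<mu>)" by (rule DERIV_continuous_on)
 have "(slab z \<mu> has_real_derivative integral {1-\<mu>..1} (%x. 2 * z t x * y t x)) (at t within {0..T})"
  if "t \<in> {0..T}" for t unfolding slab_def
 proof (rule has_derivative_integral_real)
  fix t x assume "t \<in> {0..T}" "x \<in> {1-\<mu>..1}"
  then show "((%t. (z t x)^2) has_real_derivative 2 * z t x * y t x) (at t within {0..T})"
   using assms by (auto intro!: derivative_eq_intros zt)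
 qed (use that b in "auto simp: case_prod_unfold intro!: continuous_intros cont_rect")
 then show "continuous_on {0..T} (slab z \<mu>)" by (rule DERIV_continuous_on)
qed

definition cutoff :: "real => real => real" where
 "cutoff \<mu> x = (x - 1 + \<mu>) / \<mu>"

lemma cutoff:
 assumes "0 < \<mu>"
 shows "cutoff \<mu> (1 - \<mu>) = 0" "cutoff \<mu> 1 = 1"
  "x \<in> {1-\<mu>..1} ==> 0 <= cutoff \<mu> x" "x \<in> {1-\<mu>..1} ==> cutoff \<mu> x <= 1"
  "(cutoff \<mu> has_real_derivative 1 / \<mu>) (at x within S)"
 using assms unfolding cutoff_def[abs_def] by (auto intro!: derivative_eq_intros simp: field_simps)

text \<open>Powers of the cutoff are chosen so that each cross term is absorbed by the preceding one.\<close>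

definition flux_mult :: "real => real => real" where
 "flux_mult \<mu> t = (t * (T - t))^2 * integral {1-\<mu>..1} (%x. y t x * (cutoff \<mu> x)^3 * (r x * p t x))"

definition mass_mult :: "real => real => real" where
 "mass_mult \<mu> t = (t * (T - t))^2 * integral {1-\<mu>..1} (%x. y t x * (cutoff \<mu> x)^2 * z t x)"

definition slab_flux :: "real => real => real" where
 "slab_flux \<mu> t = integral {1-\<mu>..1} (%x. (cutoff \<mu> x)^2 * (r x * (p t x)^2))"

lemma cont_cutoff: "0 < \<mu> ==> continuous_on S (cutoff \<mu>)"
 unfolding cutoff_def[abs_def] by (intro continuous_intros) auto

lemma slab_integrals:
 assumes "0 < \<mu>" "\<mu> < 1" "t \<in> {0..T}"
 shows "((%x. (y t x)^2) has_integral slab y \<mu> t) {1-\<mu>..1}"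
  "((%x. (z t x)^2) has_integral slab z \<mu> t) {1-\<mu>..1}"
  "((%x. (cutoff \<mu> x)^2 * (r x * (p t x)^2)) has_integral slab_flux \<mu> t) {1-\<mu>..1}"
 unfolding slab_def slab_flux_def using assms
 by (auto intro!: integrable_integral integrable_continuous_interval continuous_intros cont_slice cont_cutoff)

text \<open>Localised equipartition of energy: the multiplier \<open>z\<close> trades the potential
  energy of the strip for its kinetic energy. The derivative of the cutoff costs
  \<open>z^2 / \<mu>^2\<close>.\<close>

lemma mass_mult_deriv:
 assumes \<mu>: "0 < \<mu>" "\<mu> < 1" and t: "t \<in> {0..T}"
 shows "\<exists>D. (mass_mult \<mu> has_real_derivative D) (at t within {0..T}) &
   D <= 2 * (t * (T - t))^2 * slab y \<mu> t
    + ((T - 2 * t)^2 + 2 / \<mu>\<^sup>2 * (t * (T - t))^2) * slab z \<mu> t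
    - 1/2 * (t * (T - t))^2 * slab_flux \<mu> t"
proof -
 let ?\<beta> = "t * (T - t)" and ?\<beta>' = "T - 2 * t" and ?\<zeta> = "cutoff \<mu>"
 let ?f = "%t x. y t x * (?\<zeta> x)^2 * z t x"
 let ?f' = "%t x. (w t x * z t x + (y t x)^2) * (?\<zeta> x)^2"
 have b: "0 < 1 - \<mu>" using \<mu> by simp
 have D1: "((%t. integral {1-\<mu>..1} (?f t)) has_real_derivative integral {1-\<mu>..1} (?f' t)) (at t within {0..T})"
 proof (rule has_derivative_integral_real)
  fix t x assume "t \<in> {0..T}" "x \<in> {1-\<mu>..1}"
  then show "((%t. ?f t x) has_real_derivative ?f' t x) (at t within {0..T})"
   using \<mu> by (auto intro!: derivative_eq_intros zt yt simp: algebra_simps power2_eq_square)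
 qed (use t b \<mu> in "auto simp: case_prod_unfold cutoff_def intro!: continuous_intros cont_rect")
 have D: "(mass_mult \<mu> has_real_derivative 2 * ?\<beta> * ?\<beta>' * integral {1-\<mu>..1} (?f t) + ?\<beta>\<^sup>2 * integral {1-\<mu>..1} (?f' t))
   (at t within {0..T})"
 proof -
  have "((%t. (t * (T - t))^2) has_real_derivative 2 * ?\<beta> * ?\<beta>') (at t within {0..T})"
   by (auto intro!: derivative_eq_intros simp: algebra_simps)
  from DERIV_mult[OF this D1] show ?thesis
   unfolding mass_mult_def[abs_def] by (simp only: mult.commute[of "integral _ _" "?\<beta>\<^sup>2"])
 qed
 have I: "((%x. 2 * ?\<beta> * ?\<beta>' * ?f t x + ?\<beta>\<^sup>2 * ?f' t x) has_integral
   2 * ?\<beta> * ?\<beta>' * integral {1-\<mu>..1} (?f t) + ?\<beta>\<^sup>2 * integral {1-\<mu>..1} (?f' t)) {1-\<mu>..1}"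
  using b t \<mu> by (intro has_integral_add has_integral_mult_right integrable_integral integrable_continuous_interval
    continuous_intros cont_slice cont_cutoff) auto
 let ?g = "%x. w t x * ((?\<zeta> x)^2 * z t x) + p t x * (2 * ?\<zeta> x / \<mu> * z t x + (?\<zeta> x)^2 * (r x * p t x))"
 have "(?g has_integral p t 1 * ((?\<zeta> 1)^2 * z t 1) - p t (1-\<mu>) * ((?\<zeta> (1-\<mu>))^2 * z t (1-\<mu>))) {1-\<mu>..1}"
 proof (rule has_integral_real_derivative)
  fix x assume x: "x \<in> {1-\<mu>..1}"
  show "((%x. p t x * ((?\<zeta> x)^2 * z t x)) has_real_derivative ?g x) (at x within {1-\<mu>..1})"
   by (rule derivative_eq_intros x_derivs[OF b t x] cutoff(5)[OF \<mu>(1)] refl)+ simp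
 qed (use \<mu> in simp)
 then have "(?g has_integral 0) {1-\<mu>..1}" using cutoff(1,2)[OF \<mu>(1)] z1[OF t] by simp
 from has_integral_diff[OF I has_integral_mult_right[OF this, of "?\<beta>\<^sup>2"]]
 have I2: "((%x. 2 * ?\<beta> * ?\<beta>' * ?f t x + ?\<beta>\<^sup>2 * ?f' t x - ?\<beta>\<^sup>2 * ?g x) has_integral
   2 * ?\<beta> * ?\<beta>' * integral {1-\<mu>..1} (?f t) + ?\<beta>\<^sup>2 * integral {1-\<mu>..1} (?f' t)) {1-\<mu>..1}" by simp
 note J = slab_integrals[OF \<mu> t]
 have J2: "((%x. 2 * ?\<beta>\<^sup>2 * (y t x)^2 + (?\<beta>'\<^sup>2 + 2 / \<mu>\<^sup>2 * ?\<beta>\<^sup>2) * (z t x)^2 - 1/2 * ?\<beta>\<^sup>2 * ((?\<zeta> x)^2 * (r x * (p t x)^2)))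
   has_integral 2 * ?\<beta>\<^sup>2 * slab y \<mu> t + (?\<beta>'\<^sup>2 + 2 / \<mu>\<^sup>2 * ?\<beta>\<^sup>2) * slab z \<mu> t - 1/2 * ?\<beta>\<^sup>2 * slab_flux \<mu> t) {1-\<mu>..1}"
  by (intro has_integral_add has_integral_diff has_integral_mult_right J)
 show ?thesis
 proof (intro exI conjI, rule D, rule has_integral_le[OF I2 J2])
  fix x assume x: "x \<in> {1-\<mu>..1}"
  define c where "c = ?\<zeta> x"
  define s where "s = sqrt (r x)"
  have x0: "0 < x" "x <= 1" using x \<mu> by auto
  have c: "0 <= c" "c <= 1" using cutoff(3,4)[OF \<mu>(1) x] by (auto simp: c_def)
  have s: "0 < s" "r x = s^2" using r_pos[OF x0(1)] by (auto simp: s_def)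
  have s1: "1 <= s"
  proof -
   have "1 powr - \<alpha> <= x powr - \<alpha>" using x0 \<alpha> by (intro powr_mono2') auto
   then have "1 <= r x" by (simp add: r_def)
   then show ?thesis by (simp add: s_def)
  qed
  have 1: "2 * (?\<beta>' * z t x * c^2) * (?\<beta> * y t x) <= ?\<beta>'\<^sup>2 * (z t x)^2 + ?\<beta>\<^sup>2 * (y t x)^2"
  proof -
   have "(?\<beta>' * z t x * c^2)^2 <= ?\<beta>'\<^sup>2 * (z t x)^2 * 1"
    unfolding power_mult_distrib using c by (intro mult_left_mono) (auto intro!: power_le_one)
   then show ?thesis
    using two_mult_le_sum_squares[of "?\<beta>' * z t x * c^2" "?\<beta> * y t x"] by (simp add: power_mult_distrib)
  qed
  have 2: "- (2 * (c * s * p t x) * (2 * z t x / \<mu> / s)) / 2 <= 1/2 * (c^2 * (s^2 * (p t x)^2)) + 2 / \<mu>\<^sup>2 * (z t x)^2"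
  proof -
   have "(2 * z t x / \<mu>)^2 / s^2 <= (2 * z t x / \<mu>)^2 / 1"
    using s1 by (intro divide_left_mono) auto
   then have "(2 * z t x / \<mu> / s)^2 <= (2 * z t x / \<mu>)^2" by (simp only: power_divide div_by_1)
   then show ?thesis
    using two_mult_le_sum_squares[of "- (c * s * p t x)" "2 * z t x / \<mu> / s"]
    by (simp add: power_mult_distrib power_divide)
  qed
  have 3: "- (p t x * (2 * c / \<mu> * z t x)) <= 1/2 * (c^2 * (s^2 * (p t x)^2)) + 2 / \<mu>\<^sup>2 * (z t x)^2"
   using 2 s(1) by (simp add: mult_ac)
  have 4: "?\<beta>\<^sup>2 * - (p t x * (2 * c / \<mu> * z t x)) <= ?\<beta>\<^sup>2 * (1/2 * (c^2 * (s^2 * (p t x)^2)) + 2 / \<mu>\<^sup>2 * (z t x)^2)"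
   by (rule mult_left_mono[OF 3]) simp
  have 5: "?\<beta>\<^sup>2 * ((y t x)^2 * c^2) <= ?\<beta>\<^sup>2 * ((y t x)^2 * 1)"
   using c by (intro mult_left_mono) (auto intro!: power_le_one)
  have "2 * ?\<beta> * ?\<beta>' * ?f t x + ?\<beta>\<^sup>2 * ?f' t x - ?\<beta>\<^sup>2 * ?g x
   = 2 * (?\<beta>' * z t x * c^2) * (?\<beta> * y t x) + ?\<beta>\<^sup>2 * ((y t x)^2 * c^2)
    + ?\<beta>\<^sup>2 * - (p t x * (2 * c / \<mu> * z t x)) - ?\<beta>\<^sup>2 * (c^2 * (s^2 * (p t x)^2))"
   unfolding c_def[symmetric] s(2) by (simp add: algebra_simps power2_eq_square)
  also have "... <= (?\<beta>'\<^sup>2 * (z t x)^2 + ?\<beta>\<^sup>2 * (y t x)^2) + ?\<beta>\<^sup>2 * ((y t x)^2 * 1)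
    + ?\<beta>\<^sup>2 * (1/2 * (c^2 * (s^2 * (p t x)^2)) + 2 / \<mu>\<^sup>2 * (z t x)^2) - ?\<beta>\<^sup>2 * (c^2 * (s^2 * (p t x)^2))"
   using 1 4 5 by (intro add_mono diff_mono order.refl)
  also have "... = 2 * ?\<beta>\<^sup>2 * (y t x)^2 + (?\<beta>'\<^sup>2 + 2 / \<mu>\<^sup>2 * ?\<beta>\<^sup>2) * (z t x)^2
    - 1/2 * ?\<beta>\<^sup>2 * ((?\<zeta> x)^2 * (r x * (p t x)^2))"
   unfolding c_def[symmetric] s(2) by (simp add: algebra_simps)
  finally show "2 * ?\<beta> * ?\<beta>' * ?f t x + ?\<beta>\<^sup>2 * ?f' t x - ?\<beta>\<^sup>2 * ?g x <= ..." .
 qed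
qed

text \<open>This serves the term in which the time weight is differentiated; the 4 is the bound on
  the weight \<open>R\<close> in the strip.\<close>

lemma flux_cross_term:
 fixes R c B B' P Y :: real
 assumes R: "0 <= R" "R <= 4" and c: "0 <= c" "c <= 1"
 shows "- (2 * (B * c * P) * (B' * c^2 * Y) * R) <= B^2 * (c^2 * (R * P^2)) + 4 * B'^2 * Y^2"
proof -
 have "R * - (2 * (B * c * P) * (B' * c^2 * Y)) <= R * ((B * c * P)^2 + (B' * c^2 * Y)^2)"
  using two_mult_le_sum_squares[of "- (B * c * P)" "B' * c^2 * Y"] R by (intro mult_left_mono) auto
 moreover have "R * (B' * c^2 * Y)^2 <= 4 * (B'^2 * 1 * Y^2)"
  unfolding power_mult_distrib using R c
  by (intro mult_mono mult_right_mono mult_left_mono) (auto intro!: power_le_one)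
 ultimately show ?thesis by (simp add: power_mult_distrib algebra_simps)
qed

text \<open>The terms with \<open>W\<close> and \<open>Q\<close> cancel, being part of an exact
  x-derivative, so only first-order quantities are left.\<close>

lemma flux_identity:
 fixes e x :: real
 assumes "e ~= 0" "x ~= 0"
 shows "2 * B * B' * (Y * c^3 * (R * P)) + B^2 * ((W * P + Y * Q) * R * c^3)
   - B\<^sup>2 * (1/2 * (3 * c^2 / e * (R * P^2 + Y^2) + c^3 * (- d * R / x * P^2 + R * (2 * P * W) + 2 * Y * (R * Q))))
  = 2 * (B * c * P) * (B' * c^2 * Y) * R - 3 / (2 * e) * (B^2 * (c^2 * (R * P^2)))
    - 3 / (2 * e) * B^2 * (c^2 * Y^2) + B^2 * (c^3 * (d * R / x * P^2)) / 2"
 using assms by (simp add: field_simps power2_eq_square power3_eq_cube)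

text \<open>The localised multiplier \<open>z_x\<close> produces the boundary flux at 1. The
  derivative of the weight \<open>r\<close> enters with the favourable sign, and
  \<open>\<mu> <= 1/2\<close> keeps the strip in the region where \<open>r\<close> is at most
  4.\<close>

lemma flux_mult_deriv:
 assumes \<mu>: "0 < \<mu>" "\<mu> <= 1/2" and t: "t \<in> {0..T}"
 shows "\<exists>D. (flux_mult \<mu> has_real_derivative D) (at t within {0..T}) &
   (t * (T - t))\<^sup>2 * (p t 1)^2 / 2
    - (3 / (2 * \<mu>) + 1) * ((t * (T - t))^2 * slab_flux \<mu> t)
    - (3 / (2 * \<mu>) * (t * (T - t))^2 + 4 * (T - 2 * t)^2) * slab y \<mu> t <= D"
proof -
 let ?\<beta> = "t * (T - t)" and ?\<beta>' = "T - 2 * t" and ?\<zeta> = "cutoff \<mu>"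
 let ?f = "%t x. y t x * (?\<zeta> x)^3 * (r x * p t x)"
 let ?f' = "%t x. (w t x * p t x + y t x * q t x) * r x * (?\<zeta> x)^3"
 have b: "0 < 1 - \<mu>" and \<mu>1: "\<mu> < 1" using \<mu> by simp_all
 have D1: "((%t. integral {1-\<mu>..1} (?f t)) has_real_derivative integral {1-\<mu>..1} (?f' t)) (at t within {0..T})"
 proof (rule has_derivative_integral_real)
  fix t x assume "t \<in> {0..T}" "x \<in> {1-\<mu>..1}"
  then show "((%t. ?f t x) has_real_derivative ?f' t x) (at t within {0..T})"
   using \<mu> by (auto intro!: derivative_eq_intros pt yt simp: algebra_simps)
 qed (use t b \<mu> in "auto simp: case_prod_unfold cutoff_def intro!: continuous_intros cont_rect")
 have D: "(flux_mult \<mu> has_real_derivative 2 * ?\<beta> * ?\<beta>' * integral {1-\<mu>..1} (?f t) + ?\<beta>\<^sup>2 * integral {1-\<mu>..1} (?f' t))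
   (at t within {0..T})"
 proof -
  have "((%t. (t * (T - t))^2) has_real_derivative 2 * ?\<beta> * ?\<beta>') (at t within {0..T})"
   by (auto intro!: derivative_eq_intros simp: algebra_simps)
  from DERIV_mult[OF this D1] show ?thesis
   unfolding flux_mult_def[abs_def] by (simp only: mult.commute[of "integral _ _" "?\<beta>\<^sup>2"])
 qed
 have I: "((%x. 2 * ?\<beta> * ?\<beta>' * ?f t x + ?\<beta>\<^sup>2 * ?f' t x) has_integral
   2 * ?\<beta> * ?\<beta>' * integral {1-\<mu>..1} (?f t) + ?\<beta>\<^sup>2 * integral {1-\<mu>..1} (?f' t)) {1-\<mu>..1}"
  using b t \<mu> by (intro has_integral_add has_integral_mult_right integrable_integral integrable_continuous_interval
    continuous_intros cont_slice cont_cutoff) auto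
 let ?G = "%x. 1/2 * ((?\<zeta> x)^3 * (r x * (p t x)^2 + (y t x)^2))"
 let ?g = "%x. 1/2 * (3 * (?\<zeta> x)^2 / \<mu> * (r x * (p t x)^2 + (y t x)^2)
   + (?\<zeta> x)^3 * (- \<alpha> * r x / x * (p t x)^2 + r x * (2 * p t x * w t x) + 2 * y t x * (r x * q t x)))"
 have "(?g has_integral ?G 1 - ?G (1-\<mu>)) {1-\<mu>..1}"
 proof (rule has_integral_real_derivative)
  fix x assume x: "x \<in> {1-\<mu>..1}"
  show "(?G has_real_derivative ?g x) (at x within {1-\<mu>..1})"
   by (rule derivative_eq_intros x_derivs[OF b t x] cutoff(5)[OF \<mu>(1)] refl)+ (simp add: power2_eq_square)
 qed (use \<mu> in simp)
 then have "(?g has_integral 1/2 * (p t 1)^2) {1-\<mu>..1}" using cutoff(1,2)[OF \<mu>(1)] y1[OF t] by simp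
 from has_integral_diff[OF I has_integral_mult_right[OF this, of "?\<beta>\<^sup>2"]]
 have I2: "((%x. 2 * ?\<beta> * ?\<beta>' * ?f t x + ?\<beta>\<^sup>2 * ?f' t x - ?\<beta>\<^sup>2 * ?g x) has_integral
   2 * ?\<beta> * ?\<beta>' * integral {1-\<mu>..1} (?f t) + ?\<beta>\<^sup>2 * integral {1-\<mu>..1} (?f' t) - ?\<beta>\<^sup>2 * (1/2 * (p t 1)^2)) {1-\<mu>..1}" .
 note J = slab_integrals[OF \<mu>(1) \<mu>1 t]
 have J2: "((%x. - ((3 / (2 * \<mu>) + 1) * (?\<beta>\<^sup>2 * ((?\<zeta> x)^2 * (r x * (p t x)^2))))
    - (3 / (2 * \<mu>) * ?\<beta>\<^sup>2 + 4 * ?\<beta>'\<^sup>2) * (y t x)^2)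
   has_integral - ((3 / (2 * \<mu>) + 1) * (?\<beta>\<^sup>2 * slab_flux \<mu> t)) - (3 / (2 * \<mu>) * ?\<beta>\<^sup>2 + 4 * ?\<beta>'\<^sup>2) * slab y \<mu> t) {1-\<mu>..1}"
  by (intro has_integral_diff has_integral_neg has_integral_mult_right J)
 have "- ((3 / (2 * \<mu>) + 1) * (?\<beta>\<^sup>2 * slab_flux \<mu> t)) - (3 / (2 * \<mu>) * ?\<beta>\<^sup>2 + 4 * ?\<beta>'\<^sup>2) * slab y \<mu> t
   <= 2 * ?\<beta> * ?\<beta>' * integral {1-\<mu>..1} (?f t) + ?\<beta>\<^sup>2 * integral {1-\<mu>..1} (?f' t) - ?\<beta>\<^sup>2 * (1/2 * (p t 1)^2)"
 proof (rule has_integral_le[OF J2 I2])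
  fix x assume x: "x \<in> {1-\<mu>..1}"
  define c where "c = ?\<zeta> x"
  have x0: "0 < x" "x <= 1" using x \<mu> by auto
  have c: "0 <= c" "c <= 1" using cutoff(3,4)[OF \<mu>(1) x] by (auto simp: c_def)
  have r0: "0 <= r x" "r x <= 4" using r_bound[of x] x \<mu> by auto
  have 1: "- (2 * (?\<beta> * c * p t x) * (?\<beta>' * c^2 * y t x) * r x) <= ?\<beta>\<^sup>2 * (c^2 * (r x * (p t x)^2)) + 4 * ?\<beta>'\<^sup>2 * (y t x)^2"
   using r0 c by (rule flux_cross_term)
  have 2: "3 / (2 * \<mu>) * ?\<beta>\<^sup>2 * (c^2 * (y t x)^2) <= 3 / (2 * \<mu>) * ?\<beta>\<^sup>2 * (1 * (y t x)^2)"
   using c \<mu> by (intro mult_left_mono mult_right_mono) (auto intro!: power_le_one)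
  have 3: "0 <= ?\<beta>\<^sup>2 * (c^3 * (\<alpha> * r x / x * (p t x)^2)) / 2"
   using c r0 x0 \<alpha> by simp
  have eq: "2 * ?\<beta> * ?\<beta>' * ?f t x + ?\<beta>\<^sup>2 * ?f' t x - ?\<beta>\<^sup>2 * ?g x
   = 2 * (?\<beta> * c * p t x) * (?\<beta>' * c^2 * y t x) * r x - 3 / (2 * \<mu>) * (?\<beta>\<^sup>2 * (c^2 * (r x * (p t x)^2)))
    - 3 / (2 * \<mu>) * ?\<beta>\<^sup>2 * (c^2 * (y t x)^2) + ?\<beta>\<^sup>2 * (c^3 * (\<alpha> * r x / x * (p t x)^2)) / 2"
   unfolding c_def[symmetric] by (rule flux_identity) (use x0 \<mu> in auto)
  show "- ((3 / (2 * \<mu>) + 1) * (?\<beta>\<^sup>2 * ((?\<zeta> x)^2 * (r x * (p t x)^2))))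
    - (3 / (2 * \<mu>) * ?\<beta>\<^sup>2 + 4 * ?\<beta>'\<^sup>2) * (y t x)^2 <= 2 * ?\<beta> * ?\<beta>' * ?f t x + ?\<beta>\<^sup>2 * ?f' t x - ?\<beta>\<^sup>2 * ?g x"
  proof -
   have 4: "(3 / (2 * \<mu>) + 1) * v = 3 / (2 * \<mu>) * v + v" for v :: real by (simp add: distrib_right)
   have 5: "(3 / (2 * \<mu>) * ?\<beta>\<^sup>2 + 4 * ?\<beta>'\<^sup>2) * (y t x)^2 = 3 / (2 * \<mu>) * ?\<beta>\<^sup>2 * (1 * (y t x)^2) + 4 * ?\<beta>'\<^sup>2 * (y t x)^2"
    by (simp add: distrib_right)
   show ?thesis unfolding eq 4 5 unfolding c_def[symmetric] using 1 2 3 by linarith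
  qed
 qed
 note le = this
 have eq: "?\<beta>\<^sup>2 * (1/2 * (p t 1)^2) = ?\<beta>\<^sup>2 * (p t 1)^2 / 2" by simp
 show ?thesis by (intro exI conjI, rule D) (use le eq in linarith)
qed

text \<open>Subtracting \<open>2 * k\<close> times the mass inequality from the flux inequality
  cancels \<open>slab_flux\<close>. Since \<open>k\<close> is of order \<open>1 / \<mu>\<close>, the
  term \<open>z^2 / \<mu>^2\<close> of the former becomes \<open>z^2 / \<mu>^3\<close>.\<close>

lemma flux_by_slab:
 assumes \<mu>: "0 < \<mu>" "\<mu> <= 1/2" and T: "0 <= T"
 shows "integral {0..T} (%t. (t * (T - t))^2 * (p t 1)^2)
  <= (20 * T^4 + 20 * T^2) * integral {0..T} (%t. slab y \<mu> t / \<mu> + slab z \<mu> t / \<mu>^3)"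
proof -
 have \<mu>1: "\<mu> < 1" using \<mu> by simp
 define k where "k = 3 / (2 * \<mu>) + 1"
 have k: "0 <= k" "k <= 2 / \<mu>" using \<mu> by (auto simp: k_def field_simps)
 \<comment> \<open>With \<open>B <= T^4\<close> and \<open>B' <= T^2\<close> this majorises both
   \<open>10 * B + 2 * B'\<close> and \<open>8 * B + B'\<close>.\<close>
 define C where "C = 10 * T^4 + 10 * T^2"
 obtain R' where R': "!!t. t \<in> {0..T} ==> (mass_mult \<mu> has_real_derivative R' t) (at t within {0..T})"
  "!!t. t \<in> {0..T} ==> R' t <= 2 * (t * (T - t))^2 * slab y \<mu> t
    + ((T - 2 * t)^2 + 2 / \<mu>\<^sup>2 * (t * (T - t))^2) * slab z \<mu> t
    - 1/2 * (t * (T - t))^2 * slab_flux \<mu> t"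
  using mass_mult_deriv[OF \<mu>(1) \<mu>1] by metis
 obtain M' where M': "!!t. t \<in> {0..T} ==> (flux_mult \<mu> has_real_derivative M' t) (at t within {0..T})"
  "!!t. t \<in> {0..T} ==> (t * (T - t))\<^sup>2 * (p t 1)^2 / 2
    - (3 / (2 * \<mu>) + 1) * ((t * (T - t))^2 * slab_flux \<mu> t)
    - (3 / (2 * \<mu>) * (t * (T - t))^2 + 4 * (T - 2 * t)^2) * slab y \<mu> t <= M' t"
  using flux_mult_deriv[OF \<mu>] by metis
 have "((%t. M' t - 2 * k * R' t) has_integral
   (flux_mult \<mu> T - 2 * k * mass_mult \<mu> T) - (flux_mult \<mu> 0 - 2 * k * mass_mult \<mu> 0)) {0..T}"
  by (rule has_integral_real_derivative[OF T]) (auto intro!: derivative_eq_intros M'(1) R'(1))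
 \<comment> \<open>The weight \<open>(t * (T - t))^2\<close> vanishes at both ends, so no values of
   the multipliers are left.\<close>
 then have MR: "((%t. M' t - 2 * k * R' t) has_integral 0) {0..T}"
  by (simp add: flux_mult_def mass_mult_def)
 have cont: "continuous_on {0..T} (%t. slab y \<mu> t / \<mu> + slab z \<mu> t / \<mu>^3)"
  using \<mu> by (intro continuous_intros slab_cont) auto
 have S: "((%t. C * (slab y \<mu> t / \<mu> + slab z \<mu> t / \<mu>^3)) has_integral
   C * integral {0..T} (%t. slab y \<mu> t / \<mu> + slab z \<mu> t / \<mu>^3)) {0..T}"
  by (intro has_integral_mult_right integrable_integral integrable_continuous_interval cont)
 have H: "((%t. (t * (T - t))^2 * (p t 1)^2 / 2) has_integral
   integral {0..T} (%t. (t * (T - t))^2 * (p t 1)^2) / 2) {0..T}"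
  by (intro has_integral_divide integrable_integral integrable_continuous_interval continuous_intros cont_flux)
 have "integral {0..T} (%t. (t * (T - t))^2 * (p t 1)^2) / 2
   <= 0 + C * integral {0..T} (%t. slab y \<mu> t / \<mu> + slab z \<mu> t / \<mu>^3)"
 proof (rule has_integral_le[OF H has_integral_add[OF MR S]])
  fix t assume t: "t \<in> {0..T}"
  define B where "B = (t * (T - t))^2"
  define B' where "B' = (T - 2 * t)^2"
  define Y where "Y = slab y \<mu> t"
  define Z where "Z = slab z \<mu> t"
  define A where "A = slab_flux \<mu> t"
  have YZ: "0 <= Y" "0 <= Z"
   using slab_integrals(1,2)[OF \<mu>(1) \<mu>1 t] by (auto simp: Y_def Z_def elim: has_integral_nonneg)
  have B: "0 <= B" "B <= T^4"
  proof -
   have "t * (T - t) <= T * T" using t by (intro mult_mono) auto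
   then have "(t * (T - t))^2 <= (T * T)^2" using t by (intro power_mono) auto
   then show "0 <= B" "B <= T^4" by (auto simp: B_def power2_eq_square power4_eq_xxxx)
  qed
  have B': "0 <= B'" "B' <= T^2"
  proof -
   have "\<bar>T - 2 * t\<bar> <= \<bar>T\<bar>" using t by auto
   then show "0 <= B'" "B' <= T^2" by (auto simp: B'_def abs_le_square_iff)
  qed
  have "2 * k * R' t <= 2 * k * (2 * B * Y + (B' + 2 / \<mu>\<^sup>2 * B) * Z - 1/2 * B * A)"
   using R'(2)[OF t] k unfolding B_def B'_def Y_def Z_def A_def by (intro mult_left_mono) auto
  moreover have "B * (p t 1)^2 / 2 - k * (B * A) - (3 / (2 * \<mu>) * B + 4 * B') * Y <= M' t"
   using M'(2)[OF t] unfolding B_def B'_def Y_def A_def k_def .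
  moreover define u v h where "u = 3 / (2 * \<mu>) * B" and "v = 2 / \<mu>\<^sup>2 * B" and "h = B * (p t 1)^2 / 2"
  ultimately have "B * (p t 1)^2 / 2 <= M' t - 2 * k * R' t
    + (3 / (2 * \<mu>) * B + 4 * B') * Y + k * (4 * B * Y) + k * (2 * (B' + 2 / \<mu>\<^sup>2 * B) * Z)"
   unfolding u_def[symmetric] v_def[symmetric] h_def[symmetric] by (simp add: algebra_simps)
  also have "k * (4 * B * Y) <= 2 / \<mu> * (4 * B * Y)" using k B YZ by (intro mult_right_mono) auto
  also have "k * (2 * (B' + 2 / \<mu>\<^sup>2 * B) * Z) <= 2 / \<mu> * (2 * (B' + 2 / \<mu>\<^sup>2 * B) * Z)"
   using k B B' YZ by (intro mult_right_mono) auto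
  also have "(3 / (2 * \<mu>) * B + 4 * B') * Y <= (2 * B + 2 * B') / \<mu> * Y"
  proof (rule mult_right_mono)
   have "\<mu> * B' <= 1/2 * B'" using \<mu> B' by (intro mult_right_mono) auto
   then have "3 / 2 * B + 4 * B' * \<mu> <= 2 * B + 2 * B'" using B by (simp add: mult_ac)
   then have "(3 / 2 * B + 4 * B' * \<mu>) / \<mu> <= (2 * B + 2 * B') / \<mu>"
    using \<mu> by (intro divide_right_mono) auto
   then show "3 / (2 * \<mu>) * B + 4 * B' <= (2 * B + 2 * B') / \<mu>"
    using \<mu> by (simp add: field_simps)
  qed (rule YZ)
  also have "2 / \<mu> * (2 * (B' + 2 / \<mu>\<^sup>2 * B) * Z) <= (B' + 8 * B) / \<mu>^3 * Z"
  proof -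
   have "\<mu> * \<mu> <= 1/2 * (1/2)" using \<mu> by (intro mult_mono) auto
   then have "4 * (\<mu> * \<mu>) * B' <= 1 * B'" using B' by (intro mult_right_mono) auto
   then have "(4 * (\<mu> * \<mu>) * B' + 8 * B) / \<mu>^3 <= (B' + 8 * B) / \<mu>^3"
    using \<mu> by (intro divide_right_mono) auto
   moreover have "2 / \<mu> * (2 * (B' + 2 / \<mu>\<^sup>2 * B)) = (4 * (\<mu> * \<mu>) * B' + 8 * B) / \<mu>^3"
    using \<mu> by (simp add: field_simps power2_eq_square power3_eq_cube)
   ultimately have "2 / \<mu> * (2 * (B' + 2 / \<mu>\<^sup>2 * B)) * Z <= (B' + 8 * B) / \<mu>^3 * Z"
    using YZ by (intro mult_right_mono) auto
   then show ?thesis by (simp only: mult.assoc)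
  qed
  also have "M' t - 2 * k * R' t + (2 * B + 2 * B') / \<mu> * Y + 2 / \<mu> * (4 * B * Y) + (B' + 8 * B) / \<mu>^3 * Z
   = M' t - 2 * k * R' t + ((10 * B + 2 * B') * (Y / \<mu>) + (8 * B + B') * (Z / \<mu>^3))"
   using \<mu> by (simp add: field_simps)
  also have "... <= M' t - 2 * k * R' t + (C * (Y / \<mu>) + C * (Z / \<mu>^3))"
   using B B' YZ \<mu> unfolding C_def by (intro add_left_mono add_mono mult_right_mono) auto
  finally show "(t * (T - t))^2 * (p t 1)^2 / 2 <= M' t - 2 * k * R' t + C * (slab y \<mu> t / \<mu> + slab z \<mu> t / \<mu>^3)"
   unfolding B_def Y_def Z_def by (simp add: algebra_simps)
 qed
 then show ?thesis unfolding C_def by (simp add: algebra_simps)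
qed

text \<open>Half of \<delta> is given up at each end, where the weight in time degenerates. The
  remaining length \<open>4/(2 - \<alpha>) + \<delta>\<close> still leaves the gain
  \<open>(2 - \<alpha>)/2 * \<delta>\<close>, and on it \<open>t * (T - t)\<close> is at least
  \<open>\<delta> * T / 4\<close>.\<close>

lemma slab_observability:
 assumes a: "0 < a" "a <= 1"
  and \<xi>: "!!t. t \<in> {0..T} ==> \<bar>y t a * p t a\<bar> <= \<xi>" "!!t. t \<in> {0..T} ==> \<bar>p t a * z t a\<bar> <= \<xi>"
   "!!t. t \<in> {0..T} ==> a * (y t a)^2 <= \<xi>" "!!t. t \<in> {0..T} ==> a * r a * (p t a)^2 <= \<xi>"
  and \<mu>: "0 < \<mu>" "\<mu> <= 1/2"
  and \<delta>: "0 < \<delta>" "T = 4 / (2 - \<alpha>) + 2 * \<delta>"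
 shows "(2 - \<alpha>) / 2 * \<delta> * energy a 0
   <= (20 * T^4 + 20 * T^2) / (\<delta> * T / 4)^2 * integral {0..T} (%t. slab y \<mu> t / \<mu> + slab z \<mu> t / \<mu>^3)
    + \<xi> * (4 * T + T^2)"
proof -
 have T: "0 < T" "\<delta> < T" using \<delta> \<alpha> by (auto intro!: add_pos_pos add_strict_increasing2)
 define t1 t2 where "t1 = \<delta> / 2" and "t2 = T - \<delta> / 2"
 have t: "0 <= t1" "t1 <= t2" "t2 <= T" using T \<delta> by (auto simp: t1_def t2_def)
 have "(2 - \<alpha>) / 2 * (t2 - t1) - 2 = (2 - \<alpha>) / 2 * \<delta>"
  unfolding t1_def t2_def \<delta>(2) using \<alpha> by (simp add: field_simps)
 from boundary_observability[OF a \<xi> t, unfolded this]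
 have 1: "(2 - \<alpha>) / 2 * \<delta> * energy a 0 <= integral {t1..t2} (%t. (p t 1)^2) / 2 + \<xi> * (4 * T + T^2)"
  .
 define b where "b = \<delta> * T / 4"
 have b: "0 < b" using \<delta> T by (simp add: b_def)
 have i1: "(%t. (p t 1)^2) integrable_on {t1..t2}"
  using t by (intro integrable_continuous_interval continuous_on_subset[OF cont_flux]) auto
 have i2: "(%t. (t * (T - t))^2 * (p t 1)^2) integrable_on {0..T}"
  by (intro integrable_continuous_interval continuous_intros cont_flux)
 have i3: "(%t. (t * (T - t))^2 * (p t 1)^2) integrable_on {t1..t2}"
  by (rule integrable_on_subinterval[OF i2]) (use t in auto)
 have "b^2 * integral {t1..t2} (%t. (p t 1)^2) = integral {t1..t2} (%t. b^2 * (p t 1)^2)"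
  by simp
 also have "... <= integral {t1..t2} (%t. (t * (T - t))^2 * (p t 1)^2)"
 proof (rule integral_le[OF _ i3])
  show "(%t. b^2 * (p t 1)^2) integrable_on {t1..t2}"
   using t by (intro integrable_continuous_interval continuous_intros continuous_on_subset[OF cont_flux]) auto
  fix s assume s: "s \<in> {t1..t2}"
  have "b <= s * (T - s)"
  proof (cases "s <= T / 2")
   case True
   have "\<delta> / 2 * (T / 2) <= s * (T - s)" using s True \<delta> T unfolding t1_def by (intro mult_mono) auto
   then show ?thesis by (simp add: b_def)
  next
   case False
   have "T / 2 * (\<delta> / 2) <= s * (T - s)" using s False \<delta> T unfolding t2_def by (intro mult_mono) auto
   then show ?thesis by (simp add: b_def mult.commute)
  qed
  then show "b^2 * (p s 1)^2 <= (s * (T - s))^2 * (p s 1)^2" using b by (intro mult_right_mono power_mono) auto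
 qed
 also have "... <= integral {0..T} (%t. (t * (T - t))^2 * (p t 1)^2)"
  using t by (intro integral_subset_le i2 i3) auto
 also have "... <= (20 * T^4 + 20 * T^2) * integral {0..T} (%t. slab y \<mu> t / \<mu> + slab z \<mu> t / \<mu>^3)"
  using T by (intro flux_by_slab \<mu>) auto
 finally have 2: "integral {t1..t2} (%t. (p t 1)^2) <=
   (20 * T^4 + 20 * T^2) / b^2 * integral {0..T} (%t. slab y \<mu> t / \<mu> + slab z \<mu> t / \<mu>^3)"
  using b by (simp add: field_simps)
 have "0 <= integral {t1..t2} (%t. (p t 1)^2)"
  by (rule Henstock_Kurzweil_Integration.integral_nonneg[OF i1]) simp
 with 1 2 show ?thesis unfolding b_def by linarith
qed

text \<open>Hardy's inequality, obtained by integrating the derivative of \<open>x z^2\<close>; the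
  term at \<open>a\<close> has the good sign.\<close>

lemma poincare:
 assumes "0 < a" "a <= 1" "t \<in> {0..T}"
 shows "integral {a..1} (%x. (z t x)^2) <= 4 * integral {a..1} (%x. r x * (p t x)^2)"
proof -
 have Z: "((%x. (z t x)^2) has_integral integral {a..1} (%x. (z t x)^2)) {a..1}"
  and P: "((%x. r x * (p t x)^2) has_integral integral {a..1} (%x. r x * (p t x)^2)) {a..1}"
  using assms by (auto intro!: integrable_integral integrable_continuous_interval continuous_intros cont_slice)
 let ?g = "%x. (z t x)^2 + x * (2 * z t x * (r x * p t x))"
 have "(?g has_integral 1 * (z t 1)^2 - a * (z t a)^2) {a..1}"
 proof (rule has_integral_real_derivative)
  fix x assume x: "x \<in> {a..1}"
  show "((%x. x * (z t x)^2) has_real_derivative ?g x) (at x within {a..1})"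
   by (rule derivative_eq_intros x_derivs[OF assms(1,3) x] refl)+ simp
 qed (rule assms)
 then have G: "(?g has_integral - (a * (z t a)^2)) {a..1}" using z1[OF assms(3)] by simp
 let ?I = "integral {a..1} (%x. (z t x)^2)" and ?J = "integral {a..1} (%x. r x * (p t x)^2)"
 have "1/2 * ?I - 2 * ?J <= - (a * (z t a)^2)"
 proof (rule has_integral_le[OF has_integral_diff[OF has_integral_mult_right[OF Z] has_integral_mult_right[OF P]] G])
  fix x assume x: "x \<in> {a..1}"
  have "(x * r x)^2 * (p t x)^2 <= r x * (p t x)^2"
   using x assms by (intro mult_right_mono r_square) auto
  moreover have "- (2 * (z t x) * (2 * (x * r x * p t x))) <= (z t x)^2 + 4 * ((x * r x)^2 * (p t x)^2)"
   using two_mult_le_sum_squares[of "- z t x" "2 * (x * r x * p t x)"] by (simp add: power_mult_distrib)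
  ultimately show "1/2 * (z t x)^2 - 2 * (r x * (p t x)^2) <= ?g x" by (simp add: mult_ac)
 qed
 moreover have "0 <= a * (z t a)^2" using assms by simp
 ultimately show ?thesis by linarith
qed

text \<open>An elliptic estimate: \<open>p_x = w\<close> is tested with \<open>z\<close>. Young's
  inequality puts the weight 1/8 on \<open>z^2\<close>, which by the preceding inequality costs half
  of the left side.\<close>

lemma flux_le_acceleration:
 assumes "0 < a" "a <= 1" "t \<in> {0..T}" and \<xi>: "\<bar>p t a * z t a\<bar> <= \<xi>"
 shows "integral {a..1} (%x. r x * (p t x)^2) <= 2 * \<xi> + 4 * integral {a..1} (%x. (w t x)^2)"
proof -
 have Z: "((%x. (z t x)^2) has_integral integral {a..1} (%x. (z t x)^2)) {a..1}"
  and W: "((%x. (w t x)^2) has_integral integral {a..1} (%x. (w t x)^2)) {a..1}"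
  and P: "((%x. r x * (p t x)^2) has_integral integral {a..1} (%x. r x * (p t x)^2)) {a..1}"
  using assms by (auto intro!: integrable_integral integrable_continuous_interval continuous_intros cont_slice)
 let ?g = "%x. w t x * z t x + p t x * (r x * p t x)"
 have "(?g has_integral p t 1 * z t 1 - p t a * z t a) {a..1}"
  by (rule has_integral_real_derivative) (use assms in "auto intro!: derivative_eq_intros x_derivs")
 then have G: "(?g has_integral - (p t a * z t a)) {a..1}" using z1[OF assms(3)] by simp
 let ?I = "integral {a..1} (%x. (z t x)^2)" and ?J = "integral {a..1} (%x. r x * (p t x)^2)"
  and ?W = "integral {a..1} (%x. (w t x)^2)"
 have "?J - 2 * ?W - 1/8 * ?I <= - (p t a * z t a)"
 proof (rule has_integral_le[OF has_integral_diff[OF has_integral_diff[OF P has_integral_mult_right[OF W]] has_integral_mult_right[OF Z]] G])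
  fix x assume x: "x \<in> {a..1}"
  have "- (2 * (2 * w t x) * (1/2 * z t x)) <= 4 * (w t x)^2 + 1/4 * (z t x)^2"
   using two_mult_le_sum_squares[of "- (2 * w t x)" "1/2 * z t x"] by (simp add: power_mult_distrib power_divide)
  then show "r x * (p t x)^2 - 2 * (w t x)^2 - 1/8 * (z t x)^2 <= ?g x"
   by (simp add: power2_eq_square mult_ac)
 qed
 with poincare[OF assms(1-3)] \<xi> show ?thesis by linarith
qed

end

section \<open>Time translation, superposition, and the splitting by time averages\<close>

lemma classical_wave_shift:
 assumes "classical_wave \<alpha> T z y w p q" "0 <= s" "s + T' <= T"
 shows "classical_wave \<alpha> T' (%t. z (t + s)) (%t. y (t + s)) (%t. w (t + s)) (%t. p (t + s)) (%t. q (t + s))"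
proof -
 interpret classical_wave \<alpha> T z y w p q by fact
 have in_T: "t + s \<in> {0..T}" if "t \<in> {0..T'}" for t using that assms by auto
 have D: "((%t. f (t + s) x) has_real_derivative f' (t + s) x) (at t within {0..T'})"
  if "!!t x. t \<in> {0..T} ==> x \<in> {0<..1} ==> ((%t. f t x) has_real_derivative f' t x) (at t within {0..T})"
   "t \<in> {0..T'}" "x \<in> {0<..1}" for f f' :: "real => real => real" and t x
 proof -
  have "((%t. f t x) has_real_derivative f' (t + s) x) (at (t + s) within {0..T})"
   by (rule that(1)[OF in_T[OF that(2)] that(3)])
  then have "((%t. f t x) has_real_derivative f' (t + s) x) (at (t + s) within (%t. t + s) ` {0..T'})"
   by (rule has_field_derivative_subset) (use assms(2,3) in auto)
  moreover have "((%t. t + s) has_real_derivative 1) (at t within {0..T'})"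
   by (auto intro!: derivative_eq_intros)
  ultimately have "((%t. f t x) \<circ> (%t. t + s) has_real_derivative f' (t + s) x * 1) (at t within {0..T'})"
   by (rule DERIV_image_chain)
  then show ?thesis by (simp add: o_def)
 qed
 have C: "continuous_on ({0..T'} \<times> {0<..1}) (%(t, x). f (t + s) x)"
  if "continuous_on ({0..T} \<times> {0<..1}) (%(t, x). f t x)" for f :: "real => real => real"
 proof -
  have "continuous_on ({0..T'} \<times> {0<..1}) (%u. (%(t, x). f t x) (fst u + s, snd u))"
   by (rule continuous_on_compose2[OF that]) (use assms(2,3) in "auto intro!: continuous_intros")
  then show ?thesis by (simp add: case_prod_unfold)
 qed
 show ?thesis
 proof unfold_locales
  fix t x assume tx: "t \<in> {0..T'}" "x \<in> {0<..(1::real)}"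
  show "((%t. z (t + s) x) has_real_derivative y (t + s) x) (at t within {0..T'})" by (rule D[OF zt tx])
  show "((%t. y (t + s) x) has_real_derivative w (t + s) x) (at t within {0..T'})" by (rule D[OF yt tx])
  show "((%t. p (t + s) x) has_real_derivative q (t + s) x) (at t within {0..T'})" by (rule D[OF pt tx])
  show "(z (t + s) has_real_derivative x powr - \<alpha> * p (t + s) x) (at x within {0<..1})" by (rule zx[OF in_T[OF tx(1)] tx(2)])
  show "(y (t + s) has_real_derivative x powr - \<alpha> * q (t + s) x) (at x within {0<..1})" by (rule yx[OF in_T[OF tx(1)] tx(2)])
  show "(p (t + s) has_real_derivative w (t + s) x) (at x within {0<..1})" by (rule px[OF in_T[OF tx(1)] tx(2)])
 qed (rule \<alpha> C[OF cz] C[OF cy] C[OF cw] C[OF cp] C[OF cq] z1[OF in_T] y1[OF in_T], assumption?)+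
qed

lemma classical_wave_combine:
 assumes "classical_wave \<alpha> T z1 y1 w1 p1 q1" "classical_wave \<alpha> T z2 y2 w2 p2 q2"
 shows "classical_wave \<alpha> T (%t x. b * z1 t x + c * z2 t x) (%t x. b * y1 t x + c * y2 t x)
  (%t x. b * w1 t x + c * w2 t x) (%t x. b * p1 t x + c * p2 t x) (%t x. b * q1 t x + c * q2 t x)"
proof -
 interpret one: classical_wave \<alpha> T z1 y1 w1 p1 q1 by fact
 interpret two: classical_wave \<alpha> T z2 y2 w2 p2 q2 by fact
 show ?thesis
 proof unfold_locales
  fix t x assume tx: "t \<in> {0..T}" "x \<in> {0<..(1::real)}"
  show "((%x. b * z1 t x + c * z2 t x) has_real_derivative x powr - \<alpha> * (b * p1 t x + c * p2 t x)) (at x within {0<..1})"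
   by (rule derivative_eq_intros one.zx[OF tx] two.zx[OF tx] refl)+ (simp add: algebra_simps)
  show "((%x. b * y1 t x + c * y2 t x) has_real_derivative x powr - \<alpha> * (b * q1 t x + c * q2 t x)) (at x within {0<..1})"
   by (rule derivative_eq_intros one.yx[OF tx] two.yx[OF tx] refl)+ (simp add: algebra_simps)
 qed (use one.\<alpha> one.cz two.cz one.cy two.cy one.cw two.cw one.cp two.cp one.cq two.cq in
    \<open>auto simp: case_prod_unfold one.z1 two.z1 one.y1 two.y1 intro!: continuous_intros
     derivative_eq_intros one.zt two.zt one.yt two.yt one.pt two.pt one.px two.px\<close>)
qed

text \<open>Cauchy-Schwarz against the constant 1, as nonnegativity of the integral of
  \<open>(f - m)^2\<close> for the mean \<open>m\<close>.\<close>

lemma integral_square_le: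
 fixes f :: "real => real"
 assumes "continuous_on {a..b} f" "a <= b"
 shows "(integral {a..b} f)^2 <= (b - a) * integral {a..b} (%x. (f x)^2)"
proof (cases "a = b")
 case False
 then have ab: "a < b" using assms by simp
 define m where "m = integral {a..b} f / (b - a)"
 have f: "(f has_integral integral {a..b} f) {a..b}"
  "((%x. (f x)^2) has_integral integral {a..b} (%x. (f x)^2)) {a..b}"
  using assms by (auto intro!: integrable_integral integrable_continuous_interval continuous_intros)
 have "((%x. m^2) has_integral (b - a) * m^2) {a..b}" using has_integral_const_real[of "m^2" a b] ab by simp
 from has_integral_add[OF has_integral_diff[OF f(2) has_integral_mult_right[OF f(1), of "2 * m"]] this]
 have "0 <= integral {a..b} (%x. (f x)^2) - 2 * m * integral {a..b} f + (b - a) * m^2"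
  by (rule has_integral_nonneg)
    (metis power2_diff zero_le_power2 add.commute add_diff_eq diff_add_eq mult.assoc mult.commute)
 moreover have "integral {a..b} f = m * (b - a)" using ab by (simp add: m_def)
 ultimately have "m^2 * (b - a) <= integral {a..b} (%x. (f x)^2)"
  by (simp add: power2_eq_square algebra_simps)
 then have "(b - a) * (m^2 * (b - a)) <= (b - a) * integral {a..b} (%x. (f x)^2)"
  using ab by (intro mult_left_mono) auto
 then show ?thesis unfolding \<open>integral {a..b} f = m * (b - a)\<close> by (simp add: power2_eq_square mult_ac)
qed simp

lemma (in classical_wave) time_increment:
 assumes "0 <= t" "t <= s" "s <= T" "x \<in> {0<..1}"
 shows "(z s x - z t x)^2 <= (s - t) * integral {t..s} (%\<tau>. (y \<tau> x)^2)"
proof -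
 have "continuous_on {0..T} (%t. y t x)" using yt assms(4) by (intro DERIV_continuous_on) auto
 then have cont: "continuous_on {t..s} (%t. y t x)" by (rule continuous_on_subset) (use assms in auto)
 have "((%t. y t x) has_integral z s x - z t x) {t..s}"
  by (rule has_integral_real_derivative[OF assms(2)])
    (rule has_field_derivative_subset[OF zt], use assms in auto)
 then have "integral {t..s} (%t. y t x) = z s x - z t x" by (rule integral_unique)
 then show ?thesis using integral_square_le[OF cont assms(2)] by simp
qed

text \<open>Common to both parts of the splitting, each of which is bounded pointwise by an integral
  of \<open>y^2\<close> over a time window. Exchanging the integrals turns such a bound into one by
  \<open>slab y\<close>.\<close>

lemma (in classical_wave) time_increment_slab:
 assumes \<mu>: "0 < \<mu>" "\<mu> < 1" and "0 <= t" "t <= s" "s <= T" and c: "continuous_on {1-\<mu>..1} f"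
  and f: "!!x. x \<in> {1-\<mu>..1} ==> (f x)\<^sup>2 <= B * integral {t..s} (%\<tau>. (y \<tau> x)^2)" and "0 <= B"
 shows "integral {1-\<mu>..1} (%x. (f x)^2) <= B * integral {0..T} (slab y \<mu>)"
proof -
 have b: "0 < 1 - \<mu>" using \<mu> by simp
 have sub: "{t..s} \<times> {1-\<mu>..1} <= {0..T} \<times> {0<..1}" using assms b by auto
 have y2: "continuous_on ({t..s} \<times> {1-\<mu>..1}) (%(\<tau>, x). (y \<tau> x)^2)"
  using continuous_on_subset[OF cy sub] by (auto simp: case_prod_unfold intro!: continuous_intros)
 have y2': "continuous_on ({1-\<mu>..1} \<times> {t..s}) (%(x, \<tau>). (y \<tau> x)^2)"
 proof -
  have "continuous_on ({1-\<mu>..1} \<times> {t..s}) (%u. (%(\<tau>, x). (y \<tau> x)^2) (snd u, fst u))"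
   by (rule continuous_on_compose2[OF y2]) (auto intro!: continuous_intros)
  then show ?thesis by (simp add: case_prod_unfold)
 qed
 have "integral {1-\<mu>..1} (%x. (f x)^2) <= integral {1-\<mu>..1} (%x. B * integral {t..s} (%\<tau>. (y \<tau> x)^2))"
 proof (rule integral_le)
  have "continuous_on {1-\<mu>..1} (%x. integral (cbox t s) (%\<tau>. (y \<tau> x)^2))"
   by (rule integral_continuous_on_param) (use y2' in simp)
  then show "(%x. B * integral {t..s} (%\<tau>. (y \<tau> x)^2)) integrable_on {1-\<mu>..1}"
   by (intro integrable_continuous_interval continuous_intros) simp
  show "(%x. (f x)^2) integrable_on {1-\<mu>..1}"
   using c by (intro integrable_continuous_interval continuous_intros)
 qed (use f in auto)
 also have "... = B * integral {1-\<mu>..1} (%x. integral {t..s} (%\<tau>. (y \<tau> x)^2))" by simp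
 also have "integral {1-\<mu>..1} (%x. integral {t..s} (%\<tau>. (y \<tau> x)^2)) = integral {t..s} (slab y \<mu>)"
  using integral_swap_continuous[of "1-\<mu>" t 1 s "%x \<tau>. (y \<tau> x)^2"] y2'
  by (simp add: cbox_Pair_eq slab_def[abs_def])
 also have "B * integral {t..s} (slab y \<mu>) <= B * integral {0..T} (slab y \<mu>)"
 proof (rule mult_left_mono[OF _ \<open>0 <= B\<close>], rule integral_subset_le)
  show "slab y \<mu> integrable_on {0..T}" "slab y \<mu> integrable_on {t..s}"
   using assms(3-5) by (auto intro!: integrable_continuous_interval continuous_on_subset[OF slab_cont(1)[OF \<mu>]])
  show "\<forall>x\<in>{0..T}. 0 <= slab y \<mu> x"
  proof
   fix x assume "x \<in> {0..T}"
   from slab_integrals(1)[OF \<mu> this] show "0 <= slab y \<mu> x" by (rule has_integral_nonneg) simp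
  qed
 qed (use assms(3-5) in auto)
 finally show ?thesis .
qed

lemma integral_square_sum_le:
 fixes f g :: "real => real"
 assumes "continuous_on {a..b} f" "continuous_on {a..b} g"
 shows "integral {a..b} (%x. (f x + g x)^2) <= 2 * integral {a..b} (%x. (f x)^2) + 2 * integral {a..b} (%x. (g x)^2)"
proof -
 have I: "((%x. (f x + g x)^2) has_integral integral {a..b} (%x. (f x + g x)^2)) {a..b}"
  "((%x. (f x)^2) has_integral integral {a..b} (%x. (f x)^2)) {a..b}"
  "((%x. (g x)^2) has_integral integral {a..b} (%x. (g x)^2)) {a..b}"
  using assms by (auto intro!: integrable_integral integrable_continuous_interval continuous_intros)
 show ?thesis
 proof (rule has_integral_le[OF I(1) has_integral_add[OF has_integral_mult_right[OF I(2)] has_integral_mult_right[OF I(3)]]])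
  fix x
  show "(f x + g x)^2 <= 2 * (f x)^2 + 2 * (g x)^2"
   using two_mult_le_sum_squares[of "f x" "g x"] by (simp add: power2_sum)
 qed
qed

text \<open>
  Splitting off the lower order term: with \<open>Z\<^sub>t = z\<close>, write \<open>z = z\<^sub>h + z\<^sub>l\<close> where \<open>z\<^sub>l = (Z(t+\<delta>) - Z(t))/\<delta>\<close>
 is a time average of \<open>z\<close>. Both \<open>z\<^sub>h\<close> and the time derivative \<open>d\<close> of \<open>z\<^sub>l\<close> are
 controlled on the slab by \<open>z\<^sub>t\<close> alone, and the energy of \<open>z\<^sub>l\<close> is bounded by that of \<open>d\<close>.
\<close>

locale wave_with_primitive =
 prim: classical_wave \<alpha> T Z z y P p + classical_wave \<alpha> T z y w p q
 for \<alpha> T Z z y w P p q +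
 fixes \<delta> :: real
 assumes \<delta>: "0 < \<delta>" "T = 4 / (2 - \<alpha>) + 3 * \<delta>"
begin

text \<open>\<open>inc\<close> and \<open>rest\<close> are spelled as linear combinations in the
  shape of \<open>classical_wave_combine\<close>, so that they solve the system by matching.\<close>

definition inc :: "(real => real => real) => real => real => real" where
 "inc f t x = 1 / \<delta> * f (t + \<delta>) x + - (1 / \<delta>) * f t x"

definition rest :: "(real => real => real) => (real => real => real) => real => real => real" where
 "rest f F t x = 1 * f t x + - 1 * inc F t x"

abbreviation "T' \<equiv> T - \<delta>"

text \<open>One \<delta> of the time is consumed by the shift; the surplus
  \<open>2 * \<delta>\<close> that remains is the one in \<open>slab_observability\<close>.\<close>

lemma T': "0 < T'" "T' = 4 / (2 - \<alpha>) + 2 * \<delta>" "T' <= T" "0 < T"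
 using \<delta> \<alpha> by (auto intro!: add_pos_pos)

lemma low: "classical_wave \<alpha> T' (inc Z) (inc z) (inc y) (inc P) (inc p)"
 unfolding inc_def[abs_def]
 using classical_wave_combine[OF classical_wave_shift[OF prim.classical_wave_axioms, of \<delta> T']
   classical_wave_shift[OF prim.classical_wave_axioms, of 0 T'], of "1 / \<delta>" "- (1 / \<delta>)"] \<delta>(1) by simp

lemma low_t: "classical_wave \<alpha> T' (inc z) (inc y) (inc w) (inc p) (inc q)"
 unfolding inc_def[abs_def]
 using classical_wave_combine[OF classical_wave_shift[OF classical_wave_axioms, of \<delta> T']
   classical_wave_shift[OF classical_wave_axioms, of 0 T'], of "1 / \<delta>" "- (1 / \<delta>)"] \<delta>(1) by simp

lemma high: "classical_wave \<alpha> T' (rest z Z) (rest y z) (rest w y) (rest p P) (rest q p)"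
 unfolding rest_def[abs_def]
 by (rule classical_wave_combine[OF _ low])
   (use classical_wave_shift[OF classical_wave_axioms, of 0 T'] \<delta>(1) in simp)

lemma inc_square: "t \<in> {0..T'} ==> x \<in> {0<..1} ==> (inc z t x)\<^sup>2 <= 1 / \<delta> * integral {t..t+\<delta>} (%\<tau>. (y \<tau> x)^2)"
proof -
 assume "t \<in> {0..T'}" "x \<in> {0<..1}"
 then have "(z (t + \<delta>) x - z t x)^2 <= (t + \<delta> - t) * integral {t..t+\<delta>} (%\<tau>. (y \<tau> x)^2)"
  using \<delta>(1) by (intro time_increment) auto
 moreover have "inc z t x = (z (t + \<delta>) x - z t x) / \<delta>" unfolding inc_def by (simp add: diff_divide_distrib)
 moreover have "(z (t + \<delta>) x - z t x)^2 / \<delta>\<^sup>2 <= (t + \<delta> - t) * I / \<delta>\<^sup>2"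
  if "(z (t + \<delta>) x - z t x)^2 <= (t + \<delta> - t) * I" for I
  using that by (rule divide_right_mono) simp
 ultimately show ?thesis using \<delta>(1) by (simp add: power_divide power2_eq_square[of \<delta>])
qed

text \<open>Times \<delta>, the remainder is the integral of \<open>z t x - z s x\<close> for
  \<open>s\<close> in the window, and each such increment is at most the square root of
  \<open>\<delta> * Q\<close>.\<close>

lemma rest_square: 
 assumes t: "t \<in> {0..T'}" and x: "x \<in> {0<..1}"
 shows "(rest z Z t x)^2 <= \<delta> * integral {t..t+\<delta>} (%\<tau>. (y \<tau> x)^2)"
proof -
 define Q where "Q = integral {t..t+\<delta>} (%\<tau>. (y \<tau> x)^2)"
 have cy: "continuous_on {0..T} (%t. y t x)" using yt x by (intro DERIV_continuous_on) auto
 have int: "(%t. (y t x)^2) integrable_on {u..v}" if "0 <= u" "v <= T" for u v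
  using that by (intro integrable_continuous_interval continuous_intros continuous_on_subset[OF cy]) auto
 have Q0: "0 <= Q" unfolding Q_def using t by (intro Henstock_Kurzweil_Integration.integral_nonneg int) auto
 have "((%s. z s x) has_integral Z (t + \<delta>) x - Z t x) {t..t+\<delta>}"
  by (rule has_integral_real_derivative)
    (use t x \<delta>(1) in "auto intro!: has_field_derivative_subset[OF prim.zt]")
 from has_integral_diff[OF has_integral_const_real[of "z t x"] this]
 have "((%s. z t x - z s x) has_integral \<delta> * z t x - (Z (t + \<delta>) x - Z t x)) {t..t+\<delta>}"
  using \<delta>(1) by simp
 note I = this
 have "norm (\<delta> * z t x - (Z (t + \<delta>) x - Z t x)) <= sqrt (\<delta> * Q) * measure lborel {t..t+\<delta>}"
 proof (rule has_integral_bound_real[OF _ finite.emptyI I])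
  fix s assume "s \<in> {t..t+\<delta>} - {}"
  then have s: "s \<in> {t..t+\<delta>}" by simp
  have "(z s x - z t x)^2 <= (s - t) * integral {t..s} (%\<tau>. (y \<tau> x)^2)"
   using s t x by (intro time_increment) auto
  also have "... <= \<delta> * Q" unfolding Q_def
   using s t \<delta>(1) by (intro mult_mono integral_subset_le int Henstock_Kurzweil_Integration.integral_nonneg) auto
  finally have "\<bar>z s x - z t x\<bar> <= sqrt (\<delta> * Q)" by (simp add: real_le_rsqrt)
  then show "norm (z t x - z s x) <= sqrt (\<delta> * Q)" by (simp add: abs_minus_commute)
 qed (use Q0 \<delta>(1) in simp)
 then have "\<bar>\<delta> * z t x - (Z (t + \<delta>) x - Z t x)\<bar> <= \<delta> * sqrt (\<delta> * Q)" using \<delta>(1) by (simp add: mult.commute)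
 moreover have "\<delta> * rest z Z t x = \<delta> * z t x - (Z (t + \<delta>) x - Z t x)"
  using \<delta>(1) unfolding rest_def inc_def by (simp add: field_simps)
 ultimately have "\<delta> * \<bar>rest z Z t x\<bar> <= \<delta> * sqrt (\<delta> * Q)" using \<delta>(1) by (metis abs_mult abs_of_pos)
 then have "\<bar>rest z Z t x\<bar> <= sqrt (\<delta> * Q)" using \<delta>(1) by simp
 then show ?thesis unfolding Q_def[symmetric] using Q0 \<delta>(1)
  by (metis abs_ge_zero power2_abs power_mono real_sqrt_pow2 mult_nonneg_nonneg less_imp_le)
qed

text \<open>This is the purpose of the splitting: the strip quantities that observability requires
  for \<open>rest z Z\<close> and for \<open>inc z\<close> are bounded by \<open>y\<close> alone,
  without \<open>z\<close>.\<close>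

lemma slab_estimates:
 assumes \<mu>: "0 < \<mu>" "\<mu> < 1" and t: "t \<in> {0..T'}"
 shows "slab (inc z) \<mu> t <= 1 / \<delta> * integral {0..T} (slab y \<mu>)"
  "slab (rest z Z) \<mu> t <= \<delta> * integral {0..T} (slab y \<mu>)"
  "slab (inc y) \<mu> t <= 2 / \<delta>\<^sup>2 * slab y \<mu> (t + \<delta>) + 2 / \<delta>\<^sup>2 * slab y \<mu> t"
  "slab (rest y z) \<mu> t <= 2 * slab y \<mu> t + 2 / \<delta> * integral {0..T} (slab y \<mu>)"
proof -
 interpret H: classical_wave \<alpha> T' "rest z Z" "rest y z" "rest w y" "rest p P" "rest q p" by (rule high)
 interpret D: classical_wave \<alpha> T' "inc z" "inc y" "inc w" "inc p" "inc q" by (rule low_t)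
 have b: "0 < 1 - \<mu>" using \<mu> by simp
 show 1: "slab (inc z) \<mu> t <= 1 / \<delta> * integral {0..T} (slab y \<mu>)"
  unfolding slab_def[of "inc z"] by (rule time_increment_slab[where t=t and s="t+\<delta>"])
   (use \<mu> t \<delta>(1) b inc_square in "auto intro!: D.cont_slice")
 show "slab (rest z Z) \<mu> t <= \<delta> * integral {0..T} (slab y \<mu>)"
  unfolding slab_def[of "rest z Z"] by (rule time_increment_slab[where t=t and s="t+\<delta>"])
   (use \<mu> t \<delta>(1) b rest_square in "auto intro!: H.cont_slice")
 have c: "continuous_on {1-\<mu>..1} (y (t + \<delta>))" "continuous_on {1-\<mu>..1} (y t)" "continuous_on {1-\<mu>..1} (inc z t)"
  using b t \<delta>(1) by (auto intro!: cont_slice D.cont_slice)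
 have "slab (inc y) \<mu> t <= 2 * integral {1-\<mu>..1} (%x. (1 / \<delta> * y (t + \<delta>) x)^2)
   + 2 * integral {1-\<mu>..1} (%x. (- (1 / \<delta>) * y t x)^2)"
  unfolding slab_def inc_def by (intro integral_square_sum_le continuous_intros c)
 then show "slab (inc y) \<mu> t <= 2 / \<delta>\<^sup>2 * slab y \<mu> (t + \<delta>) + 2 / \<delta>\<^sup>2 * slab y \<mu> t"
  by (simp add: slab_def power_divide)
 have "slab (rest y z) \<mu> t <= 2 * integral {1-\<mu>..1} (%x. (1 * y t x)^2)
   + 2 * integral {1-\<mu>..1} (%x. (- 1 * inc z t x)^2)"
  unfolding slab_def rest_def by (intro integral_square_sum_le continuous_intros c)
 then have "slab (rest y z) \<mu> t <= 2 * slab y \<mu> t + 2 * slab (inc z) \<mu> t" by (simp add: slab_def)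
 with 1 show "slab (rest y z) \<mu> t <= 2 * slab y \<mu> t + 2 / \<delta> * integral {0..T} (slab y \<mu>)" by simp
qed

text \<open>One number that majorises the coefficients of both time integrals below; it depends on
  \<open>T\<close> and \<delta> only, not on the width of the strip.\<close>

definition obs_const :: real where
 "obs_const = 4 / \<delta>\<^sup>2 + 3 * T / \<delta> + 2 + T * \<delta>"

lemma slab_time_integrals:
 assumes \<mu>: "0 < \<mu>" "\<mu> < 1"
 shows "integral {0..T'} (%t. slab (inc y) \<mu> t / \<mu> + slab (inc z) \<mu> t / \<mu>^3)
    <= obs_const / \<mu>^3 * integral {0..T} (slab y \<mu>)"
  "integral {0..T'} (%t. slab (rest y z) \<mu> t / \<mu> + slab (rest z Z) \<mu> t / \<mu>^3)
    <= obs_const / \<mu>^3 * integral {0..T} (slab y \<mu>)"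
proof -
 interpret H: classical_wave \<alpha> T' "rest z Z" "rest y z" "rest w y" "rest p P" "rest q p" by (rule high)
 interpret D: classical_wave \<alpha> T' "inc z" "inc y" "inc w" "inc p" "inc q" by (rule low_t)
 define N where "N = integral {0..T} (slab y \<mu>)"
 have int: "slab y \<mu> integrable_on {0..T}"
  by (intro integrable_continuous_interval slab_cont \<mu>)
 have nn: "0 <= slab y \<mu> t" if "t \<in> {0..T}" for t
  using slab_integrals(1)[OF \<mu> that] by (rule has_integral_nonneg) simp
 have N: "0 <= N" unfolding N_def by (intro Henstock_Kurzweil_Integration.integral_nonneg int nn)
 have i0: "slab y \<mu> integrable_on {0..T'}" "slab y \<mu> integrable_on {\<delta>..T}"
  using \<delta>(1) by (auto intro!: integrable_on_subinterval[OF int])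
 have N0: "integral {0..T'} (slab y \<mu>) <= N" "integral {\<delta>..T} (slab y \<mu>) <= N"
  unfolding N_def using \<delta>(1) nn by (auto intro!: integral_subset_le[OF _ i0(1) int] integral_subset_le[OF _ i0(2) int])
 have sh: "((%t. slab y \<mu> (t + \<delta>)) has_integral integral {\<delta>..T} (slab y \<mu>)) {0..T'}"
 proof -
  have c: "continuous_on {0+\<delta>..T'+\<delta>} (slab y \<mu>)"
   using \<delta>(1) by (intro continuous_on_subset[OF slab_cont(1)[OF \<mu>]]) auto
  have "(%t. slab y \<mu> (t + \<delta>)) integrable_on {0..T'}"
   by (intro integrable_continuous_interval continuous_on_compose2[OF c] continuous_intros) auto
  moreover have "integral {0..T'} (%t. slab y \<mu> (t + \<delta>)) = integral {\<delta>..T} (slab y \<mu>)"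
   using integral_shift[OF c] by (simp add: o_def)
  ultimately show ?thesis by (metis integrable_integral)
 qed
 have e3: "1 / \<mu> <= 1 / \<mu>^3"
  using \<mu> power_decreasing[of 1 3 \<mu>] by (simp add: frac_le)
 have const: "((%t. c) has_integral T' * c) {0..T'}" for c :: real
  using has_integral_const_real[of c 0 T'] T'(1) by simp
 have "((%t. slab (inc y) \<mu> t / \<mu> + slab (inc z) \<mu> t / \<mu>^3) has_integral
   integral {0..T'} (%t. slab (inc y) \<mu> t / \<mu> + slab (inc z) \<mu> t / \<mu>^3)) {0..T'}"
  using \<mu> by (intro integrable_integral integrable_continuous_interval continuous_intros D.slab_cont) auto
 moreover have "((%t. 1 / \<mu>^3 * (2 / \<delta>\<^sup>2 * slab y \<mu> (t + \<delta>) + 2 / \<delta>\<^sup>2 * slab y \<mu> t + 1 / \<delta> * N)) has_integral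
   1 / \<mu>^3 * (2 / \<delta>\<^sup>2 * integral {\<delta>..T} (slab y \<mu>) + 2 / \<delta>\<^sup>2 * integral {0..T'} (slab y \<mu>) + T' * (1 / \<delta> * N))) {0..T'}"
  by (intro has_integral_mult_right has_integral_add sh integrable_integral i0 const)
 ultimately have "integral {0..T'} (%t. slab (inc y) \<mu> t / \<mu> + slab (inc z) \<mu> t / \<mu>^3) <=
   1 / \<mu>^3 * (2 / \<delta>\<^sup>2 * integral {\<delta>..T} (slab y \<mu>) + 2 / \<delta>\<^sup>2 * integral {0..T'} (slab y \<mu>) + T' * (1 / \<delta> * N))"
 proof (rule has_integral_le)
  fix t assume t: "t \<in> {0..T'}"
  have "0 <= slab (inc y) \<mu> t" using D.slab_integrals(1)[OF \<mu> t] by (rule has_integral_nonneg) simp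
  then have "slab (inc y) \<mu> t * (1 / \<mu>) <= slab (inc y) \<mu> t * (1 / \<mu>^3)" by (intro mult_left_mono e3)
  also have "... <= (2 / \<delta>\<^sup>2 * slab y \<mu> (t + \<delta>) + 2 / \<delta>\<^sup>2 * slab y \<mu> t) * (1 / \<mu>^3)"
   using \<mu> by (intro mult_right_mono slab_estimates t) auto
  finally have 1: "slab (inc y) \<mu> t / \<mu> <= (2 / \<delta>\<^sup>2 * slab y \<mu> (t + \<delta>) + 2 / \<delta>\<^sup>2 * slab y \<mu> t) / \<mu>^3" by simp
  have 2: "slab (inc z) \<mu> t / \<mu>^3 <= (1 / \<delta> * N) / \<mu>^3"
   unfolding N_def using \<mu> by (intro divide_right_mono slab_estimates t) auto
  show "slab (inc y) \<mu> t / \<mu> + slab (inc z) \<mu> t / \<mu>^3 <=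
    1 / \<mu>^3 * (2 / \<delta>\<^sup>2 * slab y \<mu> (t + \<delta>) + 2 / \<delta>\<^sup>2 * slab y \<mu> t + 1 / \<delta> * N)"
   using add_mono[OF 1 2] by (simp only: add_divide_distrib[symmetric] times_divide_eq_left mult_1_left)
 qed
 also have "... <= 1 / \<mu>^3 * (2 / \<delta>\<^sup>2 * N + 2 / \<delta>\<^sup>2 * N + T * (1 / \<delta> * N))"
  using \<mu> N N0 \<delta>(1) T'(1,3,4) by (intro mult_left_mono add_mono mult_right_mono) auto
 also have "... <= 1 / \<mu>^3 * (obs_const * N)"
 proof (rule mult_left_mono)
  have "0 <= T / \<delta>" "0 <= T * \<delta>" using \<delta>(1) T'(4) by auto
  then have "2 / \<delta>\<^sup>2 + 2 / \<delta>\<^sup>2 + T * (1 / \<delta>) <= obs_const" by (simp add: obs_const_def)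
  then have "(2 / \<delta>\<^sup>2 + 2 / \<delta>\<^sup>2 + T * (1 / \<delta>)) * N <= obs_const * N" using N by (rule mult_right_mono)
  then show "2 / \<delta>\<^sup>2 * N + 2 / \<delta>\<^sup>2 * N + T * (1 / \<delta> * N) <= obs_const * N" by (simp add: algebra_simps)
 qed (use \<mu> in auto)
 finally show "integral {0..T'} (%t. slab (inc y) \<mu> t / \<mu> + slab (inc z) \<mu> t / \<mu>^3)
    <= obs_const / \<mu>^3 * integral {0..T} (slab y \<mu>)" by (simp add: N_def)
 have "((%t. slab (rest y z) \<mu> t / \<mu> + slab (rest z Z) \<mu> t / \<mu>^3) has_integral
   integral {0..T'} (%t. slab (rest y z) \<mu> t / \<mu> + slab (rest z Z) \<mu> t / \<mu>^3)) {0..T'}"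
  using \<mu> by (intro integrable_integral integrable_continuous_interval continuous_intros H.slab_cont) auto
 moreover have "((%t. 1 / \<mu>^3 * (2 * slab y \<mu> t + (2 / \<delta> * N + \<delta> * N))) has_integral
   1 / \<mu>^3 * (2 * integral {0..T'} (slab y \<mu>) + T' * (2 / \<delta> * N + \<delta> * N))) {0..T'}"
  by (intro has_integral_mult_right has_integral_add integrable_integral i0 const)
 ultimately have "integral {0..T'} (%t. slab (rest y z) \<mu> t / \<mu> + slab (rest z Z) \<mu> t / \<mu>^3) <=
   1 / \<mu>^3 * (2 * integral {0..T'} (slab y \<mu>) + T' * (2 / \<delta> * N + \<delta> * N))"
 proof (rule has_integral_le)
  fix t assume t: "t \<in> {0..T'}"
  have "0 <= slab (rest y z) \<mu> t" using H.slab_integrals(1)[OF \<mu> t] by (rule has_integral_nonneg) simp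
  then have "slab (rest y z) \<mu> t * (1 / \<mu>) <= slab (rest y z) \<mu> t * (1 / \<mu>^3)" by (intro mult_left_mono e3)
  also have "... <= (2 * slab y \<mu> t + 2 / \<delta> * N) * (1 / \<mu>^3)"
   unfolding N_def using \<mu> by (intro mult_right_mono slab_estimates t) auto
  finally have 1: "slab (rest y z) \<mu> t / \<mu> <= (2 * slab y \<mu> t + 2 / \<delta> * N) / \<mu>^3" by simp
  have 2: "slab (rest z Z) \<mu> t / \<mu>^3 <= (\<delta> * N) / \<mu>^3"
   unfolding N_def using \<mu> by (intro divide_right_mono slab_estimates t) auto
  show "slab (rest y z) \<mu> t / \<mu> + slab (rest z Z) \<mu> t / \<mu>^3 <= 1 / \<mu>^3 * (2 * slab y \<mu> t + (2 / \<delta> * N + \<delta> * N))"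
   using add_mono[OF 1 2] by (simp only: add_divide_distrib[symmetric] times_divide_eq_left mult_1_left add.assoc)
 qed
 also have "... <= 1 / \<mu>^3 * (2 * N + T * (2 / \<delta> * N + \<delta> * N))"
  using \<mu> N N0 \<delta>(1) T'(1,3,4) by (intro mult_left_mono add_mono mult_right_mono) auto
 also have "... <= 1 / \<mu>^3 * (obs_const * N)"
 proof (rule mult_left_mono)
  have "2 + T * (2 / \<delta> + \<delta>) <= obs_const" using \<delta>(1) T'(1,3,4) by (simp add: obs_const_def field_simps)
  then have "(2 + T * (2 / \<delta> + \<delta>)) * N <= obs_const * N" using N by (rule mult_right_mono)
  then show "2 * N + T * (2 / \<delta> * N + \<delta> * N) <= obs_const * N" by (simp add: algebra_simps)
 qed (use \<mu> in auto)
 finally show "integral {0..T'} (%t. slab (rest y z) \<mu> t / \<mu> + slab (rest z Z) \<mu> t / \<mu>^3)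
    <= obs_const / \<mu>^3 * integral {0..T} (slab y \<mu>)" by (simp add: N_def)
qed

definition flux_const :: real where "flux_const = (20 * T'^4 + 20 * T'^2) / (\<delta> * T' / 4)^2"

text \<open>The low part \<open>inc Z\<close> has no strip bound of its own, only its time
  derivative \<open>inc z\<close> has one. Passing from the energy of the derivative back to that of
  \<open>inc Z\<close> uses Hardy's inequality for the velocity and the elliptic estimate for the
  flux.\<close>

lemma internal_observability:
 assumes a: "0 < a" "a <= 1" and \<mu>: "0 < \<mu>" "\<mu> <= 1/2"
  and \<sigma>: "!!t. t \<in> {0..T} ==> \<bar>Z t a\<bar> <= \<sigma>" "!!t. t \<in> {0..T} ==> \<bar>z t a\<bar> <= \<sigma>" "!!t. t \<in> {0..T} ==> \<bar>y t a\<bar> <= \<sigma>"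
  and \<rho>: "!!t. t \<in> {0..T} ==> \<bar>P t a\<bar> <= \<rho>" "!!t. t \<in> {0..T} ==> \<bar>p t a\<bar> <= \<rho>"
 shows "(2 - \<alpha>) / 2 * \<delta> * energy a 0 <= 10 * (flux_const * obs_const / \<mu>^3) * integral {0..T} (slab y \<mu>)
   + (10 * (4 * T' + T'^2) + 2 * \<delta>) * ((2 / \<delta> + 1)^2 * (\<sigma> * \<rho> + a * \<sigma>\<^sup>2 + a * r a * \<rho>\<^sup>2))"
proof -
 interpret H: classical_wave \<alpha> T' "rest z Z" "rest y z" "rest w y" "rest p P" "rest q p" by (rule high)
 interpret L: classical_wave \<alpha> T' "inc Z" "inc z" "inc y" "inc P" "inc p" by (rule low)
 interpret D: classical_wave \<alpha> T' "inc z" "inc y" "inc w" "inc p" "inc q" by (rule low_t)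
 \<comment> \<open>Bounds the size of both operations on values at \<open>a\<close>:
   \<open>2 / \<delta>\<close> for \<open>inc\<close>, and 1 more for \<open>rest\<close>.\<close>
 define c where "c = 2 / \<delta> + 1"
 have c: "0 < c" using \<delta>(1) by (simp add: c_def add_pos_pos)
 define \<xi> where "\<xi> = c^2 * (\<sigma> * \<rho> + a * \<sigma>\<^sup>2 + a * r a * \<rho>\<^sup>2)"
 have \<sigma>0: "0 <= \<sigma>" using \<sigma>(1)[of 0] T'(4) by auto
 have \<rho>0: "0 <= \<rho>" using \<rho>(1)[of 0] T'(4) by auto
 have inc_bound: "\<bar>inc f t a\<bar> <= c * B" if "!!t. t \<in> {0..T} ==> \<bar>f t a\<bar> <= B" "t \<in> {0..T'}" for f t B
 proof -
  have "\<bar>f (t + \<delta>) a\<bar> <= B" "\<bar>f t a\<bar> <= B" using that \<delta>(1) by auto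
  then have "\<bar>f (t + \<delta>) a\<bar> / \<delta> + \<bar>f t a\<bar> / \<delta> <= B / \<delta> + B / \<delta>"
   using \<delta>(1) by (intro add_mono divide_right_mono) auto
  moreover have "\<bar>inc f t a\<bar> <= \<bar>f (t + \<delta>) a\<bar> / \<delta> + \<bar>f t a\<bar> / \<delta>"
   unfolding inc_def using \<delta>(1) abs_triangle_ineq[of "1 / \<delta> * f (t + \<delta>) a" "- (1 / \<delta>) * f t a"]
   by (simp add: abs_mult)
  moreover have "0 <= B" using \<open>\<bar>f t a\<bar> <= B\<close> by linarith
  ultimately show ?thesis by (simp add: c_def distrib_right)
 qed
 have rest_bound: "\<bar>rest f F t a\<bar> <= c * B"
  if "!!t. t \<in> {0..T} ==> \<bar>f t a\<bar> <= B" "!!t. t \<in> {0..T} ==> \<bar>F t a\<bar> <= B" "t \<in> {0..T'}" for f F t B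
 proof -
  have "\<bar>F (t + \<delta>) a\<bar> <= B" "\<bar>F t a\<bar> <= B" "\<bar>f t a\<bar> <= B" using that \<delta>(1) by auto
  then have "\<bar>F (t + \<delta>) a\<bar> / \<delta> + \<bar>F t a\<bar> / \<delta> <= B / \<delta> + B / \<delta>"
   using \<delta>(1) by (intro add_mono divide_right_mono) auto
  moreover have "\<bar>inc F t a\<bar> <= \<bar>F (t + \<delta>) a\<bar> / \<delta> + \<bar>F t a\<bar> / \<delta>"
   unfolding inc_def using \<delta>(1) abs_triangle_ineq[of "1 / \<delta> * F (t + \<delta>) a" "- (1 / \<delta>) * F t a"]
   by (simp add: abs_mult)
  moreover have "\<bar>rest f F t a\<bar> <= \<bar>f t a\<bar> + \<bar>inc F t a\<bar>" unfolding rest_def by simp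
  ultimately show ?thesis using \<open>\<bar>f t a\<bar> <= B\<close> by (simp add: c_def distrib_right)
 qed
 have r0: "0 <= a * r a" using a by simp
 have k1: "0 <= c^2 * (\<sigma> * \<rho>)" "0 <= c^2 * (a * \<sigma>\<^sup>2)" "0 <= c^2 * (a * r a * \<rho>\<^sup>2)"
  using \<sigma>0 \<rho>0 a by auto
 have \<xi>_eq: "\<xi> = c^2 * (\<sigma> * \<rho>) + c^2 * (a * \<sigma>\<^sup>2) + c^2 * (a * r a * \<rho>\<^sup>2)"
  by (simp add: \<xi>_def distrib_left)
 have \<xi>0: "0 <= \<xi>" using k1 \<xi>_eq by linarith
 have prod: "\<bar>u * v\<bar> <= \<xi>" if "\<bar>u\<bar> <= c * \<sigma>" "\<bar>v\<bar> <= c * \<rho>" for u v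
 proof -
  have "\<bar>u * v\<bar> <= (c * \<sigma>) * (c * \<rho>)" unfolding abs_mult using that c \<sigma>0 by (intro mult_mono) auto
  also have "... = c^2 * (\<sigma> * \<rho>)" by (simp add: power2_eq_square mult_ac)
  finally show ?thesis using k1 \<xi>_eq by linarith
 qed
 have sq1: "a * u^2 <= \<xi>" if "\<bar>u\<bar> <= c * \<sigma>" for u
 proof -
  have "a * \<bar>u\<bar>\<^sup>2 <= a * (c * \<sigma>)^2" using that a by (intro mult_left_mono power_mono) auto
  also have "... = c^2 * (a * \<sigma>\<^sup>2)" by (simp add: power2_eq_square mult_ac)
  finally show ?thesis using k1 \<xi>_eq by simp
 qed
 have sq2: "a * r a * u^2 <= \<xi>" if "\<bar>u\<bar> <= c * \<rho>" for u
 proof -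
  have "a * r a * \<bar>u\<bar>\<^sup>2 <= a * r a * (c * \<rho>)^2" using that r0 by (intro mult_left_mono power_mono) auto
  also have "... = c^2 * (a * r a * \<rho>\<^sup>2)" by (simp add: power2_eq_square mult_ac)
  finally show ?thesis using k1 \<xi>_eq by simp
 qed
 have \<mu>1: "\<mu> < 1" using \<mu> by simp
 define N where "N = integral {0..T} (slab y \<mu>)"
 define K where "K = flux_const * (obs_const / \<mu>^3 * N) + \<xi> * (4 * T' + T'^2)"
 have fc: "0 <= flux_const" by (simp add: flux_const_def)
 have ED: "(2 - \<alpha>) / 2 * \<delta> * D.energy a 0 <= K"
 proof -
  have "(2 - \<alpha>) / 2 * \<delta> * D.energy a 0
   <= (20 * T'^4 + 20 * T'^2) / (\<delta> * T' / 4)^2 * integral {0..T'} (%t. slab (inc y) \<mu> t / \<mu> + slab (inc z) \<mu> t / \<mu>^3)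
    + \<xi> * (4 * T' + T'^2)"
  proof (rule D.slab_observability[OF a _ _ _ _ \<mu> \<delta>(1) T'(2)])
   fix t assume t: "t \<in> {0..T'}"
   show "\<bar>inc y t a * inc p t a\<bar> <= \<xi>" by (intro prod inc_bound \<sigma> \<rho> t)
   have "\<bar>inc z t a * inc p t a\<bar> <= \<xi>" by (intro prod inc_bound \<sigma> \<rho> t)
   then show "\<bar>inc p t a * inc z t a\<bar> <= \<xi>" by (simp add: mult.commute)
   show "a * (inc y t a)^2 <= \<xi>" by (intro sq1 inc_bound \<sigma> t)
   show "a * r a * (inc p t a)^2 <= \<xi>" by (intro sq2 inc_bound \<rho> t)
  qed
  also have "... <= flux_const * (obs_const / \<mu>^3 * N) + \<xi> * (4 * T' + T'^2)"
   unfolding flux_const_def[symmetric] N_def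
   by (intro add_right_mono mult_left_mono slab_time_integrals(1) \<mu> \<mu>1 fc)
  finally show ?thesis by (simp add: K_def)
 qed
 have EH: "(2 - \<alpha>) / 2 * \<delta> * H.energy a 0 <= K"
 proof -
  have "(2 - \<alpha>) / 2 * \<delta> * H.energy a 0
   <= (20 * T'^4 + 20 * T'^2) / (\<delta> * T' / 4)^2 * integral {0..T'} (%t. slab (rest y z) \<mu> t / \<mu> + slab (rest z Z) \<mu> t / \<mu>^3)
    + \<xi> * (4 * T' + T'^2)"
  proof (rule H.slab_observability[OF a _ _ _ _ \<mu> \<delta>(1) T'(2)])
   fix t assume t: "t \<in> {0..T'}"
   show "\<bar>rest y z t a * rest p P t a\<bar> <= \<xi>" by (intro prod rest_bound \<sigma> \<rho> t)
   have "\<bar>rest z Z t a * rest p P t a\<bar> <= \<xi>" by (intro prod rest_bound \<sigma> \<rho> t)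
   then show "\<bar>rest p P t a * rest z Z t a\<bar> <= \<xi>" by (simp add: mult.commute)
   show "a * (rest y z t a)^2 <= \<xi>" by (intro sq1 rest_bound \<sigma> t)
   show "a * r a * (rest p P t a)^2 <= \<xi>" by (intro sq2 rest_bound \<rho> t)
  qed
  also have "... <= flux_const * (obs_const / \<mu>^3 * N) + \<xi> * (4 * T' + T'^2)"
   unfolding flux_const_def[symmetric] N_def
   by (intro add_right_mono mult_left_mono slab_time_integrals(2) \<mu> \<mu>1 fc)
  finally show ?thesis by (simp add: K_def)
 qed
 have T0: "0 \<in> {0..T'}" "0 \<in> {0..T}" using T'(1,4) by auto
 have EL: "L.energy a 0 <= 4 * D.energy a 0 + \<xi>"
 proof -
  have i: "(%x. (inc z 0 x)^2) integrable_on {a..1}" "(%x. (inc y 0 x)^2) integrable_on {a..1}"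
   "(%x. r x * (inc p 0 x)^2) integrable_on {a..1}" "(%x. r x * (inc P 0 x)^2) integrable_on {a..1}"
   using a T0 by (auto intro!: integrable_continuous_interval continuous_intros L.cont_slice D.cont_slice)
  have "integral {a..1} (%x. (inc z 0 x)^2) <= 4 * integral {a..1} (%x. r x * (inc p 0 x)^2)"
   by (rule D.poincare[OF a T0(1)])
  moreover have "integral {a..1} (%x. r x * (inc P 0 x)^2) <= 2 * \<xi> + 4 * integral {a..1} (%x. (inc y 0 x)^2)"
  proof (rule L.flux_le_acceleration[OF a T0(1)])
   have "\<bar>inc Z 0 a * inc P 0 a\<bar> <= \<xi>" by (intro prod inc_bound \<sigma> \<rho> T0)
   then show "\<bar>inc P 0 a * inc Z 0 a\<bar> <= \<xi>" by (simp add: mult.commute)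
  qed
  ultimately show ?thesis
   unfolding L.energy_def D.energy_def
   using Henstock_Kurzweil_Integration.integral_add[OF i(1,4)] Henstock_Kurzweil_Integration.integral_add[OF i(2,3)] by linarith
 qed
 have "energy a 0 <= 2 * H.energy a 0 + 2 * L.energy a 0"
 proof -
  have i: "((%x. (y 0 x)^2 + r x * (p 0 x)^2) has_integral 2 * energy a 0) {a..1}"
   "((%x. (rest y z 0 x)^2 + r x * (rest p P 0 x)^2) has_integral 2 * H.energy a 0) {a..1}"
   "((%x. (inc z 0 x)^2 + r x * (inc P 0 x)^2) has_integral 2 * L.energy a 0) {a..1}"
   unfolding energy_def L.energy_def H.energy_def using a T0
   by (auto intro!: integrable_integral integrable_continuous_interval continuous_intros L.cont_slice H.cont_slice cont_slice)
  have "2 * energy a 0 <= 2 * (2 * H.energy a 0) + 2 * (2 * L.energy a 0)"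
  proof (rule has_integral_le[OF i(1) has_integral_add[OF has_integral_mult_right[OF i(2)] has_integral_mult_right[OF i(3)]]])
   fix x
   have y: "y 0 x = rest y z 0 x + inc z 0 x" and p: "p 0 x = rest p P 0 x + inc P 0 x"
    unfolding rest_def by simp_all
   have "(y 0 x)^2 <= 2 * (rest y z 0 x)^2 + 2 * (inc z 0 x)^2"
    unfolding y using two_mult_le_sum_squares[of "rest y z 0 x" "inc z 0 x"] by (simp add: power2_sum)
   moreover have "r x * (p 0 x)^2 <= r x * (2 * (rest p P 0 x)^2 + 2 * (inc P 0 x)^2)"
    unfolding p using two_mult_le_sum_squares[of "rest p P 0 x" "inc P 0 x"]
    by (intro mult_left_mono) (auto simp: power2_sum)
   ultimately show "(y 0 x)^2 + r x * (p 0 x)^2 <= 2 * ((rest y z 0 x)^2 + r x * (rest p P 0 x)^2)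
     + 2 * ((inc z 0 x)^2 + r x * (inc P 0 x)^2)"
    by (simp add: algebra_simps)
  qed
  then show ?thesis by simp
 qed
 \<comment> \<open>The weights 2 and 8 of the two observability estimates add up to the factor 10 in
   the conclusion.\<close>
 with EL have "energy a 0 <= 2 * H.energy a 0 + 8 * D.energy a 0 + 2 * \<xi>" by linarith
 then have "(2 - \<alpha>) / 2 * \<delta> * energy a 0 <= (2 - \<alpha>) / 2 * \<delta> * (2 * H.energy a 0 + 8 * D.energy a 0 + 2 * \<xi>)"
  using \<alpha> \<delta>(1) by (intro mult_left_mono) auto
 also have "... = 2 * ((2 - \<alpha>) / 2 * \<delta> * H.energy a 0) + 8 * ((2 - \<alpha>) / 2 * \<delta> * D.energy a 0) + (2 - \<alpha>) / 2 * \<delta> * (2 * \<xi>)"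
  by (simp add: algebra_simps)
 also have "... <= 2 * K + 8 * K + 1 * \<delta> * (2 * \<xi>)"
  using EH ED \<alpha> \<delta>(1) \<xi>0 by (intro add_mono mult_left_mono mult_right_mono) auto
 also have "... = 10 * (flux_const * obs_const / \<mu>^3) * N + (10 * (4 * T' + T'^2) + 2 * \<delta>) * \<xi>"
  unfolding K_def by (simp add: algebra_simps)
 finally show ?thesis unfolding N_def \<xi>_def c_def .
qed

end

section \<open>Square-integrable functions on the unit interval\<close>

lemma cauchy_schwarz_integral:
 fixes f g :: "'a => real"
 assumes [measurable]: "f \<in> borel_measurable M" "g \<in> borel_measurable M"
  and f2: "integrable M (%x. (f x)^2)" and g2: "integrable M (%x. (g x)^2)"
 shows "integrable M (%x. f x * g x)"
  "(\<integral>x. \<bar>f x * g x\<bar> \<partial>M) <= sqrt (\<integral>x. (f x)^2 \<partial>M) * sqrt (\<integral>x. (g x)^2 \<partial>M)"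
  "\<bar>\<integral>x. f x * g x \<partial>M\<bar> <= sqrt (\<integral>x. (f x)^2 \<partial>M) * sqrt (\<integral>x. (g x)^2 \<partial>M)"
proof -
 have bound: "norm (f x * g x) <= norm ((f x)^2 + (g x)^2)" for x
 proof -
  have "2 * (\<bar>f x\<bar> * \<bar>g x\<bar>) <= (f x)^2 + (g x)^2"
   using zero_le_power2[of "\<bar>f x\<bar> - \<bar>g x\<bar>"] by (simp add: power2_diff)
  moreover have "0 <= \<bar>f x\<bar> * \<bar>g x\<bar>" by simp
  ultimately have "\<bar>f x\<bar> * \<bar>g x\<bar> <= (f x)^2 + (g x)^2" by linarith
  then show ?thesis by (simp add: abs_mult)
 qed
 show fg: "integrable M (%x. f x * g x)"
  by (rule Bochner_Integration.integrable_bound[OF Bochner_Integration.integrable_add[OF f2 g2]]) (use bound in auto)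
 define A B C where "A = (\<integral>x. (f x)^2 \<partial>M)" and "B = (\<integral>x. (g x)^2 \<partial>M)" and "C = (\<integral>x. \<bar>f x * g x\<bar> \<partial>M)"
 have C0: "0 <= C" "0 <= A" "0 <= B" unfolding A_def B_def C_def by simp_all
 have quad: "0 <= t^2 * A - 2 * t * C + B" for t
 proof -
  have "0 <= (\<integral>x. (t * \<bar>f x\<bar> - \<bar>g x\<bar>)^2 \<partial>M)" by simp
  also have "(%x. (t * \<bar>f x\<bar> - \<bar>g x\<bar>)^2) = (%x. t^2 * (f x)^2 - 2 * t * \<bar>f x * g x\<bar> + (g x)^2)"
   by (rule ext) (simp add: power2_diff power_mult_distrib abs_mult algebra_simps)
  also have "(\<integral>x. t^2 * (f x)^2 - 2 * t * \<bar>f x * g x\<bar> + (g x)^2 \<partial>M) = t^2 * A - 2 * t * C + B"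
   unfolding A_def B_def C_def using f2 g2 fg by simp
  finally show ?thesis .
 qed
 have "C^2 <= A * B"
 proof (cases "A = 0")
  case True
  have "C = 0"
  proof (rule ccontr)
   assume "C ~= 0"
   then have "2 * ((B + 1) / C) * C = 2 * (B + 1)" by simp
   then show False using quad[of "(B + 1) / C"] True C0 by simp
  qed
  then show ?thesis using True by simp
 next
  case False
  then have "0 < A" using C0 by simp
  then have "0 <= A * ((C / A)^2 * A - 2 * (C / A) * C + B)" using quad[of "C / A"] by simp
  also have "... = A * B - C\<^sup>2" using \<open>0 < A\<close> by (simp add: field_simps power2_eq_square)
  finally show ?thesis by simp
 qed
 then have "C <= sqrt A * sqrt B" using C0 by (simp add: real_le_rsqrt real_sqrt_mult[symmetric])
 then show "(\<integral>x. \<bar>f x * g x\<bar> \<partial>M) <= sqrt (\<integral>x. (f x)^2 \<partial>M) * sqrt (\<integral>x. (g x)^2 \<partial>M)"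
  by (simp add: A_def B_def C_def)
 then show "\<bar>\<integral>x. f x * g x \<partial>M\<bar> <= sqrt (\<integral>x. (f x)^2 \<partial>M) * sqrt (\<integral>x. (g x)^2 \<partial>M)"
  using integral_abs_bound[of M "%x. f x * g x"] by linarith
qed

text \<open>Lebesgue measure on the unit interval, with all Borel sets of the line measurable.\<close>

definition unit_meas :: "real measure" where
 "unit_meas = density lborel (%x. ennreal (indicator {0<..<1} x))"

abbreviation "U \<equiv> unit_meas"

lemma sets_U [simp, measurable_cong]: "sets U = sets borel" by (simp add: unit_meas_def)

lemma space_U [simp]: "space U = UNIV" by (simp add: unit_meas_def)

lemma emeasure_U: "emeasure U UNIV = 1"
 unfolding unit_meas_def by (subst emeasure_density) (auto simp: ennreal_indicator)

interpretation U: finite_measure U by standard (simp add: emeasure_U)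

lemma measure_U [simp]: "measure U UNIV = 1" by (simp add: measure_def emeasure_U)

interpretation UL: pair_sigma_finite U lborel ..
interpretation LU: pair_sigma_finite lborel U ..
interpretation UU: pair_sigma_finite U U ..

lemma U_integral: "f \<in> Borel ==> (\<integral>x. f x \<partial>U) = (\<integral>x. indicator {0<..<1} x * (f x :: real) \<partial>lborel)"
 unfolding unit_meas_def by (subst integral_density) auto

lemma U_integrable: "f \<in> Borel ==>
  integrable U (f :: real => real) \<longleftrightarrow> integrable lborel (%x. indicator {0<..<1} x * f x)"
 unfolding unit_meas_def by (subst integrable_density) auto

lemma U_AE: "(AE x in U. P x) \<longleftrightarrow> (AE x in lborel. x \<in> {0<..<1} --> P x)"
 unfolding unit_meas_def by (subst AE_density) (auto simp: indicator_def)

lemma U_AE_in: "AE x in U. 0 < x & x < 1"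
 by (simp add: U_AE)

lemma U_AE_neq: "AE x in U. x ~= c"
 using AE_lborel_singleton[of c] by (auto simp: U_AE elim: eventually_mono)

lemma lebesgue_on_AE: "A \<in> sets borel ==> (AE x in lborel. x \<in> A --> P x) ==> AE x in lebesgue_on A. P x"
 by (subst AE_restrict_space_iff) (auto intro: AE_completion)

lemma lebesgue_on_integral_Borel:
 fixes f :: "'a::euclidean_space => real"
 assumes "A \<in> sets borel" and [measurable]: "f \<in> Borel"
 shows "(LINT x|lebesgue_on A. f x) = (LINT x|lborel. indicator A x * f x)"
  "integrable (lebesgue_on A) f \<longleftrightarrow> integrable lborel (%x. indicator A x * f x)"
proof -
 have [measurable]: "A \<in> sets borel" by fact
 show "(LINT x|lebesgue_on A. f x) = (LINT x|lborel. indicator A x * f x)"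
  by (subst integral_restrict_space) (auto simp: integral_completion)
 show "integrable (lebesgue_on A) f \<longleftrightarrow> integrable lborel (%x. indicator A x * f x)"
  by (subst integrable_restrict_space) (auto simp: integrable_completion)
qed

lemma lebesgue_on_Borel_representative:
 fixes f :: "'a::euclidean_space => real"
 assumes "f \<in> borel_measurable (lebesgue_on A)" "A \<in> sets borel"
 obtains g where "g \<in> Borel" "AE x in lborel. x \<in> A --> f x = g x"
proof -
 have "(%x. indicator A x *\<^sub>R f x) \<in> borel_measurable lebesgue"
  using assms by (subst (asm) borel_measurable_restrict_space_iff) auto
 then obtain g where g: "g \<in> borel_measurable lborel" "AE x in lborel. indicator A x *\<^sub>R f x = g x"
  using completion_ex_borel_measurable_real by blast
 show thesis
 proof (rule that)
  show "g \<in> Borel" using g(1) by simp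
  show "AE x in lborel. x \<in> A --> f x = g x" using g(2) by eventually_elim auto
 qed
qed

lemma AE_imp_negligible:
 fixes P :: "'a::euclidean_space => bool"
 assumes "AE x in lborel. P x"
 shows "negligible {x. \<not> P x}"
proof -
 obtain N where "{x \<in> space lborel. \<not> P x} <= N" "emeasure lborel N = 0" "N \<in> sets lborel"
  by (rule AE_E[OF assms])
 then have "N \<in> null_sets lborel" "{x. \<not> P x} <= N" by auto
 then show ?thesis
  by (meson negligible_iff_null_sets negligible_subset null_sets_completionI)
qed

text \<open>Borel measurability is asked on the whole line. Elements of \<open>L2\<close>, which are
  merely Lebesgue measurable on the interval, enter through
  \<open>L2_representative\<close>.\<close>

definition sq :: "(real => real) => bool" where
 "sq f \<longleftrightarrow> f \<in> Borel & integrable U (%x. (f x)^2)"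

definition norm2 :: "(real => real) => real" where
 "norm2 f = sqrt (\<integral>x. (f x)^2 \<partial>U)"

lemma norm2_nonneg [simp]: "0 <= norm2 f" by (simp add: norm2_def)

lemma norm2_square: "(norm2 f)^2 = (\<integral>x. (f x)^2 \<partial>U)" by (simp add: norm2_def)

lemma sq_measurable [measurable_dest]: "sq f ==> f \<in> Borel" by (simp add: sq_def)

lemma sq_integrable2: "sq f ==> integrable U (%x. (f x)^2)" by (simp add: sq_def)

lemma sq_cs:
 assumes "sq f" "sq g"
 shows "integrable U (%x. f x * g x)" "\<bar>\<integral>x. f x * g x \<partial>U\<bar> <= norm2 f * norm2 g"
  "(\<integral>x. \<bar>f x * g x\<bar> \<partial>U) <= norm2 f * norm2 g"
proof -
 have [measurable]: "f \<in> Borel" "g \<in> Borel" using assms by (auto simp: sq_def)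
 show "integrable U (%x. f x * g x)" "\<bar>\<integral>x. f x * g x \<partial>U\<bar> <= norm2 f * norm2 g"
  "(\<integral>x. \<bar>f x * g x\<bar> \<partial>U) <= norm2 f * norm2 g"
  unfolding norm2_def using assms by (auto intro!: cauchy_schwarz_integral simp: sq_def)
qed

lemma sq_bounded:
 assumes "f \<in> Borel" "!!x. 0 < x ==> x < 1 ==> \<bar>f x\<bar> <= B"
 shows "sq f"
 unfolding sq_def
proof
 show "integrable U (%x. (f x)^2)"
 proof (rule U.integrable_const_bound)
  show "AE x in U. norm ((f x)^2) <= B^2"
   using U_AE_in
  proof eventually_elim
   case (elim x)
   then have "\<bar>f x\<bar>\<^sup>2 <= B^2" using assms(2) by (intro power_mono) auto
   then show ?case by simp
  qed
 qed (use assms in auto)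
qed fact

lemma sq_dominated:
 assumes "sq g" "f \<in> Borel" "!!x. 0 < x ==> x < 1 ==> \<bar>f x\<bar> <= \<bar>g x\<bar>"
 shows "sq f" "norm2 f <= norm2 g"
proof -
 have le: "AE x in U. (f x)^2 <= (g x)^2"
  using U_AE_in by eventually_elim (use assms(3) in "auto simp: abs_le_square_iff")
 then have le': "AE x in U. norm ((f x)^2) <= norm ((g x)^2)" by eventually_elim simp
 have "integrable U (%x. (f x)^2)"
  by (rule Bochner_Integration.integrable_bound[OF sq_integrable2[OF assms(1)] _ le']) (use assms(2) in auto)
 then show "sq f" using assms by (simp add: sq_def)
 then show "norm2 f <= norm2 g" unfolding norm2_def
  using le assms(1) by (intro real_sqrt_le_mono integral_mono_AE) (auto simp: sq_def)
qed

lemma sq_mult_const: "sq f ==> sq (%x. c * f x)" "norm2 (%x. c * f x) = \<bar>c\<bar> * norm2 f"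
 by (auto simp: sq_def norm2_def power_mult_distrib real_sqrt_mult)

lemma sq_add:
 assumes "sq f" "sq g"
 shows "sq (%x. f x + g x)" "norm2 (%x. f x + g x) <= norm2 f + norm2 g"
proof -
 have i: "integrable U (%x. (f x)^2)" "integrable U (%x. (g x)^2)" "integrable U (%x. f x * g x)"
  using assms sq_cs by (auto simp: sq_def)
 have eq: "(%x. (f x + g x)^2) = (%x. (f x)^2 + 2 * (f x * g x) + (g x)^2)"
  by (rule ext) (simp add: power2_sum algebra_simps)
 show "sq (%x. f x + g x)" unfolding sq_def eq using i assms by (auto simp: sq_def)
 have "(\<integral>x. (f x + g x)^2 \<partial>U) = (norm2 f)^2 + 2 * (\<integral>x. f x * g x \<partial>U) + (norm2 g)^2"
  unfolding eq norm2_square using i by simp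
 also have "... <= (norm2 f + norm2 g)^2"
  using sq_cs(2)[OF assms] by (simp add: power2_sum abs_le_iff)
 finally show "norm2 (%x. f x + g x) <= norm2 f + norm2 g"
  unfolding norm2_def[of "%x. f x + g x"] by (intro real_le_lsqrt) auto
qed

lemma sq_diff: "sq f ==> sq g ==> sq (%x. f x - g x)"
 using sq_add(1)[of f "%x. (-1) * g x"] sq_mult_const(1)[of g "-1"] by simp

lemma sq_const: "sq (%x. c)" "norm2 (%x. c) = \<bar>c\<bar>"
 by (auto simp: sq_def norm2_def)

lemma sq_integrable: "sq f ==> integrable U f"
 using sq_cs(1)[OF _ sq_const(1)[of 1]] by simp

lemma L2_iff_sq:
 assumes "f \<in> Borel"
 shows "f \<in> L2 \<longleftrightarrow> sq f" "L2_norm f = norm2 f"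
proof -
 have [measurable]: "f \<in> Borel" by fact
 have "f \<in> borel_measurable (lebesgue_on {0<..<1})"
  using assms by (intro measurable_restrict_space1 measurable_completion) auto
 then show "f \<in> L2 \<longleftrightarrow> sq f" unfolding L2_def sq_def
  using assms by (simp add: lebesgue_on_integral_Borel U_integrable)
 show "L2_norm f = norm2 f" unfolding L2_norm_def norm2_def
  by (simp add: lebesgue_on_integral_Borel U_integral)
qed

lemma L2_representative:
 assumes "f \<in> L2"
 obtains g where "sq g" "AE x in U. f x = g x" "L2_norm f = norm2 g"
proof -
 have f: "f \<in> borel_measurable (lebesgue_on {0<..<1})" "integrable (lebesgue_on {0<..<1}) (%x. (f x)^2)"
  using assms by (auto simp: L2_def)
 obtain g where g[measurable]: "g \<in> Borel" and ae: "AE x in lborel. x \<in> {0<..<1} --> f x = g x"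
  using lebesgue_on_Borel_representative[OF f(1)] by auto
 have gm: "g \<in> borel_measurable (lebesgue_on {0<..<1})"
  by (intro measurable_restrict_space1 measurable_completion) auto
 have ae': "AE x in lebesgue_on {0<..<1}. f x = g x" by (rule lebesgue_on_AE[OF _ ae]) simp
 then have ae2: "AE x in lebesgue_on {0<..<1}. (f x)^2 = (g x)^2" by eventually_elim simp
 have "integrable (lebesgue_on {0<..<1}) (%x. (g x)^2)"
  using f(1,2) gm ae2 by (subst integrable_cong_AE[OF _ _ AE_symmetric[OF ae2]]) auto
 then have "g \<in> L2" using gm by (simp add: L2_def)
 then have "sq g" using L2_iff_sq(1)[OF g] by simp
 moreover have "L2_norm f = L2_norm g" unfolding L2_norm_def
  using f(1) gm ae2 by (intro arg_cong[where f=sqrt] integral_cong_AE) auto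
 ultimately show thesis using that ae L2_iff_sq(2)[OF g] by (simp add: U_AE)
qed

lemma L2_cong_AE:
 assumes "sq g" "AE x in U. f x = g x"
 shows "f \<in> L2" "L2_norm f = norm2 g"
proof -
 have g[measurable]: "g \<in> Borel" using assms by (simp add: sq_def)
 have gm: "g \<in> borel_measurable (lebesgue_on {0<..<1})"
  by (intro measurable_restrict_space1 measurable_completion) auto
 have ae: "AE x in lebesgue_on {0<..<1}. g x = f x"
  by (rule lebesgue_on_AE) (use assms(2) in "auto simp: U_AE elim: eventually_mono")
 have fm: "f \<in> borel_measurable (lebesgue_on {0<..<1})"
 proof -
  have "AE x in lebesgue. indicator {0<..<1} x *\<^sub>R g x = indicator {0<..<1} x *\<^sub>R f x"
   using assms(2) unfolding U_AE by (intro AE_completion) (auto elim!: eventually_mono simp: indicator_def)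
  moreover have "(%x. indicator {0<..<1} x *\<^sub>R g x) \<in> borel_measurable lebesgue"
   by (intro measurable_completion) simp
  ultimately have "(%x. indicator {0<..<1} x *\<^sub>R f x) \<in> borel_measurable lebesgue"
   by (rule borel_measurable_AE[rotated])
  then show ?thesis by (subst borel_measurable_restrict_space_iff) auto
 qed
 have ae2: "AE x in lebesgue_on {0<..<1}. (g x)^2 = (f x)^2" using ae by eventually_elim simp
 have "g \<in> L2" using L2_iff_sq(1)[OF g] assms by simp
 then have "integrable (lebesgue_on {0<..<1}) (%x. (g x)^2)" by (simp add: L2_def)
 then have "integrable (lebesgue_on {0<..<1}) (%x. (f x)^2)"
  using gm fm ae2 by (subst integrable_cong_AE[OF _ _ AE_symmetric[OF ae2]]) auto
 then show "f \<in> L2" using fm by (simp add: L2_def)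
 have "L2_norm f = L2_norm g" unfolding L2_norm_def
  using fm gm ae2 by (intro arg_cong[where f=sqrt] integral_cong_AE[OF _ _ AE_symmetric[OF ae2]]) auto
 then show "L2_norm f = norm2 g" using L2_iff_sq(2)[OF g] by simp
qed

text \<open>Half-open intervals make \<open>J\<close> exactly additive in its endpoints. As a
  Bochner integral it is 0 for a non-integrable integrand, hence the integrability facts that
  accompany its rules.\<close>

definition J :: "(real => real) => real => real => real" where
 "J f a b = (\<integral>x. indicator {a<..b} x * f x \<partial>U)"

lemma J_has_integral:
 assumes [measurable]: "f \<in> Borel" and i: "integrable U (%x. indicator {a<..b} x * f x)"
  and ab: "0 <= a" "b <= 1"
 shows "(f has_integral J f a b) {a..b}"
proof -
 let ?S = "{a<..b} \<inter> {0<..<1}"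
 have m: "(%x. indicator {a<..b} x * f x) \<in> Borel" by simp
 have "integrable lborel (%x. indicator {0<..<1} x * (indicator {a<..b} x * f x))"
  using i by (simp add: U_integrable)
 from has_integral_integral_real[OF this]
 have "((%x. indicator {0<..<1} x * (indicator {a<..b} x * f x)) has_integral J f a b) UNIV"
  unfolding J_def U_integral[OF m] .
 also have "(%x. indicator {0<..<1} x * (indicator {a<..b} x * f x)) = (%x. if x \<in> ?S then f x else 0)"
  by (auto simp: indicator_def)
 finally have "(f has_integral J f a b) ?S" by (simp only: has_integral_restrict_UNIV)
 then show ?thesis
 proof (rule has_integral_spike_set_eq[THEN iffD1, rotated 2])
  show "negligible {x \<in> ?S - {a..b}. f x ~= 0}" by (rule negligible_subset[of "{}"]) auto
  show "negligible {x \<in> {a..b} - ?S. f x ~= 0}"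
   by (rule negligible_subset[of "{0, 1, a, b}"]) (use ab in auto)
 qed
qed

lemma J_integrable:
 fixes f :: "real => real"
 assumes "integrable U f" shows "integrable U (%x. indicator {a<..b} x * f x)"
 by (rule Bochner_Integration.integrable_bound[OF assms]) (use borel_measurable_integrable[OF assms] in "auto simp: indicator_def")

lemma J_continuous:
 assumes [measurable]: "g \<in> Borel" and c: "continuous_on {0<..1} g" and ab: "0 < a" "a <= b" "b <= 1"
 shows "integrable U (%x. indicator {a<..b} x * g x)" "(g has_integral J g a b) {a..b}" "J g a b = integral {a..b} g"
proof -
 have "continuous_on {a..b} g" using c by (rule continuous_on_subset) (use ab in auto)
 then have "compact (g ` {a..b})" by (intro compact_continuous_image) auto
 then obtain B where B: "!!x. x \<in> {a..b} ==> \<bar>g x\<bar> <= B"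
  using compact_imp_bounded bounded_iff by (metis image_eqI real_norm_def)
 show i: "integrable U (%x. indicator {a<..b} x * g x)"
 proof (rule U.integrable_const_bound[where B="\<bar>B\<bar>"])
  show "AE x in U. norm (indicator {a<..b} x * g x) <= \<bar>B\<bar>"
  proof (rule AE_I2)
   fix x show "norm (indicator {a<..b} x * g x) <= \<bar>B\<bar>"
    using order_trans[OF B abs_ge_self] by (cases "x \<in> {a<..b}") auto
  qed
 qed simp
 show hi: "(g has_integral J g a b) {a..b}" by (rule J_has_integral[OF assms(1) i]) (use ab in auto)
 then show "J g a b = integral {a..b} g" by (simp add: integral_unique)
qed

lemma J_split:
 assumes "integrable U (%x. indicator {a<..c} x * f x)" "a <= b" "b <= c" "f \<in> Borel"
 shows "J f a c = J f a b + J f b c"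
proof -
 have 1: "integrable U (%x. indicator {a<..b} x * f x)" "integrable U (%x. indicator {b<..c} x * f x)"
  by (rule Bochner_Integration.integrable_bound[OF assms(1)]; use assms(2-) in "auto simp: indicator_def")+
 have "indicator {a<..c} x * f x = indicator {a<..b} x * f x + indicator {b<..c} x * f x" for x
  using assms(2,3) by (auto simp: indicator_def)
 then show ?thesis unfolding J_def using 1 by simp
qed

lemma has_derivative_primitive:
 fixes F g :: "real => real"
 assumes c: "continuous_on {0<..1} g"
  and F: "!!x x'. 0 < x ==> x <= x' ==> x' <= 1 ==> F x' - F x = integral {x..x'} g"
  and x: "x \<in> {0<..1}"
 shows "(F has_real_derivative g x) (at x within {0<..1})"
proof -
 define a where "a = x / 2"
 have a: "0 < a" "a < x" using x by (auto simp: a_def)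
 have "((%y. integral {a..y} g) has_real_derivative g x) (at x within {a..1})"
  by (rule integral_has_real_derivative) (use a x in "auto intro: continuous_on_subset[OF c]")
 then have "((%y. F a + integral {a..y} g) has_real_derivative g x) (at x within {a..1})"
  by (auto intro!: derivative_eq_intros)
 then have "(F has_real_derivative g x) (at x within {a..1})"
 proof (rule has_field_derivative_transform_within[OF _ zero_less_one])
  show "F a + integral {a..y} g = F y" if "y \<in> {a..1}" for y
   using F[of a y] that a(1) by simp
 qed (use a x in auto)
 moreover have "at x within {a..1} = at x within {0<..1}"
  by (rule at_within_nhd[of _ "{a<..}"]) (use a x in auto)
 ultimately show ?thesis by simp
qed

lemma J_bound:
 assumes "sq f" "0 <= a" "a <= b" "b <= 1"
 shows "\<bar>J f a b\<bar> <= sqrt (b - a) * norm2 f" "J (%x. \<bar>f x\<bar>) a b <= sqrt (b - a) * norm2 f"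
proof -
 have s: "sq (indicator {a<..b})" by (rule sq_bounded[where B=1]) (auto simp: indicator_def)
 have "(\<integral>x. (indicator {a<..b} x :: real)^2 \<partial>U) = (\<integral>x. indicator {0<..<1} x * indicator {a<..b} x \<partial>lborel)"
  by (subst U_integral) (auto simp: indicator_def intro!: Bochner_Integration.integral_cong)
 also have "... = (\<integral>x. indicator ({0<..<1} \<inter> {a<..b}) x \<partial>lborel)"
  by (intro Bochner_Integration.integral_cong) (auto simp: indicator_def)
 also have "... = measure lborel ({0<..<1} \<inter> {a<..b})" by simp
 also have "... <= measure lborel {a..b}"
  by (intro measure_mono_fmeasurable) (auto intro: fmeasurable_cbox[of a b, simplified])
 finally have "norm2 (indicator {a<..b}) <= sqrt (b - a)"
  unfolding norm2_def using assms by (intro real_sqrt_le_mono) simp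
 then have *: "norm2 (indicator {a<..b}) * norm2 f <= sqrt (b - a) * norm2 f" by (intro mult_right_mono) auto
 show "\<bar>J f a b\<bar> <= sqrt (b - a) * norm2 f"
  unfolding J_def using sq_cs(2)[OF s assms(1)] * by linarith
 have "J (%x. \<bar>f x\<bar>) a b = (\<integral>x. \<bar>indicator {a<..b} x * f x\<bar> \<partial>U)" unfolding J_def by (simp add: abs_mult)
 then show "J (%x. \<bar>f x\<bar>) a b <= sqrt (b - a) * norm2 f"
  using sq_cs(3)[OF s assms(1)] * by linarith
qed

lemma J_measurable [measurable]:
 assumes [measurable]: "f \<in> Borel"
 shows "(%x. J f a x) \<in> Borel" "(%x. J f x b) \<in> Borel"
proof -
 have m: "(%(x, s). indicator {a<..x} s * f s) \<in> borel_measurable (borel \<Otimes>\<^sub>M U)"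
  "(%(x, s). indicator {x<..b} s * f s) \<in> borel_measurable (borel \<Otimes>\<^sub>M U)"
  unfolding greaterThanAtMost_iff indicator_def of_bool_def by measurable
 from U.borel_measurable_lebesgue_integral[OF m(1)] U.borel_measurable_lebesgue_integral[OF m(2)]
 show "(%x. J f a x) \<in> Borel" "(%x. J f x b) \<in> Borel"
  unfolding J_def[abs_def] by simp_all
qed

lemma U_powr_integrable:
 assumes "-1 < \<gamma>" shows "integrable U (%x. x powr \<gamma>)"
proof -
 have "(%x::real. x powr \<gamma>) absolutely_integrable_on {0<..1}"
  using integrable_on_powr_from_0'[of \<gamma> 1] assms by (intro nonnegative_absolutely_integrable_1) auto
 then have "(%x::real. x powr \<gamma>) absolutely_integrable_on {0<..<1}"
  by (rule set_integrable_subset) auto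
 then have "integrable lebesgue (%x::real. indicator {0<..<1} x *\<^sub>R x powr \<gamma>)"
  by (simp add: set_integrable_def)
 then show ?thesis by (subst U_integrable) (auto simp: integrable_completion)
qed

lemma J_powr:
 assumes "\<gamma> ~= -1" "0 < a" "a <= b" "b <= 1"
 shows "J (%x. x powr \<gamma>) a b = (b powr (\<gamma> + 1) - a powr (\<gamma> + 1)) / (\<gamma> + 1)"
proof -
 have "J (%x. x powr \<gamma>) a b = integral {a..b} (%x. x powr \<gamma>)"
  by (rule J_continuous(3)) (use assms in "auto intro!: continuous_intros")
 also have "... = b powr (\<gamma> + 1) / (\<gamma> + 1) - a powr (\<gamma> + 1) / (\<gamma> + 1)"
 proof (rule integral_unique, rule fundamental_theorem_of_calculus[OF assms(3)])
  fix x assume "x \<in> {a..b}"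
  then have x: "0 < x" using assms by auto
  have "((%x. x powr (\<gamma> + 1) / (\<gamma> + 1)) has_real_derivative x powr \<gamma>) (at x)"
   using has_real_derivative_powr[OF x, of "\<gamma> + 1"] assms(1) DERIV_cdivide[of _ _ _ UNIV "\<gamma> + 1"] by fastforce
  then show "((%x. x powr (\<gamma> + 1) / (\<gamma> + 1)) has_vector_derivative x powr \<gamma>) (at x within {a..b})"
   by (simp add: has_real_derivative_iff_has_vector_derivative[symmetric] has_field_derivative_at_within)
 qed
 finally show ?thesis by (simp add: diff_divide_distrib)
qed

lemma J_open: "f \<in> Borel ==> J f a b = (\<integral>x. indicator {a<..<b} x * f x \<partial>U)"
 unfolding J_def using U_AE_neq[of b]
 by (intro integral_cong_AE) (auto elim!: eventually_mono simp: indicator_def)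

lemma J_UNIV: "f \<in> Borel ==> J f 0 1 = (\<integral>x. f x \<partial>U)"
proof -
 assume [measurable]: "f \<in> Borel"
 have "AE x in U. indicator {0<..1} x * f x = f x"
  using U_AE_in by eventually_elim (auto simp: indicator_def)
 then show ?thesis unfolding J_def by (intro integral_cong_AE) auto
qed

lemma measurable_U [simp]: "borel_measurable U = borel_measurable borel"
 by (rule measurable_cong_sets) simp_all

lemma U_indicator_integrable:
 fixes f :: "real => real"
 shows "integrable U f ==> A \<in> sets borel ==> integrable U (%x. indicator A x * f x)"
 using integrable_mult_indicator[of A U f] by simp

text \<open>Uniform integrability: the part of \<open>g\<close> exceeding a level \<open>m\<close>
  has integral below \<open>e / 2\<close>, and the part below that level contributes at most
  \<open>m\<close> times the total length. The interiors of the pieces are disjoint, so the large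
  parts add up to at most one integral.\<close>

lemma absolutely_cont_on_integral:
 assumes g: "integrable U g" and ab: "0 <= a" "b <= 1"
  and F: "!!x y. a <= x ==> x <= y ==> y <= b ==> F y - F x = J g x y"
 shows "absolutely_cont_on {a..b} F"
 unfolding absolutely_cont_on_def
proof (intro allI impI)
 fix e :: real assume e: "0 < e"
 have [measurable]: "g \<in> Borel" using borel_measurable_integrable[OF g] by simp
 have "(%n. \<integral>x. (if real n < \<bar>g x\<bar> then \<bar>g x\<bar> else 0) \<partial>U) \<longlonglongrightarrow> (\<integral>x. 0 \<partial>U)"
 proof (rule integral_dominated_convergence)
  show "integrable U (%x. \<bar>g x\<bar>)" using g by simp
  show "AE x in U. (%n. if real n < \<bar>g x\<bar> then \<bar>g x\<bar> else 0) \<longlonglongrightarrow> 0"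
  proof (rule AE_I2)
   fix x
   obtain N where "\<bar>g x\<bar> <= real N" using real_arch_simple by blast
   then show "(%n. if real n < \<bar>g x\<bar> then \<bar>g x\<bar> else 0) \<longlonglongrightarrow> 0"
    by (intro tendsto_eventually eventually_sequentiallyI[of N]) auto
  qed
 qed auto
 then have "eventually (%n. (\<integral>x. (if real n < \<bar>g x\<bar> then \<bar>g x\<bar> else 0) \<partial>U) < e / 2) sequentially"
  using e by (intro order_tendstoD(2)) auto
 then obtain m where m: "(\<integral>x. (if real m < \<bar>g x\<bar> then \<bar>g x\<bar> else 0) \<partial>U) < e / 2"
  by (auto simp: eventually_sequentially)
 define d where "d = e / (2 * (real m + 1))"
 show "\<exists>d>0. \<forall>\<D>. \<D> division_of \<Union>\<D> & \<Union>\<D> <= {a..b} & (\<Sum>k\<in>\<D>. measure lborel k) < d -->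
   (\<Sum>k\<in>\<D>. \<bar>F (Sup k) - F (Inf k)\<bar>) < e"
 proof (intro exI[of _ d] conjI allI impI)
  show "0 < d" using e by (simp add: d_def)
  fix \<D> :: "real set set"
  assume \<D>: "\<D> division_of \<Union>\<D> & \<Union>\<D> <= {a..b} & (\<Sum>k\<in>\<D>. measure lborel k) < d"
  then have div: "\<D> division_of \<Union>\<D>" and sub: "\<Union>\<D> <= {a..b}" and len: "(\<Sum>k\<in>\<D>. measure lborel k) < d" by auto
  have fin: "finite \<D>" using div by blast
  have iv: "\<exists>u v. k = {u..v} & u <= v & a <= u & v <= b" if k: "k \<in> \<D>" for k
  proof -
   obtain u v where uv: "k = cbox u v" using division_ofD(4)[OF div k] by blast
   moreover have "k ~= {}" by (rule division_ofD(3)[OF div k])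
   moreover have "k <= {a..b}" using k sub by auto
   ultimately show ?thesis by (intro exI[of _ u] exI[of _ v]) auto
  qed
  let ?gm = "%x. if real m < \<bar>g x\<bar> then \<bar>g x\<bar> else 0"
  have gm: "integrable U ?gm"
   by (rule Bochner_Integration.integrable_bound[OF g]) auto
  have ind: "integrable U (indicator (interior k) :: real => real)" for k
   by (intro U.integrable_const_bound[where B=1] borel_measurable_indicator) (auto simp: borel_open)
  have one: "\<bar>F (Sup k) - F (Inf k)\<bar> <= (\<integral>x. indicator (interior k) x * (real m + ?gm x) \<partial>U)" if k: "k \<in> \<D>" for k
  proof -
   obtain u v where uv: "k = {u..v}" "u <= v" "a <= u" "v <= b" using iv[OF k] by blast
   have int: "interior k = {u<..<v}" using uv by simp
   have "F (Sup k) - F (Inf k) = J g u v" using F[of u v] uv by simp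
   also have "... = (\<integral>x. indicator {u<..<v} x * g x \<partial>U)" by (rule J_open) simp
   finally have "\<bar>F (Sup k) - F (Inf k)\<bar> <= (\<integral>x. \<bar>indicator {u<..<v} x * g x\<bar> \<partial>U)"
    using integral_abs_bound[of U "%x. indicator {u<..<v} x * g x"] by simp
   also have "... <= (\<integral>x. indicator (interior k) x * (real m + ?gm x) \<partial>U)"
   proof (rule integral_mono)
    show "integrable U (%x. \<bar>indicator {u<..<v} x * g x\<bar>)"
     by (rule Bochner_Integration.integrable_bound[OF g]) (auto simp: indicator_def)
    show "integrable U (%x. indicator (interior k) x * (real m + ?gm x))"
     unfolding int
     by (rule Bochner_Integration.integrable_bound[of _ "%x. real m + ?gm x"]) (use gm in "auto simp: indicator_def")
    show "\<bar>indicator {u<..<v} x * g x\<bar> <= indicator (interior k) x * (real m + ?gm x)" for x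
     unfolding int by (auto simp: indicator_def)
   qed
   finally show ?thesis .
  qed
  have disj: "disjoint_family_on interior \<D>"
   using division_ofD(5)[OF div] by (auto simp: disjoint_family_on_def)
  have intm: "interior k \<in> sets borel" for k :: "real set" by simp
  have split: "(\<integral>x. indicator (interior k) x * (real m + ?gm x) \<partial>U)
    = real m * measure U (interior k) + (\<integral>x. indicator (interior k) x * ?gm x \<partial>U)" for k
  proof -
   have "integrable U (%x. indicator (interior k) x * ?gm x)"
    by (rule U_indicator_integrable[OF gm intm])
   then show ?thesis using ind[of k] intm[of k]
    by (simp add: distrib_left mult.commute[of _ "real m"])
  qed
  have "(\<Sum>k\<in>\<D>. \<bar>F (Sup k) - F (Inf k)\<bar>) <= (\<Sum>k\<in>\<D>. real m * measure U (interior k) + (\<integral>x. indicator (interior k) x * ?gm x \<partial>U))"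
   using one split by (intro sum_mono) simp
  also have "... = real m * (\<Sum>k\<in>\<D>. measure U (interior k)) + (\<Sum>k\<in>\<D>. \<integral>x. indicator (interior k) x * ?gm x \<partial>U)"
   by (simp add: sum.distrib sum_distrib_left)
  also have "(\<Sum>k\<in>\<D>. measure U (interior k)) <= (\<Sum>k\<in>\<D>. measure lborel k)"
  proof (rule sum_mono)
   fix k assume k: "k \<in> \<D>"
   obtain u v where uv: "k = {u..v}" "u <= v" using iv[OF k] by blast
   have "emeasure U (interior k) <= emeasure lborel {u<..<v}"
    unfolding unit_meas_def uv(1) by (subst emeasure_density)
     (auto simp: indicator_def intro!: nn_integral_mono order_trans[OF _ eq_refl[OF nn_integral_indicator]])
   then show "measure U (interior k) <= measure lborel k"
    using uv by (simp add: measure_def enn2real_leI)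
  qed
  also have "(\<Sum>k\<in>\<D>. \<integral>x. indicator (interior k) x * ?gm x \<partial>U) = (\<integral>x. (\<Sum>k\<in>\<D>. indicator (interior k) x * ?gm x) \<partial>U)"
   by (rule Bochner_Integration.integral_sum[symmetric]) (rule U_indicator_integrable[OF gm intm])
  also have "... <= (\<integral>x. ?gm x \<partial>U)"
  proof (rule integral_mono[OF _ gm])
   show "integrable U (%x. \<Sum>k\<in>\<D>. indicator (interior k) x * ?gm x)"
    by (rule Bochner_Integration.integrable_sum) (rule U_indicator_integrable[OF gm intm])
   fix x
   have "(\<Sum>k\<in>\<D>. indicator (interior k) x) = (indicator (\<Union>k\<in>\<D>. interior k) x :: real)"
    by (rule indicator_UN_disjoint[symmetric, OF fin disj])
   also have "... <= 1" by (simp add: indicator_def)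
   finally have "(\<Sum>k\<in>\<D>. indicator (interior k) x) * ?gm x <= 1 * ?gm x" by (intro mult_right_mono) auto
   then show "(\<Sum>k\<in>\<D>. indicator (interior k) x * ?gm x) <= ?gm x" by (simp add: sum_distrib_right)
  qed
  finally have "(\<Sum>k\<in>\<D>. \<bar>F (Sup k) - F (Inf k)\<bar>) <= real m * (\<Sum>k\<in>\<D>. measure lborel k) + (\<integral>x. ?gm x \<partial>U)"
   by (simp add: mult_left_mono)
  moreover have "real m * (\<Sum>k\<in>\<D>. measure lborel k) <= real m * d" using len by (intro mult_left_mono) auto
  moreover have "real m * d <= e / 2" using e by (simp add: d_def field_simps)
  ultimately show "(\<Sum>k\<in>\<D>. \<bar>F (Sup k) - F (Inf k)\<bar>) < e" using m by linarith
 qed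
qed

lemma holder_continuous_on:
 fixes F :: "real => real"
 assumes "!!x y. x \<in> S ==> y \<in> S ==> x <= y ==> \<bar>F y - F x\<bar> <= sqrt (y - x) * N"
 shows "continuous_on S F"
 unfolding continuous_on_def
proof
 fix x assume x: "x \<in> S"
 have le: "norm (F y - F x) <= sqrt \<bar>y - x\<bar> * \<bar>N\<bar>" if "y \<in> S" for y
 proof -
  have "\<bar>F y - F x\<bar> <= sqrt \<bar>y - x\<bar> * N"
   using assms[OF x that] assms[OF that x] by (cases "x <= y") (auto simp: abs_minus_commute)
  also have "... <= sqrt \<bar>y - x\<bar> * \<bar>N\<bar>" by (intro mult_left_mono) auto
  finally show ?thesis by simp
 qed
 have "((%y. sqrt \<bar>y - x\<bar> * \<bar>N\<bar>) \<longlongrightarrow> sqrt \<bar>x - x\<bar> * \<bar>N\<bar>) (at x within S)"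
  by (intro tendsto_intros)
 then have lim: "((%y. sqrt \<bar>y - x\<bar> * \<bar>N\<bar>) \<longlongrightarrow> 0) (at x within S)" by simp
 have "((%y. F y - F x) \<longlongrightarrow> 0) (at x within S)"
 proof (rule Lim_null_comparison[OF _ lim])
  show "\<forall>\<^sub>F y in at x within S. norm (F y - F x) <= sqrt \<bar>y - x\<bar> * \<bar>N\<bar>"
  proof -
   have "eventually (%y. y \<in> S) (at x within S)"
    unfolding eventually_at_filter by (rule always_eventually) blast
   then show ?thesis by eventually_elim (rule le)
  qed
 qed
 then show "(F \<longlongrightarrow> F x) (at x within S)" by (rule LIM_zero_cancel)
qed

lemma (in pair_sigma_finite) integrable_product_bound:
 fixes f :: "'a => real" and g :: "'b => real"
 assumes f: "integrable M1 f" and g: "integrable M2 g"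
  and k: "k \<in> borel_measurable (M1 \<Otimes>\<^sub>M M2)"
  and le: "AE z in M1 \<Otimes>\<^sub>M M2. \<bar>k z\<bar> <= \<bar>f (fst z) * g (snd z)\<bar>"
 shows "integrable (M1 \<Otimes>\<^sub>M M2) k"
proof (rule Bochner_Integration.integrable_bound[OF _ k])
 note [measurable] = borel_measurable_integrable[OF f] borel_measurable_integrable[OF g]
 show "integrable (M1 \<Otimes>\<^sub>M M2) (%(x, y). f x * g y)"
 proof (rule Fubini_integrable)
  show "(%(x, y). f x * g y) \<in> borel_measurable (M1 \<Otimes>\<^sub>M M2)" by measurable
  have "(%x. \<integral>y. norm (case (x, y) of (x, y) => f x * g y) \<partial>M2) = (%x. \<bar>f x\<bar> * (\<integral>y. \<bar>g y\<bar> \<partial>M2))"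
   by (simp add: abs_mult)
  then show "integrable M1 (%x. \<integral>y. norm (case (x, y) of (x, y) => f x * g y) \<partial>M2)" using f by simp
  show "AE x in M1. integrable M2 (%y. case (x, y) of (x, y) => f x * g y)" using g by simp
 qed
 show "AE x in M1 \<Otimes>\<^sub>M M2. norm (k x) <= norm (case x of (x, y) => f x * g y)"
  using le by (simp add: case_prod_unfold)
qed

section \<open>The stationary problem\<close>

locale degenerate =
 fixes \<alpha> :: real
 assumes \<alpha>: "0 < \<alpha>" "\<alpha> < 2"
begin

text \<open>For \<open>\<alpha> < 1\<close>, exchanging the order in the integral of
  \<open>s^(-\<alpha>) * (J f 0 s - C)\<close> over the unit interval shows that it vanishes exactly
  when \<open>C\<close> is the integral of \<open>(1 - r^(1-\<alpha>)) * f r\<close>. For larger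
  \<alpha> the natural condition is that the flux itself vanishes at 0, so nothing is
  subtracted.\<close>

definition cK :: "real => real" where
 "cK r = (if \<alpha> < 1 then 1 - r powr (1 - \<alpha>) else 0)"

text \<open>
  \<open>Sop f\<close> solves \<open>-(x\<^sup>\<alpha> u\<^sub>x)\<^sub>x = f\<close> with the boundary conditions of \<open>H1 \<alpha>\<close>; \<open>- Pop f\<close> is its flux. For
  \<open>\<alpha> < 1\<close> the constant subtracted in \<open>Pop\<close> is the one that makes \<open>Sop f 0 = 0\<close>.
\<close>

definition Pop :: "(real => real) => real => real" where
 "Pop f x = J f 0 x - (\<integral>r. cK r * f r \<partial>U)"

definition flux :: "(real => real) => real => real" where
 "flux f s = s powr - \<alpha> * Pop f s"

definition Sop :: "(real => real) => real => real" where
 "Sop f x = J (flux f) x 1"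

definition flux_bd :: "real => real" where
 "flux_bd x = (if \<alpha> < 1 then 2 else sqrt x)"

text \<open>For \<open>\<alpha> >= 1\<close> the integral of the flux bound is a power, a logarithm
  or bounded, depending on \<alpha>. The exponent chosen here is weaker and covers all cases at
  once; it still exceeds -1/2, so \<open>sol_bd\<close> is square integrable and
  \<open>sol_bd * flux_bd\<close> tends to 0 at 0.\<close>

definition sol_bd :: "real => real" where
 "sol_bd x = (if \<alpha> < 1 then 2 * x powr (1 - \<alpha>) / (1 - \<alpha>) else 4 * x powr (- 1/2 + (2 - \<alpha>) / 4))"

lemma cK_measurable [measurable]: "cK \<in> Borel"
 unfolding cK_def[abs_def] by measurable

lemma cK_bound: "0 < r ==> r < 1 ==> \<bar>cK r\<bar> <= 1"
 unfolding cK_def by (auto simp: powr_le1)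

lemma cK_sq: "sq cK" "norm2 cK <= 1"
proof -
 show "sq cK" by (rule sq_bounded[where B=1]) (auto intro: cK_bound)
 show "norm2 cK <= 1" using sq_dominated(2)[OF sq_const(1)[of 1], of cK] cK_bound sq_const(2)[of 1] by simp
qed

lemma Pop_measurable [measurable]: "f \<in> Borel ==> Pop f \<in> Borel"
 unfolding Pop_def[abs_def] by (intro borel_measurable_diff borel_measurable_const J_measurable)

lemma flux_measurable [measurable]: "f \<in> Borel ==> flux f \<in> Borel"
 unfolding flux_def[abs_def] by measurable

lemma Sop_measurable [measurable]: "f \<in> Borel ==> Sop f \<in> Borel"
 unfolding Sop_def[abs_def] by measurable

lemma Pop_diff:
 assumes "sq f" "0 <= x" "x <= x'"
 shows "Pop f x' - Pop f x = J f x x'"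
 using J_split[OF J_integrable[OF sq_integrable[OF assms(1)]] assms(2,3)] assms(1)
 unfolding Pop_def by (simp add: sq_def)

lemma Pop_bound:
 assumes f: "sq f" and x: "0 <= x" "x <= 1"
 shows "\<bar>Pop f x\<bar> <= flux_bd x * norm2 f"
proof (cases "\<alpha> < 1")
 case True
 have "\<bar>J f 0 x\<bar> <= sqrt (x - 0) * norm2 f" using J_bound(1)[OF f order.refl x] .
 also have "... <= 1 * norm2 f" using x by (intro mult_right_mono) auto
 finally have 1: "\<bar>J f 0 x\<bar> <= norm2 f" by simp
 have "\<bar>\<integral>r. cK r * f r \<partial>U\<bar> <= norm2 cK * norm2 f" by (rule sq_cs(2)[OF cK_sq(1) f])
 also have "... <= 1 * norm2 f" by (intro mult_right_mono cK_sq) auto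
 finally show ?thesis using 1 True unfolding Pop_def flux_bd_def by simp
next
 case False
 then show ?thesis using J_bound(1)[OF f, of 0 x] x unfolding Pop_def flux_bd_def cK_def by simp
qed

lemma Pop_continuous: "sq f ==> continuous_on {0..1} (Pop f)"
proof (rule holder_continuous_on[where N="norm2 f"])
 fix x y :: real assume f: "sq f" and "x \<in> {0..1}" "y \<in> {0..1}" "x <= y"
 then show "\<bar>Pop f y - Pop f x\<bar> <= sqrt (y - x) * norm2 f"
  unfolding Pop_diff[OF f, of x y] using J_bound(1)[OF f, of x y] Pop_diff[OF f, of x y] by simp
qed

lemma flux_continuous: "sq f ==> continuous_on {0<..1} (flux f)"
 unfolding flux_def[abs_def]
 by (intro continuous_intros continuous_on_subset[OF Pop_continuous]) auto

lemma Sop_diff: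
 assumes "sq f" "0 < x" "x <= x'" "x' <= 1"
 shows "Sop f x' - Sop f x = - J (flux f) x x'"
proof -
 have "J (flux f) x 1 = J (flux f) x x' + J (flux f) x' 1"
  using assms by (intro J_split J_continuous(1) flux_continuous) (auto simp: sq_def)
 then show ?thesis by (simp add: Sop_def)
qed

lemma Sop_deriv:
 assumes f: "sq f" and x: "x \<in> {0<..1}"
 shows "(Sop f has_real_derivative - flux f x) (at x within {0<..1})"
proof (rule has_derivative_primitive[OF _ _ x])
 show "continuous_on {0<..1} (%x. - flux f x)" by (intro continuous_intros flux_continuous f)
 fix x x' :: real assume "0 < x" "x <= x'" "x' <= 1"
 then show "Sop f x' - Sop f x = integral {x..x'} (%x. - flux f x)"
  using Sop_diff[OF f] J_continuous(3)[OF _ flux_continuous[OF f]] f by (simp add: sq_def)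
qed

lemma deriv_Sop:
 assumes "sq f" "0 < x" "x < 1"
 shows "deriv (Sop f) x = - flux f x"
proof -
 have "(Sop f has_real_derivative - flux f x) (at x within {0<..<1})"
  by (rule has_field_derivative_subset[OF Sop_deriv[OF assms(1)]]) (use assms in auto)
 then have "(Sop f has_real_derivative - flux f x) (at x)"
  using assms by (simp add: at_within_open[of x "{0<..<1}"])
 then show ?thesis by (rule DERIV_imp_deriv)
qed

lemma Sop_1: "Sop f 1 = 0"
 by (simp add: Sop_def J_def)

lemma powr_split: "0 < x ==> x powr (\<alpha> / 2) * x powr - \<alpha> = x powr (- \<alpha> / 2)"
 by (simp add: powr_add[symmetric])

text \<open>Up to sign this function is the weighted derivative of \<open>Sop f\<close>. The
  exponent \<gamma> exceeds -1 in both cases; for \<open>\<alpha> >= 1\<close> this is due to the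
  factor \<open>sqrt s\<close> in the flux bound.\<close>

lemma weighted_flux_sq:
 assumes f: "sq f"
 shows "sq (%s. s powr (- \<alpha> / 2) * Pop f s)"
 unfolding sq_def
proof
 show [measurable]: "(%s. s powr (- \<alpha> / 2) * Pop f s) \<in> Borel" using f by (auto simp: sq_def)
 define \<gamma> where "\<gamma> = (if \<alpha> < 1 then - \<alpha> else 1 - \<alpha>)"
 have "integrable U (%s. (2 * norm2 f)^2 * s powr \<gamma>)"
  using \<alpha> by (intro integrable_mult_right U_powr_integrable) (auto simp: \<gamma>_def)
 then show "integrable U (%s. (s powr (- \<alpha> / 2) * Pop f s)^2)"
 proof (rule Bochner_Integration.integrable_bound)
  show "AE s in U. norm ((s powr (- \<alpha> / 2) * Pop f s)^2) <= norm ((2 * norm2 f)^2 * s powr \<gamma>)"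
   using U_AE_in
  proof eventually_elim
   case (elim s)
   have p: "(s powr - (\<alpha> / 2))^2 = s powr - \<alpha>" using elim by (simp add: power2_eq_square powr_add[symmetric])
   have "\<bar>Pop f s\<bar>\<^sup>2 <= (flux_bd s * norm2 f)^2" using Pop_bound[OF f, of s] elim by (intro power_mono) auto
   then have "s powr - \<alpha> * (Pop f s)^2 <= s powr - \<alpha> * (flux_bd s * norm2 f)^2" by (intro mult_left_mono) auto
   also have "... <= (2 * norm2 f)^2 * s powr \<gamma>"
   proof (cases "\<alpha> < 1")
    case False
    have "s powr - \<alpha> * s = s powr (1 - \<alpha>)" using elim by (simp add: powr_diff powr_minus_divide)
    then have "s powr - \<alpha> * (flux_bd s * norm2 f)^2 = s powr (1 - \<alpha>) * (norm2 f)^2"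
     using False elim by (simp add: flux_bd_def power_mult_distrib mult_ac)
    also have "... <= s powr (1 - \<alpha>) * (2 * norm2 f)^2" by (intro mult_left_mono power_mono) auto
    finally show ?thesis using False by (simp add: \<gamma>_def mult.commute)
   qed (simp add: flux_bd_def \<gamma>_def mult.commute)
   finally show ?case by (simp add: power_mult_distrib p)
  qed
 qed measurable
qed

lemma deriv_Sop_weighted:
 assumes f: "sq f"
 shows "AE x in U. x powr (\<alpha> / 2) * deriv (Sop f) x = - (x powr (- \<alpha> / 2) * Pop f x)"
 using U_AE_in by eventually_elim (use deriv_Sop[OF f] powr_split in "simp add: flux_def")

lemma H1_seminorm_Sop: "sq f ==> H1_seminorm \<alpha> (Sop f) = norm2 (%s. s powr (- \<alpha> / 2) * Pop f s)"
proof -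
 assume f: "sq f"
 have s: "sq (%x. (-1) * (x powr (- \<alpha> / 2) * Pop f x))" by (intro sq_mult_const weighted_flux_sq f)
 have "L2_norm (%x. x powr (\<alpha> / 2) * deriv (Sop f) x) = norm2 (%x. (-1) * (x powr (- \<alpha> / 2) * Pop f x))"
  by (rule L2_cong_AE(2)[OF s]) (use deriv_Sop_weighted[OF f] in simp)
 then show ?thesis unfolding H1_seminorm_def by (simp only: sq_mult_const(2) abs_minus_cancel abs_one mult_1)
qed

lemma flux_integrable:
 assumes "\<alpha> < 1" and f: "sq f"
 shows "integrable U (flux f)"
proof (rule Bochner_Integration.integrable_bound)
 show "integrable U (%s. 2 * norm2 f * s powr - \<alpha>)"
  using assms by (intro integrable_mult_right U_powr_integrable) auto
 show "AE s in U. norm (flux f s) <= norm (2 * norm2 f * s powr - \<alpha>)" using U_AE_in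
 proof eventually_elim
  case (elim s)
  then have "\<bar>Pop f s\<bar> <= 2 * norm2 f" using Pop_bound[OF f, of s] assms(1) by (simp add: flux_bd_def)
  then have "s powr - \<alpha> * \<bar>Pop f s\<bar> <= s powr - \<alpha> * (2 * norm2 f)" by (intro mult_left_mono) auto
  moreover have "norm (flux f s) = s powr - \<alpha> * \<bar>Pop f s\<bar>" by (simp add: flux_def abs_mult)
  moreover have "norm (2 * norm2 f * s powr - \<alpha>) = s powr - \<alpha> * (2 * norm2 f)" by (simp add: abs_mult)
  ultimately show ?case by (simp add: mult.commute mult.left_commute)
 qed
qed (use f in "auto simp: sq_def")

text \<open>This is the boundary condition \<open>Sop f 0 = 0\<close>. Fubini on the triangle
  \<open>r <= s\<close> reproduces the kernel \<open>cK\<close> divided by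
  \<open>1 - \<alpha>\<close>, and the constant in \<open>Pop\<close> was chosen to cancel
  it.\<close>

lemma flux_mean_zero:
 assumes a1: "\<alpha> < 1" and f: "sq f"
 shows "J (flux f) 0 1 = 0"
proof -
 have [measurable]: "f \<in> Borel" using f by (simp add: sq_def)
 have p_int: "integrable U (%s. s powr - \<alpha>)" using a1 by (intro U_powr_integrable) auto
 define C where "C = (\<integral>r. cK r * f r \<partial>U)"
 have h1: "((%s. s powr - \<alpha>) has_integral J (%s. s powr - \<alpha>) 0 1) {0..1}"
  by (rule J_has_integral[OF _ J_integrable[OF p_int]]) auto
 have h2: "((%s. s powr - \<alpha>) has_integral (1 powr (- \<alpha> + 1) / (- \<alpha> + 1))) {0..1}"
  using a1 by (intro has_integral_powr_from_0) auto
 have p1: "J (%s. s powr - \<alpha>) 0 1 = 1 / (1 - \<alpha>)" using has_integral_unique[OF h1 h2] by simp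
 let ?k = "%s r. indicator {0<..s} r * (s powr - \<alpha> * f r)"
 have m: "(%(s, r). ?k s r) \<in> borel_measurable (borel \<Otimes>\<^sub>M borel)"
  unfolding indicator_def of_bool_def greaterThanAtMost_iff by measurable
 have int: "integrable (U \<Otimes>\<^sub>M U) (%(s, r). ?k s r)"
  by (rule UU.integrable_product_bound[OF p_int sq_integrable[OF f]]) (use m in "auto simp: indicator_def intro!: AE_I2")
 have "(\<integral>s. (\<integral>r. ?k s r \<partial>U) \<partial>U) = (\<integral>r. (\<integral>s. ?k s r \<partial>U) \<partial>U)"
  by (rule UU.Fubini_integral[OF int, symmetric])
 also have "... = (\<integral>r. cK r * f r / (1 - \<alpha>) \<partial>U)"
 proof (rule integral_cong_AE)
  show "(%r. \<integral>s. ?k s r \<partial>U) \<in> borel_measurable U"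
  proof -
   have "(%(r, s). ?k s r) \<in> borel_measurable (borel \<Otimes>\<^sub>M U)"
    unfolding indicator_def of_bool_def greaterThanAtMost_iff by measurable
   from U.borel_measurable_lebesgue_integral[OF this] show ?thesis by simp
  qed
  show "AE r in U. (\<integral>s. ?k s r \<partial>U) = cK r * f r / (1 - \<alpha>)"
   using U_AE_in
  proof eventually_elim
   case (elim r)
   have "(\<integral>s. ?k s r \<partial>U) = (\<integral>s. f r * (indicator {r..} s * s powr - \<alpha>) \<partial>U)"
    by (intro Bochner_Integration.integral_cong) (use elim in "auto simp: indicator_def")
   also have "... = f r * (\<integral>s. indicator {r..} s * s powr - \<alpha> \<partial>U)" by simp
   also have "(\<integral>s. indicator {r..} s * s powr - \<alpha> \<partial>U) = J (%s. s powr - \<alpha>) r 1"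
   proof -
    have "AE s in U. indicator {r..} s * s powr - \<alpha> = indicator {r<..1} s * s powr - \<alpha>"
     using U_AE_in U_AE_neq[of r] by eventually_elim (auto simp: indicator_def)
    then show ?thesis unfolding J_def by (intro integral_cong_AE) auto
   qed
   also have "... = (1 powr (- \<alpha> + 1) - r powr (- \<alpha> + 1)) / (- \<alpha> + 1)"
    using a1 elim \<alpha> by (intro J_powr) auto
   finally show ?case using a1 by (simp add: cK_def)
  qed
 qed measurable
 also have "... = C / (1 - \<alpha>)" by (simp add: C_def)
 finally have K: "(\<integral>s. (\<integral>r. ?k s r \<partial>U) \<partial>U) = C / (1 - \<alpha>)" .
 have k_eq: "(\<integral>r. ?k s r \<partial>U) = s powr - \<alpha> * J f 0 s" for s
 proof -
  have "(%r. ?k s r) = (%r. s powr - \<alpha> * (indicator {0<..s} r * f r))" by (simp add: mult_ac)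
  then show ?thesis unfolding J_def by simp
 qed
 have kint: "integrable U (%s. s powr - \<alpha> * J f 0 s)"
  using UU.integrable_fst[OF int] by (simp add: k_eq)
 have "J (flux f) 0 1 = (\<integral>s. flux f s \<partial>U)" by (rule J_UNIV) simp
 also have "... = (\<integral>s. s powr - \<alpha> * J f 0 s - C * s powr - \<alpha> \<partial>U)"
  by (simp add: flux_def Pop_def C_def algebra_simps)
 also have "... = (\<integral>s. s powr - \<alpha> * J f 0 s \<partial>U) - C * (\<integral>s. s powr - \<alpha> \<partial>U)"
  using kint p_int by simp
 also have "... = 0" using K p1 J_UNIV[of "%s. s powr - \<alpha>"] by (simp add: k_eq)
 finally show ?thesis .
qed

lemma Sop_bound:
 assumes f: "sq f" and x: "0 < x" "x <= 1"
 shows "\<bar>Sop f x\<bar> <= sol_bd x * norm2 f"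
proof (cases "\<alpha> < 1")
 case True
 have p_int: "integrable U (%s. s powr - \<alpha>)" using True by (intro U_powr_integrable) auto
 have [measurable]: "f \<in> Borel" using f by (simp add: sq_def)
 have "J (flux f) 0 1 = J (flux f) 0 x + J (flux f) x 1"
  using x by (intro J_split J_integrable flux_integrable True f) auto
 \<comment> \<open>By the vanishing mean the integral may be taken from 0 to \<open>x\<close>
   instead, which produces the decay at 0.\<close>
 then have "Sop f x = - J (flux f) 0 x" using flux_mean_zero[OF True f] by (simp add: Sop_def)
 then have "\<bar>Sop f x\<bar> <= (\<integral>s. \<bar>indicator {0<..x} s * flux f s\<bar> \<partial>U)"
  using integral_abs_bound[of U "%s. indicator {0<..x} s * flux f s"] by (simp add: J_def)
 also have "... <= (\<integral>s. 2 * norm2 f * (indicator {0<..x} s * s powr - \<alpha>) \<partial>U)"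
 proof (rule integral_mono)
  show "integrable U (%s. \<bar>indicator {0<..x} s * flux f s\<bar>)"
   using J_integrable[OF flux_integrable[OF True f]] by simp
  show "integrable U (%s. 2 * norm2 f * (indicator {0<..x} s * s powr - \<alpha>))"
   using J_integrable[OF p_int] by simp
  fix s
  show "\<bar>indicator {0<..x} s * flux f s\<bar> <= 2 * norm2 f * (indicator {0<..x} s * s powr - \<alpha>)"
  proof (cases "s \<in> {0<..x}")
   case s: True
   then have "\<bar>Pop f s\<bar> <= 2 * norm2 f" using Pop_bound[OF f, of s] True x by (simp add: flux_bd_def)
   then have "s powr - \<alpha> * \<bar>Pop f s\<bar> <= s powr - \<alpha> * (2 * norm2 f)" by (intro mult_left_mono) auto
   moreover have "\<bar>flux f s\<bar> = s powr - \<alpha> * \<bar>Pop f s\<bar>" by (simp add: flux_def abs_mult)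
   ultimately show ?thesis using s by (simp add: mult.commute)
  qed simp
 qed
 also have "... = 2 * norm2 f * J (%s. s powr - \<alpha>) 0 x" by (simp add: J_def)
 also have "J (%s. s powr - \<alpha>) 0 x = x powr (1 - \<alpha>) / (1 - \<alpha>)"
 proof -
  have h1: "((%s. s powr - \<alpha>) has_integral J (%s. s powr - \<alpha>) 0 x) {0..x}"
   by (rule J_has_integral[OF _ J_integrable[OF p_int]]) (use x in auto)
  have h2: "((%s. s powr - \<alpha>) has_integral (x powr (- \<alpha> + 1) / (- \<alpha> + 1))) {0..x}"
   using True x by (intro has_integral_powr_from_0) auto
  show ?thesis using has_integral_unique[OF h1 h2] by simp
 qed
 finally show ?thesis using True by (simp add: sol_bd_def mult_ac)
next
 case False
 \<comment> \<open>\<open>1/2 - \<alpha> >= \<gamma>\<close> since \<open>\<alpha> < 2\<close>, and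
   \<open>\<gamma> + 1 <= - 1/4\<close> since \<open>\<alpha> >= 1\<close>; the second inequality
   yields the factor 4.\<close>
 define \<gamma> where "\<gamma> = - 3/2 + (2 - \<alpha>) / 4"
 have [measurable]: "f \<in> Borel" using f by (simp add: sq_def)
 have "\<bar>Sop f x\<bar> <= (\<integral>s. \<bar>indicator {x<..1} s * flux f s\<bar> \<partial>U)"
  using integral_abs_bound[of U "%s. indicator {x<..1} s * flux f s"] by (simp add: J_def Sop_def)
 also have "... <= (\<integral>s. norm2 f * (indicator {x<..1} s * s powr \<gamma>) \<partial>U)"
 proof (rule integral_mono)
  show "integrable U (%s. \<bar>indicator {x<..1} s * flux f s\<bar>)"
   using J_continuous(1)[OF _ flux_continuous[OF f], of x 1] x by simp
  have "continuous_on {0<..1} (%s::real. s powr \<gamma>)" by (intro continuous_intros) auto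
  then show "integrable U (%s. norm2 f * (indicator {x<..1} s * s powr \<gamma>))"
   using J_continuous(1)[of "%s. s powr \<gamma>" x 1] x by simp
  fix s
  show "\<bar>indicator {x<..1} s * flux f s\<bar> <= norm2 f * (indicator {x<..1} s * s powr \<gamma>)"
  proof (cases "s \<in> {x<..1}")
   case s: True
   then have s0: "0 < s" "s <= 1" using x by auto
   have "\<bar>Pop f s\<bar> <= sqrt s * norm2 f" using Pop_bound[OF f, of s] False s0 by (simp add: flux_bd_def)
   then have "s powr - \<alpha> * \<bar>Pop f s\<bar> <= s powr - \<alpha> * (sqrt s * norm2 f)" by (intro mult_left_mono) auto
   also have "... = s powr (1/2 - \<alpha>) * norm2 f"
    using s0 by (simp add: powr_half_sqrt[symmetric] powr_diff powr_minus_divide)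
   also have "... <= s powr \<gamma> * norm2 f"
   proof (rule mult_right_mono)
    show "s powr (1/2 - \<alpha>) <= s powr \<gamma>" using s0 \<alpha> by (intro powr_mono') (auto simp: \<gamma>_def field_simps)
   qed simp
   finally have "s powr - \<alpha> * \<bar>Pop f s\<bar> <= s powr \<gamma> * norm2 f" .
   moreover have "\<bar>flux f s\<bar> = s powr - \<alpha> * \<bar>Pop f s\<bar>" by (simp add: flux_def abs_mult)
   ultimately show ?thesis using s by (simp add: mult.commute)
  qed simp
 qed
 also have "... = norm2 f * J (%s. s powr \<gamma>) x 1" by (simp add: J_def)
 also have "J (%s. s powr \<gamma>) x 1 = (1 powr (\<gamma> + 1) - x powr (\<gamma> + 1)) / (\<gamma> + 1)"
  using x False \<alpha> by (intro J_powr) (auto simp: \<gamma>_def field_simps)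
 also have "... <= 4 * x powr (- 1/2 + (2 - \<alpha>) / 4)"
 proof -
  have e: "\<gamma> + 1 = - (1/2 - (2 - \<alpha>) / 4)" by (simp add: \<gamma>_def)
  have d: "1/4 <= 1/2 - (2 - \<alpha>) / 4" using False by (simp add: field_simps)
  have "(1 powr (\<gamma> + 1) - x powr (\<gamma> + 1)) / (\<gamma> + 1) = (x powr (\<gamma> + 1) - 1) / (1/2 - (2 - \<alpha>) / 4)"
   unfolding e by (simp add: minus_divide_right[symmetric] diff_divide_distrib)
  also have "... <= x powr (\<gamma> + 1) / (1/2 - (2 - \<alpha>) / 4)" using d by (intro divide_right_mono) auto
  also have "... <= x powr (\<gamma> + 1) / (1/4)" using d by (intro divide_left_mono) auto
  finally show ?thesis by (simp add: \<gamma>_def mult.commute)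
 qed
 finally have "\<bar>Sop f x\<bar> <= norm2 f * (4 * x powr (- 1/2 + (2 - \<alpha>) / 4))"
  by (simp add: mult_left_mono)
 then show ?thesis using False by (simp add: sol_bd_def mult.commute)
qed

end

context degenerate
begin

lemma sq_sol_bd: "sq sol_bd"
proof (cases "\<alpha> < 1")
 case True
 show ?thesis
 proof (rule sq_bounded[where B="2 / (1 - \<alpha>)"])
  show "sol_bd \<in> Borel" unfolding sol_bd_def[abs_def] by measurable
  fix x :: real assume "0 < x" "x < 1"
  then have "x powr (1 - \<alpha>) <= 1" using True by (simp add: powr_le1)
  then show "\<bar>sol_bd x\<bar> <= 2 / (1 - \<alpha>)" using True by (simp add: sol_bd_def divide_right_mono)
 qed
next
 case False
 have eq: "(%x. (sol_bd x)^2) = (%x. 16 * x powr (- 1 + (2 - \<alpha>) / 2))"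
  using False by (auto simp: sol_bd_def power_mult_distrib power2_eq_square powr_add[symmetric])
 have "integrable U (%x. 16 * x powr (- 1 + (2 - \<alpha>) / 2))"
  using \<alpha> by (intro integrable_mult_right U_powr_integrable) auto
 moreover have "sol_bd \<in> Borel" unfolding sol_bd_def[abs_def] by measurable
 ultimately show ?thesis unfolding sq_def eq by simp
qed

lemma Sop_sq:
 assumes f: "sq f" shows "sq (Sop f)"
proof (rule sq_dominated(1)[OF sq_mult_const(1)[OF sq_sol_bd, of "norm2 f"]])
 show "Sop f \<in> Borel" using f by (intro Sop_measurable) (simp add: sq_def)
 fix x :: real assume "0 < x" "x < 1"
 then have "\<bar>Sop f x\<bar> <= sol_bd x * norm2 f" by (intro Sop_bound[OF f]) auto
 also have "... <= \<bar>norm2 f * sol_bd x\<bar>" by (simp add: mult.commute)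
 finally show "\<bar>Sop f x\<bar> <= \<bar>norm2 f * sol_bd x\<bar>" .
qed

lemma Sop_H1:
 assumes f: "sq f" shows "Sop f \<in> H1 \<alpha>"
proof -
 have [measurable]: "f \<in> Borel" using f by (simp add: sq_def)
 have L: "Sop f \<in> L2" using L2_iff_sq(1)[of "Sop f"] Sop_sq[OF f] by simp
 have W: "(%x. x powr (\<alpha>/2) * deriv (Sop f) x) \<in> L2"
  by (rule L2_cong_AE(1)[OF sq_mult_const(1)[OF weighted_flux_sq[OF f], of "-1"]])
    (use deriv_Sop_weighted[OF f] in simp)
 show ?thesis
 proof (cases "\<alpha> < 1")
  case True
  have i: "integrable U (flux f)" by (rule flux_integrable[OF True f])
  have "absolutely_cont_on {0..1} (Sop f)"
  proof (rule absolutely_cont_on_integral[of "%s. - flux f s"])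
   fix x y :: real assume xy: "0 <= x" "x <= y" "y <= 1"
   have "J (flux f) x 1 = J (flux f) x y + J (flux f) y 1"
    using xy by (intro J_split J_integrable i) auto
   then show "Sop f y - Sop f x = J (%s. - flux f s) x y" by (simp add: Sop_def J_def)
  qed (use i in auto)
  moreover have "Sop f 0 = 0" using flux_mean_zero[OF True f] by (simp add: Sop_def)
  ultimately show ?thesis unfolding H1_def using True L W Sop_1 by simp
 next
  case False
  have "absolutely_cont_on {\<delta>..1} (Sop f)" if \<delta>: "0 < \<delta> & \<delta> < 1" for \<delta>
  proof (rule absolutely_cont_on_integral[of "%s. - (indicator {\<delta><..1} s * flux f s)"])
   show "integrable U (%s. - (indicator {\<delta><..1} s * flux f s))"
    using J_continuous(1)[OF _ flux_continuous[OF f], of \<delta> 1] \<delta> by simp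
   fix x y assume xy: "\<delta> <= x" "x <= y" "y <= 1"
   have "(%s. indicator {x<..y} s * - (indicator {\<delta><..1} s * flux f s)) = (%s. - (indicator {x<..y} s * flux f s))"
    using xy by (auto simp: indicator_def)
   then show "Sop f y - Sop f x = J (%s. - (indicator {\<delta><..1} s * flux f s)) x y"
    using Sop_diff[OF f, of x y] xy \<delta> by (simp add: J_def)
  qed (use \<delta> in auto)
  then show ?thesis unfolding H1_def using False L W Sop_1 by simp
 qed
qed

text \<open>Working form of membership in \<open>H1\<close>: a Borel version of the derivative, and
  \<open>w\<close> as its integral. Integrability is asked only away from 0 in general; for
  \<open>\<alpha> < 1\<close> it holds up to 0, and the condition \<open>w 0 = 0\<close> turns into
  a vanishing mean.\<close>

definition h1_deriv :: "(real => real) => (real => real) => bool" where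
 "h1_deriv w g \<longleftrightarrow> g \<in> Borel & (AE x in U. deriv w x = g x) & sq (%x. x powr (\<alpha>/2) * g x) &
  (\<forall>x\<in>{0<..1}. integrable U (%s. indicator {x<..1} s * g s) & w x = - J g x 1) &
  (\<alpha> < 1 --> integrable U g & J g 0 1 = 0)"

text \<open>Here the fundamental theorem for absolutely continuous functions enters: the pointwise
  \<open>deriv\<close> recovers the function.\<close>

lemma h1_deriv_exists:
 assumes w: "w \<in> H1 \<alpha>"
 obtains g where "h1_deriv w g"
proof -
 have "(%x. x powr (\<alpha>/2) * deriv w x) \<in> L2" using w unfolding H1_def by (auto split: if_splits)
 then obtain h where h: "sq h" "AE x in U. x powr (\<alpha>/2) * deriv w x = h x" by (rule L2_representative)
 have [measurable]: "h \<in> Borel" using h by (simp add: sq_def)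
 define g where "g x = x powr (- (\<alpha>/2)) * h x" for x
 have g[measurable]: "g \<in> Borel" unfolding g_def by measurable
 have pp: "x powr (\<alpha>/2) * x powr (- (\<alpha>/2)) = 1" if "0 < x" for x :: real
  using that by (simp add: powr_add[symmetric])
 have ae: "AE x in U. deriv w x = g x"
  using h(2) U_AE_in
 proof eventually_elim
  case (elim x)
  have "g x = x powr (\<alpha>/2) * x powr (- (\<alpha>/2)) * deriv w x" unfolding g_def elim(1)[symmetric] by simp
  then show ?case using pp[of x] elim by simp
 qed
 have sqg: "sq (%x. x powr (\<alpha>/2) * g x)"
 proof (rule sq_dominated(1)[OF h(1)])
  fix x :: real assume "0 < x" "x < 1"
  then show "\<bar>x powr (\<alpha>/2) * g x\<bar> <= \<bar>h x\<bar>" using pp[of x] by (simp add: g_def mult.assoc[symmetric])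
 qed measurable
 have neg: "negligible {x. \<not> (x \<in> {0<..<1} --> deriv w x = g x)}"
  using ae unfolding U_AE by (rule AE_imp_negligible)
 have loc: "integrable U (%s. indicator {x<..1} s * g s)" if x: "x \<in> {0<..1}" for x
 proof (rule Bochner_Integration.integrable_bound)
  show "integrable U (%s. x powr (- (\<alpha>/2)) * h s)" using sq_integrable[OF h(1)] by simp
  show "AE s in U. norm (indicator {x<..1} s * g s) <= norm (x powr (- (\<alpha>/2)) * h s)"
  proof (rule AE_I2)
   fix s
   show "norm (indicator {x<..1} s * g s) <= norm (x powr (- (\<alpha>/2)) * h s)"
   proof (cases "s \<in> {x<..1}")
    case True
    then have "s powr (- (\<alpha>/2)) <= x powr (- (\<alpha>/2))" using x \<alpha> by (intro powr_mono2') auto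
    then have "s powr (- (\<alpha>/2)) * \<bar>h s\<bar> <= x powr (- (\<alpha>/2)) * \<bar>h s\<bar>" by (rule mult_right_mono) simp
    then show ?thesis using True by (simp add: g_def abs_mult)
   qed simp
  qed
 qed measurable
 have FTC: "w 1 - w x = J g x 1" if AC: "absolutely_cont_on {x..1} w" and x: "0 <= x" "x <= 1"
   and i: "integrable U (%s. indicator {x<..1} s * g s)" for x
 proof -
  have "(deriv w has_integral w 1 - w x) {x..1}" by (rule absolutely_cont_on_has_integral_deriv[OF AC x(2)])
  moreover have "(deriv w has_integral J g x 1) {x..1}"
  proof (rule has_integral_spike[OF _ _ J_has_integral[OF g i x(1) order.refl]])
   show "negligible ({x. \<not> (x \<in> {0<..<1} --> deriv w x = g x)} \<union> {0, 1})"
    using neg by (simp add: negligible_Un)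
  qed (use x in auto)
  ultimately show ?thesis by (rule has_integral_unique)
 qed
 have w1: "w 1 = 0" using w unfolding H1_def by (auto split: if_splits)
 have rep: "w x = - J g x 1" if x: "x \<in> {0<..1}" for x
 proof (cases "x = 1")
  case True
  then show ?thesis using w1 by (simp add: J_def)
 next
  case False
  have "absolutely_cont_on {x..1} w"
   using w x False unfolding H1_def by (auto split: if_splits intro: absolutely_cont_on_subset)
  from FTC[OF this _ _ loc[OF x]] show ?thesis using w1 x by simp
 qed
 have "integrable U g & J g 0 1 = 0" if a1: "\<alpha> < 1"
 proof -
  have "sq (%x. x powr (- (\<alpha>/2)))" unfolding sq_def
  proof
   have "integrable U (%x. x powr - \<alpha>)" using a1 by (intro U_powr_integrable) auto
   then show "integrable U (%x. (x powr (- (\<alpha>/2)))^2)"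
    by (simp add: power2_eq_square powr_add[symmetric])
  qed simp
  then have i: "integrable U g" using sq_cs(1)[OF _ h(1)] by (simp add: g_def[abs_def])
  have w': "absolutely_cont_on {0..1} w" "w 0 = 0" using w a1 unfolding H1_def by auto
  have "w 1 - w 0 = J g 0 1" by (rule FTC[OF w'(1) _ _ J_integrable[OF i]]) auto
  then show ?thesis using w' w1 i by simp
 qed
 then show thesis using that[of g] g ae sqg loc rep unfolding h1_deriv_def by blast
qed

lemma h1_deriv_seminorm:
 assumes "h1_deriv w g" shows "H1_seminorm \<alpha> w = norm2 (%x. x powr (\<alpha>/2) * g x)"
 unfolding H1_seminorm_def
 by (rule L2_cong_AE(2)) (use assms in "auto simp: h1_deriv_def elim: eventually_mono")

lemma h1_deriv_Sop:
 assumes f: "sq f" shows "h1_deriv (Sop f) (%x. - flux f x)"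
 unfolding h1_deriv_def
proof (intro conjI ballI impI)
 have [measurable]: "f \<in> Borel" using f by (simp add: sq_def)
 show "(%x. - flux f x) \<in> Borel" by measurable
 show "AE x in U. deriv (Sop f) x = - flux f x" using U_AE_in by eventually_elim (use deriv_Sop[OF f] in simp)
 show "sq (%x. x powr (\<alpha>/2) * - flux f x)"
 proof (rule sq_dominated(1)[OF weighted_flux_sq[OF f]])
  fix x :: real assume "0 < x" "x < 1"
  then show "\<bar>x powr (\<alpha>/2) * - flux f x\<bar> <= \<bar>x powr (- \<alpha> / 2) * Pop f x\<bar>"
   unfolding powr_split[OF \<open>0 < x\<close>, symmetric] by (simp add: flux_def mult.assoc)
 qed measurable
 show "integrable U (%s. indicator {x<..1} s * - flux f s)" if "x \<in> {0<..1}" for x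
  using J_continuous(1)[OF _ flux_continuous[OF f], of x 1] that by simp
 show "Sop f x = - J (%x. - flux f x) x 1" for x by (simp add: Sop_def J_def)
 show "integrable U (%x. - flux f x)" if "\<alpha> < 1" using flux_integrable[OF that f] by simp
 show "J (%x. - flux f x) 0 1 = 0" if "\<alpha> < 1" using flux_mean_zero[OF that f] by (simp add: J_def)
qed

text \<open>Integration by parts in the form of Fubini on the triangle \<open>x <= s\<close>, so
  that no boundary term at 0 arises. Absolute integrability follows from the bound
  \<open>sqrt s * norm2 f\<close> on the integral of the absolute value of \<open>f\<close> up to
  \<open>s\<close>, and from the factorisation of \<open>sqrt s * g s\<close> into
  \<open>s^((1-\<alpha>)/2)\<close> and \<open>s^(\<alpha>/2) * g s\<close>, both square
  integrable.\<close>

lemma weak_form: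
 assumes f: "sq f" and w: "h1_deriv w g"
 shows "integrable U (%s. Pop f s * g s)" "(\<integral>x. f x * - J g x 1 \<partial>U) = - (\<integral>s. Pop f s * g s \<partial>U)"
proof -
 have [measurable]: "f \<in> Borel" "g \<in> Borel"
  using f w by (auto simp: sq_def h1_deriv_def)
 have g2: "sq (%x. x powr (\<alpha>/2) * g x)" using w by (simp add: h1_deriv_def)
 have pp: "x powr (- \<alpha> / 2) * x powr (\<alpha>/2) = 1" if "0 < x" for x :: real
  using that by (simp add: powr_add[symmetric])
 have "integrable U (%s. (s powr (- \<alpha> / 2) * Pop f s) * (s powr (\<alpha>/2) * g s))"
  by (rule sq_cs(1)[OF weighted_flux_sq[OF f] g2])
 then show Pg: "integrable U (%s. Pop f s * g s)"
 proof (rule integrable_cong_AE_imp)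
  show "AE s in U. (s powr (- \<alpha> / 2) * Pop f s) * (s powr (\<alpha>/2) * g s) = Pop f s * g s"
   using U_AE_in
  proof eventually_elim
   case (elim s)
   have "(s powr (- \<alpha> / 2) * Pop f s) * (s powr (\<alpha>/2) * g s) = (s powr (- \<alpha> / 2) * s powr (\<alpha>/2)) * (Pop f s * g s)"
    by (simp add: mult_ac)
   then show ?case using pp[of s] elim by simp
  qed
 qed measurable
 have hs: "sq (%s. s powr ((1 - \<alpha>) / 2))" unfolding sq_def
 proof
  have "integrable U (%x. x powr (1 - \<alpha>))" using \<alpha> by (intro U_powr_integrable) auto
  then show "integrable U (%x. (x powr ((1 - \<alpha>) / 2))^2)"
   by (simp add: power2_eq_square powr_add[symmetric])
 qed simp
 have sg: "integrable U (%s. sqrt s * g s)"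
 proof (rule integrable_cong_AE_imp[OF sq_cs(1)[OF hs g2]])
  show "AE s in U. s powr ((1 - \<alpha>) / 2) * (s powr (\<alpha>/2) * g s) = sqrt s * g s"
   using U_AE_in
  proof eventually_elim
   case (elim s)
   have "s powr ((1 - \<alpha>) / 2) * s powr (\<alpha>/2) = s powr (1/2)"
    by (simp add: powr_add[symmetric] diff_divide_distrib)
   then show ?case using elim by (simp add: powr_half_sqrt mult.assoc[symmetric])
  qed
 qed measurable
 let ?k = "%s x. indicator {0<..s} x * (f x * g s)"
 have m: "(%(s, x). ?k s x) \<in> borel_measurable (U \<Otimes>\<^sub>M U)"
  unfolding indicator_def of_bool_def greaterThanAtMost_iff by measurable
 have norm_eq: "(%x. norm (?k s x)) = (%x. \<bar>g s\<bar> * (indicator {0<..s} x * \<bar>f x\<bar>))" for s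
  by (auto simp: abs_mult)
 have int: "integrable (U \<Otimes>\<^sub>M U) (%(s, x). ?k s x)"
 proof (rule UU.Fubini_integrable[OF m])
  have "integrable U (%s. \<bar>g s\<bar> * J (%x. \<bar>f x\<bar>) 0 s)"
  proof (rule Bochner_Integration.integrable_bound)
   show "integrable U (%s. norm2 f * \<bar>sqrt s * g s\<bar>)" using sg by simp
   show "AE s in U. norm (\<bar>g s\<bar> * J (%x. \<bar>f x\<bar>) 0 s) <= norm (norm2 f * \<bar>sqrt s * g s\<bar>)"
    using U_AE_in
   proof eventually_elim
    case (elim s)
    have "0 <= J (%x. \<bar>f x\<bar>) 0 s" unfolding J_def by (intro Bochner_Integration.integral_nonneg) simp
    moreover have "J (%x. \<bar>f x\<bar>) 0 s <= sqrt s * norm2 f" using J_bound(2)[OF f, of 0 s] elim by simp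
    ultimately have "\<bar>g s\<bar> * J (%x. \<bar>f x\<bar>) 0 s <= \<bar>g s\<bar> * (sqrt s * norm2 f)"
     "0 <= \<bar>g s\<bar> * J (%x. \<bar>f x\<bar>) 0 s" by (auto intro!: mult_left_mono)
    then show ?case using elim by (simp add: abs_mult mult_ac)
   qed
  qed measurable
  then show "integrable U (%s. \<integral>x. norm (case (s, x) of (s, x) => ?k s x) \<partial>U)"
   unfolding prod.case norm_eq by (simp add: J_def)
  have "integrable U (%x. ?k s x)" for s
   using U_indicator_integrable[OF integrable_mult_left[OF sq_integrable[OF f], of "g s"], of "{0<..s}"] by simp
  then show "AE s in U. integrable U (%x. case (s, x) of (s, x) => ?k s x)" by simp
 qed
 have kx: "(\<integral>x. ?k s x \<partial>U) = J f 0 s * g s" for s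
 proof -
  have "(%x. ?k s x) = (%x. g s * (indicator {0<..s} x * f x))" by (auto simp: mult_ac)
  then show ?thesis by (simp add: J_def)
 qed
 have ks: "AE x in U. (\<integral>s. ?k s x \<partial>U) = f x * J g x 1"
  using U_AE_in
 proof eventually_elim
  case (elim x)
  have "AE s in U. ?k s x = f x * (indicator {x<..1} s * g s)"
   using U_AE_in U_AE_neq[of x] by eventually_elim (use elim in "auto simp: indicator_def")
  then have "(\<integral>s. ?k s x \<partial>U) = (\<integral>s. f x * (indicator {x<..1} s * g s) \<partial>U)"
  proof (rule integral_cong_AE[rotated 2])
   show "(%s. ?k s x) \<in> borel_measurable U"
    unfolding indicator_def of_bool_def greaterThanAtMost_iff by simp
  qed simp
  then show ?case by (simp add: J_def)
 qed
 have "(\<integral>x. f x * J g x 1 \<partial>U) = (\<integral>x. (\<integral>s. ?k s x \<partial>U) \<partial>U)"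
 proof (rule integral_cong_AE)
  have "(%(x, s). ?k s x) \<in> borel_measurable (borel \<Otimes>\<^sub>M U)"
   unfolding indicator_def of_bool_def greaterThanAtMost_iff by measurable
  from U.borel_measurable_lebesgue_integral[OF this] show "(%x. \<integral>s. ?k s x \<partial>U) \<in> borel_measurable U" by simp
  show "AE x in U. f x * J g x 1 = (\<integral>s. ?k s x \<partial>U)" using ks by eventually_elim simp
 qed simp
 also have "... = (\<integral>s. (\<integral>x. ?k s x \<partial>U) \<partial>U)" by (rule UU.Fubini_integral[OF int])
 also have "... = (\<integral>s. J f 0 s * g s \<partial>U)" by (simp add: kx)
 also have "... = (\<integral>s. Pop f s * g s \<partial>U)"
 proof (cases "\<alpha> < 1")
  case True
  define C where "C = (\<integral>r. cK r * f r \<partial>U)"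
  have g: "integrable U g" "J g 0 1 = 0" using w True by (auto simp: h1_deriv_def)
  have "(%s. J f 0 s * g s) = (%s. Pop f s * g s + C * g s)"
   by (auto simp: Pop_def C_def algebra_simps)
  \<comment> \<open>\<open>g\<close> has mean zero, so the constant subtracted in \<open>Pop\<close>
    does not contribute.\<close>
  then have "(\<integral>s. J f 0 s * g s \<partial>U) = (\<integral>s. Pop f s * g s \<partial>U) + C * (\<integral>s. g s \<partial>U)"
   using Pg g(1) by simp
  then show ?thesis using g(2) J_UNIV[of g] by simp
 qed (simp add: Pop_def cK_def)
 finally show "(\<integral>x. f x * - J g x 1 \<partial>U) = - (\<integral>s. Pop f s * g s \<partial>U)" by simp
qed

text \<open>These are the kinds of terms at \<open>a\<close> that the multiplier identities leave
  behind. The smallest exponent is \<open>1 - \<alpha>\<close> in the first case and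
  \<open>(2 - \<alpha>)/4\<close> in the second.\<close>

lemma boundary_bounds_tendsto:
 "((%a. sol_bd a * flux_bd a + a * (sol_bd a)^2 + a * a powr - \<alpha> * (flux_bd a)^2) \<longlongrightarrow> 0) (at_right 0)"
proof -
 have p: "((%a::real. a powr c) \<longlongrightarrow> 0) (at_right 0)" if "0 < c" for c
 proof (rule tendsto_zero_powrI[OF tendsto_ident_at tendsto_const _ that])
  show "eventually ((<=) 0) (at_right (0::real))"
   using eventually_at_right_less[of "0::real"] by eventually_elim simp
 qed
 have pos: "eventually (%a::real. 0 < a) (at_right 0)" by (rule eventually_at_right_less)
 show ?thesis
 proof (cases "\<alpha> < 1")
  case True
  define c where "c = 2 / (1 - \<alpha>)"
  have "((%a. 2 * c * a powr (1 - \<alpha>) + c^2 * a powr (3 - 2 * \<alpha>) + 4 * a powr (1 - \<alpha>)) \<longlongrightarrow> 2 * c * 0 + c^2 * 0 + 4 * 0) (at_right 0)"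
   using True by (intro tendsto_intros p) auto
  moreover have "eventually (%a. 2 * c * a powr (1 - \<alpha>) + c^2 * a powr (3 - 2 * \<alpha>) + 4 * a powr (1 - \<alpha>)
   = sol_bd a * flux_bd a + a * (sol_bd a)^2 + a * a powr - \<alpha> * (flux_bd a)^2) (at_right 0)"
   using pos
  proof eventually_elim
   case (elim a)
   have s: "sol_bd a = c * a powr (1 - \<alpha>)" using True by (simp add: sol_bd_def c_def)
   have e1: "a * a powr - \<alpha> = a powr (1 - \<alpha>)" using elim by (simp add: powr_diff powr_minus_divide)
   have "a powr (3 - 2 * \<alpha>) = a powr (1 + ((1 - \<alpha>) + (1 - \<alpha>)))" by (simp add: algebra_simps)
   also have "... = a * (a powr (1 - \<alpha>))^2" using elim by (simp only: powr_add powr_one power2_eq_square less_imp_le)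
   finally have e2: "a powr (3 - 2 * \<alpha>) = a * (a powr (1 - \<alpha>))^2" .
   show ?case unfolding s e1 e2 using True by (simp add: flux_bd_def power_mult_distrib)
  qed
  ultimately show ?thesis by (simp add: Lim_transform_eventually)
 next
  case False
  define b where "b = - 1/2 + (2 - \<alpha>) / 4"
  have "((%a. 4 * a powr (b + 1/2) + 16 * a powr (2 * b + 1) + a powr (2 - \<alpha>)) \<longlongrightarrow> 4 * 0 + 16 * 0 + 0) (at_right 0)"
   using \<alpha> by (intro tendsto_intros p) (auto simp: b_def)
  moreover have "eventually (%a. 4 * a powr (b + 1/2) + 16 * a powr (2 * b + 1) + a powr (2 - \<alpha>)
   = sol_bd a * flux_bd a + a * (sol_bd a)^2 + a * a powr - \<alpha> * (flux_bd a)^2) (at_right 0)"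
   using pos
  proof eventually_elim
   case (elim a)
   have s: "sol_bd a = 4 * a powr b" "flux_bd a = sqrt a" using False by (auto simp: sol_bd_def flux_bd_def b_def)
   have e1: "a powr (b + 1/2) = a powr b * sqrt a" using elim by (simp only: powr_add powr_half_sqrt less_imp_le)
   have "a powr (2 * b + 1) = a powr (1 + (b + b))" by (simp add: add.commute)
   also have "... = a * (a powr b)^2" using elim by (simp only: powr_add powr_one power2_eq_square less_imp_le)
   finally have e2: "a powr (2 * b + 1) = a * (a powr b)^2" .
   have "a powr (2 - \<alpha>) = a powr ((1 + 1) + - \<alpha>)" by simp
   also have "... = a * a * a powr - \<alpha>" using elim by (simp only: powr_add powr_one less_imp_le)
   finally have e3: "a powr (2 - \<alpha>) = a * a * a powr - \<alpha>" .
   show ?case unfolding s e1 e2 e3 using elim by (simp add: power_mult_distrib)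
  qed
  ultimately show ?thesis by (simp add: Lim_transform_eventually)
 qed
qed

end

section \<open>Density of the range of the solution operator, and duality\<close>

lemma norm2_tendsto_zero:
 assumes [measurable]: "!!n. F n \<in> Borel" and g: "integrable U g"
  and le: "!!n x. 0 < x ==> x < 1 ==> (F n x)\<^sup>2 <= g x" and lim: "AE x in U. (%n. F n x) \<longlonglongrightarrow> 0"
  and e: "0 < e"
 obtains n :: nat where "sq (F n)" "norm2 (F n) < e"
proof -
 have ae: "AE x in U. norm ((F n x)^2) <= g x" for n
  using U_AE_in by eventually_elim (use le in auto)
 have "(%n. \<integral>x. (F n x)^2 \<partial>U) \<longlonglongrightarrow> (\<integral>x. 0 \<partial>U)"
 proof (rule integral_dominated_convergence[OF _ _ g])
  show "AE x in U. (%n. (F n x)^2) \<longlonglongrightarrow> 0"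
   using lim by eventually_elim (auto intro: tendsto_eq_intros)
 qed (use ae in auto)
 then have "eventually (%n. (\<integral>x. (F n x)^2 \<partial>U) < e^2) sequentially"
  using e by (intro order_tendstoD(2)) auto
 then obtain n where n: "(\<integral>x. (F n x)^2 \<partial>U) < e^2" by (auto simp: eventually_sequentially)
 have "integrable U (%x. (F n x)^2)"
  by (rule Bochner_Integration.integrable_bound[OF g]) (use ae[of n] in "auto elim: eventually_mono")
 then have "sq (F n)" by (simp add: sq_def)
 moreover have "norm2 (F n) < e" unfolding norm2_def using n e by (simp add: real_less_lsqrt)
 ultimately show thesis by (rule that)
qed

text \<open>After a truncation \<open>r\<close> is \<phi> times a bounded function, which is
  replaced first by a continuous function and then by a polynomial. Multiplying back by \<phi>, at
  most 1, does not enlarge the errors; each of the three replacements costs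
  \<open>e / 3\<close>.\<close>

lemma weighted_poly_dense:
 assumes \<phi>[measurable]: "\<phi> \<in> Borel" and \<phi>01: "!!x. 0 < x ==> x < 1 ==> 0 < \<phi> x & \<phi> x <= 1"
  and r: "sq r" and e: "0 < e"
 obtains p :: "real poly" where "sq (%x. r x - \<phi> x * poly p x)" "norm2 (%x. r x - \<phi> x * poly p x) < e"
proof -
 have rm[measurable]: "r \<in> Borel" using r by (simp add: sq_def)
 have e3: "0 < e / 3" using e by simp
 define R where "R n x = (if 1 / real (Suc n) < \<phi> x & \<bar>r x\<bar> <= real n then r x else 0)" for n x
 have Rm[measurable]: "R n \<in> Borel" for n unfolding R_def by measurable
 have "AE x in U. (%n. r x - R n x) \<longlonglongrightarrow> 0" using U_AE_in
 proof eventually_elim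
  case (elim x)
  obtain N1 where N1: "inverse (real (Suc N1)) < \<phi> x" using reals_Archimedean \<phi>01[of x] elim by blast
  obtain N2 where N2: "\<bar>r x\<bar> <= real N2" using real_arch_simple by blast
  have "r x - R n x = 0" if "max N1 N2 <= n" for n
  proof -
   have "1 / real (Suc n) <= inverse (real (Suc N1))" using that by (simp add: field_simps)
   then show ?thesis using N1 N2 that unfolding R_def by auto
  qed
  then show ?case by (intro tendsto_eventually eventually_sequentiallyI[of "max N1 N2"]) auto
 qed
 moreover have "(r x - R n x)^2 <= (r x)^2" for n x by (simp add: R_def)
 ultimately obtain n where n: "sq (%x. r x - R n x)" "norm2 (%x. r x - R n x) < e / 3"
  using norm2_tendsto_zero[of "%n x. r x - R n x" "%x. (r x)^2" "e/3"] sq_integrable2[OF r] e3 by auto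
 define B where "B = real n * real (Suc n)"
 define \<rho> where "\<rho> x = (if 1 / real (Suc n) < \<phi> x then R n x / \<phi> x else 0)" for x
 have [measurable]: "\<rho> \<in> Borel" unfolding \<rho>_def by measurable
 have \<rho>_bd: "\<bar>\<rho> x\<bar> <= B" for x
 proof (cases "1 / real (Suc n) < \<phi> x")
  case True
  have "0 < 1 / real (Suc n)" by simp
  then have pos: "0 < \<phi> x" using True by linarith
  have "1 / \<phi> x <= real (Suc n)" using True pos by (simp add: field_simps)
  then have "\<bar>R n x\<bar> * (1 / \<phi> x) <= real n * real (Suc n)" using pos by (intro mult_mono) (auto simp: R_def)
  then show ?thesis using True pos by (simp add: \<rho>_def B_def abs_divide)
 next
  case False
  then show ?thesis by (simp add: \<rho>_def B_def)
 qed
 have B0: "0 <= B" by (simp add: B_def)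
 have R_eq: "R n x = \<phi> x * \<rho> x" if "0 < x" "x < 1" for x
  using \<phi>01[OF that] by (auto simp: \<rho>_def R_def)
 have "\<rho> \<in> borel_measurable lebesgue" by (intro measurable_completion) simp
 then have "\<rho> measurable_on UNIV" by (rule lebesgue_measurable_imp_measurable_on) auto
 then obtain N g where N: "negligible N" and g: "!!k. continuous_on UNIV (g k)"
  and lim: "!!x. x \<notin> N ==> (%k::nat. g k x) \<longlonglongrightarrow> \<rho> x"
  unfolding measurable_on_def by auto
 \<comment> \<open>Clipping at the bound of \<rho> leaves the limit unchanged and supplies the
   dominating function.\<close>
 define G where "G k x = max (- B) (min B (g k x))" for k x
 have Gc: "continuous_on UNIV (G k)" for k unfolding G_def by (intro continuous_intros g)
 have Gm[measurable]: "G k \<in> Borel" for k using Gc by (rule borel_measurable_continuous_onI)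
 have "AE x in lebesgue. x \<notin> N" using N by (simp add: negligible_iff_null_sets AE_not_in)
 then have "AE x in lborel. x \<notin> N" by (simp add: AE_completion_iff)
 then have "AE x in U. (%k. \<rho> x - G k x) \<longlonglongrightarrow> 0"
  unfolding U_AE
 proof eventually_elim
  case (elim x)
  have "(%k. \<rho> x - G k x) \<longlonglongrightarrow> \<rho> x - max (- B) (min B (\<rho> x))"
   unfolding G_def by (intro tendsto_intros lim elim)
  then show ?case using \<rho>_bd[of x] by (simp add: abs_le_iff max_def min_def split: if_splits)
 qed
 moreover have "(\<rho> x - G k x)^2 <= (2 * B)^2" for k x
 proof -
  have "\<bar>\<rho> x - G k x\<bar> <= 2 * B" using \<rho>_bd[of x] B0 unfolding G_def by (auto simp: max_def min_def abs_if split: if_splits)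
  then have "\<bar>\<rho> x - G k x\<bar>\<^sup>2 <= (2 * B)^2" by (intro power_mono) auto
  then show ?thesis by simp
 qed
 ultimately obtain k where k: "sq (%x. \<rho> x - G k x)" "norm2 (%x. \<rho> x - G k x) < e / 3"
  using norm2_tendsto_zero[of "%k x. \<rho> x - G k x" "%x. (2 * B)^2" "e/3"] e3 by auto
 have "continuous_on {0..1} (G k)" by (rule continuous_on_subset[OF Gc]) auto
 from Stone_Weierstrass_real_polynomial_function[OF _ this e3]
 obtain P where P: "real_polynomial_function P" "!!x. x \<in> {0..1} ==> \<bar>G k x - P x\<bar> < e / 3" by auto
 obtain a m where am: "P = (%x. \<Sum>i\<le>m. a i * x ^ i)" using P(1) unfolding real_polynomial_function_iff_sum by blast
 define p where "p = (\<Sum>i\<le>m. monom (a i) i)"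
 have Pp: "P x = poly p x" for x by (simp add: am p_def poly_sum poly_monom)
 have [measurable]: "poly p \<in> Borel"
  by (intro borel_measurable_continuous_onI continuous_intros)
 have s2: "sq (%x. \<phi> x * (\<rho> x - G k x))" "norm2 (%x. \<phi> x * (\<rho> x - G k x)) <= norm2 (%x. \<rho> x - G k x)"
  using \<phi>01 by (auto intro!: sq_dominated[OF k(1)] simp: abs_mult mult_left_le_one_le less_imp_le abs_of_pos)
 have le3: "\<bar>\<phi> x * (G k x - poly p x)\<bar> <= e / 3" if "0 < x" "x < 1" for x
 proof -
  have "\<bar>\<phi> x\<bar> * \<bar>G k x - poly p x\<bar> <= 1 * (e / 3)"
   using \<phi>01[OF that] P(2)[of x] that e by (intro mult_mono) (auto simp: Pp)
  then show ?thesis by (simp add: abs_mult)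
 qed
 have s3: "sq (%x. \<phi> x * (G k x - poly p x))" by (rule sq_bounded[where B="e/3"]) (use le3 in auto)
 have n3: "norm2 (%x. \<phi> x * (G k x - poly p x)) <= e / 3"
  using sq_dominated(2)[OF sq_const(1)[of "e/3"], of "%x. \<phi> x * (G k x - poly p x)"] le3 sq_const(2)[of "e/3"] e by simp
 let ?s = "%x. (r x - R n x) + (\<phi> x * (\<rho> x - G k x) + \<phi> x * (G k x - poly p x))"
 have s: "sq ?s" by (intro sq_add n s2 s3)
 have "norm2 ?s <= norm2 (%x. r x - R n x) + (norm2 (%x. \<phi> x * (\<rho> x - G k x)) + norm2 (%x. \<phi> x * (G k x - poly p x)))"
  using sq_add(2)[OF n(1) sq_add(1)[OF s2(1) s3]] sq_add(2)[OF s2(1) s3] by linarith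
 then have ns: "norm2 ?s < e" using n(2) s2(2) k(2) n3 by linarith
 have eq: "r x - \<phi> x * poly p x = ?s x" if "0 < x" "x < 1" for x
  using R_eq[OF that] by (simp add: algebra_simps)
 have "sq (%x. r x - \<phi> x * poly p x)" "norm2 (%x. r x - \<phi> x * poly p x) <= norm2 ?s"
  using sq_dominated[OF s, of "%x. r x - \<phi> x * poly p x"] eq by simp_all
 then show thesis using that[of p] ns by linarith
qed

lemma poly_bounded: "\<exists>B. \<forall>x\<in>{0..1}. \<bar>poly p (x::real)\<bar> <= B"
proof -
 have "compact (poly p ` {0..1})" by (intro compact_continuous_image continuous_intros) auto
 then show ?thesis using compact_imp_bounded bounded_iff by (metis image_eqI real_norm_def)
qed

lemma poly_measurable [measurable]: "poly (p :: real poly) \<in> Borel"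
 by (intro borel_measurable_continuous_onI continuous_intros)

lemma sq_poly: "sq (poly p)"
 using poly_bounded[of p] by (auto intro!: sq_bounded)

lemma J_FTC:
 assumes "f \<in> Borel" "integrable U f" "0 <= a" "a <= b" "b <= 1" "continuous_on {a..b} F"
  and "!!x. x \<in> {a<..<b} ==> (F has_real_derivative f x) (at x)"
 shows "J f a b = F b - F a"
proof -
 have "(f has_integral F b - F a) {a..b}"
  using assms by (intro fundamental_theorem_of_calculus_interior)
   (auto simp: has_real_derivative_iff_has_vector_derivative)
 moreover have "(f has_integral J f a b) {a..b}"
  by (intro J_has_integral J_integrable assms)
 ultimately show ?thesis using has_integral_unique by blast
qed

lemma absolutely_cont_on_diff:
 assumes "absolutely_cont_on S F" "absolutely_cont_on S G"
 shows "absolutely_cont_on S (%x. F x - G x)"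
 unfolding absolutely_cont_on_def
proof (intro allI impI)
 fix e :: real assume "0 < e"
 then have e2: "0 < e / 2" by simp
 obtain d1 where d1: "0 < d1" "!!\<D>. \<D> division_of \<Union>\<D> & \<Union>\<D> <= S & (\<Sum>k\<in>\<D>. measure lborel k) < d1 -->
    (\<Sum>k\<in>\<D>. \<bar>F (Sup k) - F (Inf k)\<bar>) < e / 2" using assms(1) e2 unfolding absolutely_cont_on_def by blast
 obtain d2 where d2: "0 < d2" "!!\<D>. \<D> division_of \<Union>\<D> & \<Union>\<D> <= S & (\<Sum>k\<in>\<D>. measure lborel k) < d2 -->
    (\<Sum>k\<in>\<D>. \<bar>G (Sup k) - G (Inf k)\<bar>) < e / 2" using assms(2) e2 unfolding absolutely_cont_on_def by blast
 show "\<exists>d>0. \<forall>\<D>. \<D> division_of \<Union>\<D> & \<Union>\<D> <= S & (\<Sum>k\<in>\<D>. measure lborel k) < d -->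
    (\<Sum>k\<in>\<D>. \<bar>F (Sup k) - G (Sup k) - (F (Inf k) - G (Inf k))\<bar>) < e"
 proof (intro exI[of _ "min d1 d2"] conjI allI impI)
  fix \<D> assume D: "\<D> division_of \<Union>\<D> & \<Union>\<D> <= S & (\<Sum>k\<in>\<D>. measure lborel k) < min d1 d2"
  have "(\<Sum>k\<in>\<D>. \<bar>F (Sup k) - G (Sup k) - (F (Inf k) - G (Inf k))\<bar>) <=
   (\<Sum>k\<in>\<D>. \<bar>F (Sup k) - F (Inf k)\<bar> + \<bar>G (Sup k) - G (Inf k)\<bar>)" by (intro sum_mono) linarith
  also have "... < e" using d1(2)[of \<D>] d2(2)[of \<D>] D by (simp add: sum.distrib)
  finally show "(\<Sum>k\<in>\<D>. \<bar>F (Sup k) - G (Sup k) - (F (Inf k) - G (Inf k))\<bar>) < e" .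
 qed (use d1 d2 in auto)
qed

context degenerate
begin

text \<open>Polynomial multiples of \<open>x^2 (1 - x)\<close> are dense, and each such
  \<open>w\<close> is \<open>Sop f\<close> for \<open>f = -(x^\<alpha> w')'\<close>: the double zero
  at 0 makes \<open>w'\<close> divisible by \<open>x\<close>, which keeps \<open>f\<close>
  bounded.\<close>

lemma Sop_dense_L2:
 assumes v: "sq v" and e: "0 < e"
 obtains f where "sq f" "norm2 (%x. v x - Sop f x) < e"
proof -
 have [measurable]: "v \<in> Borel" using v by (simp add: sq_def)
 have bd: "0 < x^2 * (1 - x) & x\<^sup>2 * (1 - x) <= 1" if "0 < x" "x < 1" for x :: real
  using that by (auto intro!: mult_le_one power_le_one)
 obtain p where p: "norm2 (%x. v x - x\<^sup>2 * (1 - x) * poly p x) < e"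
  by (rule weighted_poly_dense[of "%x. x^2 * (1 - x)" v e]) (use bd v e in auto)
 define w where "w = [:0, 0, 1, -1:] * p"
 \<comment> \<open>The quotient of \<open>w'\<close> by \<open>x\<close>, written without a
   division.\<close>
 define q where "q = pderiv ([:0, 1, -1:] * p) + [:1, -1:] * p"
 have wx: "poly w x = x^2 * (1 - x) * poly p x" for x by (simp add: w_def algebra_simps power2_eq_square)
 have "w = [:0, 1:] * ([:0, 1, -1:] * p)" by (simp add: w_def)
 then have "pderiv w = [:0, 1:] * pderiv ([:0, 1, -1:] * p) + ([:0, 1, -1:] * p)"
  by (simp only: pderiv_mult) (simp add: pderiv_pCons)
 also have "[:0, 1, -1:] * p = [:0, 1:] * ([:1, -1:] * p)" by simp
 finally have "pderiv w = [:0, 1:] * q" unfolding q_def by (simp add: algebra_simps)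
 then have q: "poly (pderiv w) x = x * poly q x" for x by simp
 \<comment> \<open>This is \<open>-(x^\<alpha> w')'\<close> expanded with \<open>w' = x q\<close>,
   so that no negative power of \<open>x\<close> occurs.\<close>
 define f where "f x = - (x powr \<alpha> * (\<alpha> * poly q x + poly (pderiv (pderiv w)) x))" for x
 define H where "H x = - (x powr \<alpha> * poly (pderiv w) x)" for x
 have [measurable]: "f \<in> Borel" unfolding f_def by measurable
 obtain B1 B2 where B: "!!x. x \<in> {0..1} ==> \<bar>poly q x\<bar> <= B1" "!!x. x \<in> {0..1} ==> \<bar>poly (pderiv (pderiv w)) x\<bar> <= B2"
  using poly_bounded by metis
 have f: "sq f"
 proof (rule sq_bounded[where B="\<alpha> * B1 + B2"])
  fix x :: real assume x: "0 < x" "x < 1"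
  have "\<bar>\<alpha> * poly q x + poly (pderiv (pderiv w)) x\<bar> <= \<alpha> * \<bar>poly q x\<bar> + \<bar>poly (pderiv (pderiv w)) x\<bar>"
   using \<alpha> abs_triangle_ineq[of "\<alpha> * poly q x" "poly (pderiv (pderiv w)) x"] by (simp add: abs_mult)
  also have "... <= \<alpha> * B1 + B2" using B[of x] x \<alpha> by (intro add_mono mult_left_mono) auto
  finally have "x powr \<alpha> * \<bar>\<alpha> * poly q x + poly (pderiv (pderiv w)) x\<bar> <= 1 * (\<alpha> * B1 + B2)"
   using x \<alpha> by (intro mult_mono) (auto simp: powr_le1)
  then show "\<bar>f x\<bar> <= \<alpha> * B1 + B2" by (simp add: f_def abs_mult)
 qed measurable
 define C where "C = (\<integral>r. cK r * f r \<partial>U)"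
 have Pop: "Pop f x = H x - C" if x: "0 < x" "x <= 1" for x
 proof -
  have "J f 0 x = H x - H 0"
  proof (rule J_FTC[OF _ sq_integrable[OF f]])
   show "continuous_on {0..x} H" unfolding H_def[abs_def] using \<alpha>
    by (intro continuous_intros continuous_on_powr') auto
   fix y assume y: "y \<in> {0<..<x}"
   then have d: "(H has_real_derivative - (\<alpha> * y powr (\<alpha> - 1) * poly (pderiv w) y + poly (pderiv (pderiv w)) y * y powr \<alpha>)) (at y)"
    unfolding H_def[abs_def] by (intro DERIV_minus DERIV_mult has_real_derivative_powr poly_DERIV) auto
   have yy: "y powr (\<alpha> - 1) * y = y powr \<alpha>" using y by (simp add: powr_diff)
   have "\<alpha> * y powr (\<alpha> - 1) * poly (pderiv w) y = \<alpha> * (y powr (\<alpha> - 1) * y) * poly q y" by (simp add: q)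
   then have "- (\<alpha> * y powr (\<alpha> - 1) * poly (pderiv w) y + poly (pderiv (pderiv w)) y * y powr \<alpha>) = f y"
    unfolding yy f_def by (simp add: distrib_left)
   with d show "(H has_real_derivative f y) (at y)" by (rule DERIV_cong)
  qed (use x in auto)
  then show ?thesis unfolding Pop_def C_def by (simp add: H_def)
 qed
 have flux: "flux f s = - poly (pderiv w) s - C * s powr - \<alpha>" if s: "0 < s" "s <= 1" for s
  using Pop[OF s] s by (simp add: flux_def H_def algebra_simps powr_minus field_simps)
 have dw: "J (%s. - poly (pderiv w) s) a 1 = poly w a - poly w 1" if "0 <= a" "a <= 1" for a
 proof -
  have d: "((%s. - poly w s) has_real_derivative - poly (pderiv w) y) (at y)" for y
   by (intro DERIV_minus poly_DERIV)
  have "continuous_on {a..1} (%s. - poly w s)" by (intro continuous_intros)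
  then have "J (%s. - poly (pderiv w) s) a 1 = - poly w 1 - - poly w a"
   using sq_integrable[OF sq_poly, of "pderiv w"] by (intro J_FTC d) (use that in auto)
  then show ?thesis by simp
 qed
 have w0: "poly w 0 = 0" "poly w 1 = 0" by (simp_all add: wx)
 \<comment> \<open>For \<open>\<alpha> < 1\<close> both the flux and \<open>w'\<close> have mean
   zero, while \<open>s^(-\<alpha>)\<close> has not; this forces the constant to vanish.\<close>
 have C0: "C = 0"
 proof (cases "\<alpha> < 1")
  case True
  have pi: "integrable U (%s. s powr - \<alpha>)" using True by (intro U_powr_integrable) auto
  have "0 = J (flux f) 0 1" using flux_mean_zero[OF True f] by simp
  also have "... = (\<integral>s. - poly (pderiv w) s - C * s powr - \<alpha> \<partial>U)"
   unfolding J_UNIV[OF flux_measurable[OF \<open>f \<in> Borel\<close>]]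
  proof (rule integral_cong_AE)
   show "AE s in U. flux f s = - poly (pderiv w) s - C * s powr - \<alpha>"
    using U_AE_in by eventually_elim (simp add: flux)
  qed (use \<open>f \<in> Borel\<close> in auto)
  also have "... = (\<integral>s. - poly (pderiv w) s \<partial>U) - C * (\<integral>s. s powr - \<alpha> \<partial>U)"
   using pi sq_integrable[OF sq_poly] by simp
  also have "(\<integral>s. - poly (pderiv w) s \<partial>U) = 0"
   using dw[of 0] w0 J_UNIV[of "%s. - poly (pderiv w) s"] by simp
  finally have "C * (\<integral>s. s powr - \<alpha> \<partial>U) = 0" by simp
  moreover have "(\<integral>s. s powr - \<alpha> \<partial>U) ~= 0"
  proof -
   have "(\<integral>s. 1 \<partial>U) <= (\<integral>s. s powr - \<alpha> \<partial>U)"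
   proof (rule integral_mono_AE)
    show "AE s in U. 1 <= s powr - \<alpha>" using U_AE_in
    proof eventually_elim
     case (elim s)
     then have "1 powr - \<alpha> <= s powr - \<alpha>" using \<alpha> by (intro powr_mono2') auto
     then show ?case by simp
    qed
   qed (use pi in auto)
   then show ?thesis by simp
  qed
  ultimately show ?thesis by simp
 qed (simp add: C_def cK_def)
 have S: "Sop f x = poly w x" if x: "0 < x" "x <= 1" for x
 proof -
  have "Sop f x = J (%s. - poly (pderiv w) s) x 1"
   unfolding Sop_def J_def
  proof (rule integral_cong_AE)
   show "AE s in U. indicator {x<..1} s * flux f s = indicator {x<..1} s * - poly (pderiv w) s"
    using U_AE_in by eventually_elim (simp add: flux C0)
  qed (use \<open>f \<in> Borel\<close> in auto)
  then show ?thesis using dw[of x] x w0 by simp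
 qed
 have s0: "sq (%x. v x - x\<^sup>2 * (1 - x) * poly p x)"
  using sq_diff[OF v sq_poly[of w]] by (simp add: wx)
 have "norm2 (%x. v x - Sop f x) <= norm2 (%x. v x - x\<^sup>2 * (1 - x) * poly p x)"
  by (rule sq_dominated(2)[OF s0]) (auto simp: S wx)
 then show thesis using that[OF f] p by linarith
qed

text \<open>The negated weighted derivative is approximated by
  \<open>x^(2-\<alpha>/2) p = x^(-\<alpha>/2) q\<close> with \<open>q = x^2 p\<close>. For
  \<open>f = q'\<close> the flux is \<open>x^(-\<alpha>) q\<close> up to the constant in
  \<open>Pop\<close>, so only that constant remains to be controlled.\<close>

lemma Sop_dense_H1:
 assumes g: "h1_deriv w g" and e: "0 < e"
 obtains f where "sq f" "norm2 (%x. x powr (\<alpha>/2) * (g x + flux f x)) < e"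
proof -
 have [measurable]: "g \<in> Borel" using g by (simp add: h1_deriv_def)
 have e2: "0 < e / 2" using e by simp
 define r where "r x = (-1) * (x powr (\<alpha>/2) * g x)" for x
 have r: "sq r" unfolding r_def[abs_def] using g by (intro sq_mult_const) (simp add: h1_deriv_def)
 have bd: "0 < x powr (2 - \<alpha>/2) & x powr (2 - \<alpha>/2) <= 1" if "0 < x" "x < 1" for x :: real
  using that \<alpha> by (auto simp: powr_le1)
 obtain p where p: "sq (%x. r x - x powr (2 - \<alpha>/2) * poly p x)" "norm2 (%x. r x - x powr (2 - \<alpha>/2) * poly p x) < e / 2"
  by (rule weighted_poly_dense[of "%x. x powr (2 - \<alpha>/2)" r "e/2"]) (use bd r e2 in auto)
 define q where "q = [:0, 0, 1:] * p"
 have qx: "poly q x = x^2 * poly p x" for x by (simp add: q_def power2_eq_square)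
 define f where "f = poly (pderiv q)"
 have f: "sq f" unfolding f_def by (rule sq_poly)
 have [measurable]: "f \<in> Borel" unfolding f_def by measurable
 define C where "C = (\<integral>r. cK r * f r \<partial>U)"
 have Pop: "Pop f x = poly q x - C" if x: "0 < x" "x <= 1" for x
 proof -
  have "J f 0 x = poly q x - poly q 0"
   unfolding f_def by (rule J_FTC) (use x sq_integrable[OF sq_poly] in "auto intro!: continuous_intros poly_DERIV")
  then show ?thesis unfolding Pop_def C_def by (simp add: qx)
 qed
 have eq: "x powr (\<alpha>/2) * (g x + flux f x) = (-1) * (r x - x powr (2 - \<alpha>/2) * poly p x) + (- C) * x powr (- (\<alpha>/2))"
  if x: "0 < x" "x < 1" for x
 proof -
  have "x powr (\<alpha>/2) * flux f x = (x powr (\<alpha>/2) * x powr - \<alpha>) * (poly q x - C)"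
   using Pop[of x] x by (simp add: flux_def)
  also have "x powr (\<alpha>/2) * x powr - \<alpha> = x powr (- (\<alpha>/2))" using powr_split[OF x(1)] by simp
  also have "x powr (- (\<alpha>/2)) * (poly q x - C) = x powr (2 - \<alpha>/2) * poly p x - C * x powr (- (\<alpha>/2))"
  proof -
   have "x powr (2 + - (\<alpha>/2)) = x^2 * x powr (- (\<alpha>/2))" using x by (simp only: powr_add) (simp add: powr_numeral)
   then have "x powr (2 - \<alpha>/2) = x^2 * x powr (- (\<alpha>/2))" by simp
   then show ?thesis by (simp add: qx algebra_simps)
  qed
  finally show ?thesis by (simp add: r_def algebra_simps)
 qed
 have n1: "sq (%x. (-1) * (r x - x powr (2 - \<alpha>/2) * poly p x))" "norm2 (%x. (-1) * (r x - x powr (2 - \<alpha>/2) * poly p x)) < e / 2"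
  using sq_mult_const(1)[OF p(1), of "-1"] p(2) unfolding sq_mult_const(2) by simp_all
 show thesis
 proof (cases "\<alpha> < 1")
  case False
  then have "C = 0" by (simp add: C_def cK_def)
  then have "norm2 (%x. x powr (\<alpha>/2) * (g x + flux f x)) <= norm2 (%x. (-1) * (r x - x powr (2 - \<alpha>/2) * poly p x))"
   by (intro sq_dominated(2)[OF n1(1)]) (auto simp: eq)
  then show thesis using that[OF f] n1(2) e by linarith
 next
  case True
  let ?m = "%x::real. x powr (- (\<alpha>/2))"
  have pi: "integrable U (%x. x powr - \<alpha>)" using True by (intro U_powr_integrable) auto
  have m2: "(%x. (?m x)^2) = (%x. x powr - \<alpha>)" by (auto simp: power2_eq_square powr_add[symmetric])
  have m: "sq ?m" unfolding sq_def m2 using pi by simp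
  define I where "I = (\<integral>x. x powr - \<alpha> \<partial>U)"
  have I: "(norm2 ?m)^2 = I" unfolding norm2_square m2 I_def ..
  have mm: "?m x * x powr (\<alpha>/2) = 1" "?m x * ?m x = x powr - \<alpha>" if "0 < x" for x
   using that by (simp_all add: powr_add[symmetric])
  have gi: "integrable U g" "(\<integral>x. g x \<partial>U) = 0"
   using g True J_UNIV[of g] by (auto simp: h1_deriv_def)
  \<comment> \<open>Both \<open>g\<close> and the flux have mean zero. Hence \<open>C * I\<close> is
    the scalar product of the approximation error with the weight \<open>x^(-\<alpha>/2)\<close>,
    and the constant is as small as the error.\<close>
  have "0 = J (flux f) 0 1" using flux_mean_zero[OF True f] by simp
  also have "... = (\<integral>x. ?m x * ((-1) * (r x - x powr (2 - \<alpha>/2) * poly p x)) - C * x powr - \<alpha> - g x \<partial>U)"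
   unfolding J_UNIV[OF flux_measurable[OF \<open>f \<in> Borel\<close>]]
  proof (rule integral_cong_AE)
   show "AE x in U. flux f x = ?m x * ((-1) * (r x - x powr (2 - \<alpha>/2) * poly p x)) - C * x powr - \<alpha> - g x"
    using U_AE_in
   proof eventually_elim
    case (elim x)
    have "g x + flux f x = ?m x * (x powr (\<alpha>/2) * (g x + flux f x))"
     using mm(1)[of x] elim by (simp add: mult.assoc[symmetric])
    also have "... = ?m x * ((-1) * (r x - x powr (2 - \<alpha>/2) * poly p x)) + (- C) * (?m x * ?m x)"
     using eq[of x] elim by (simp only: distrib_left mult.left_commute[of "?m x" "- C"])
    finally show ?case using mm(2)[of x] elim by simp
   qed
  qed (use r in "auto simp: sq_def")
  also have "... = (\<integral>x. ?m x * ((-1) * (r x - x powr (2 - \<alpha>/2) * poly p x)) \<partial>U) - C * I"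
   using gi pi sq_cs(1)[OF m n1(1)] unfolding I_def by simp
  finally have CI: "C * I = (\<integral>x. ?m x * ((-1) * (r x - x powr (2 - \<alpha>/2) * poly p x)) \<partial>U)" by simp
  have "\<bar>C\<bar> * I <= norm2 ?m * (e / 2)"
  proof -
   have "0 <= I" unfolding I[symmetric] by simp
   then have "\<bar>C\<bar> * I = \<bar>C * I\<bar>" by (simp add: abs_mult)
   also have "... <= norm2 ?m * norm2 (%x. (-1) * (r x - x powr (2 - \<alpha>/2) * poly p x))"
    unfolding CI by (rule sq_cs(2)[OF m n1(1)])
   also have "... <= norm2 ?m * (e / 2)" using n1(2) by (intro mult_left_mono) auto
   finally show ?thesis .
  qed
  then have Cm: "\<bar>C\<bar> * norm2 ?m <= e / 2"
  proof (cases "norm2 ?m = 0")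
   case False
   then have "0 < norm2 ?m" using norm2_nonneg[of ?m] by linarith
   moreover have "norm2 ?m * (\<bar>C\<bar> * norm2 ?m) <= norm2 ?m * (e / 2)"
    using \<open>\<bar>C\<bar> * I <= norm2 ?m * (e / 2)\<close> unfolding I[symmetric] by (simp add: power2_eq_square mult_ac)
   ultimately show ?thesis by (rule mult_left_le_imp_le[rotated])
  qed (use e in simp)
  have "norm2 (%x. (- C) * ?m x) <= e / 2" using Cm by (simp only: sq_mult_const(2)) simp
  then have "norm2 (%x. (-1) * (r x - x powr (2 - \<alpha>/2) * poly p x) + (- C) * ?m x) < e"
   using sq_add(2)[OF n1(1) sq_mult_const(1)[OF m, of "- C"]] n1(2) by linarith
  moreover have "norm2 (%x. x powr (\<alpha>/2) * (g x + flux f x)) <= norm2 (%x. (-1) * (r x - x powr (2 - \<alpha>/2) * poly p x) + (- C) * ?m x)"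
   by (intro sq_dominated(2)[OF sq_add(1)[OF n1(1) sq_mult_const(1)[OF m, of "- C"]]]) (auto simp: eq)
  ultimately show thesis using that[OF f] by linarith
 qed
qed

text \<open>The function \<open>v\<close> is its own best test function; density allows it to be
  replaced by an element of the range of \<open>Sop\<close>.\<close>

lemma norm2_le_by_duality:
 assumes v: "sq v" and K: "0 <= K" and le: "!!f. sq f ==> \<bar>\<integral>x. v x * Sop f x \<partial>U\<bar> <= K * norm2 (Sop f)"
 shows "norm2 v <= K"
proof -
 define N where "N = norm2 v"
 have N0: "0 <= N" by (simp add: N_def)
 have "N * N <= K * N + \<eta>" if \<eta>: "0 < \<eta>" for \<eta>
 proof -
  define e where "e = \<eta> / (N + K + 1)"
  have e: "0 < e" using \<eta> N0 K by (simp add: e_def)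
  obtain f where f: "sq f" "norm2 (%x. v x - Sop f x) < e" using Sop_dense_L2[OF v e] by blast
  have S: "sq (Sop f)" by (rule Sop_sq[OF f(1)])
  have d: "sq (%x. v x - Sop f x)" by (rule sq_diff[OF v S])
  have "norm2 (%x. v x + (-1) * (v x - Sop f x)) <= norm2 v + norm2 (%x. (-1) * (v x - Sop f x))"
   by (rule sq_add(2)[OF v sq_mult_const(1)[OF d]])
  then have nS: "norm2 (Sop f) <= N + e" using f(2) unfolding sq_mult_const(2) by (simp add: N_def)
  have "N * N = (\<integral>x. v x * v x \<partial>U)" using norm2_square[of v] by (simp add: N_def power2_eq_square)
  also have "... = (\<integral>x. v x * (v x - Sop f x) + v x * Sop f x \<partial>U)" by (simp add: algebra_simps)
  also have "... = (\<integral>x. v x * (v x - Sop f x) \<partial>U) + (\<integral>x. v x * Sop f x \<partial>U)"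
   by (intro Bochner_Integration.integral_add sq_cs v d S)
  also have "... <= N * e + K * (N + e)"
  proof (rule add_mono)
   have "(\<integral>x. v x * (v x - Sop f x) \<partial>U) <= N * norm2 (%x. v x - Sop f x)"
    using sq_cs(2)[OF v d] by (simp add: N_def abs_le_iff)
   also have "... <= N * e" using f(2) N0 by (intro mult_left_mono) auto
   finally show "(\<integral>x. v x * (v x - Sop f x) \<partial>U) <= N * e" .
   have "(\<integral>x. v x * Sop f x \<partial>U) <= K * norm2 (Sop f)" using le[OF f(1)] by (simp add: abs_le_iff)
   also have "... <= K * (N + e)" using nS K by (intro mult_left_mono) auto
   finally show "(\<integral>x. v x * Sop f x \<partial>U) <= K * (N + e)" .
  qed
  also have "... <= K * N + e * (N + K + 1)" using e by (simp add: algebra_simps)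
  also have "e * (N + K + 1) = \<eta>" using N0 K by (simp add: e_def)
  finally show ?thesis .
 qed
 then have "N * N <= K * N" by (rule field_le_epsilon)
 then show ?thesis using N0 K unfolding N_def[symmetric] by (cases "N = 0") (auto simp: mult_le_cancel_right)
qed

end

context degenerate
begin

text \<open>\<open>H1_seminorm\<close> is built on \<open>deriv\<close>, whose additivity is assured
  only where both functions are differentiable.\<close>

lemma H1_AE_differentiable:
 assumes w: "w \<in> H1 \<alpha>"
 shows "AE x in U. (w has_real_derivative deriv w x) (at x)"
proof -
 have "\<exists>N. negligible N & (\<forall>x\<in>{1 / (real n + 2)<..<1} - N. (w has_real_derivative deriv w x) (at x))" for n :: nat
 proof -
  have "absolutely_cont_on {1 / (real n + 2)..1} w"
  proof (cases "\<alpha> < 1")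
   case True
   then have "absolutely_cont_on {0..1} w" using w by (simp add: H1_def)
   then show ?thesis by (rule absolutely_cont_on_subset) auto
  next
   case False
   moreover have "0 < 1 / (real n + 2) & 1 / (real n + 2) < 1" by (simp add: field_simps)
   ultimately show ?thesis using w by (simp add: H1_def)
  qed
  then show ?thesis by (rule absolutely_cont_on_AE_derivative) blast
 qed
 then obtain N where N: "!!n. negligible (N n)"
  "!!n x. x \<in> {1 / (real n + 2)<..<1} - N n ==> (w has_real_derivative deriv w x) (at x)" by metis
 have "AE x in lebesgue. x \<notin> N n" for n using N(1)[of n] by (simp add: negligible_iff_null_sets AE_not_in)
 then have "AE x in lborel. x \<notin> N n" for n by (simp add: AE_completion_iff)
 then have "AE x in lborel. \<forall>n. x \<notin> N n" unfolding AE_all_countable by blast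
 then show ?thesis unfolding U_AE
 proof eventually_elim
  case (elim x)
  show ?case
  proof
   assume x: "x \<in> {0<..<1}"
   obtain n where "inverse (real (Suc n)) < x" using reals_Archimedean x by auto
   moreover have "1 / (real n + 2) <= inverse (real (Suc n))" by (simp add: field_simps)
   ultimately have "x \<in> {1 / (real n + 2)<..<1} - N n" using x elim by auto
   then show "(w has_real_derivative deriv w x) (at x)" by (rule N(2))
  qed
 qed
qed

lemma H1_diff:
 assumes u: "u \<in> H1 \<alpha>" "h1_deriv u g" and w: "w \<in> H1 \<alpha>" "h1_deriv w h"
 shows "(%x. u x - w x) \<in> H1 \<alpha>" "H1_seminorm \<alpha> (%x. u x - w x) = norm2 (%x. x powr (\<alpha>/2) * (g x - h x))"
  "sq (%x. x powr (\<alpha>/2) * (g x - h x))"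
proof -
 have "sq (%x. x powr (\<alpha>/2) * g x - x powr (\<alpha>/2) * h x)"
  by (rule sq_diff) (use u(2) w(2) in "auto simp: h1_deriv_def")
 then show s: "sq (%x. x powr (\<alpha>/2) * (g x - h x))" by (simp add: right_diff_distrib)
 have "AE x in U. deriv u x = g x" "AE x in U. deriv w x = h x" using u(2) w(2) by (auto simp: h1_deriv_def)
 then have ae: "AE x in U. x powr (\<alpha>/2) * deriv (%x. u x - w x) x = x powr (\<alpha>/2) * (g x - h x)"
  using H1_AE_differentiable[OF u(1)] H1_AE_differentiable[OF w(1)]
 proof eventually_elim
  case (elim x)
  have "deriv (%x. u x - w x) x = deriv u x - deriv w x" by (rule DERIV_imp_deriv) (intro DERIV_diff elim)
  then show ?case using elim by simp
 qed
 show "H1_seminorm \<alpha> (%x. u x - w x) = norm2 (%x. x powr (\<alpha>/2) * (g x - h x))"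
  unfolding H1_seminorm_def by (rule L2_cong_AE(2)[OF s ae])
 have W: "(%x. x powr (\<alpha>/2) * deriv (%x. u x - w x) x) \<in> L2" by (rule L2_cong_AE(1)[OF s ae])
 have "u \<in> L2" "w \<in> L2" using u(1) w(1) by (auto simp: H1_def split: if_splits)
 then obtain a b where ab: "sq a" "AE x in U. u x = a x" "sq b" "AE x in U. w x = b x" by (metis L2_representative)
 have L: "(%x. u x - w x) \<in> L2"
  by (rule L2_cong_AE(1)[OF sq_diff[OF ab(1,3)]]) (use ab(2,4) in eventually_elim, simp)
 show "(%x. u x - w x) \<in> H1 \<alpha>"
  using u(1) w(1) L W unfolding H1_def by (auto split: if_splits intro: absolutely_cont_on_diff)
qed

text \<open>In the integral representing \<open>w\<close> the weight \<open>s^(-\<alpha>/2)\<close>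
  is split evenly, and one half is estimated by its value at \<open>x\<close>. Each half is square
  integrable because \<open>\<alpha> < 2\<close>.\<close>

lemma L2_norm_le_H1_seminorm:
 assumes w: "h1_deriv w g"
 shows "L2_norm w <= (norm2 (%x. x powr (- (\<alpha>/4))))^2 * norm2 (%x. x powr (\<alpha>/2) * g x)"
proof -
 let ?h = "%x::real. x powr (- (\<alpha>/4))"
 define N where "N = norm2 (%x. x powr (\<alpha>/2) * g x)"
 have [measurable]: "g \<in> Borel" and g2: "sq (%x. x powr (\<alpha>/2) * g x)"
  using w by (auto simp: h1_deriv_def)
 have hh: "(%x. (?h x)^2) = (%x. x powr (- (\<alpha>/2)))" by (auto simp: power2_eq_square powr_add[symmetric])
 have h: "sq ?h" unfolding sq_def hh using \<alpha> by (auto intro!: U_powr_integrable)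
 have bd: "\<bar>J g x 1\<bar> <= \<bar>(norm2 ?h * N) * ?h x\<bar>" if x: "0 < x" "x < 1" for x
 proof -
  let ?k = "%s. indicator {x<..1} s * s powr (- (\<alpha>/2)) :: real"
  have le: "\<bar>?k s\<bar> <= \<bar>?h x * ?h s\<bar>" if s: "0 < s" "s < 1" for s
  proof (cases "s \<in> {x<..1}")
   case True
   then have "?h s <= ?h x" using x \<alpha> by (intro powr_mono2') auto
   then have "?h s * ?h s <= ?h x * ?h s" by (rule mult_right_mono) simp
   moreover have "?h s * ?h s = s powr (- (\<alpha>/2))" by (simp add: powr_add[symmetric])
   ultimately show ?thesis using True by (simp add: abs_mult)
  qed simp
  have k: "sq ?k" "norm2 ?k <= norm2 (%s. ?h x * ?h s)"
   using sq_dominated[OF sq_mult_const(1)[OF h, of "?h x"], of ?k] le by auto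
  have "J g x 1 = (\<integral>s. ?k s * (s powr (\<alpha>/2) * g s) \<partial>U)"
   unfolding J_def
  proof (rule integral_cong_AE)
   show "AE s in U. indicator {x<..1} s * g s = ?k s * (s powr (\<alpha>/2) * g s)"
    using U_AE_in
   proof eventually_elim
    case (elim s)
    then have "s powr (- (\<alpha>/2)) * s powr (\<alpha>/2) = 1" by (simp add: powr_add[symmetric])
    then show ?case by (simp add: mult.assoc[symmetric])
   qed
  qed auto
  then have "\<bar>J g x 1\<bar> <= norm2 ?k * N" using sq_cs(2)[OF k(1) g2] by (simp add: N_def)
  also have "... <= (?h x * norm2 ?h) * N" using k(2) unfolding sq_mult_const(2) by (intro mult_right_mono) (auto simp: N_def)
  also have "... = \<bar>(norm2 ?h * N) * ?h x\<bar>" by (simp add: abs_mult N_def)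
  finally show ?thesis .
 qed
 have s: "sq (%x. - J g x 1)" "norm2 (%x. - J g x 1) <= norm2 (%x. (norm2 ?h * N) * ?h x)"
  using sq_dominated[OF sq_mult_const(1)[OF h, of "norm2 ?h * N"], of "%x. - J g x 1"] bd by auto
 have "AE x in U. w x = - J g x 1" using U_AE_in by eventually_elim (use w in "auto simp: h1_deriv_def")
 then have "L2_norm w = norm2 (%x. - J g x 1)" by (rule L2_cong_AE(2)[OF s(1)])
 also have "... <= norm2 ?h * N * norm2 ?h" using s(2) unfolding sq_mult_const(2) by (simp add: N_def abs_mult)
 finally show ?thesis by (simp add: N_def power2_eq_square mult.commute mult.left_commute)
qed

text \<open>Functionals are bounded for the full norm, while approximation is available in the
  seminorm; \<open>L2_norm_le_H1_seminorm\<close> links the two. Nonnegativity is recorded because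
  the supremum defining \<open>Hm1_norm\<close> is meaningful only once boundedness is known, and
  the final estimate squares it.\<close>

lemma Hm1_norm_le_by_duality:
 assumes \<xi>: "\<xi> \<in> Hm1 \<alpha>" and K: "0 <= K" and le: "!!f. sq f ==> \<bar>\<xi> (Sop f)\<bar> <= K * H1_seminorm \<alpha> (Sop f)"
 shows "0 <= Hm1_norm \<alpha> \<xi>" "Hm1_norm \<alpha> \<xi> <= K"
proof -
 have "\<exists>B. \<forall>u\<in>H1 \<alpha>. \<bar>\<xi> u\<bar> <= B * H1_norm \<alpha> u" using \<xi> by (simp add: Hm1_def)
 then obtain B where B: "!!u. u \<in> H1 \<alpha> ==> \<bar>\<xi> u\<bar> <= B * H1_norm \<alpha> u" by blast
 define c where "c = (norm2 (%x::real. x powr (- (\<alpha>/4))))^2"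
 have c0: "0 <= c" by (simp add: c_def)
 have le1: "\<bar>\<xi> u\<bar> <= K" if u: "u \<in> H1 \<alpha>" "H1_seminorm \<alpha> u <= 1" for u
 proof (rule field_le_epsilon)
  fix \<eta> :: real assume \<eta>: "0 < \<eta>"
  obtain g where g: "h1_deriv u g" using h1_deriv_exists[OF u(1)] .
  define e where "e = \<eta> / (\<bar>B\<bar> * (c + 1) + K + 1)"
  have pos: "0 < \<bar>B\<bar> * (c + 1) + K + 1" using c0 K by (intro add_nonneg_pos add_nonneg_nonneg mult_nonneg_nonneg) auto
  have e: "0 < e" using \<eta> pos by (simp add: e_def)
  obtain f where f: "sq f" "norm2 (%x. x powr (\<alpha>/2) * (g x + flux f x)) < e" using Sop_dense_H1[OF g e] .
  define S where "S = H1_seminorm \<alpha> (Sop f)"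
  define d where "d x = u x - Sop f x" for x
  note D = H1_diff[OF u(1) g Sop_H1[OF f(1)] h1_deriv_Sop[OF f(1)]]
  have dH: "d \<in> H1 \<alpha>" and ds: "H1_seminorm \<alpha> d < e" using D(1,2) f(2) unfolding d_def[abs_def] by auto
  obtain h where h: "h1_deriv d h" using h1_deriv_exists[OF dH] .
  have s0: "0 <= H1_seminorm \<alpha> d" unfolding h1_deriv_seminorm[OF h] by simp
  have "L2_norm d <= c * H1_seminorm \<alpha> d"
   using L2_norm_le_H1_seminorm[OF h] unfolding h1_deriv_seminorm[OF h] c_def .
  moreover have l0: "0 <= L2_norm d" by (simp add: L2_norm_def)
  moreover have "H1_norm \<alpha> d <= L2_norm d + H1_seminorm \<alpha> d"
   unfolding H1_norm_def by (rule sqrt_sum_squares_le_sum[OF l0 s0])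
  ultimately have "H1_norm \<alpha> d <= (c + 1) * H1_seminorm \<alpha> d" by (simp add: distrib_right)
  also have "... <= (c + 1) * e" using ds c0 by (intro mult_left_mono) auto
  finally have n: "H1_norm \<alpha> d <= (c + 1) * e" .
  have "\<bar>\<xi> d\<bar> <= B * H1_norm \<alpha> d" by (rule B[OF dH])
  also have "... <= \<bar>B\<bar> * H1_norm \<alpha> d" by (intro mult_right_mono) (auto simp: H1_norm_def)
  also have "... <= \<bar>B\<bar> * ((c + 1) * e)" using n by (intro mult_left_mono) auto
  finally have 1: "\<bar>\<xi> d\<bar> <= \<bar>B\<bar> * (c + 1) * e" by simp
  have "S = norm2 (%x. x powr (\<alpha>/2) * - flux f x)" unfolding S_def by (rule h1_deriv_seminorm[OF h1_deriv_Sop[OF f(1)]])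
  also have "(%x. x powr (\<alpha>/2) * - flux f x) = (%x. x powr (\<alpha>/2) * g x + (-1) * (x powr (\<alpha>/2) * (g x - - flux f x)))"
   by (auto simp: right_diff_distrib distrib_left)
  also have "norm2 ... <= norm2 (%x. x powr (\<alpha>/2) * g x) + norm2 (%x. (-1) * (x powr (\<alpha>/2) * (g x - - flux f x)))"
   by (rule sq_add(2)[OF _ sq_mult_const(1)[OF D(3)]]) (use g in "simp add: h1_deriv_def")
  also have "... <= 1 + e"
   using u(2) f(2) unfolding sq_mult_const(2) h1_deriv_seminorm[OF g] by simp
  finally have "K * S <= K * (1 + e)" using K by (rule mult_left_mono)
  then have 2: "\<bar>\<xi> (Sop f)\<bar> <= K + K * e" using le[OF f(1)] by (simp add: S_def distrib_left)
  have "\<forall>u\<in>H1 \<alpha>. \<forall>w\<in>H1 \<alpha>. \<xi> (%x. u x + w x) = \<xi> u + \<xi> w" using \<xi> by (simp add: Hm1_def)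
  then have "\<xi> (%x. d x + Sop f x) = \<xi> d + \<xi> (Sop f)" using dH Sop_H1[OF f(1)] by blast
  then have "\<bar>\<xi> u\<bar> <= \<bar>\<xi> d\<bar> + \<bar>\<xi> (Sop f)\<bar>" by (simp add: d_def)
  also have "... <= K + (\<bar>B\<bar> * (c + 1) + K + 1) * e" using 1 2 e by (simp add: distrib_right)
  also have "... = K + \<eta>" using pos by (simp add: e_def)
  finally show "\<bar>\<xi> u\<bar> <= K + \<eta>" .
 qed
 have z: "Sop (%x. 0) \<in> {u \<in> H1 \<alpha>. H1_seminorm \<alpha> u <= 1}"
 proof -
  have z: "sq (%x. 0)" by (rule sq_const)
  have "Pop (%x. 0) s = 0" for s by (simp add: Pop_def J_def)
  then show ?thesis using Sop_H1[OF z] H1_seminorm_Sop[OF z] by (simp add: norm2_def)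
 qed
 show "Hm1_norm \<alpha> \<xi> <= K" unfolding Hm1_norm_def using z le1 by (intro cSUP_least) auto
 have "bdd_above ((%u. \<bar>\<xi> u\<bar>) ` {u \<in> H1 \<alpha>. H1_seminorm \<alpha> u <= 1})" by (rule bdd_aboveI2[of _ _ K]) (use le1 in auto)
 then show "0 <= Hm1_norm \<alpha> \<xi>" unfolding Hm1_norm_def by (rule cSUP_upper2[OF _ z]) simp
qed

end

text \<open>Two intervals occur because the difference of two translates of a kernel lives on the
  union of two supports.\<close>

lemma lborel_integral_bound:
 fixes h :: "real => real"
 assumes [measurable]: "h \<in> Borel" and ab: "a <= b" "c <= d"
  and le: "!!s. \<bar>h s\<bar> <= A * (indicator {a..b} s + indicator {c..d} s)"
 shows "integrable lborel h" "\<bar>\<integral>s. h s \<partial>lborel\<bar> <= A * ((b - a) + (d - c))"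
proof -
 have i: "integrable lborel (%s. A * (indicator {a..b} s + indicator {c..d} s :: real))"
  by (intro integrable_mult_right Bochner_Integration.integrable_add integrable_real_indicator)
   (auto simp: emeasure_lborel_Icc_eq)
 show h: "integrable lborel h"
  by (rule Bochner_Integration.integrable_bound[OF i]) (use le in "auto intro!: AE_I2 order.trans[OF _ abs_ge_self]")
 have "\<bar>\<integral>s. h s \<partial>lborel\<bar> <= (\<integral>s. \<bar>h s\<bar> \<partial>lborel)" by (rule integral_abs_bound)
 also have "... <= (\<integral>s. A * (indicator {a..b} s + indicator {c..d} s) \<partial>lborel)"
  by (rule integral_mono[OF _ i le]) (use h in simp)
 also have "... = A * ((b - a) + (d - c))" using ab by simp
 finally show "\<bar>\<integral>s. h s \<partial>lborel\<bar> <= A * ((b - a) + (d - c))" .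
qed

text \<open>A remainder of order 3/2 is what Hoelder continuity of exponent 1/2 of the derivative
  yields; the derivatives of averages, in time and in space, are obtained in this form.\<close>

lemma has_derivative_from_bound:
 fixes F :: "real => real"
 assumes d: "0 < d" and le: "!!y. y \<in> S ==> \<bar>y - x\<bar> < d ==> \<bar>F y - F x - (y - x) * D\<bar> <= L * \<bar>y - x\<bar> * sqrt \<bar>y - x\<bar>"
 shows "(F has_real_derivative D) (at x within S)"
proof -
 have "((%y. (F y - F x) / (y - x) - D) \<longlongrightarrow> 0) (at x within S)"
 proof (rule Lim_null_comparison)
  have "eventually (%y. y \<in> S & y ~= x & \<bar>y - x\<bar> < d) (at x within S)"
   unfolding eventually_at using d by (intro exI[of _ d]) (auto simp: dist_real_def)
  then show "eventually (%y. norm ((F y - F x) / (y - x) - D) <= L * sqrt \<bar>y - x\<bar>) (at x within S)"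
  proof eventually_elim
   case (elim y)
   then have "0 < \<bar>y - x\<bar>" by simp
   moreover have "(F y - F x) / (y - x) - D = (F y - F x - (y - x) * D) / (y - x)"
    using elim by (simp add: divide_simps)
   ultimately show ?case using le[of y] elim by (simp add: abs_divide pos_divide_le_eq mult_ac)
  qed
  have "((%y. L * sqrt \<bar>y - x\<bar>) \<longlongrightarrow> L * sqrt \<bar>x - x\<bar>) (at x within S)" by (intro tendsto_intros)
  then show "((%y. L * sqrt \<bar>y - x\<bar>) \<longlongrightarrow> 0) (at x within S)" by simp
 qed
 then show ?thesis unfolding has_field_derivative_iff by (simp add: LIM_zero_iff)
qed

lemma le_sqrt: "0 <= (x::real) ==> x <= 1 ==> x <= sqrt x"
 by (rule real_le_rsqrt) (simp add: power2_eq_square mult_left_le)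

section \<open>Averages in time\<close>

text \<open>The support lies to the right of 0, so an average at time \<open>t\<close> sees only the
  times from \<open>t\<close> to \<open>t + \<eta>\<close> and nothing before the initial time. The
  last argument is the derivative, whose boundedness makes the kernel Lipschitz.\<close>

definition kernel :: "real => (real => real) => (real => real) => bool" where
 "kernel \<eta> \<xi> \<xi>' \<longleftrightarrow> 0 <= \<eta> & (\<forall>u. (\<xi> has_real_derivative \<xi>' u) (at u)) & (\<forall>u. u \<notin> {0..\<eta>} --> \<xi> u = 0) &
   (\<exists>B. \<forall>u. \<bar>\<xi>' u\<bar> <= B)"

text \<open>A correlation with the kernel; since \<open>t\<close> enters as \<open>s - t\<close>,
  each derivative in time brings a minus sign.\<close>

definition average :: "(real => real) => (real => real) => real => real" where
 "average \<xi> g t = (\<integral>s. \<xi> (s - t) * g s \<partial>lborel)"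

lemma kernel_continuous: "kernel \<eta> \<xi> \<xi>' ==> continuous_on UNIV \<xi>"
 unfolding kernel_def by (auto intro!: continuous_at_imp_continuous_on DERIV_isCont)

lemma kernel_measurable: "kernel \<eta> \<xi> \<xi>' ==> \<xi> \<in> Borel"
 using kernel_continuous by (rule borel_measurable_continuous_onI)

lemma kernel_bounded:
 assumes "kernel \<eta> \<xi> \<xi>'"
 obtains B where "0 <= B" "!!u. \<bar>\<xi> u\<bar> <= B"
proof -
 have "compact (\<xi> ` {0..\<eta>})"
  by (intro compact_continuous_image continuous_on_subset[OF kernel_continuous[OF assms]]) auto
 then obtain B where B: "!!u. u \<in> {0..\<eta>} ==> \<bar>\<xi> u\<bar> <= B" using compact_imp_bounded[THEN bounded_imp_bdd_above] 
  by (metis (no_types, lifting) bounded_iff compact_imp_bounded imageI real_norm_def)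
 have "\<bar>\<xi> u\<bar> <= max B 0" for u
  using B[of u] assms by (cases "u \<in> {0..\<eta>}") (auto simp: kernel_def)
 then show thesis using that[of "max B 0"] by simp
qed

lemma kernel_lipschitz:
 assumes "kernel \<eta> \<xi> \<xi>'" "!!u. \<bar>\<xi>' u\<bar> <= B"
 shows "\<bar>\<xi> u - \<xi> v\<bar> <= B * \<bar>u - v\<bar>"
 using field_differentiable_bound[of UNIV \<xi> \<xi>' B u v] assms by (auto simp: kernel_def)

lemma kernel_taylor:
 assumes k: "kernel \<eta> \<xi> \<xi>'" and k': "kernel \<eta> \<xi>' \<xi>''" and B: "!!u. \<bar>\<xi>'' u\<bar> <= B"
 shows "\<bar>\<xi> v - \<xi> u - (v - u) * \<xi>' u\<bar> <= B * \<bar>v - u\<bar> * \<bar>v - u\<bar>"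
proof -
 have "norm ((%z. \<xi> z - z * \<xi>' u) v - (%z. \<xi> z - z * \<xi>' u) u) <= (B * \<bar>v - u\<bar>) * norm (v - u)"
 proof (rule field_differentiable_bound[of "closed_segment u v" _ "%z. \<xi>' z - \<xi>' u"])
  fix z assume z: "z \<in> closed_segment u v"
  have "(\<xi> has_real_derivative \<xi>' z) (at z within closed_segment u v)"
   using k by (auto simp: kernel_def has_field_derivative_at_within)
  then show "((%z. \<xi> z - z * \<xi>' u) has_real_derivative \<xi>' z - \<xi>' u) (at z within closed_segment u v)"
   by (auto intro!: derivative_eq_intros)
  have "\<bar>\<xi>' z - \<xi>' u\<bar> <= B * \<bar>z - u\<bar>" by (rule kernel_lipschitz[OF k' B])
  also have "... <= B * \<bar>v - u\<bar>"
   using z B[of 0] by (intro mult_left_mono) (auto simp: closed_segment_eq_real_ivl split: if_splits)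
  finally show "norm (\<xi>' z - \<xi>' u) <= B * \<bar>v - u\<bar>" by simp
 qed auto
 then show ?thesis by (simp add: left_diff_distrib algebra_simps)
qed

lemma average_integrable:
 assumes k: "kernel \<eta> \<xi> \<xi>'" and B: "!!u. \<bar>\<xi> u\<bar> <= B" and [measurable]: "g \<in> Borel"
  and g: "!!s. \<bar>g s\<bar> <= C"
 shows "integrable lborel (%s. \<xi> (s - t) * g s)" "\<bar>average \<xi> g t\<bar> <= (2 * \<eta> * B) * C"
proof -
 have [measurable]: "\<xi> \<in> Borel" by (rule kernel_measurable[OF k])
 have BC: "0 <= B" "0 <= C" using B[of 0] g[of 0] by linarith+
 have \<eta>: "0 <= \<eta>" using k by (simp add: kernel_def)
 have le: "\<bar>\<xi> (s - t) * g s\<bar> <= (B * C) * (indicator {t..t+\<eta>} s + indicator {t..t+\<eta>} s)" for s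
 proof (cases "s \<in> {t..t+\<eta>}")
  case True
  have "\<bar>\<xi> (s - t)\<bar> * \<bar>g s\<bar> <= B * C" using B g BC by (intro mult_mono) auto
  moreover have "(B * C) * 1 <= (B * C) * (indicator {t..t+\<eta>} s + indicator {t..t+\<eta>} s)"
   using True BC by (intro mult_left_mono) (auto simp: indicator_def)
  ultimately show ?thesis by (simp only: abs_mult mult_1_right)
 next
  case False
  then have "\<xi> (s - t) = 0" using k by (auto simp: kernel_def)
  then show ?thesis using BC by simp
 qed
 have *: "t <= t + \<eta>" using \<eta> by simp
 have m: "(%s. \<xi> (s - t) * g s) \<in> Borel" by measurable
 note R = lborel_integral_bound[OF m * * le]
 show "integrable lborel (%s. \<xi> (s - t) * g s)" by (rule R(1))
 show "\<bar>average \<xi> g t\<bar> <= (2 * \<eta> * B) * C" using R(2) by (simp add: average_def algebra_simps)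
qed

lemma average_cmult: "average \<xi> (%s. c * g s) t = c * average \<xi> g t" 
proof -
 have "average \<xi> (%s. c * g s) t = (\<integral>s. c * (\<xi> (s - t) * g s) \<partial>lborel)" by (simp only: average_def mult.left_commute)
 then show ?thesis by (simp add: average_def)
qed

lemma average_diff:
 assumes k: "kernel \<eta> \<xi> \<xi>'" and "g \<in> Borel" "h \<in> Borel"
  and "!!s. \<bar>g s\<bar> <= C" "!!s. \<bar>h s\<bar> <= D"
 shows "average \<xi> (%s. g s - h s) t = average \<xi> g t - average \<xi> h t"
proof -
 obtain B where B: "!!u. \<bar>\<xi> u\<bar> <= B" using kernel_bounded[OF k] by blast
 show ?thesis
  unfolding average_def right_diff_distrib
  by (intro Bochner_Integration.integral_diff average_integrable(1)[OF k B _ assms(4)] average_integrable(1)[OF k B _ assms(5)] assms)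
qed

lemma average_time_lipschitz:
 assumes k: "kernel \<eta> \<xi> \<xi>'" and B: "!!u. \<bar>\<xi>' u\<bar> <= B" and [measurable]: "g \<in> Borel"
  and g: "!!s. \<bar>g s\<bar> <= C"
 shows "\<bar>average \<xi> g t' - average \<xi> g t\<bar> <= (2 * \<eta> * B) * C * \<bar>t' - t\<bar>"
proof -
 have [measurable]: "\<xi> \<in> Borel" by (rule kernel_measurable[OF k])
 have BC: "0 <= B" "0 <= C" using B[of 0] g[of 0] by linarith+
 have \<eta>: "0 <= \<eta>" using k by (simp add: kernel_def)
 obtain B0 where B0: "!!u. \<bar>\<xi> u\<bar> <= B0" using kernel_bounded[OF k] by blast
 have le: "\<bar>(\<xi> (s - t') - \<xi> (s - t)) * g s\<bar> <= (B * \<bar>t' - t\<bar> * C) * (indicator {t'..t'+\<eta>} s + indicator {t..t+\<eta>} s)" for s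
 proof (cases "s \<in> {t'..t'+\<eta>} \<union> {t..t+\<eta>}")
  case True
  have "\<bar>\<xi> (s - t') - \<xi> (s - t)\<bar> * \<bar>g s\<bar> <= (B * \<bar>t' - t\<bar>) * C"
   using kernel_lipschitz[OF k B, of "s - t'" "s - t"] g BC by (intro mult_mono) (auto simp: abs_minus_commute)
  moreover have "(B * \<bar>t' - t\<bar> * C) * 1 <= (B * \<bar>t' - t\<bar> * C) * (indicator {t'..t'+\<eta>} s + indicator {t..t+\<eta>} s)"
   using True BC by (intro mult_left_mono) (auto simp: indicator_def)
  ultimately show ?thesis by (simp add: abs_mult)
 next
  case False
  then have "\<xi> (s - t') = 0" "\<xi> (s - t) = 0" using k by (auto simp: kernel_def)
  then show ?thesis using BC by simp
 qed
 have *: "t <= t + \<eta>" "t' <= t' + \<eta>" using \<eta> by simp_all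
 have m: "(%s. (\<xi> (s - t') - \<xi> (s - t)) * g s) \<in> Borel" by measurable
 have "average \<xi> g t' - average \<xi> g t = (\<integral>s. (\<xi> (s - t') - \<xi> (s - t)) * g s \<partial>lborel)"
  using average_integrable(1)[OF k B0 _ g] unfolding average_def by (simp add: left_diff_distrib)
 then show ?thesis using lborel_integral_bound(2)[OF m *(2) *(1) le] by (simp add: algebra_simps)
qed

lemma average_time_derivative:
 assumes k: "kernel \<eta> \<xi> \<xi>'" and k': "kernel \<eta> \<xi>' \<xi>''" and [measurable]: "g \<in> Borel"
  and g: "!!s. \<bar>g s\<bar> <= C"
 shows "(average \<xi> g has_real_derivative - average \<xi>' g t) (at t within S)"
proof -
 have [measurable]: "\<xi> \<in> Borel" "\<xi>' \<in> Borel"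
  by (rule kernel_measurable[OF k] kernel_measurable[OF k'])+
 obtain B where B: "!!u. \<bar>\<xi>'' u\<bar> <= B" using k' unfolding kernel_def by auto
 have BC: "0 <= B" "0 <= C" using B[of 0] g[of 0] by linarith+
 have \<eta>: "0 <= \<eta>" using k by (simp add: kernel_def)
 obtain B0 where B0: "!!u. \<bar>\<xi> u\<bar> <= B0" using kernel_bounded[OF k] by blast
 obtain B1 where B1: "!!u. \<bar>\<xi>' u\<bar> <= B1" using kernel_bounded[OF k'] by blast
 have bd: "\<bar>average \<xi> g t' - average \<xi> g t - (t' - t) * - average \<xi>' g t\<bar> <= (2 * \<eta> * B * C) * \<bar>t' - t\<bar> * \<bar>t' - t\<bar>" for t'
 proof -
  let ?R = "%s. \<xi> (s - t') - \<xi> (s - t) - ((s - t') - (s - t)) * \<xi>' (s - t)"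
  have le: "\<bar>?R s * g s\<bar> <= (B * \<bar>t' - t\<bar> * \<bar>t' - t\<bar> * C) * (indicator {t'..t'+\<eta>} s + indicator {t..t+\<eta>} s)" for s
  proof (cases "s \<in> {t'..t'+\<eta>} \<union> {t..t+\<eta>}")
   case True
   have "\<bar>?R s\<bar> * \<bar>g s\<bar> <= (B * \<bar>t' - t\<bar> * \<bar>t' - t\<bar>) * C"
    using kernel_taylor[OF k k' B, of "s - t'" "s - t"] g BC by (intro mult_mono) (auto simp: abs_minus_commute)
   moreover have "(B * \<bar>t' - t\<bar> * \<bar>t' - t\<bar> * C) * 1 <= (B * \<bar>t' - t\<bar> * \<bar>t' - t\<bar> * C) * (indicator {t'..t'+\<eta>} s + indicator {t..t+\<eta>} s)"
    using True BC by (intro mult_left_mono) (auto simp: indicator_def)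
   ultimately show ?thesis by (simp only: abs_mult mult_1_right)
  next
   case False
   then have "\<xi> (s - t') = 0" "\<xi> (s - t) = 0" "\<xi>' (s - t) = 0" using k k' by (auto simp: kernel_def)
   then show ?thesis using BC by simp
  qed
  have *: "t <= t + \<eta>" "t' <= t' + \<eta>" using \<eta> by simp_all
  have m: "(%s. ?R s * g s) \<in> Borel" by measurable
  have "(\<integral>s. ?R s * g s \<partial>lborel) = (\<integral>s. \<xi> (s - t') * g s - \<xi> (s - t) * g s + (t' - t) * (\<xi>' (s - t) * g s) \<partial>lborel)"
   by (intro Bochner_Integration.integral_cong refl) (simp add: algebra_simps)
  also have "... = average \<xi> g t' - average \<xi> g t + (t' - t) * average \<xi>' g t"
   using average_integrable(1)[OF k B0 _ g] average_integrable(1)[OF k' B1 _ g] unfolding average_def by simp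
  finally show ?thesis using lborel_integral_bound(2)[OF m *(2) *(1) le] by (simp add: algebra_simps)
 qed
 show ?thesis
 proof (rule has_derivative_from_bound[of 1])
  fix t' assume "\<bar>t' - t\<bar> < 1"
  then have "(2 * \<eta> * B * C * \<bar>t' - t\<bar>) * \<bar>t' - t\<bar> <= (2 * \<eta> * B * C * \<bar>t' - t\<bar>) * sqrt \<bar>t' - t\<bar>"
   using \<eta> BC by (intro mult_left_mono le_sqrt mult_nonneg_nonneg) auto
  then show "\<bar>average \<xi> g t' - average \<xi> g t - (t' - t) * - average \<xi>' g t\<bar> <= (2 * \<eta> * B * C) * \<bar>t' - t\<bar> * sqrt \<bar>t' - t\<bar>"
   using bd[of t'] by linarith
 qed simp
qed

text \<open>Only measurability is asked in time, as nothing more is known of a solution by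
  transposition; averaging supplies the rest. In space, Hoelder continuity of exponent 1/2 is the
  regularity of a primitive of a square-integrable function, and uniformity in \<open>s\<close> lets
  it pass through averages.\<close>

definition profile :: "(real => real => real) => bool" where
 "profile \<Psi> \<longleftrightarrow> (\<forall>x\<in>{0<..1}. (%s. \<Psi> s x) \<in> Borel) &
   (\<forall>a\<in>{0<..1}. \<exists>L. \<forall>s. \<forall>x\<in>{a..1}. \<bar>\<Psi> s x\<bar> <= L & (\<forall>x'\<in>{a..1}. \<bar>\<Psi> s x' - \<Psi> s x\<bar> <= L * sqrt \<bar>x' - x\<bar>))"

lemma profileD:
 assumes "profile \<Psi>" "a \<in> {0<..1}"
 obtains L where "0 <= L" "!!s x. x \<in> {a..1} ==> \<bar>\<Psi> s x\<bar> <= L"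
  "!!s x x'. x \<in> {a..1} ==> x' \<in> {a..1} ==> \<bar>\<Psi> s x' - \<Psi> s x\<bar> <= L * sqrt \<bar>x' - x\<bar>"
proof -
 obtain L where L: "!!s x. x \<in> {a..1} ==> \<bar>\<Psi> s x\<bar> <= L"
  "!!s x x'. x \<in> {a..1} ==> x' \<in> {a..1} ==> \<bar>\<Psi> s x' - \<Psi> s x\<bar> <= L * sqrt \<bar>x' - x\<bar>"
  using assms unfolding profile_def by meson
 have "0 <= L" using L(1)[of 1 0] assms by auto
 then show thesis using L by (rule that)
qed

lemma profile_bounded:
 assumes "profile \<Psi>" "a \<in> {0<..1}"
 obtains L where "!!s x. x \<in> {a..1} ==> \<bar>\<Psi> s x\<bar> <= L"
 using profileD[OF assms] that by metis

lemma profile_measurable: "profile \<Psi> ==> x \<in> {0<..1} ==> (%s. \<Psi> s x) \<in> Borel"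
 unfolding profile_def by blast

lemma average_profile_continuous:
 assumes k: "kernel \<eta> \<xi> \<xi>'" and \<Psi>: "profile \<Psi>"
 shows "continuous_on (S \<times> {0<..1}) (%(t, x). average \<xi> (%s. \<Psi> s x) t)"
 unfolding continuous_on_def
proof (intro ballI)
 fix z :: "real \<times> real" assume "z \<in> S \<times> {0<..1}"
 then obtain t x where z: "z = (t, x)" and x: "x \<in> {0<..1}" by auto
 have m: "(%s. \<Psi> s x) \<in> Borel" if "x \<in> {0<..1}" for x using \<Psi> that by (simp add: profile_def)
 obtain L where L: "0 <= L" "!!s x'. x' \<in> {x/2..1} ==> \<bar>\<Psi> s x'\<bar> <= L"
  "!!s y x'. y \<in> {x/2..1} ==> x' \<in> {x/2..1} ==> \<bar>\<Psi> s x' - \<Psi> s y\<bar> <= L * sqrt \<bar>x' - y\<bar>"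
  using profileD[OF \<Psi>, of "x/2"] x by auto
 obtain B where B: "!!u. \<bar>\<xi> u\<bar> <= B" using kernel_bounded[OF k] by blast
 obtain B' where B': "!!u. \<bar>\<xi>' u\<bar> <= B'" using k unfolding kernel_def by auto
 let ?F = "%(t, x). average \<xi> (%s. \<Psi> s x) t"
 have "((%z. ?F z - ?F (t, x)) \<longlongrightarrow> 0) (at (t, x) within S \<times> {0<..1})"
 proof (rule Lim_null_comparison)
  have "eventually (%z. z \<in> S \<times> {0<..1}) (at (t, x) within S \<times> {0<..1})" by (simp add: eventually_at_filter)
  moreover have "eventually (%z. x / 2 < snd z) (at (t, x) within S \<times> {0<..1})"
   by (rule order_tendstoD(1)[OF tendsto_snd[OF tendsto_ident_at]]) (use x in simp)
  ultimately show "eventually (%z. norm (?F z - ?F (t, x))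
   <= (2 * \<eta> * B') * L * \<bar>fst z - t\<bar> + (2 * \<eta> * B) * (L * sqrt \<bar>snd z - x\<bar>)) (at (t, x) within S \<times> {0<..1})"
  proof eventually_elim
   case (elim z)
   obtain t' x' where z: "z = (t', x')" by (cases z)
   have x': "x' \<in> {x/2..1}" "x' \<in> {0<..1}" and xx: "x \<in> {x/2..1}" using elim x unfolding z by auto
   have "\<bar>average \<xi> (%s. \<Psi> s x') t' - average \<xi> (%s. \<Psi> s x') t\<bar> <= (2 * \<eta> * B') * L * \<bar>t' - t\<bar>"
    by (rule average_time_lipschitz[OF k B' m[OF x'(2)] L(2)[OF x'(1)]])
   moreover have "\<bar>average \<xi> (%s. \<Psi> s x' - \<Psi> s x) t\<bar> <= (2 * \<eta> * B) * (L * sqrt \<bar>x' - x\<bar>)"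
    by (rule average_integrable(2)[OF k B borel_measurable_diff[OF m[OF x'(2)] m[OF x]] L(3)[OF xx x'(1)]])
   moreover have "average \<xi> (%s. \<Psi> s x' - \<Psi> s x) t = average \<xi> (%s. \<Psi> s x') t - average \<xi> (%s. \<Psi> s x) t"
    by (rule average_diff[OF k m[OF x'(2)] m[OF x] L(2)[OF x'(1)] L(2)[OF xx]])
   ultimately show ?case unfolding z by simp
  qed
  have "((%z. (2 * \<eta> * B') * L * \<bar>fst z - t\<bar> + (2 * \<eta> * B) * (L * sqrt \<bar>snd z - x\<bar>)) \<longlongrightarrow>
    (2 * \<eta> * B') * L * \<bar>fst (t, x) - t\<bar> + (2 * \<eta> * B) * (L * sqrt \<bar>snd (t, x) - x\<bar>)) (at (t, x) within S \<times> {0<..1})"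
   by (intro tendsto_intros tendsto_ident_at)
  then show "((%z. (2 * \<eta> * B') * L * \<bar>fst z - t\<bar> + (2 * \<eta> * B) * (L * sqrt \<bar>snd z - x\<bar>)) \<longlongrightarrow> 0) (at (t, x) within S \<times> {0<..1})"
   by simp
 qed
 then show "(?F \<longlongrightarrow> ?F z) (at z within S \<times> {0<..1})" unfolding z LIM_zero_iff .
qed

lemma average_space_derivative:
 assumes k: "kernel \<eta> \<xi> \<xi>'" and \<Psi>: "profile \<Psi>" and \<Psi>': "profile \<Psi>'" and x: "x \<in> {0<..1}"
  and L: "!!a. a \<in> {0<..1} ==> \<exists>L. \<forall>s. \<forall>x\<in>{a..1}. \<forall>x'\<in>{a..1}. \<bar>\<Psi> s x' - \<Psi> s x - (x' - x) * \<Psi>' s x\<bar> <= L * \<bar>x' - x\<bar> * sqrt \<bar>x' - x\<bar>"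
 shows "((%x. average \<xi> (%s. \<Psi> s x) t) has_real_derivative average \<xi> (%s. \<Psi>' s x) t) (at x within {0<..1})"
proof -
 have x2: "x / 2 \<in> {0<..1}" using x by auto
 obtain N where N: "\<forall>s. \<forall>y\<in>{x/2..1}. \<forall>x'\<in>{x/2..1}. \<bar>\<Psi> s x' - \<Psi> s y - (x' - y) * \<Psi>' s y\<bar> <= N * \<bar>x' - y\<bar> * sqrt \<bar>x' - y\<bar>"
  using L[OF x2] ..
 have m: "(%s. \<Psi> s x) \<in> Borel" "(%s. \<Psi>' s x) \<in> Borel" if "x \<in> {0<..1}" for x
  by (rule profile_measurable[OF \<Psi> that] profile_measurable[OF \<Psi>' that])+
 obtain C where C: "!!s y. y \<in> {x/2..1} ==> \<bar>\<Psi> s y\<bar> <= C" using profile_bounded[OF \<Psi> x2] by metis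
 obtain C' where C': "!!s y. y \<in> {x/2..1} ==> \<bar>\<Psi>' s y\<bar> <= C'" using profile_bounded[OF \<Psi>' x2] by metis
 obtain B where B: "!!u. \<bar>\<xi> u\<bar> <= B" using kernel_bounded[OF k] by blast
 have xx: "x \<in> {x/2..1}" using x by auto
 show ?thesis
 proof (rule has_derivative_from_bound[of "x/2"])
  fix x' assume x': "x' \<in> {0<..1}" "\<bar>x' - x\<bar> < x / 2"
  then have "x / 2 <= x'" "x' <= 1" using abs_ge_minus_self[of "x' - x"] by auto
  then have x2': "x' \<in> {x/2..1}" by simp
  have d: "\<bar>\<Psi> s x' - \<Psi> s x\<bar> <= C + C" "\<bar>(x' - x) * \<Psi>' s x\<bar> <= \<bar>x' - x\<bar> * C'" for s
  proof -
   show "\<bar>\<Psi> s x' - \<Psi> s x\<bar> <= C + C" using C[OF x2', of s] C[OF xx, of s] by linarith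
   show "\<bar>(x' - x) * \<Psi>' s x\<bar> <= \<bar>x' - x\<bar> * C'"
    unfolding abs_mult by (intro mult_left_mono C'[OF xx]) simp
  qed
  have mm: "(%s. \<Psi> s x' - \<Psi> s x) \<in> Borel" "(%s. (x' - x) * \<Psi>' s x) \<in> Borel"
   using m[OF x'(1)] m[OF x] by simp_all
  have "average \<xi> (%s. (\<Psi> s x' - \<Psi> s x) - (x' - x) * \<Psi>' s x) t
    = average \<xi> (%s. \<Psi> s x') t - average \<xi> (%s. \<Psi> s x) t - (x' - x) * average \<xi> (%s. \<Psi>' s x) t"
   unfolding average_diff[OF k mm d] average_diff[OF k m(1)[OF x'(1)] m(1)[OF x] C[OF x2'] C[OF xx]] average_cmult ..
  moreover have "\<bar>average \<xi> (%s. (\<Psi> s x' - \<Psi> s x) - (x' - x) * \<Psi>' s x) t\<bar> <= (2 * \<eta> * B) * (N * \<bar>x' - x\<bar> * sqrt \<bar>x' - x\<bar>)"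
   by (rule average_integrable(2)[OF k B borel_measurable_diff[OF mm] N[rule_format, OF xx x2']])
  ultimately show "\<bar>average \<xi> (%s. \<Psi> s x') t - average \<xi> (%s. \<Psi> s x) t - (x' - x) * average \<xi> (%s. \<Psi>' s x) t\<bar>
    <= (2 * \<eta> * B * N) * \<bar>x' - x\<bar> * sqrt \<bar>x' - x\<bar>" by (simp add: mult.assoc)
 qed (use x in simp)
qed

lemma average_integral_commute:
 assumes k: "kernel \<eta> \<xi> \<xi>'" and \<Psi>[measurable]: "(%(s, x). \<Psi> s x) \<in> borel_measurable (borel \<Otimes>\<^sub>M borel)"
  and h[measurable]: "h \<in> Borel" and b: "integrable U (%x. b x * h x)"
  and le: "!!s x. 0 < x ==> x < 1 ==> \<bar>\<Psi> s x\<bar> <= b x"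
 shows "(\<integral>x. average \<xi> (%s. \<Psi> s x) t * h x \<partial>U) = average \<xi> (%s. \<integral>x. \<Psi> s x * h x \<partial>U) t"
proof -
 have [measurable]: "\<xi> \<in> Borel" by (rule kernel_measurable[OF k])
 obtain B where B: "0 <= B" "!!u. \<bar>\<xi> u\<bar> <= B" using kernel_bounded[OF k] by blast
 have i1: "integrable lborel (%s. B * indicator {t..t+\<eta>} s :: real)"
  by (intro integrable_mult_right integrable_real_indicator) (auto simp: emeasure_lborel_Icc_eq)
 have i: "integrable (lborel \<Otimes>\<^sub>M U) (%(s, x). \<xi> (s - t) * (\<Psi> s x * h x))"
 proof (rule LU.integrable_product_bound[OF i1 b])
  show "(%(s, x). \<xi> (s - t) * (\<Psi> s x * h x)) \<in> borel_measurable (lborel \<Otimes>\<^sub>M U)" by measurable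
  have "AE z in lborel \<Otimes>\<^sub>M U. 0 < snd z & snd z < 1"
  proof (rule LU.AE_pair_measure)
   show "{z \<in> space (lborel \<Otimes>\<^sub>M U). 0 < snd z & snd z < 1} \<in> sets (lborel \<Otimes>\<^sub>M U)" by measurable
  qed (use U_AE_in in simp)
  then show "AE z in lborel \<Otimes>\<^sub>M U. \<bar>(%(s, x). \<xi> (s - t) * (\<Psi> s x * h x)) z\<bar>
   <= \<bar>B * indicator {t..t+\<eta>} (fst z) * (b (snd z) * h (snd z))\<bar>"
  proof eventually_elim
   case (elim z)
   obtain s x where z: "z = (s, x)" by (cases z)
   have "\<bar>\<Psi> s x\<bar> <= \<bar>b x\<bar>" using le[of x s] elim unfolding z by simp
   then have "\<bar>\<Psi> s x * h x\<bar> <= \<bar>b x * h x\<bar>" by (simp add: abs_mult mult_right_mono)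
   moreover have "\<bar>\<xi> (s - t)\<bar> <= \<bar>B * indicator {t..t+\<eta>} s\<bar>"
    using B k by (auto simp: kernel_def indicator_def)
   ultimately show ?case unfolding z by (simp only: abs_mult[of "\<xi> _"] abs_mult[of "B * _"] case_prod_conv fst_conv snd_conv) (intro mult_mono, auto)
  qed
 qed
 have "(\<integral>x. average \<xi> (%s. \<Psi> s x) t * h x \<partial>U) = (\<integral>x. (\<integral>s. \<xi> (s - t) * (\<Psi> s x * h x) \<partial>lborel) \<partial>U)"
  unfolding average_def integral_mult_left_zero[symmetric] by (simp only: mult.assoc)
 also have "... = (\<integral>s. (\<integral>x. \<xi> (s - t) * (\<Psi> s x * h x) \<partial>U) \<partial>lborel)"
  by (rule LU.Fubini_integral[OF i])
 also have "... = average \<xi> (%s. \<integral>x. \<Psi> s x * h x \<partial>U) t" by (simp add: average_def)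
 finally show ?thesis .
qed

lemma J_approx:
 assumes f: "integrable U f" and ab: "0 <= a" "a <= b" "b <= 1" and le: "!!x. x \<in> {a<..b} ==> \<bar>f x - c\<bar> <= D"
 shows "\<bar>J f a b - (b - a) * c\<bar> <= (b - a) * D"
proof -
 have m: "(\<integral>x. indicator {a<..b} x * C \<partial>U) = (b - a) * C" for C :: real
 proof -
  have "integrable U (%x. indicator {a<..b} x * C)" by (intro U_indicator_integrable) auto
  then have "((%x. C) has_integral J (%x. C) a b) {a..b}" by (intro J_has_integral) (use ab in auto)
  moreover have "((%x. C) has_integral (b - a) * C) {a..b}" using has_integral_const_real[of C a b] ab by simp
  ultimately show ?thesis unfolding J_def by (rule has_integral_unique)
 qed
 have i: "integrable U (%x. indicator {a<..b} x * f x)" "integrable U (%x. indicator {a<..b} x * C)" for C :: real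
  by (intro U_indicator_integrable f; simp)+
 have "J f a b - (b - a) * c = (\<integral>x. indicator {a<..b} x * f x - indicator {a<..b} x * c \<partial>U)"
  unfolding J_def m[symmetric] by (rule Bochner_Integration.integral_diff[symmetric]) (rule i)+
 also have "\<bar>...\<bar> <= (\<integral>x. \<bar>indicator {a<..b} x * f x - indicator {a<..b} x * c\<bar> \<partial>U)" by (rule integral_abs_bound)
 also have "... <= (\<integral>x. indicator {a<..b} x * D \<partial>U)"
  by (rule integral_mono) (use i le in "auto simp: indicator_def")
 finally show ?thesis unfolding m .
qed

text \<open>The energy estimates are available on \<open>{a<..1}\<close> with a bound uniform in
  \<open>a\<close>; monotone convergence carries them to the degenerate end.\<close>

lemma sq_norm2_from_below:
 assumes [measurable]: "f \<in> Borel" and K: "0 <= K"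
  and le: "!!a. 0 < a ==> a < 1 ==> integrable U (%x. indicator {a<..1} x * (f x)^2) & (\<integral>x. indicator {a<..1} x * (f x)^2 \<partial>U) <= K^2"
 shows "sq f" "norm2 f <= K"
proof -
 define F where "F n x = indicator {1 / (real n + 2)<..1} x * (f x)^2" for n :: nat and x
 have a: "0 < 1 / (real n + 2)" "1 / (real n + 2) < 1" for n by (simp_all add: field_simps)
 have Fm: "F m x <= F n x" if "m <= n" for m n x
 proof -
  from that have "1 / (real n + 2) <= 1 / (real m + 2)" by (simp add: field_simps)
  then show "F m x <= F n x" unfolding F_def by (auto simp: indicator_def)
 qed
 then have mono: "AE x in U. mono (%n. F n x)" by (intro AE_I2 monoI)
 have lim: "AE x in U. (%n. F n x) \<longlonglongrightarrow> (f x)\<^sup>2"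
  using U_AE_in
 proof eventually_elim
  case (elim x)
  obtain N where N: "inverse (real (Suc N)) < x" using reals_Archimedean elim by blast
  have "F n x = (f x)^2" if "N <= n" for n
  proof -
   have "1 / (real n + 2) <= inverse (real (Suc N))" using that by (simp add: field_simps)
   then show ?thesis using N elim unfolding F_def by auto
  qed
  then show ?case by (intro tendsto_eventually eventually_sequentiallyI)
 qed
 have Fi: "integrable U (F n)" "integral\<^sup>L U (F n) <= K^2" for n
  using le[OF a, of n] unfolding F_def[abs_def] by auto
 define I where "I = lim (%n. integral\<^sup>L U (F n))"
 have inc: "incseq (%n. integral\<^sup>L U (F n))"
  by (intro incseq_SucI integral_mono Fi Fm) simp
 have "convergent (%n. integral\<^sup>L U (F n))"
  by (rule incseq_convergent[OF inc]) (use Fi(2) in "auto intro: convergentI")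
 then have I: "(%n. integral\<^sup>L U (F n)) \<longlonglongrightarrow> I" unfolding I_def by (simp add: convergent_LIMSEQ_iff)
 note R = integrable_monotone_convergence[OF Fi(1) mono lim I]
 have i: "integrable U (%x. (f x)^2)" by (rule R) simp
 then show "sq f" by (simp add: sq_def)
 have "(\<integral>x. (f x)^2 \<partial>U) = I" by (rule integral_monotone_convergence[OF Fi(1) mono lim I]) simp
 moreover have "I <= K^2" by (rule LIMSEQ_le_const2[OF I]) (use Fi(2) in auto)
 ultimately show "norm2 f <= K" unfolding norm2_def using K by (simp add: real_le_lsqrt)
qed

section \<open>Square-integrable paths and the wave system of their averages\<close>

definition pairing :: "(real => real) => (real => real) => real" where
 "pairing f g = (\<integral>x. f x * g x \<partial>U)"

text \<open>Describes a representative of the solution that is Borel in both variables and norm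
  bounded at every time, not merely at almost every time.\<close>

locale bounded_path = degenerate \<alpha> for \<alpha> +
 fixes V :: "real => real => real" and M :: real
 assumes V[measurable]: "(%(s, x). V s x) \<in> borel_measurable (borel \<Otimes>\<^sub>M borel)"
  and Vsq: "!!s. sq (V s)" and VM: "!!s. norm2 (V s) <= M"
begin

lemma M: "0 <= M" using VM[of 0] norm2_nonneg[of "V 0"] by linarith

lemma Pop_joint[measurable]: "(%(s, x). Pop (V s) x) \<in> borel_measurable (borel \<Otimes>\<^sub>M borel)"
proof -
 have m: "(%(z, r). indicator {0<..snd z} r * V (fst z) r) \<in> borel_measurable ((borel \<Otimes>\<^sub>M borel) \<Otimes>\<^sub>M U)"
  "(%(z, r). cK r * V (fst z) r) \<in> borel_measurable ((borel \<Otimes>\<^sub>M (borel :: real measure)) \<Otimes>\<^sub>M U)"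
  unfolding greaterThanAtMost_iff indicator_def of_bool_def by measurable
 show ?thesis
  using borel_measurable_diff[OF U.borel_measurable_lebesgue_integral[OF m(1)] U.borel_measurable_lebesgue_integral[OF m(2)]]
  by (simp add: Pop_def J_def case_prod_unfold)
qed

lemma flux_joint[measurable]: "(%(s, x). flux (V s) x) \<in> borel_measurable (borel \<Otimes>\<^sub>M borel)"
 unfolding flux_def by measurable

lemma Sop_joint[measurable]: "(%(s, x). Sop (V s) x) \<in> borel_measurable (borel \<Otimes>\<^sub>M borel)"
proof -
 have m: "(%(z, r). indicator {snd z<..1} r * flux (V (fst z)) r) \<in> borel_measurable ((borel \<Otimes>\<^sub>M borel) \<Otimes>\<^sub>M U)"
  unfolding greaterThanAtMost_iff indicator_def of_bool_def by measurable
 show ?thesis using U.borel_measurable_lebesgue_integral[OF m] by (simp add: Sop_def J_def case_prod_unfold)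
qed

lemma pairing_measurable[measurable]:
 assumes [measurable]: "f \<in> Borel"
 shows "(%s. pairing (V s) f) \<in> Borel"
proof -
 have m: "(%(s, x). V s x * f x) \<in> borel_measurable (borel \<Otimes>\<^sub>M U)" by measurable
 show ?thesis using U.borel_measurable_lebesgue_integral[OF m] by (simp add: pairing_def)
qed

lemma pairing_bound: "sq f ==> \<bar>pairing (V s) f\<bar> <= M * norm2 f"
 using sq_cs(2)[OF Vsq, of f s] mult_right_mono[OF VM norm2_nonneg, of s f] unfolding pairing_def by linarith

lemma Pop_le: "0 < x ==> x <= 1 ==> \<bar>Pop (V s) x\<bar> <= flux_bd x * M"
 by (rule order.trans[OF Pop_bound[OF Vsq] mult_left_mono[OF VM]]) (auto simp: flux_bd_def)

lemma Sop_le: "0 < x ==> x <= 1 ==> \<bar>Sop (V s) x\<bar> <= sol_bd x * M"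
 by (rule order.trans[OF Sop_bound[OF Vsq] mult_left_mono[OF VM]]) (auto simp: sol_bd_def)

lemma Pop_holder:
 assumes "x \<in> {0..1}" "x' \<in> {0..1}"
 shows "\<bar>Pop (V s) x' - Pop (V s) x\<bar> <= M * sqrt \<bar>x' - x\<bar>"
proof -
 have *: "\<bar>Pop (V s) v - Pop (V s) u\<bar> <= M * sqrt (v - u)" if "0 <= u" "u <= v" "v <= 1" for u v
  using Pop_diff[OF Vsq that(1,2), of s] J_bound(1)[OF Vsq that, of s] mult_left_mono[OF VM, of "sqrt (v - u)" s] that
  by (simp add: mult.commute)
 show ?thesis
  using *[of x x'] *[of x' x] assms by (cases "x <= x'") (auto simp: abs_minus_commute)
qed

lemma profile_Pop: "profile (%s. Pop (V s))"
 unfolding profile_def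
proof (intro conjI ballI)
 fix a :: real assume a: "a \<in> {0<..1}"
 show "\<exists>L. \<forall>s. \<forall>x\<in>{a..1}. \<bar>Pop (V s) x\<bar> <= L & (\<forall>x'\<in>{a..1}. \<bar>Pop (V s) x' - Pop (V s) x\<bar> <= L * sqrt \<bar>x' - x\<bar>)"
 proof (intro exI[of _ "2 * M"] allI ballI conjI)
  fix s x assume x: "x \<in> {a..1}"
  have "flux_bd x <= 2" using x a by (simp add: flux_bd_def real_le_lsqrt)
  then have "flux_bd x * M <= 2 * M" using M by (rule mult_right_mono)
  then show "\<bar>Pop (V s) x\<bar> <= 2 * M" using Pop_le[of x s] x a by simp
  fix x' assume x': "x' \<in> {a..1}"
  have "M * sqrt \<bar>x' - x\<bar> <= 2 * M * sqrt \<bar>x' - x\<bar>" using M by (intro mult_right_mono) auto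
  then show "\<bar>Pop (V s) x' - Pop (V s) x\<bar> <= 2 * M * sqrt \<bar>x' - x\<bar>" using Pop_holder[of x x' s] x x' a by simp
 qed
qed measurable

text \<open>Product rule for the Hoelder function \<open>Pop\<close> and the power
  \<open>x^(-\<alpha>)\<close>, which is Lipschitz away from 0.\<close>

lemma profile_flux: "profile (%s x. - flux (V s) x)"
 unfolding profile_def
proof (intro conjI ballI)
 fix a :: real assume a: "a \<in> {0<..1}"
 obtain L where L: "0 <= L" "!!s x. x \<in> {a..1} ==> \<bar>Pop (V s) x\<bar> <= L"
  "!!s x x'. x \<in> {a..1} ==> x' \<in> {a..1} ==> \<bar>Pop (V s) x' - Pop (V s) x\<bar> <= L * sqrt \<bar>x' - x\<bar>"
  using profileD[OF profile_Pop a] by metis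
 define A where "A = a powr - \<alpha>"
 define A' where "A' = \<alpha> * a powr (- \<alpha> - 1)"
 have A: "0 <= A" "0 <= A'" using \<alpha> by (simp_all add: A_def A'_def)
 have r: "x powr - \<alpha> <= A" if "x \<in> {a..1}" for x
  unfolding A_def using that a \<alpha> by (intro powr_mono2') auto
 have r': "\<bar>x' powr - \<alpha> - x powr - \<alpha>\<bar> <= A' * sqrt \<bar>x' - x\<bar>" if "x \<in> {a..1}" "x' \<in> {a..1}" for x x'
 proof -
  have "norm (x' powr - \<alpha> - x powr - \<alpha>) <= A' * norm (x' - x)"
  proof (rule field_differentiable_bound[of "{a..1}" _ "%z. - \<alpha> * z powr (- \<alpha> - 1)"])
   fix z assume z: "z \<in> {a..1}"
   show "((%z. z powr - \<alpha>) has_real_derivative - \<alpha> * z powr (- \<alpha> - 1)) (at z within {a..1})"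
    by (rule has_field_derivative_at_within[OF has_real_derivative_powr]) (use z a in auto)
   have "z powr (- \<alpha> - 1) <= a powr (- \<alpha> - 1)" using z a \<alpha> by (intro powr_mono2') auto
   then show "norm (- \<alpha> * z powr (- \<alpha> - 1)) <= A'" using \<alpha> by (simp add: A'_def abs_mult)
  qed (use that in auto)
  also have "... <= A' * sqrt \<bar>x' - x\<bar>"
   using that a A by (intro mult_left_mono) (auto intro!: le_sqrt)
  finally show ?thesis by simp
 qed
 show "\<exists>L. \<forall>s. \<forall>x\<in>{a..1}. \<bar>- flux (V s) x\<bar> <= L & (\<forall>x'\<in>{a..1}. \<bar>- flux (V s) x' - - flux (V s) x\<bar> <= L * sqrt \<bar>x' - x\<bar>)"
 proof (intro exI[of _ "A * L + A' * L"] allI ballI conjI)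
  fix s x assume x: "x \<in> {a..1}"
  have "\<bar>flux (V s) x\<bar> <= A * L" unfolding flux_def abs_mult
   using r[OF x] L(2)[OF x, of s] A by (intro mult_mono) auto
  then show "\<bar>- flux (V s) x\<bar> <= A * L + A' * L" using mult_nonneg_nonneg[OF A(2) L(1)] by simp
  fix x' assume x': "x' \<in> {a..1}"
  have "\<bar>x' powr - \<alpha> * (Pop (V s) x' - Pop (V s) x)\<bar> <= A * (L * sqrt \<bar>x' - x\<bar>)"
   unfolding abs_mult using r[OF x'] L(3)[OF x x', of s] A by (intro mult_mono) auto
  moreover have "\<bar>(x' powr - \<alpha> - x powr - \<alpha>) * Pop (V s) x\<bar> <= (A' * sqrt \<bar>x' - x\<bar>) * L"
   unfolding abs_mult using r'[OF x x'] L(2)[OF x, of s] A by (intro mult_mono) auto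
  moreover have "- flux (V s) x' - - flux (V s) x = - (x' powr - \<alpha> * (Pop (V s) x' - Pop (V s) x) + (x' powr - \<alpha> - x powr - \<alpha>) * Pop (V s) x)"
   by (simp add: flux_def right_diff_distrib left_diff_distrib)
  moreover have "(A * L + A' * L) * sqrt \<bar>x' - x\<bar> = A * (L * sqrt \<bar>x' - x\<bar>) + (A' * sqrt \<bar>x' - x\<bar>) * L"
   by (simp add: distrib_right)
  ultimately show "\<bar>- flux (V s) x' - - flux (V s) x\<bar> <= (A * L + A' * L) * sqrt \<bar>x' - x\<bar>"
   by linarith
 qed
qed measurable

lemma Sop_taylor:
 assumes a: "a \<in> {0<..1}"
 shows "\<exists>L. \<forall>s. \<forall>x\<in>{a..1}. \<forall>x'\<in>{a..1}. \<bar>Sop (V s) x' - Sop (V s) x - (x' - x) * - flux (V s) x\<bar> <= L * \<bar>x' - x\<bar> * sqrt \<bar>x' - x\<bar>"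
proof -
 obtain L where L: "0 <= L" "!!s x x'. x \<in> {a..1} ==> x' \<in> {a..1} ==> \<bar>- flux (V s) x' - - flux (V s) x\<bar> <= L * sqrt \<bar>x' - x\<bar>"
  using profileD[OF profile_flux a] by metis
 show ?thesis
 proof (intro exI[of _ L] allI ballI)
  fix s x x' assume x: "x \<in> {a..1}" "x' \<in> {a..1}"
  let ?S = "closed_segment x x'"
  have sub: "?S <= {a..1}" using x by (auto simp: closed_segment_eq_real_ivl)
  have "norm ((%z. Sop (V s) z + z * flux (V s) x) x' - (%z. Sop (V s) z + z * flux (V s) x) x) <= (L * sqrt \<bar>x' - x\<bar>) * norm (x' - x)"
  proof (rule field_differentiable_bound[of ?S _ "%z. - flux (V s) z - - flux (V s) x"])
   fix z assume z: "z \<in> ?S"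
   then have za: "z \<in> {a..1}" using sub by auto
   have "(Sop (V s) has_real_derivative - flux (V s) z) (at z within ?S)"
    by (rule has_field_derivative_subset[OF Sop_deriv[OF Vsq]]) (use za sub a in auto)
   then show "((%z. Sop (V s) z + z * flux (V s) x) has_real_derivative - flux (V s) z - - flux (V s) x) (at z within ?S)"
    by (auto intro!: derivative_eq_intros)
   have "\<bar>- flux (V s) z - - flux (V s) x\<bar> <= L * sqrt \<bar>z - x\<bar>" by (rule L(2)[OF x(1) za])
   also have "... <= L * sqrt \<bar>x' - x\<bar>"
    using z L(1) by (intro mult_left_mono) (auto simp: closed_segment_eq_real_ivl split: if_splits)
   finally show "norm (- flux (V s) z - - flux (V s) x) <= L * sqrt \<bar>x' - x\<bar>" by simp
  qed auto
  moreover have "(%z. Sop (V s) z + z * flux (V s) x) x' - (%z. Sop (V s) z + z * flux (V s) x) x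
   = Sop (V s) x' - Sop (V s) x - (x' - x) * - flux (V s) x" by (simp add: left_diff_distrib)
  moreover have "(L * sqrt \<bar>x' - x\<bar>) * \<bar>x' - x\<bar> = L * \<bar>x' - x\<bar> * sqrt \<bar>x' - x\<bar>" by simp
  ultimately show "\<bar>Sop (V s) x' - Sop (V s) x - (x' - x) * - flux (V s) x\<bar> <= L * \<bar>x' - x\<bar> * sqrt \<bar>x' - x\<bar>"
   by (simp only: real_norm_def)
 qed
qed

lemma Sop_holder:
 assumes a: "a \<in> {0<..1}"
 obtains L where "0 <= L" "!!s x x'. x \<in> {a..1} ==> x' \<in> {a..1} ==> \<bar>Sop (V s) x' - Sop (V s) x\<bar> <= L * sqrt \<bar>x' - x\<bar>"
proof -
 obtain L where L: "0 <= L" "!!s x. x \<in> {a..1} ==> \<bar>- flux (V s) x\<bar> <= L"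
  using profileD[OF profile_flux a] by metis
 show thesis
 proof (rule that[OF L(1)])
  fix s x x' assume x: "x \<in> {a..1}" "x' \<in> {a..1}"
  have "norm (Sop (V s) x' - Sop (V s) x) <= L * norm (x' - x)"
  proof (rule field_differentiable_bound[of "{a..1}" _ "%z. - flux (V s) z"])
   fix z assume z: "z \<in> {a..1}"
   show "(Sop (V s) has_real_derivative - flux (V s) z) (at z within {a..1})"
    by (rule has_field_derivative_subset[OF Sop_deriv[OF Vsq]]) (use z a in auto)
   show "norm (- flux (V s) z) <= L" using L(2)[OF z] by simp
  qed (use x in auto)
  also have "... <= L * sqrt \<bar>x' - x\<bar>" using x a L(1) by (intro mult_left_mono) (auto intro!: le_sqrt)
  finally show "\<bar>Sop (V s) x' - Sop (V s) x\<bar> <= L * sqrt \<bar>x' - x\<bar>" by simp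
 qed
qed

lemma profile_Sop: "profile (%s. Sop (V s))"
 unfolding profile_def
proof (intro conjI ballI)
 fix a :: real assume a: "a \<in> {0<..1}"
 obtain L where L: "0 <= L" "!!s x x'. x \<in> {a..1} ==> x' \<in> {a..1} ==> \<bar>Sop (V s) x' - Sop (V s) x\<bar> <= L * sqrt \<bar>x' - x\<bar>"
  using Sop_holder[OF a] by metis
 show "\<exists>L. \<forall>s. \<forall>x\<in>{a..1}. \<bar>Sop (V s) x\<bar> <= L & (\<forall>x'\<in>{a..1}. \<bar>Sop (V s) x' - Sop (V s) x\<bar> <= L * sqrt \<bar>x' - x\<bar>)"
 proof (intro exI[of _ L] allI ballI conjI)
  fix s x assume x: "x \<in> {a..1}"
  have "sqrt \<bar>x - 1\<bar> <= 1" using x a by auto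
  then have "L * sqrt \<bar>x - 1\<bar> <= L * 1" using L(1) by (intro mult_left_mono)
  then show "\<bar>Sop (V s) x\<bar> <= L" using L(2)[of 1 x s] x a by (simp add: Sop_1)
 qed (use L(2) in auto)
qed measurable

end

context degenerate
begin

text \<open>Dominating function for the exchange of a time average with the integral against
  \<open>flux f\<close>.\<close>

lemma flux_bd_flux_integrable:
 assumes f: "sq f" shows "integrable U (%x. flux_bd x * flux f x)"
proof -
 define \<beta> where "\<beta> = (if \<alpha> < 1 then - \<alpha> else 1 - \<alpha>)"
 define c :: real where "c = (if \<alpha> < 1 then 4 else 1)"
 let ?h = "%x. flux_bd x * x powr (- \<alpha> / 2)"
 have m: "?h \<in> Borel" unfolding flux_bd_def[abs_def] by measurable
 have "integrable U (%x. c * x powr \<beta>)"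
  using \<alpha> by (intro integrable_mult_right U_powr_integrable) (auto simp: \<beta>_def)
 moreover have "AE x in U. c * x powr \<beta> = (?h x)^2"
  using U_AE_in
 proof eventually_elim
  case (elim x)
  have "(x powr (- \<alpha> / 2))^2 = x powr - \<alpha>" by (simp add: power2_eq_square powr_add[symmetric])
  then show ?case using elim by (simp add: power_mult_distrib flux_bd_def \<beta>_def c_def powr_diff powr_minus field_simps)
 qed
 ultimately have "integrable U (%x. (?h x)^2)"
  using integrable_cong_AE[of "%x. c * x powr \<beta>" U "%x. (?h x)^2"] m by simp
 then have h: "sq ?h" using m by (simp add: sq_def)
 have "integrable U (%x. ?h x * (x powr (- \<alpha> / 2) * Pop f x))" by (rule sq_cs(1)[OF h weighted_flux_sq[OF f]])
 moreover have "?h x * (x powr (- \<alpha> / 2) * Pop f x) = flux_bd x * flux f x" for x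
 proof -
  have "x powr - \<alpha> = x powr (- \<alpha> / 2) * x powr (- \<alpha> / 2)" by (simp add: powr_add[symmetric])
  then show ?thesis unfolding flux_def by (simp only: mult_ac)
 qed
 ultimately show ?thesis by (simp only:)
qed

text \<open>The weak form with \<open>Sop g\<close> in place of \<open>w\<close> has a right side
  symmetric in \<open>f\<close> and \<open>g\<close>.\<close>

lemma pairing_Sop:
 assumes f: "sq f" and g: "sq g"
 shows "pairing f (Sop g) = (\<integral>x. Pop f x * flux g x \<partial>U)" "pairing f (Sop g) = pairing (Sop f) g"
proof -
 have *: "pairing f (Sop g) = (\<integral>x. Pop f x * flux g x \<partial>U)" if "sq f" "sq g" for f g
 proof -
  have "(%x. f x * - J (%x. - flux g x) x 1) = (%x. f x * Sop g x)" by (simp add: Sop_def J_def)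
  then show ?thesis using weak_form(2)[OF that(1) h1_deriv_Sop[OF that(2)]] by (simp add: pairing_def)
 qed
 show "pairing f (Sop g) = (\<integral>x. Pop f x * flux g x \<partial>U)" by (rule *[OF f g])
 have "pairing (Sop f) g = pairing g (Sop f)" by (simp add: pairing_def mult.commute)
 then show "pairing f (Sop g) = pairing (Sop f) g"
  unfolding *[OF f g] *[OF g f] by (simp add: flux_def mult_ac)
qed

end

context bounded_path
begin

text \<open>The weak equation is tested with the indicator of a short interval. One pairing then
  becomes an increment of \<open>Pop\<close>; the other, by symmetry of \<open>Sop\<close>, an
  integral of \<open>Sop (V s)\<close>, nearly its value times the length. So a pointwise equation
  arises although \<open>V s\<close> is only square integrable.\<close>

lemma flux_space_derivative:
 assumes k: "kernel \<eta> \<xi> \<xi>'" and k2: "kernel \<eta> \<xi>2 \<xi>3" and x: "x \<in> {0<..1}"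
  and weak: "!!f. sq f ==> average \<xi>2 (%s. pairing (V s) (Sop f)) t + average \<xi> (%s. pairing (V s) f) t = 0"
 shows "((%x. average \<xi> (%s. Pop (V s) x) t) has_real_derivative - average \<xi>2 (%s. Sop (V s) x) t) (at x within {0<..1})"
proof -
 define A where "A x = average \<xi> (%s. Pop (V s) x) t" for x
 define S where "S x = average \<xi>2 (%s. Sop (V s) x) t" for x
 have x2: "x / 2 \<in> {0<..1}" using x by auto
 obtain L where L: "0 <= L" "!!s y. y \<in> {x/2..1} ==> \<bar>Sop (V s) y\<bar> <= L"
  "!!s y x'. y \<in> {x/2..1} ==> x' \<in> {x/2..1} ==> \<bar>Sop (V s) x' - Sop (V s) y\<bar> <= L * sqrt \<bar>x' - y\<bar>"
  using profileD[OF profile_Sop x2] by metis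
 obtain N where N: "!!s y. y \<in> {x/2..1} ==> \<bar>Pop (V s) y\<bar> <= N" using profile_bounded[OF profile_Pop x2] by metis
 obtain B where B: "0 <= B" "!!u. \<bar>\<xi>2 u\<bar> <= B" using kernel_bounded[OF k2] by blast
 have bd: "\<bar>A v - A u + (v - u) * S c\<bar> <= (2 * \<eta> * B) * ((v - u) * (L * sqrt (v - u)))"
  if uv: "x / 2 <= u" "u <= v" "v <= 1" and c: "c \<in> {u..v}" for u v c
 proof -
  have u: "0 <= u" "0 < u" "u \<in> {x/2..1}" "v \<in> {x/2..1}" "c \<in> {x/2..1}" using x uv c by auto
  let ?f = "indicator {u<..v} :: real => real"
  have f: "sq ?f" by (rule sq_bounded[where B=1]) (auto simp: indicator_def)
  have mS: "(%s. Sop (V s) y) \<in> Borel" "(%s. Pop (V s) y) \<in> Borel" for y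
   by measurable
  have Jx: "J (V s) u v = Pop (V s) v - Pop (V s) u" for s using Pop_diff[OF Vsq u(1) uv(2)] by simp
  have p1: "(%s. pairing (V s) ?f) = (%s. Pop (V s) v - Pop (V s) u)"
   using Jx by (simp add: pairing_def J_def mult.commute)
  have p2: "(%s. pairing (V s) (Sop ?f)) = (%s. J (Sop (V s)) u v)"
   unfolding pairing_Sop(2)[OF Vsq f] by (simp add: pairing_def J_def mult.commute)
  have Jb: "\<bar>J (Sop (V s)) u v - (v - u) * Sop (V s) c\<bar> <= (v - u) * (L * sqrt (v - u))" for s
  proof (rule J_approx[OF sq_integrable[OF Sop_sq[OF Vsq]] u(1) uv(2,3)])
   fix y assume y: "y \<in> {u<..v}"
   have "\<bar>Sop (V s) y - Sop (V s) c\<bar> <= L * sqrt \<bar>y - c\<bar>" by (rule L(3)) (use y u uv in auto)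
   also have "... <= L * sqrt (v - u)" using y c L(1) by (intro mult_left_mono) auto
   finally show "\<bar>Sop (V s) y - Sop (V s) c\<bar> <= L * sqrt (v - u)" .
  qed
  have mJ: "(%s. J (Sop (V s)) u v) \<in> Borel"
   unfolding p2[symmetric] by (rule pairing_measurable) (use Sop_sq[OF f] in "simp add: sq_def")
  have bc: "\<bar>(v - u) * Sop (V s) c\<bar> <= (v - u) * L" for s
   using mult_left_mono[OF L(2)[OF u(5)], of "v - u" s] uv by (simp add: abs_mult)
  have bJ: "\<bar>J (Sop (V s)) u v\<bar> <= (v - u) * (L * sqrt (v - u)) + (v - u) * L" for s
   using Jb[of s] bc[of s] by linarith
  have mc: "(%s. (v - u) * Sop (V s) c) \<in> Borel" using mS(1)[of c] by simp
  have "A v - A u = average \<xi> (%s. pairing (V s) ?f) t"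
   unfolding p1 A_def by (rule average_diff[OF k mS(2) mS(2) N[OF u(4)] N[OF u(3)], symmetric])
  also have "... = - average \<xi>2 (%s. J (Sop (V s)) u v) t" using weak[OF f] unfolding p2 by linarith
  finally have "A v - A u + (v - u) * S c = - average \<xi>2 (%s. J (Sop (V s)) u v - (v - u) * Sop (V s) c) t"
   unfolding average_diff[OF k2 mJ mc bJ bc] S_def average_cmult by simp
  then show ?thesis
   using average_integrable(2)[OF k2 B(2) borel_measurable_diff[OF mJ mc] Jb, of t] by (simp only: abs_minus)
 qed
 have "(A has_real_derivative - S x) (at x within {0<..1})"
 proof (rule has_derivative_from_bound[of "x/2"])
  fix x' assume x': "x' \<in> {0<..1}" "\<bar>x' - x\<bar> < x / 2"
  then have xx': "x / 2 <= x'" "x' <= 1" using abs_ge_minus_self[of "x' - x"] by auto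
  have "\<bar>A x' - A x - (x' - x) * - S x\<bar> <= (2 * \<eta> * B) * (\<bar>x' - x\<bar> * (L * sqrt \<bar>x' - x\<bar>))"
  proof (cases "x <= x'")
   case True
   have "A x' - A x - (x' - x) * - S x = A x' - A x + (x' - x) * S x" by simp
   then show ?thesis using bd[of x x' x] xx' x True by simp
  next
   case False
   have "A x' - A x - (x' - x) * - S x = - (A x - A x' + (x - x') * S x)" by (simp add: left_diff_distrib)
   moreover have "\<bar>x' - x\<bar> = x - x'" using False by simp
   ultimately show ?thesis using bd[of x' x x] xx' x False by (simp only: abs_minus) simp
  qed
  then show "\<bar>A x' - A x - (x' - x) * - S x\<bar> <= (2 * \<eta> * B * L) * \<bar>x' - x\<bar> * sqrt \<bar>x' - x\<bar>"
   by (simp only: mult_ac)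
 qed (use x in simp)
 then show ?thesis unfolding A_def[abs_def] S_def .
qed

definition AS :: "(real => real) => real => real => real" where "AS \<xi> t x = average \<xi> (%s. Sop (V s) x) t"
definition AP :: "(real => real) => real => real => real" where "AP \<xi> t x = average \<xi> (%s. Pop (V s) x) t"

lemma A_continuous:
 assumes "kernel \<eta> \<xi> \<xi>'"
 shows "continuous_on (S \<times> {0<..1}) (%(t, x). AS \<xi> t x)" "continuous_on (S \<times> {0<..1}) (%(t, x). AP \<xi> t x)"
 unfolding AS_def AP_def
 by (rule average_profile_continuous[OF assms profile_Sop] average_profile_continuous[OF assms profile_Pop])+

lemma A_time_derivative:
 assumes k: "kernel \<eta> \<xi> \<xi>'" "kernel \<eta> \<xi>' \<xi>''" and x: "x \<in> {0<..1}"
 shows "((%t. AS \<xi> t x) has_real_derivative - AS \<xi>' t x) (at t within S)"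
  "((%t. AP \<xi> t x) has_real_derivative - AP \<xi>' t x) (at t within S)"
proof -
 have m: "(%s. Sop (V s) x) \<in> Borel" "(%s. Pop (V s) x) \<in> Borel" by measurable
 have b: "\<bar>Sop (V s) x\<bar> <= sol_bd x * M" "\<bar>Pop (V s) x\<bar> <= flux_bd x * M" for s using x Sop_le Pop_le by auto
 show "((%t. AS \<xi> t x) has_real_derivative - AS \<xi>' t x) (at t within S)"
  unfolding AS_def[abs_def] by (rule average_time_derivative[OF k m(1) b(1)])
 show "((%t. AP \<xi> t x) has_real_derivative - AP \<xi>' t x) (at t within S)"
  unfolding AP_def[abs_def] by (rule average_time_derivative[OF k m(2) b(2)])
qed

lemma A_space_derivative:
 assumes k: "kernel \<eta> \<xi> \<xi>'" and x: "x \<in> {0<..1}"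
 shows "(AS \<xi> t has_real_derivative - (x powr - \<alpha> * AP \<xi> t x)) (at x within {0<..1})"
proof -
 have "(AS \<xi> t has_real_derivative average \<xi> (%s. - flux (V s) x) t) (at x within {0<..1})"
  unfolding AS_def[abs_def]
  by (rule average_space_derivative[OF k profile_Sop profile_flux x Sop_taylor])
 moreover have "average \<xi> (%s. - flux (V s) x) t = average \<xi> (%s. (- (x powr - \<alpha>)) * Pop (V s) x) t" by (simp add: flux_def)
 ultimately show ?thesis unfolding average_cmult AP_def by simp
qed

lemma A_bound:
 assumes "kernel \<eta> \<xi> \<xi>'" "!!u. \<bar>\<xi> u\<bar> <= B" "x \<in> {0<..1}"
 shows "\<bar>AS \<xi> t x\<bar> <= (2 * \<eta> * B) * (sol_bd x * M)" "\<bar>AP \<xi> t x\<bar> <= (2 * \<eta> * B) * (flux_bd x * M)"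
proof -
 have m: "(%s. Sop (V s) x) \<in> Borel" "(%s. Pop (V s) x) \<in> Borel" by measurable
 show "\<bar>AS \<xi> t x\<bar> <= (2 * \<eta> * B) * (sol_bd x * M)" "\<bar>AP \<xi> t x\<bar> <= (2 * \<eta> * B) * (flux_bd x * M)"
  unfolding AS_def AP_def
  by (rule average_integrable(2)[OF assms(1,2) m(1)] average_integrable(2)[OF assms(1,2) m(2)], use assms(3) Sop_le Pop_le in auto)+
qed

lemma A_measurable[measurable]:
 assumes "kernel \<eta> \<xi> \<xi>'" shows "AS \<xi> t \<in> Borel" "AP \<xi> t \<in> Borel"
proof -
 have [measurable]: "\<xi> \<in> Borel" by (rule kernel_measurable[OF assms])
 have m: "(%(x, s). \<xi> (s - t) * Sop (V s) x) \<in> borel_measurable (borel \<Otimes>\<^sub>M lborel)"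
  "(%(x, s). \<xi> (s - t) * Pop (V s) x) \<in> borel_measurable (borel \<Otimes>\<^sub>M lborel)" by measurable
 show "AS \<xi> t \<in> Borel" "AP \<xi> t \<in> Borel"
  using lborel.borel_measurable_lebesgue_integral[OF m(1)] lborel.borel_measurable_lebesgue_integral[OF m(2)]
  by (simp_all add: AS_def[abs_def] AP_def[abs_def] average_def)
qed

lemma pairing_average:
 assumes k: "kernel \<eta> \<xi> \<xi>'" and h: "sq h"
 shows "pairing (AS \<xi> t) h = average \<xi> (%s. pairing (V s) (Sop h)) t"
  "(\<integral>x. AP \<xi> t x * flux h x \<partial>U) = average \<xi> (%s. pairing (V s) (Sop h)) t"
proof -
 have [measurable]: "h \<in> Borel" using h by (simp add: sq_def)
 have "integrable U (%x. M * (sol_bd x * h x))" "integrable U (%x. M * (flux_bd x * flux h x))"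
  using sq_cs(1)[OF sq_sol_bd h] flux_bd_flux_integrable[OF h] by simp_all
 then have i: "integrable U (%x. (sol_bd x * M) * h x)" "integrable U (%x. (flux_bd x * M) * flux h x)"
  by (simp_all add: mult_ac)
 have "pairing (AS \<xi> t) h = average \<xi> (%s. \<integral>x. Sop (V s) x * h x \<partial>U) t"
  unfolding pairing_def AS_def by (rule average_integral_commute[OF k Sop_joint _ i(1)]) (use Sop_le in auto)
 then show "pairing (AS \<xi> t) h = average \<xi> (%s. pairing (V s) (Sop h)) t"
  unfolding pairing_Sop(2)[OF Vsq h] by (simp add: pairing_def)
 have "(\<integral>x. AP \<xi> t x * flux h x \<partial>U) = average \<xi> (%s. \<integral>x. Pop (V s) x * flux h x \<partial>U) t"
  unfolding AP_def by (rule average_integral_commute[OF k Pop_joint _ i(2)]) (use Pop_le in auto)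
 then show "(\<integral>x. AP \<xi> t x * flux h x \<partial>U) = average \<xi> (%s. pairing (V s) (Sop h)) t"
  unfolding pairing_Sop(1)[OF Vsq h] .
qed

end

text \<open>The systems for \<open>Z\<close> and \<open>z\<close> involve averages against
  \<open>k0\<close> to \<open>k3\<close>, and \<open>k4\<close> certifies that \<open>k3\<close> is
  a kernel. Because of the signs in time derivatives, \<open>Z\<close>, \<open>z\<close> and
  \<open>y\<close> are \<open>- AS k0\<close>, \<open>AS k1\<close> and \<open>- AS k2\<close>. The
  weak equations are those of \<open>V\<close> averaged against \<open>k0\<close> and
  \<open>k1\<close>.\<close>

locale mollified_path = bounded_path \<alpha> V M for \<alpha> V M +
 fixes \<eta> T \<tau> :: real and k0 k1 k2 k3 k4 :: "real => real"
 assumes k: "kernel \<eta> k0 k1" "kernel \<eta> k1 k2" "kernel \<eta> k2 k3" "kernel \<eta> k3 k4"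
  and k0: "!!u. 0 <= k0 u" "integrable lborel k0" "(\<integral>u. k0 u \<partial>lborel) = 1"
  and V_zero: "!!s x. s \<notin> {0..T} ==> V s x = 0"
  and weak: "!!t f. t \<in> {0..\<tau>} ==> sq f ==> average k2 (%s. pairing (V s) (Sop f)) t + average k0 (%s. pairing (V s) f) t = 0"
   "!!t f. t \<in> {0..\<tau>} ==> sq f ==> average k3 (%s. pairing (V s) (Sop f)) t + average k1 (%s. pairing (V s) f) t = 0"
begin

lemma classical:
 "classical_wave \<alpha> \<tau> (%t x. - AS k0 t x) (AS k1) (%t x. - AS k2 t x) (AP k0) (%t x. - AP k1 t x)"
 "classical_wave \<alpha> \<tau> (AS k1) (%t x. - AS k2 t x) (AS k3) (%t x. - AP k1 t x) (AP k2)"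
proof -
 have neg: "((%x. - f x) has_real_derivative D) (at x within S)"
  if "(f has_real_derivative - D) (at x within S)" for f :: "real => real" and D x S
  using DERIV_minus[OF that] by (simp only: minus_minus)
 have px: "(AP k0 t has_real_derivative - AS k2 t x) (at x within {0<..1})"
  "((%x. - AP k1 t x) has_real_derivative AS k3 t x) (at x within {0<..1})" if "t \<in> {0..\<tau>}" "x \<in> {0<..1}" for t x
  using flux_space_derivative[OF k(1) k(3) that(2) weak(1)[OF that(1)]]
   neg[OF flux_space_derivative[OF k(2) k(4) that(2) weak(2)[OF that(1)]]]
  unfolding AS_def[abs_def] AP_def[abs_def] by auto
 have Sx: "((%x. - AS \<xi> t x) has_real_derivative x powr - \<alpha> * AP \<xi> t x) (at x within {0<..1})"
  "(AS \<xi> t has_real_derivative x powr - \<alpha> * - AP \<xi> t x) (at x within {0<..1})" if "kernel \<eta> \<xi> \<xi>'" "x \<in> {0<..1}" for \<xi> \<xi>' t x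
  using neg[OF A_space_derivative[OF that]] A_space_derivative[OF that] by (simp_all only: mult_minus_right)
 have C: "continuous_on ({0..\<tau>} \<times> {0<..1}) (%(t, x). - AS \<xi> t x)" "continuous_on ({0..\<tau>} \<times> {0<..1}) (%(t, x). - AP \<xi> t x)"
  if "kernel \<eta> \<xi> \<xi>'" for \<xi> \<xi>'
  using A_continuous[OF that, of "{0..\<tau>}"] by (auto simp: case_prod_unfold intro!: continuous_intros)
 have one: "AS \<xi> t 1 = 0" "- AS \<xi> t 1 = 0" for \<xi> t by (simp_all add: AS_def Sop_1 average_def)
 note T = A_time_derivative[OF k(1,2)] A_time_derivative[OF k(2,3)] A_time_derivative[OF k(3,4)]
 show "classical_wave \<alpha> \<tau> (%t x. - AS k0 t x) (AS k1) (%t x. - AS k2 t x) (AP k0) (%t x. - AP k1 t x)"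
 proof unfold_locales
  fix t x assume tx: "t \<in> {0..\<tau>}" "x \<in> {0<..(1::real)}"
  show "((%t. - AS k0 t x) has_real_derivative AS k1 t x) (at t within {0..\<tau>})" by (rule neg[OF T(1)[OF tx(2)]])
  show "((%t. AS k1 t x) has_real_derivative - AS k2 t x) (at t within {0..\<tau>})" by (rule T(3)[OF tx(2)])
  show "((%t. AP k0 t x) has_real_derivative - AP k1 t x) (at t within {0..\<tau>})" by (rule T(2)[OF tx(2)])
  show "((%x. - AS k0 t x) has_real_derivative x powr - \<alpha> * AP k0 t x) (at x within {0<..1})" by (rule Sx(1)[OF k(1) tx(2)])
  show "(AS k1 t has_real_derivative x powr - \<alpha> * - AP k1 t x) (at x within {0<..1})" by (rule Sx(2)[OF k(2) tx(2)])
  show "(AP k0 t has_real_derivative - AS k2 t x) (at x within {0<..1})" by (rule px(1)[OF tx])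
 qed (rule \<alpha> one C[OF k(1)] C[OF k(2)] C[OF k(3)] A_continuous[OF k(1)] A_continuous[OF k(2)])+
 show "classical_wave \<alpha> \<tau> (AS k1) (%t x. - AS k2 t x) (AS k3) (%t x. - AP k1 t x) (AP k2)"
 proof unfold_locales
  fix t x assume tx: "t \<in> {0..\<tau>}" "x \<in> {0<..(1::real)}"
  show "((%t. AS k1 t x) has_real_derivative - AS k2 t x) (at t within {0..\<tau>})" by (rule T(3)[OF tx(2)])
  show "((%t. - AS k2 t x) has_real_derivative AS k3 t x) (at t within {0..\<tau>})" by (rule neg[OF T(5)[OF tx(2)]])
  show "((%t. - AP k1 t x) has_real_derivative AP k2 t x) (at t within {0..\<tau>})" by (rule neg[OF T(4)[OF tx(2)]])
  show "(AS k1 t has_real_derivative x powr - \<alpha> * - AP k1 t x) (at x within {0<..1})" by (rule Sx(2)[OF k(2) tx(2)])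
  show "((%x. - AS k2 t x) has_real_derivative x powr - \<alpha> * AP k2 t x) (at x within {0<..1})" by (rule Sx(1)[OF k(3) tx(2)])
  show "((%x. - AP k1 t x) has_real_derivative AS k3 t x) (at x within {0<..1})" by (rule px(2)[OF tx])
 qed (rule \<alpha> one C[OF k(2)] C[OF k(3)] A_continuous[OF k(2)] A_continuous[OF k(3)] A_continuous[OF k(4)])+
qed

text \<open>Identifies the velocity \<open>- AS k2\<close> with the average of \<open>V\<close>
  against \<open>k0\<close>, in the weak sense.\<close>

lemma pairing_y:
 assumes t: "t \<in> {0..\<tau>}" and h: "sq h"
 shows "pairing (%x. - AS k2 t x) h = average k0 (%s. pairing (V s) h) t"
proof -
 have "pairing (%x. - AS k2 t x) h = - pairing (AS k2 t) h" by (simp add: pairing_def)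
 then show ?thesis using pairing_average(1)[OF k(3) h, of t] weak(1)[OF t h] by linarith
qed

definition strip :: "real => real => real" where
 "strip \<mu> s = (\<integral>x. indicator {1-\<mu><..1} x * (V s x)^2 \<partial>U)"

lemma strip_measurable[measurable]: "strip \<mu> \<in> Borel"
proof -
 have m: "(%(s, x). indicator {1-\<mu><..1} x * (V s x)^2) \<in> borel_measurable (borel \<Otimes>\<^sub>M U)" by measurable
 show ?thesis using U.borel_measurable_lebesgue_integral[OF m] by (simp add: strip_def[abs_def])
qed

lemma strip_bounds: "0 <= strip \<mu> s" "\<bar>strip \<mu> s\<bar> <= M^2" "s \<notin> {0..T} ==> strip \<mu> s = 0"
proof -
 show 0: "0 <= strip \<mu> s" unfolding strip_def by (rule integral_nonneg_AE) simp
 have "strip \<mu> s <= (\<integral>x. (V s x)^2 \<partial>U)"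
  unfolding strip_def using sq_integrable2[OF Vsq, of s]
  by (intro integral_mono U_indicator_integrable) (auto simp: indicator_def)
 also have "... <= M^2" unfolding norm2_square[symmetric] by (rule power_mono[OF VM]) simp
 finally show "\<bar>strip \<mu> s\<bar> <= M^2" using 0 by simp
 show "s \<notin> {0..T} ==> strip \<mu> s = 0" by (simp add: strip_def V_zero)
qed

lemma k0_shift: "integrable lborel (%s. k0 (s - t))" "(\<integral>s. k0 (s - t) \<partial>lborel) = 1"
proof -
 have "integrable lborel (%s. k0 (- t + 1 * s))" using lborel_integrable_real_affine[OF k0(2), of 1 "- t"] by simp
 then show "integrable lborel (%s. k0 (s - t))" by simp
 show "(\<integral>s. k0 (s - t) \<partial>lborel) = 1" using lborel_integral_real_affine[of 1 k0 "- t"] k0(3) by simp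
qed

text \<open>Jensen's inequality by duality: the velocity cut off to the strip serves as its own test
  function, and Young's inequality leaves half of its square to be absorbed on the left. The kernel
  acts as a probability density.\<close>

lemma slab_le:
 assumes \<mu>: "0 < \<mu>" "\<mu> <= 1/2" and t: "t \<in> {0..\<tau>}"
 shows "slab (%t x. - AS k2 t x) \<mu> t <= average k0 (strip \<mu>) t"
proof -
 interpret W: classical_wave \<alpha> \<tau> "AS k1" "%t x. - AS k2 t x" "AS k3" "%t x. - AP k1 t x" "AP k2" by (rule classical)
 define f where "f x = indicator {1-\<mu><..1} x * - AS k2 t x" for x
 note A_measurable(1)[OF k(3), measurable]
 have [measurable]: "f \<in> Borel" unfolding f_def[abs_def] by measurable
 obtain L where L: "!!s y. y \<in> {1/2..1} ==> \<bar>Sop (V s) y\<bar> <= L" using profile_bounded[OF profile_Sop, of "1/2"] by auto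
 obtain B where B: "!!u. \<bar>k2 u\<bar> <= B" using kernel_bounded[OF k(3)] by blast
 have bd: "\<bar>AS k2 t x\<bar> <= (2 * \<eta> * B) * L" if "x \<in> {1/2..1}" for x
  unfolding AS_def by (rule average_integrable(2)[OF k(3) B _ L[OF that]]) measurable
 have "0 <= (2 * \<eta> * B) * L" using bd[of 1] by (simp add: order_trans[OF abs_ge_zero])
 then have f: "sq f"
  using bd \<mu> by (intro sq_bounded[where B="(2 * \<eta> * B) * L"]) (auto simp: f_def indicator_def)
 have cy: "continuous_on {0<..1} (%x. (- AS k2 t x)^2)"
 proof -
  have "continuous_on {0<..1} (%x. (%(t, x). - AS k2 t x) (t, x))"
   by (rule continuous_on_compose2[OF W.cy]) (use t in "auto intro!: continuous_intros")
  then have "continuous_on {0<..1} (%x. - AS k2 t x)" by (simp only: case_prod_conv)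
  then show ?thesis by (rule continuous_on_power)
 qed
 define N where "N = slab (%t x. - AS k2 t x) \<mu> t"
 have "N = J (%x. (- AS k2 t x)^2) (1 - \<mu>) 1"
  unfolding N_def slab_def by (rule J_continuous(3)[OF _ cy, symmetric]) (use \<mu> in auto)
 also have "... = (\<integral>x. (f x)^2 \<partial>U)" unfolding J_def f_def by (intro Bochner_Integration.integral_cong) (auto simp: indicator_def)
 finally have N: "N = (\<integral>x. (f x)^2 \<partial>U)" .
 have "N = pairing (%x. - AS k2 t x) f"
  unfolding N pairing_def by (intro Bochner_Integration.integral_cong) (auto simp: f_def indicator_def power2_eq_square)
 then have Np: "N = average k0 (%s. pairing (V s) f) t" using pairing_y[OF t f] by simp
 have le: "pairing (V s) f <= (strip \<mu> s + N) / 2" for s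
 proof -
  have i: "integrable U (%x. indicator {1-\<mu><..1} x * (V s x)^2)" using sq_integrable2[OF Vsq] by (intro U_indicator_integrable) auto
  have "pairing (V s) f <= (\<integral>x. (indicator {1-\<mu><..1} x * (V s x)^2 + (f x)^2) / 2 \<partial>U)"
   unfolding pairing_def
  proof (rule integral_mono[OF sq_cs(1)[OF Vsq f]])
   fix x show "V s x * f x <= (indicator {1-\<mu><..1} x * (V s x)^2 + (f x)^2) / 2"
    using two_mult_le_sum_squares[of "V s x" "f x"] by (auto simp: f_def indicator_def)
  qed (use i sq_integrable2[OF f] in auto)
  also have "... = (strip \<mu> s + N) / 2" unfolding strip_def N using i sq_integrable2[OF f] by simp
  finally show ?thesis .
 qed
 obtain B0 where B0: "!!u. \<bar>k0 u\<bar> <= B0" using kernel_bounded[OF k(1)] by blast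
 have i1: "integrable lborel (%s. k0 (s - t) * pairing (V s) f)"
  by (rule average_integrable(1)[OF k(1) B0 _ pairing_bound[OF f]]) measurable
 have i2: "integrable lborel (%s. k0 (s - t) * strip \<mu> s)"
  by (rule average_integrable(1)[OF k(1) B0 _ strip_bounds(2)]) measurable
 have "N <= (\<integral>s. (k0 (s - t) * strip \<mu> s + k0 (s - t) * N) / 2 \<partial>lborel)"
  unfolding Np average_def
 proof (rule integral_mono[OF i1])
  fix s show "k0 (s - t) * pairing (V s) f <= (k0 (s - t) * strip \<mu> s + k0 (s - t) * (\<integral>s. k0 (s - t) * pairing (V s) f \<partial>lborel)) / 2"
   using mult_left_mono[OF le[of s] k0(1)[of "s - t"]] unfolding Np average_def by (simp add: distrib_left)
 qed (use i2 k0_shift(1)[of t] in auto)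
 also have "... = (average k0 (strip \<mu>) t + N) / 2"
  using i2 k0_shift[of t] by (simp add: average_def)
 finally show ?thesis unfolding N_def by simp
qed

end

context mollified_path
begin

lemma strip_integrable: "integrable lborel (strip \<mu>)"
proof (rule Bochner_Integration.integrable_bound)
 show "integrable lborel (%s. M^2 * indicator {0..T} s :: real)"
  by (intro integrable_mult_right integrable_real_indicator) (auto simp: emeasure_lborel_Icc_eq)
 show "AE s in lborel. norm (strip \<mu> s) <= norm (M^2 * indicator {0..T} s :: real)"
  using strip_bounds by (intro AE_I2) (auto simp: indicator_def)
qed measurable

text \<open>After exchanging the order of integration, each value of \<open>strip\<close> is
  weighted by a part of the kernel's mass, which is at most 1.\<close>

lemma slab_integral_le:
 assumes \<mu>: "0 < \<mu>" "\<mu> <= 1/2"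
 shows "integral {0..\<tau>} (slab (%t x. - AS k2 t x) \<mu>) <= (\<integral>s. strip \<mu> s \<partial>lborel)"
proof -
 interpret W: classical_wave \<alpha> \<tau> "AS k1" "%t x. - AS k2 t x" "AS k3" "%t x. - AP k1 t x" "AP k2" by (rule classical)
 note kernel_measurable[OF k(1), measurable]
 obtain B where B: "0 <= B" "!!u. \<bar>k0 u\<bar> <= B" using kernel_bounded[OF k(1)] by blast
 have cS: "continuous_on {0..\<tau>} (slab (%t x. - AS k2 t x) \<mu>)" by (rule W.slab_cont(1)) (use \<mu> in auto)
 have cA: "continuous_on {0..\<tau>} (average k0 (strip \<mu>))"
  by (rule DERIV_continuous_on) (rule average_time_derivative[OF k(1,2) strip_measurable strip_bounds(2)])
 have "integral {0..\<tau>} (slab (%t x. - AS k2 t x) \<mu>) <= integral {0..\<tau>} (average k0 (strip \<mu>))"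
  by (intro integral_le integrable_continuous_interval cS cA slab_le[OF \<mu>])
 also have "... = (\<integral>t. indicator {0..\<tau>} t * average k0 (strip \<mu>) t \<partial>lborel)"
  using set_borel_integral_eq_integral(2)[OF borel_integrable_atLeastAtMost'[OF cA]]
  by (simp add: set_lebesgue_integral_def)
 also have "... = (\<integral>t. (\<integral>s. indicator {0..\<tau>} t * (k0 (s - t) * strip \<mu> s) \<partial>lborel) \<partial>lborel)"
  by (simp add: average_def)
 finally have 1: "integral {0..\<tau>} (slab (%t x. - AS k2 t x) \<mu>)
  <= (\<integral>t. (\<integral>s. indicator {0..\<tau>} t * (k0 (s - t) * strip \<mu> s) \<partial>lborel) \<partial>lborel)" .
 have ind: "integrable lborel (%s. C * indicator {0..b} s :: real)" for C b :: real
  by (intro integrable_mult_right integrable_real_indicator) (auto simp: emeasure_lborel_Icc_eq)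
 have i: "integrable (lborel \<Otimes>\<^sub>M lborel) (%(t, s). indicator {0..\<tau>} t * (k0 (s - t) * strip \<mu> s))"
 proof (rule lborel_pair.integrable_product_bound[OF ind[of B \<tau>] ind[of "M^2" T]])
  show "(%(t, s). indicator {0..\<tau>} t * (k0 (s - t) * strip \<mu> s)) \<in> borel_measurable (lborel \<Otimes>\<^sub>M lborel)" by measurable
  have "\<bar>indicator {0..\<tau>} t * (k0 (s - t) * strip \<mu> s)\<bar> <= \<bar>B * indicator {0..\<tau>} t * (M^2 * indicator {0..T} s)\<bar>" for t s
  proof (cases "t \<in> {0..\<tau>} & s \<in> {0..T}")
   case True
   have "\<bar>k0 (s - t)\<bar> * \<bar>strip \<mu> s\<bar> <= B * M^2" using B strip_bounds(2) by (intro mult_mono) auto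
   then show ?thesis using True B by (simp add: abs_mult)
  qed (auto simp: indicator_def strip_bounds(3))
  then show "AE z in lborel \<Otimes>\<^sub>M lborel. \<bar>(%(t, s). indicator {0..\<tau>} t * (k0 (s - t) * strip \<mu> s)) z\<bar>
   <= \<bar>B * indicator {0..\<tau>} (fst z) * (M^2 * indicator {0..T} (snd z))\<bar>"
   by (intro AE_I2) (simp add: case_prod_unfold)
 qed
 have "(\<integral>t. (\<integral>s. indicator {0..\<tau>} t * (k0 (s - t) * strip \<mu> s) \<partial>lborel) \<partial>lborel)
   = (\<integral>s. (\<integral>t. indicator {0..\<tau>} t * (k0 (s - t) * strip \<mu> s) \<partial>lborel) \<partial>lborel)"
  by (rule lborel_pair.Fubini_integral[OF i, symmetric])
 also have "... <= (\<integral>s. strip \<mu> s \<partial>lborel)"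
 proof (rule integral_mono[OF lborel_pair.integrable_snd[OF i] strip_integrable])
  fix s
  have k: "integrable lborel (%t. k0 (s - t))" "(\<integral>t. k0 (s - t) \<partial>lborel) = 1"
   using lborel_integrable_real_affine[OF k0(2), of "-1" s] lborel_integral_real_affine[of "-1" k0 s] k0(3) by simp_all
  have "(\<integral>t. indicator {0..\<tau>} t * k0 (s - t) \<partial>lborel) <= (\<integral>t. k0 (s - t) \<partial>lborel)"
  proof (rule integral_mono[OF _ k(1)])
   show "integrable lborel (%t. indicator {0..\<tau>} t * k0 (s - t))"
    by (rule Bochner_Integration.integrable_bound[OF k(1)]) (measurable, auto simp: indicator_def)
  qed (auto simp: indicator_def k0(1))
  then have "(\<integral>t. indicator {0..\<tau>} t * k0 (s - t) \<partial>lborel) * strip \<mu> s <= 1 * strip \<mu> s"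
   unfolding k(2) by (rule mult_right_mono) (rule strip_bounds(1))
  then show "(\<integral>t. indicator {0..\<tau>} t * (k0 (s - t) * strip \<mu> s) \<partial>lborel) <= strip \<mu> s"
   by (simp add: mult.assoc[symmetric])
 qed
 finally show ?thesis using 1 by linarith
qed

abbreviation "initial_energy_density \<equiv> %x. (AS k2 0 x)^2 + x powr - \<alpha> * (AP k1 0 x)^2"

text \<open>The point \<open>b\<close> stays fixed while the point \<open>a\<close> of the
  multiplier estimates tends to 0. By monotonicity in the domain, the energy on
  \<open>{b..1}\<close> is bounded by that on \<open>{a..1}\<close>.\<close>

lemma initial_energy_le:
 assumes \<delta>: "0 < \<delta>" "\<tau> = 4 / (2 - \<alpha>) + 3 * \<delta>" and \<mu>: "0 < \<mu>" "\<mu> <= 1/2" and b: "0 < b" "b < 1"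
  and X: "10 * (wave_with_primitive.flux_const \<tau> \<delta> * wave_with_primitive.obs_const \<tau> \<delta> / \<mu>^3) * (\<integral>s. strip \<mu> s \<partial>lborel) <= X"
 shows "integrable U (%x. indicator {b<..1} x * (AS k2 0 x)^2)"
  "integrable U (%x. indicator {b<..1} x * (x powr - \<alpha> * (AP k1 0 x)^2))"
  "(2 - \<alpha>) / 2 * \<delta> * (J initial_energy_density b 1 / 2) <= X"
proof -
 interpret W: wave_with_primitive \<alpha> \<tau> "%t x. - AS k0 t x" "AS k1" "%t x. - AS k2 t x" "AS k3" "AP k0" "%t x. - AP k1 t x" "AP k2" \<delta>
  by (intro wave_with_primitive.intro wave_with_primitive_axioms.intro classical \<delta>)
 have \<tau>: "0 <= \<tau>" using W.T' by simp
 have c: "continuous_on {0<..1} (%x. (%(t, x). - AS k2 t x) (0, x))" "continuous_on {0<..1} (%x. (%(t, x). - AP k1 t x) (0, x))"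
  by (rule continuous_on_compose2[OF W.cy] continuous_on_compose2[OF W.cp]; use \<tau> in "auto intro!: continuous_intros")+
 then have c': "continuous_on {0<..1} (%x. - AS k2 0 x)" "continuous_on {0<..1} (%x. - AP k1 0 x)" by (simp_all only: case_prod_conv)
 have c1: "continuous_on {0<..1} (%x. (AS k2 0 x)^2)" "continuous_on {0<..1} (%x. x powr - \<alpha> * (AP k1 0 x)^2)"
  using continuous_on_power[OF c'(1), of 2] continuous_on_power[OF c'(2), of 2]
  by (auto intro!: continuous_intros)
 note A_measurable[OF k(3), measurable] A_measurable[OF k(2), measurable]
 show "integrable U (%x. indicator {b<..1} x * (AS k2 0 x)^2)"
  by (rule J_continuous(1)[OF _ c1(1)]) (use b in auto)
 show "integrable U (%x. indicator {b<..1} x * (x powr - \<alpha> * (AP k1 0 x)^2))"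
  by (rule J_continuous(1)[OF _ c1(2)]) (use b in auto)
 have cg: "continuous_on {0<..1} initial_energy_density" by (intro continuous_on_add c1)
 have Jb: "J initial_energy_density b 1 = integral {b..1} initial_energy_density"
  by (rule J_continuous(3)[OF _ cg]) (use b in auto)
 obtain B0 B1 B2 where B': "!!u. \<bar>k0 u\<bar> <= B0" "!!u. \<bar>k1 u\<bar> <= B1" "!!u. \<bar>k2 u\<bar> <= B2"
  using kernel_bounded[OF k(1)] kernel_bounded[OF k(2)] kernel_bounded[OF k(3)] by metis
 define B where "B = max B0 (max B1 B2)"
 have B: "\<bar>k0 u\<bar> <= B" "\<bar>k1 u\<bar> <= B" "\<bar>k2 u\<bar> <= B" for u using B'[of u] by (auto simp: B_def)
 \<comment> \<open>This number contains the suprema of the kernels. It enters only through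
   \<open>R\<close>, which multiplies \<open>bnd a\<close>; that product tends to 0 with
   \<open>a\<close>, so no supremum of a kernel survives in the bound.\<close>
 define D where "D = 2 * \<eta> * B * M"
 have bds: "\<bar>AS k0 t a\<bar> <= D * sol_bd a" "\<bar>AS k1 t a\<bar> <= D * sol_bd a" "\<bar>AS k2 t a\<bar> <= D * sol_bd a"
  "\<bar>AP k0 t a\<bar> <= D * flux_bd a" "\<bar>AP k1 t a\<bar> <= D * flux_bd a" if "a \<in> {0<..1}" for t a
  using A_bound[OF k(1) B(1) that, of t] A_bound[OF k(2) B(2) that, of t] A_bound[OF k(3) B(3) that, of t]
  by (simp_all add: D_def mult_ac)
 define R where "R = (10 * (4 * (\<tau> - \<delta>) + (\<tau> - \<delta>)^2) + 2 * \<delta>) * (2 / \<delta> + 1)^2 * D^2"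
 define bnd where "bnd a = sol_bd a * flux_bd a + a * (sol_bd a)^2 + a * a powr - \<alpha> * (flux_bd a)^2" for a
 have c0: "0 <= W.flux_const" "0 <= W.obs_const"
  using \<delta>(1) \<tau> by (simp_all add: W.flux_const_def W.obs_const_def)
 have "(2 - \<alpha>) / 2 * \<delta> * (J initial_energy_density b 1 / 2) <= X + R * bnd a" if a: "a \<in> {0<..<b}" for a
 proof -
  have a1: "0 < a" "a <= 1" "a \<in> {0<..1}" "a <= b" using a b by auto
  have "integral {b..1} initial_energy_density <= integral {a..1} initial_energy_density"
  proof (rule integral_subset_le)
   show "initial_energy_density integrable_on {b..1}" "initial_energy_density integrable_on {a..1}"
    by (intro integrable_continuous_interval continuous_on_subset[OF cg]; use a b in auto)+
  qed (use a in auto)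
  also have "... = 2 * W.energy a 0" by (simp add: W.energy_def W.r_def)
  finally have "J initial_energy_density b 1 / 2 <= W.energy a 0" unfolding Jb by simp
  then have "(2 - \<alpha>) / 2 * \<delta> * (J initial_energy_density b 1 / 2) <= (2 - \<alpha>) / 2 * \<delta> * W.energy a 0"
   using \<alpha> \<delta> by (intro mult_left_mono) auto
  also have "... <= 10 * (W.flux_const * W.obs_const / \<mu>^3) * integral {0..\<tau>} (slab (%t x. - AS k2 t x) \<mu>)
    + (10 * (4 * (\<tau> - \<delta>) + (\<tau> - \<delta>)^2) + 2 * \<delta>) * ((2 / \<delta> + 1)^2 *
     ((D * sol_bd a) * (D * flux_bd a) + a * (D * sol_bd a)^2 + a * W.r a * (D * flux_bd a)^2))"
   by (rule W.internal_observability[OF a1(1,2) \<mu>]) (use bds[OF a1(3)] in simp_all)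
  also have "... <= X + R * bnd a"
  proof (rule add_mono)
   show "10 * (W.flux_const * W.obs_const / \<mu>^3) * integral {0..\<tau>} (slab (%t x. - AS k2 t x) \<mu>) <= X"
    by (rule order.trans[OF mult_left_mono[OF slab_integral_le[OF \<mu>]] X]) (use c0 \<mu> in auto)
   have "(D * sol_bd a) * (D * flux_bd a) + a * (D * sol_bd a)^2 + a * W.r a * (D * flux_bd a)^2 = D^2 * bnd a"
    by (simp add: bnd_def W.r_def power2_eq_square distrib_left mult_ac)
   then show "(10 * (4 * (\<tau> - \<delta>) + (\<tau> - \<delta>)^2) + 2 * \<delta>) * ((2 / \<delta> + 1)^2 *
     ((D * sol_bd a) * (D * flux_bd a) + a * (D * sol_bd a)^2 + a * W.r a * (D * flux_bd a)^2)) <= R * bnd a"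
    unfolding R_def by (simp only: mult.assoc)
  qed
  finally show ?thesis .
 qed
 moreover have "eventually (%a. a \<in> {0<..<b}) (at_right 0)" by (rule eventually_at_right_real[OF b(1)])
 ultimately have ev: "eventually (%a. (2 - \<alpha>) / 2 * \<delta> * (J initial_energy_density b 1 / 2) <= X + R * bnd a) (at_right 0)"
  by (auto elim: eventually_mono)
 have "((%a. X + R * bnd a) \<longlongrightarrow> X + R * 0) (at_right 0)"
  unfolding bnd_def by (intro tendsto_intros boundary_bounds_tendsto)
 from tendsto_lowerbound[OF this ev] show "(2 - \<alpha>) / 2 * \<delta> * (J initial_energy_density b 1 / 2) <= X" by simp
qed

text \<open>Both averages at time 0 are scalar products, the first with the velocity and the second
  with the weighted flux, whose norms are at most \<open>K\<close>. The formula for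
  \<open>K^2\<close> solves \<open>(2 - \<alpha>)/2 * \<delta>\<close> times half of the integral
  \<open><= X\<close> for that integral.\<close>

lemma initial_functionals_le:
 assumes \<delta>: "0 < \<delta>" "\<tau> = 4 / (2 - \<alpha>) + 3 * \<delta>" and \<mu>: "0 < \<mu>" "\<mu> <= 1/2"
  and X: "10 * (wave_with_primitive.flux_const \<tau> \<delta> * wave_with_primitive.obs_const \<tau> \<delta> / \<mu>^3) * (\<integral>s. strip \<mu> s \<partial>lborel) <= X"
  and K: "0 <= K" "K^2 = 4 * X / ((2 - \<alpha>) * \<delta>)" and f: "sq f"
 shows "\<bar>average k0 (%s. pairing (V s) (Sop f)) 0\<bar> <= K * norm2 (Sop f)"
  "\<bar>average k1 (%s. pairing (V s) (Sop f)) 0\<bar> <= K * H1_seminorm \<alpha> (Sop f)"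
proof -
 note A_measurable[OF k(3), measurable] A_measurable[OF k(2), measurable]
 let ?p = "%x. x powr (- \<alpha> / 2) * AP k1 0 x"
 have p2: "(?p x)^2 = x powr - \<alpha> * (AP k1 0 x)^2" for x
  by (simp add: power2_eq_square mult_ac) (simp add: powr_add[symmetric] mult.assoc[symmetric])
 have E: "integrable U (%x. indicator {b<..1} x * (AS k2 0 x)^2) & (\<integral>x. indicator {b<..1} x * (AS k2 0 x)^2 \<partial>U) <= K^2"
  "integrable U (%x. indicator {b<..1} x * (?p x)^2) & (\<integral>x. indicator {b<..1} x * (?p x)^2 \<partial>U) <= K^2"
  if b: "0 < b" "b < 1" for b
 proof -
  note I = initial_energy_le[OF \<delta> \<mu> b X]
  have "J initial_energy_density b 1 <= K^2" using I(3) \<alpha> \<delta>(1) unfolding K(2) by (simp add: field_simps)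
  moreover have "J initial_energy_density b 1 = (\<integral>x. indicator {b<..1} x * (AS k2 0 x)^2 \<partial>U) + (\<integral>x. indicator {b<..1} x * (?p x)^2 \<partial>U)"
   unfolding J_def distrib_left p2 by (rule Bochner_Integration.integral_add[OF I(1,2)])
  moreover have "0 <= (\<integral>x. indicator {b<..1} x * (AS k2 0 x)^2 \<partial>U)" "0 <= (\<integral>x. indicator {b<..1} x * (?p x)^2 \<partial>U)"
   by (rule integral_nonneg_AE; simp)+
  ultimately have "(\<integral>x. indicator {b<..1} x * (AS k2 0 x)^2 \<partial>U) <= K^2" "(\<integral>x. indicator {b<..1} x * (?p x)^2 \<partial>U) <= K^2"
   by linarith+
  then show "integrable U (%x. indicator {b<..1} x * (AS k2 0 x)^2) & (\<integral>x. indicator {b<..1} x * (AS k2 0 x)^2 \<partial>U) <= K^2"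
   "integrable U (%x. indicator {b<..1} x * (?p x)^2) & (\<integral>x. indicator {b<..1} x * (?p x)^2 \<partial>U) <= K^2"
   using I(1,2) unfolding p2 by blast+
 qed
 have y: "sq (AS k2 0)" "norm2 (AS k2 0) <= K" by (rule sq_norm2_from_below[OF _ K(1) E(1)]; measurable)+
 have p: "sq ?p" "norm2 ?p <= K" by (rule sq_norm2_from_below[OF _ K(1) E(2)]; measurable)+
 have "0 <= \<tau>" using \<delta> \<alpha> by simp
 then have "average k0 (%s. pairing (V s) (Sop f)) 0 = - pairing (AS k2 0) (Sop f)"
  using pairing_y[of 0, OF _ Sop_sq[OF f]] by (simp add: pairing_def)
 then have "\<bar>average k0 (%s. pairing (V s) (Sop f)) 0\<bar> <= norm2 (AS k2 0) * norm2 (Sop f)"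
  using sq_cs(2)[OF y(1) Sop_sq[OF f]] by (simp add: pairing_def)
 also have "... <= K * norm2 (Sop f)" by (rule mult_right_mono[OF y(2)]) simp
 finally show "\<bar>average k0 (%s. pairing (V s) (Sop f)) 0\<bar> <= K * norm2 (Sop f)" .
 have "AP k1 0 x * flux f x = ?p x * (x powr (- \<alpha> / 2) * Pop f x)" for x
 proof -
  have "x powr - \<alpha> = x powr (- \<alpha> / 2) * x powr (- \<alpha> / 2)" by (simp add: powr_add[symmetric])
  then show ?thesis unfolding flux_def by (simp only: mult_ac)
 qed
 then have "average k1 (%s. pairing (V s) (Sop f)) 0 = (\<integral>x. ?p x * (x powr (- \<alpha> / 2) * Pop f x) \<partial>U)"
  unfolding pairing_average(2)[OF k(2) f, symmetric] by (simp only:)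
 then have "\<bar>average k1 (%s. pairing (V s) (Sop f)) 0\<bar> <= norm2 ?p * H1_seminorm \<alpha> (Sop f)"
  using sq_cs(2)[OF p(1) weighted_flux_sq[OF f]] unfolding H1_seminorm_Sop[OF f] by simp
 also have "... <= K * H1_seminorm \<alpha> (Sop f)"
  by (rule mult_right_mono[OF p(2)]) (simp add: H1_seminorm_def L2_norm_def)
 finally show "\<bar>average k1 (%s. pairing (V s) (Sop f)) 0\<bar> <= K * H1_seminorm \<alpha> (Sop f)" .
qed

end

section \<open>Construction of the kernels\<close>

lemma power_dvd_pderiv:
 fixes q p :: "real poly"
 assumes "q ^ Suc n dvd p" shows "q ^ n dvd pderiv p"
proof -
 obtain r where "p = q ^ Suc n * r" using assms by (auto elim: dvdE)
 then have "pderiv p = q ^ Suc n * pderiv r + r * smult (of_nat (Suc n)) (q ^ n) * pderiv q"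
  by (simp only: pderiv_mult pderiv_power_Suc mult.assoc)
 also have "... = q ^ n * (q * pderiv r + smult (of_nat (Suc n)) r * pderiv q)"
  by (simp add: algebra_simps)
 finally show ?thesis by simp
qed

definition bump :: "real => real poly" where "bump \<eta> = [:0, \<eta>, -1:]"

lemma poly_bump: "poly (bump \<eta>) u = u * (\<eta> - u)" by (simp add: bump_def algebra_simps)

definition cut :: "real => real poly => real => real" where
 "cut \<eta> p u = (if u \<in> {0..\<eta>} then poly p u else 0)"

lemma poly_bounded_on: obtains B where "0 <= B" "!!u. u \<in> {a..b} ==> \<bar>poly p (u::real)\<bar> <= B"
proof -
 have "bounded (poly p ` {a..b})"
  by (intro compact_imp_bounded compact_continuous_image continuous_intros) auto
 then obtain B where B: "\<forall>u\<in>{a..b}. \<bar>poly p u\<bar> <= B" by (auto simp: bounded_iff)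
 then have "\<bar>poly p u\<bar> <= max B 0" if "u \<in> {a..b}" for u using bspec[OF B that] by linarith
 then show thesis using that[of "max B 0"] by simp
qed

text \<open>Double zeros at 0 and \<eta> make the extension by 0 differentiable there, with
  derivative 0.\<close>

lemma cut_derivative:
 assumes \<eta>: "0 < \<eta>" and p: "bump \<eta> ^ 2 dvd p"
 shows "(cut \<eta> p has_real_derivative cut \<eta> (pderiv p) u) (at u)"
proof -
 obtain r where r: "p = bump \<eta> ^ 2 * r" using p by (auto elim: dvdE)
 obtain R where R: "0 <= R" "!!u. u \<in> {0..\<eta>} ==> \<bar>poly r u\<bar> <= R" by (rule poly_bounded_on) blast
 have "bump \<eta> ^ 1 dvd pderiv p" by (rule power_dvd_pderiv) (use p in "simp add: numeral_2_eq_2")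
 then obtain r' where r': "pderiv p = bump \<eta> * r'" by (auto elim: dvdE)
 have edge: "(cut \<eta> p has_real_derivative 0) (at e)" if e: "e = 0 \<or> e = \<eta>" for e
 proof (rule has_derivative_from_bound[of 1])
  fix y :: real assume y: "\<bar>y - e\<bar> < 1"
  have e0: "cut \<eta> p e = 0" using e by (auto simp: cut_def r poly_bump)
  have "\<bar>cut \<eta> p y\<bar> <= (\<eta>\<^sup>2 * R) * (\<bar>y - e\<bar> * \<bar>y - e\<bar>)"
  proof (cases "y \<in> {0..\<eta>}")
   case True
   \<comment> \<open>The factor of \<open>y * (\<eta> - y)\<close> that stays away from 0 near the
     endpoint \<open>e\<close>.\<close>
   define o' where "o' = (if e = 0 then \<eta> - y else y)"
   have o': "0 <= o'" "o' <= \<eta>" "(y * (\<eta> - y))^2 = (\<bar>y - e\<bar> * \<bar>y - e\<bar>) * o'^2"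
    using True e by (auto simp: o'_def power2_eq_square algebra_simps)
   have "o'^2 * \<bar>poly r y\<bar> <= \<eta>\<^sup>2 * R" using o' R(2)[OF True] by (intro mult_mono power_mono) auto
   then have "(\<bar>y - e\<bar> * \<bar>y - e\<bar>) * (o'^2 * \<bar>poly r y\<bar>) <= (\<bar>y - e\<bar> * \<bar>y - e\<bar>) * (\<eta>\<^sup>2 * R)"
    by (rule mult_left_mono) simp
   moreover have "\<bar>cut \<eta> p y\<bar> = (y * (\<eta> - y))^2 * \<bar>poly r y\<bar>"
    using True by (simp add: cut_def r poly_bump abs_mult)
   then have "\<bar>cut \<eta> p y\<bar> = (\<bar>y - e\<bar> * \<bar>y - e\<bar>) * (o'^2 * \<bar>poly r y\<bar>)" unfolding o'(3) by (simp only: mult.assoc)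
   ultimately show ?thesis by (simp only: mult.commute[of "\<eta>\<^sup>2 * R"])
  qed (use R in "auto simp: cut_def")
  also have "... <= (\<eta>\<^sup>2 * R) * (\<bar>y - e\<bar> * sqrt \<bar>y - e\<bar>)"
   using y R(1) by (intro mult_left_mono le_sqrt) auto
  finally show "\<bar>cut \<eta> p y - cut \<eta> p e - (y - e) * 0\<bar> <= (\<eta>\<^sup>2 * R) * \<bar>y - e\<bar> * sqrt \<bar>y - e\<bar>"
   unfolding e0 by (simp add: mult.assoc)
 qed simp
 consider "u < 0" | "u > \<eta>" | "0 < u" "u < \<eta>" | "u = 0 \<or> u = \<eta>" by fastforce
 then show ?thesis
 proof cases
  case 1
  have "(cut \<eta> p has_real_derivative 0) (at u)"
   by (rule has_field_derivative_transform_within_open[OF DERIV_const[of 0], of "{..<0}"]) (use 1 in "auto simp: cut_def")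
  then show ?thesis using 1 by (simp add: cut_def)
 next
  case 2
  have "(cut \<eta> p has_real_derivative 0) (at u)"
   by (rule has_field_derivative_transform_within_open[OF DERIV_const[of 0], of "{\<eta><..}"]) (use 2 in "auto simp: cut_def")
  then show ?thesis using 2 by (simp add: cut_def)
 next
  case 3
  have "(cut \<eta> p has_real_derivative poly (pderiv p) u) (at u)"
   by (rule has_field_derivative_transform_within_open[OF poly_DERIV, of "{0<..<\<eta>}"]) (use 3 in "auto simp: cut_def")
  then show ?thesis using 3 by (simp add: cut_def)
 next
  case 4
  then have "cut \<eta> (pderiv p) u = 0" by (auto simp: cut_def r' poly_bump)
  then show ?thesis using edge[OF 4] by simp
 qed
qed

lemma kernel_cut:
 assumes "0 < \<eta>" "bump \<eta> ^ 2 dvd p"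
 shows "kernel \<eta> (cut \<eta> p) (cut \<eta> (pderiv p))"
proof -
 obtain B where "0 <= B" "!!u. u \<in> {0..\<eta>} ==> \<bar>poly (pderiv p) u\<bar> <= B" by (rule poly_bounded_on) blast
 then have "\<forall>u. \<bar>cut \<eta> (pderiv p) u\<bar> <= B" by (simp add: cut_def)
 moreover have "\<forall>u. u \<notin> {0..\<eta>} --> cut \<eta> p u = 0" by (simp add: cut_def)
 ultimately show ?thesis unfolding kernel_def using assms(1) cut_derivative[OF assms] by (auto simp del: atLeastAtMost_iff)
qed

text \<open>The fifth power of the bump keeps a double zero after three differentiations, which is
  what \<open>kernel_cut\<close> requires of \<open>k3\<close>.\<close>

lemma exists_kernels:
 assumes \<eta>: "0 < \<eta>"
 obtains k0 k1 k2 k3 k4 where "kernel \<eta> k0 k1" "kernel \<eta> k1 k2" "kernel \<eta> k2 k3" "kernel \<eta> k3 k4"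
  "!!u. 0 <= k0 u" "integrable lborel k0" "(\<integral>u. k0 u \<partial>lborel) = 1"
proof -
 define b where "b = cut \<eta> (bump \<eta> ^ 5)"
 have bk: "kernel \<eta> b (cut \<eta> (pderiv (bump \<eta> ^ 5)))"
  unfolding b_def by (rule kernel_cut[OF \<eta>]) (simp add: le_imp_power_dvd)
 have [measurable]: "b \<in> Borel" by (rule kernel_measurable[OF bk])
 have b0: "0 <= b u" for u by (auto simp: b_def cut_def poly_power poly_bump)
 obtain B where B: "0 <= B" "!!u. \<bar>b u\<bar> <= B" using kernel_bounded[OF bk] by blast
 have bi: "integrable lborel b"
 proof (rule lborel_integral_bound(1)[of _ 0 \<eta> 0 \<eta> B])
  fix s show "\<bar>b s\<bar> <= B * (indicator {0..\<eta>} s + indicator {0..\<eta>} s)"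
  proof (cases "s \<in> {0..\<eta>}")
   case True
   then show ?thesis using B(2)[of s] B(1) by simp
  qed (auto simp: b_def cut_def)
 qed (use \<eta> in auto)
 define I where "I = (\<integral>u. b u \<partial>lborel)"
 \<comment> \<open>On the middle half of the support the bump is at least
   \<open>3 * \<eta>^2 / 16\<close>, so its mass is positive and can be normalised.\<close>
 have "(\<integral>u. (3 * \<eta>\<^sup>2 / 16) ^ 5 * indicator {\<eta>/4..3*\<eta>/4} u \<partial>lborel) <= I"
  unfolding I_def
 proof (rule integral_mono[OF _ bi])
  show "integrable lborel (%u. (3 * \<eta>\<^sup>2 / 16) ^ 5 * indicator {\<eta>/4..3*\<eta>/4} u :: real)"
   by (intro integrable_mult_right integrable_real_indicator) (auto simp: emeasure_lborel_Icc_eq)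
  fix u
  show "(3 * \<eta>\<^sup>2 / 16) ^ 5 * indicator {\<eta>/4..3*\<eta>/4} u <= b u"
  proof (cases "u \<in> {\<eta>/4..3*\<eta>/4}")
   case True
   then have "0 <= (u - \<eta>/4) * (3*\<eta>/4 - u)" by simp
   moreover have "(u - \<eta>/4) * (3*\<eta>/4 - u) = u * (\<eta> - u) - 3 * \<eta>\<^sup>2 / 16" by (simp add: power2_eq_square field_simps)
   ultimately have "3 * \<eta>\<^sup>2 / 16 <= u * (\<eta> - u)" by linarith
   then have "(3 * \<eta>\<^sup>2 / 16) ^ 5 <= (u * (\<eta> - u)) ^ 5" by (intro power_mono) auto
   then show ?thesis using True \<eta> by (simp add: b_def cut_def poly_power poly_bump)
  qed (simp add: b0)
 qed
 moreover have "0 < (\<integral>u. (3 * \<eta>\<^sup>2 / 16) ^ 5 * indicator {\<eta>/4..3*\<eta>/4} u \<partial>lborel)" using \<eta> by simp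
 ultimately have I: "0 < I" by linarith
 define p where "p = smult (1 / I) (bump \<eta> ^ 5)"
 have pb: "cut \<eta> p = (%u. 1 / I * b u)" by (auto simp: p_def b_def cut_def)
 have d: "bump \<eta> ^ 5 dvd p" unfolding p_def by (rule dvd_smult) simp
 have d1: "bump \<eta> ^ 4 dvd pderiv p" by (rule power_dvd_pderiv) (use d in "simp add: eval_nat_numeral")
 have d2: "bump \<eta> ^ 3 dvd pderiv (pderiv p)" by (rule power_dvd_pderiv) (use d1 in "simp add: eval_nat_numeral")
 have d3: "bump \<eta> ^ 2 dvd pderiv (pderiv (pderiv p))" by (rule power_dvd_pderiv) (use d2 in "simp add: eval_nat_numeral")
 have le: "bump \<eta> ^ 2 dvd q" if "bump \<eta> ^ n dvd q" "2 <= n" for q n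
  using le_imp_power_dvd[OF that(2), of "bump \<eta>"] that(1) by (rule dvd_trans)
 show thesis
 proof (rule that)
  show "kernel \<eta> (cut \<eta> p) (cut \<eta> (pderiv p))" by (rule kernel_cut[OF \<eta> le[OF d]]) simp
  show "kernel \<eta> (cut \<eta> (pderiv p)) (cut \<eta> (pderiv (pderiv p)))" by (rule kernel_cut[OF \<eta> le[OF d1]]) simp
  show "kernel \<eta> (cut \<eta> (pderiv (pderiv p))) (cut \<eta> (pderiv (pderiv (pderiv p))))" by (rule kernel_cut[OF \<eta> le[OF d2]]) simp
  show "kernel \<eta> (cut \<eta> (pderiv (pderiv (pderiv p)))) (cut \<eta> (pderiv (pderiv (pderiv (pderiv p)))))" by (rule kernel_cut[OF \<eta> d3])
  show "0 <= cut \<eta> p u" for u unfolding pb using b0[of u] I by simp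
  show "integrable lborel (cut \<eta> p)" unfolding pb using bi by simp
  show "(\<integral>u. cut \<eta> p u \<partial>lborel) = 1" unfolding pb using I by (simp add: I_def)
 qed
qed

section \<open>Solutions by transposition\<close>

text \<open>Lebesgue measure is complete, so agreement almost everywhere with a Borel function makes
  \<open>F\<close> measurable.\<close>

lemma lebesgue_on_integral_cong:
 fixes F b :: "'a::euclidean_space => real"
 assumes A[measurable]: "A \<in> sets borel" and b[measurable]: "b \<in> Borel"
  and ae: "AE x in lborel. x \<in> A --> F x = b x"
 shows "(LINT x|lebesgue_on A. F x) = (LINT x|lborel. indicator A x * b x)"
proof -
 have bm: "b \<in> borel_measurable (lebesgue_on A)" by (intro measurable_restrict_space1 measurable_completion) simp
 have "AE x in lebesgue. indicator A x *\<^sub>R b x = indicator A x *\<^sub>R F x"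
  using ae by (intro AE_completion) (auto elim!: eventually_mono simp: indicator_def)
 moreover have "(%x. indicator A x *\<^sub>R b x) \<in> borel_measurable lebesgue" by (intro measurable_completion) simp
 ultimately have "(%x. indicator A x *\<^sub>R F x) \<in> borel_measurable lebesgue" by (rule borel_measurable_AE[rotated])
 then have "F \<in> borel_measurable (lebesgue_on A)" by (subst borel_measurable_restrict_space_iff) auto
 then have "(LINT x|lebesgue_on A. F x) = (LINT x|lebesgue_on A. b x)"
  by (rule integral_cong_AE[OF _ bm lebesgue_on_AE[OF A ae]])
 then show ?thesis using lebesgue_on_integral_Borel(1)[OF A b] by simp
qed

lemma unit_integral_cong:
 fixes F b :: "real => real"
 assumes "b \<in> Borel" "AE x in U. F x = b x"
 shows "(LINT x|lebesgue_on {0<..<1}. F x) = (\<integral>x. b x \<partial>U)"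
 unfolding U_integral[OF assms(1)]
 by (rule lebesgue_on_integral_cong[OF _ assms(1)]) (use assms(2) in "simp_all add: U_AE")

lemma lebesgue_on_continuous:
 fixes F :: "real => real"
 assumes c: "continuous_on {0..T} F"
 shows "integrable (lebesgue_on {0<..<T}) F" "(LINT t|lebesgue_on {0<..<T}. F t) = integral {0..T} F"
proof -
 have "set_integrable lborel {0..T} F" by (rule borel_integrable_atLeastAtMost'[OF c])
 then have s: "set_integrable lborel {0<..<T} F" by (rule set_integrable_subset) auto
 then have "integrable lebesgue (%t. indicator {0<..<T} t *\<^sub>R F t)"
  unfolding set_integrable_def by (subst integrable_completion) auto
 then show i: "integrable (lebesgue_on {0<..<T}) F" by (subst integrable_restrict_space) auto
 then show "(LINT t|lebesgue_on {0<..<T}. F t) = integral {0..T} F"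
  by (simp add: lebesgue_integral_eq_integral integral_open_interval_real)
qed

lemma Linf_L2_representative:
 assumes v: "v \<in> Linf_L2 T"
 obtains V M where "(%(s, x). V s x) \<in> borel_measurable (borel \<Otimes>\<^sub>M borel)" "\<forall>s. sq (V s) & norm2 (V s) <= M"
  "\<forall>s x. s \<notin> {0<..<T} --> V s x = 0" "AE t in lborel. t \<in> {0<..<T} --> (AE x in U. v t x = V t x)"
proof -
 have vm: "(%(t, x). v t x) \<in> borel_measurable (lebesgue_on ({0<..<T} \<times> {0<..<1}))" using v by (simp add: Linf_L2_def)
 have vM0: "\<exists>M. AE t in lebesgue_on {0<..<T}. v t \<in> L2 & L2_norm (v t) <= M" using v by (simp add: Linf_L2_def)
 then obtain M0 where M0: "AE t in lebesgue_on {0<..<T}. v t \<in> L2 & L2_norm (v t) <= M0" ..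
 define M where "M = max M0 0"
 have M: "0 <= M" "M0 <= M" by (simp_all add: M_def)
 have box: "{0<..<T} \<times> {0<..<1::real} \<in> sets borel" by (intro borel_open open_Times) auto
 obtain g where g: "g \<in> Borel" and ae: "AE z in lborel. z \<in> {0<..<T} \<times> {0<..<1} --> (%(t, x). v t x) z = g z"
  by (rule lebesgue_on_Borel_representative[OF vm box])
 have gm[measurable]: "g \<in> borel_measurable (borel \<Otimes>\<^sub>M borel)" using g by (simp add: borel_prod)
 note ae[unfolded lborel_prod[symmetric]]
 then have "AE t in lborel. AE x in lborel. (t, x) \<in> {0<..<T} \<times> {0<..<1} --> (%(t, x). v t x) (t, x) = g (t, x)"
  by (rule lborel_pair.AE_pair)
 then have ae1: "AE t in lborel. t \<in> {0<..<T} --> (AE x in U. v t x = g (t, x))"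
  unfolding U_AE by (rule eventually_mono) (auto elim: eventually_mono)
 have "AE t in lebesgue. t \<in> {0<..<T} --> v t \<in> L2 & L2_norm (v t) <= M0" using M0 by (subst (asm) AE_restrict_space_iff) auto
 then have ae2: "AE t in lborel. t \<in> {0<..<T} --> v t \<in> L2 & L2_norm (v t) <= M0" by (simp add: AE_completion_iff)
 \<comment> \<open>A Borel condition on \<open>t\<close>, thanks to the nonnegative integral.
   Setting \<open>V\<close> to 0 at all other times turns a bound valid almost everywhere into one
   valid at every time.\<close>
 define good where "good t \<longleftrightarrow> t \<in> {0<..<T} & (\<integral>\<^sup>+x. ennreal ((g (t, x))^2) \<partial>U) <= ennreal (M^2)" for t
 define V where "V t x = (if good t then g (t, x) else 0)" for t x
 have "(%t. \<integral>\<^sup>+x. ennreal ((g (t, x))^2) \<partial>U) \<in> Borel" by measurable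
 then have [measurable]: "Measurable.pred borel good" unfolding good_def[abs_def] by measurable
 have V: "sq (V t) & norm2 (V t) <= M" for t
 proof (cases "good t")
  case True
  then have le: "(\<integral>\<^sup>+x. ennreal ((g (t, x))^2) \<partial>U) <= ennreal (M^2)" by (simp add: good_def)
  have i: "integrable U (%x. (g (t, x))^2)"
  proof (rule integrableI_bounded)
   show "(\<integral>\<^sup>+x. ennreal (norm ((g (t, x))^2)) \<partial>U) < \<infinity>" using le ennreal_less_top order.strict_trans1 by fastforce
  qed measurable
  have "ennreal (\<integral>x. (g (t, x))^2 \<partial>U) <= ennreal (M^2)" using le by (subst nn_integral_eq_integral[OF i, symmetric]) auto
  then have "(\<integral>x. (g (t, x))^2 \<partial>U) <= M^2" by (simp add: ennreal_le_iff)
  then show ?thesis using i True M(1) by (simp add: V_def[abs_def] sq_def norm2_def real_le_lsqrt)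
 next
  case False
  then show ?thesis using M(1) by (simp add: V_def[abs_def] sq_const norm2_def)
 qed
 show thesis
 proof (rule that[of V M])
  show "(%(s, x). V s x) \<in> borel_measurable (borel \<Otimes>\<^sub>M borel)" unfolding V_def by measurable
  show "AE t in lborel. t \<in> {0<..<T} --> (AE x in U. v t x = V t x)"
   using ae1 ae2
  proof eventually_elim
   case (elim t)
   show ?case
   proof
    assume t: "t \<in> {0<..<T}"
    then have vg: "AE x in U. v t x = g (t, x)" and L: "v t \<in> L2" "L2_norm (v t) <= M0" using elim by auto
    obtain a where a: "sq a" "AE x in U. v t x = a x" "L2_norm (v t) = norm2 a" by (rule L2_representative[OF L(1)])
    have "(\<integral>\<^sup>+x. ennreal ((g (t, x))^2) \<partial>U) = (\<integral>\<^sup>+x. ennreal ((a x)^2) \<partial>U)"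
    proof (rule nn_integral_cong_AE)
     show "AE x in U. ennreal ((g (t, x))^2) = ennreal ((a x)^2)" using vg a(2) by eventually_elim simp
    qed
    also have "... = ennreal ((norm2 a)^2)"
     unfolding norm2_square by (rule nn_integral_eq_integral[OF sq_integrable2[OF a(1)]]) simp
    also have "... <= ennreal (M^2)"
     using L(2) M unfolding a(3) by (intro ennreal_leI power_mono) auto
    finally have "good t" using t by (simp add: good_def)
    then show "AE x in U. v t x = V t x" using vg by (simp add: V_def)
   qed
  qed
 qed (use V in "auto simp: V_def good_def")
qed

context degenerate
begin

lemma Sop_scale: "Sop (%x. c * f x) = (%x. c * Sop f x)" "Pop (%x. c * f x) = (%x. c * Pop f x)"
proof -
 show P: "Pop (%x. c * f x) = (%x. c * Pop f x)" by (simp add: fun_eq_iff Pop_def J_def mult.left_commute right_diff_distrib)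
 show "Sop (%x. c * f x) = (%x. c * Sop f x)"
  by (simp add: fun_eq_iff Sop_def J_def flux_def P mult.left_commute)
qed

lemma Sop_multiple:
 assumes f: "sq f"
 shows "(%x. c * Sop f x) \<in> L2" "L2_norm (%x. c * Sop f x) = \<bar>c\<bar> * norm2 (Sop f)"
  "(%x. c * Sop f x) \<in> H1 \<alpha>" "H1_norm \<alpha> (%x. c * Sop f x) = \<bar>c\<bar> * H1_norm \<alpha> (Sop f)"
proof -
 have S: "sq (Sop f)" by (rule Sop_sq[OF f])
 have cf: "sq (%x. c * f x)" by (rule sq_mult_const(1)[OF f])
 have cS: "sq (%x. c * Sop f x)" by (rule sq_mult_const(1)[OF S])
 have m: "Sop f \<in> Borel" "(%x. c * Sop f x) \<in> Borel" using S cS by (simp_all add: sq_def)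
 show "(%x. c * Sop f x) \<in> L2" using L2_iff_sq(1)[OF m(2)] cS by simp
 show L: "L2_norm (%x. c * Sop f x) = \<bar>c\<bar> * norm2 (Sop f)" using L2_iff_sq(2)[OF m(2)] by (simp add: sq_mult_const(2))
 show "(%x. c * Sop f x) \<in> H1 \<alpha>" using Sop_H1[OF cf] by (simp add: Sop_scale)
 have "H1_seminorm \<alpha> (%x. c * Sop f x) = norm2 (%s. s powr (- \<alpha> / 2) * (c * Pop f s))"
  using H1_seminorm_Sop[OF cf] by (simp only: Sop_scale)
 also have "... = \<bar>c\<bar> * H1_seminorm \<alpha> (Sop f)"
  unfolding H1_seminorm_Sop[OF f] sq_mult_const(2)[symmetric] by (simp only: mult.left_commute)
 finally have "H1_seminorm \<alpha> (%x. c * Sop f x) = \<bar>c\<bar> * H1_seminorm \<alpha> (Sop f)" .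
 then have "H1_norm \<alpha> (%x. c * Sop f x) = sqrt (c^2 * ((norm2 (Sop f))^2 + (H1_seminorm \<alpha> (Sop f))^2))"
  unfolding H1_norm_def L by (simp add: power_mult_distrib distrib_left)
 then show "H1_norm \<alpha> (%x. c * Sop f x) = \<bar>c\<bar> * H1_norm \<alpha> (Sop f)"
  unfolding H1_norm_def L2_iff_sq(2)[OF m(1)] by (simp only: real_sqrt_mult real_sqrt_abs)
qed

text \<open>Separation of variables: \<open>Sop f\<close> solves the stationary problem with source
  \<open>f\<close>. For a fixed test function the spatial integrals reduce to the two numbers
  \<open>A\<close> and \<open>B\<close>, and an integration by parts in time remains.\<close>

lemma separated_weak_solution:
 assumes T: "0 < T" and f: "sq f"
  and h: "!!t. t \<in> {0..T} ==> (h has_real_derivative h' t) (at t within {0..T})"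
  and h': "!!t. t \<in> {0..T} ==> (h' has_real_derivative h'' t) (at t within {0..T})"
  and h'': "continuous_on {0..T} h''" and h0: "h 0 = 0" "h' 0 = 0"
 shows "weak_solution \<alpha> T (%t x. h'' t * Sop f x + h t * f x) (%x. 0) (%x. 0) (%t x. h t * Sop f x) (%t x. h' t * Sop f x)"
proof -
 have S: "sq (Sop f)" by (rule Sop_sq[OF f])
 note mult = Sop_multiple[OF f]
 have ch: "continuous_on {0..T} h" "continuous_on {0..T} h'" by (rule DERIV_continuous_on[OF h] DERIV_continuous_on[OF h'], assumption)+
 have lim: "((%s. \<bar>e s - e t\<bar> * C) \<longlongrightarrow> 0) (at t within {0..T})" if "continuous_on {0..T} e" "t \<in> {0..T}" for e :: "real => real" and t C
 proof -
  have "(e \<longlongrightarrow> e t) (at t within {0..T})" using that by (simp add: continuous_on_def)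
  from tendsto_mult[OF tendsto_rabs[OF tendsto_diff[OF this tendsto_const]] tendsto_const]
  have "((%s. \<bar>e s - e t\<bar> * C) \<longlongrightarrow> \<bar>e t - e t\<bar> * C) (at t within {0..T})" .
  then show ?thesis by simp
 qed
 have L: "(%t x. e t * Sop f x) \<in> C0_L2 T" if "continuous_on {0..T} e" for e
  unfolding C0_L2_def using lim[OF that] by (simp add: mult left_diff_distrib[symmetric])
 have C0: "(%t x. h t * Sop f x) \<in> C0_H1 \<alpha> T"
  unfolding C0_H1_def using lim[OF ch(1)] by (simp add: mult left_diff_distrib[symmetric])
 have C1: "C1_L2_with T (%t x. h t * Sop f x) (%t x. h' t * Sop f x)"
  unfolding C1_L2_with_def
 proof (intro conjI L ch ballI)
  fix t assume t: "t \<in> {0..T}"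
  have "((%s. (h s - h t) / (s - t)) \<longlongrightarrow> h' t) (at t within {0..T})" using h[OF t] by (simp add: has_field_derivative_iff)
  from tendsto_mult[OF tendsto_rabs[OF tendsto_diff[OF this tendsto_const]] tendsto_const]
  have "((%s. \<bar>(h s - h t) / (s - t) - h' t\<bar> * norm2 (Sop f)) \<longlongrightarrow> \<bar>h' t - h' t\<bar> * norm2 (Sop f)) (at t within {0..T})" .
  moreover have "(%x. (h s * Sop f x - h t * Sop f x) / (s - t) - h' t * Sop f x) = (%x. ((h s - h t) / (s - t) - h' t) * Sop f x)" for s
   by (simp add: fun_eq_iff left_diff_distrib diff_divide_distrib)
  ultimately show "((%s. L2_norm (%x. (h s * Sop f x - h t * Sop f x) / (s - t) - h' t * Sop f x)) \<longlongrightarrow> 0) (at t within {0..T})"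
   by (simp add: mult(2))
 qed
 have var: "(LINT t|lebesgue_on {0<..<T}. LINT x|lebesgue_on {0<..<1}.
      - (h' t * Sop f x) * w x * deriv \<phi> t + x powr \<alpha> * deriv (%x. h t * Sop f x) x * deriv w x * \<phi> t)
    = (LINT t|lebesgue_on {0<..<T}. LINT x|lebesgue_on {0<..<1}. (h'' t * Sop f x + h t * f x) * w x * \<phi> t)"
  if w: "w \<in> H1 \<alpha>" and \<phi>: "\<phi> \<in> test_functions T" for w \<phi>
 proof -
  have diff: "(deriv ^^ n) \<phi> field_differentiable at t" for n t using \<phi> by (simp add: test_functions_def)
  have d0: "(\<phi> has_real_derivative deriv \<phi> t) (at t)" for t
   using diff[of 0 t] by (simp add: DERIV_deriv_iff_field_differentiable)
  have "isCont (deriv \<phi>) t" for t using diff[of 1 t] by (simp add: field_differentiable_imp_continuous_at)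
  then have c\<phi>': "continuous_on {0..T} (deriv \<phi>)" by (simp add: continuous_at_imp_continuous_on)
  have c\<phi>: "continuous_on {0..T} \<phi>" using d0 by (intro continuous_at_imp_continuous_on) (auto intro: DERIV_isCont)
  have \<phi>0: "\<phi> 0 = 0" "\<phi> T = 0" using \<phi> by (auto simp: test_functions_def subset_eq)
  obtain g where g: "h1_deriv w g" by (rule h1_deriv_exists[OF w])
  have [measurable]: "g \<in> Borel" "f \<in> Borel" using g f by (auto simp: h1_deriv_def sq_def)
  have "w \<in> L2" using w by (auto simp: H1_def split: if_splits)
  then obtain a where a: "sq a" "AE x in U. w x = a x" by (rule L2_representative)
  have [measurable]: "a \<in> Borel" using a by (simp add: sq_def)
  define A where "A = (\<integral>x. Sop f x * a x \<partial>U)"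
  define B where "B = (\<integral>x. f x * a x \<partial>U)"
  have rep: "AE x in U. a x = - J g x 1"
   using a(2) U_AE_in by eventually_elim (use g in "auto simp: h1_deriv_def")
  have "B = (\<integral>x. f x * - J g x 1 \<partial>U)" unfolding B_def
   by (rule integral_cong_AE) (use rep in "auto elim: eventually_mono")
  then have B: "(\<integral>s. Pop f s * g s \<partial>U) = - B" using weak_form(2)[OF f g] by simp
  note Pg = weak_form(1)[OF f g]
  have aeg: "AE x in U. deriv w x = g x" using g by (simp add: h1_deriv_def)
  have lhs: "(LINT x|lebesgue_on {0<..<1}. - (h' t * Sop f x) * w x * deriv \<phi> t + x powr \<alpha> * deriv (%x. h t * Sop f x) x * deriv w x * \<phi> t)
    = - (h' t * deriv \<phi> t) * A + h t * \<phi> t * B" for t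
  proof -
   have "(LINT x|lebesgue_on {0<..<1}. - (h' t * Sop f x) * w x * deriv \<phi> t + x powr \<alpha> * deriv (%x. h t * Sop f x) x * deriv w x * \<phi> t)
    = (\<integral>x. - (h' t * deriv \<phi> t) * (Sop f x * a x) + - (h t * \<phi> t) * (Pop f x * g x) \<partial>U)"
   proof (rule unit_integral_cong)
    show "AE x in U. - (h' t * Sop f x) * w x * deriv \<phi> t + x powr \<alpha> * deriv (%x. h t * Sop f x) x * deriv w x * \<phi> t
     = - (h' t * deriv \<phi> t) * (Sop f x * a x) + - (h t * \<phi> t) * (Pop f x * g x)"
     using a(2) aeg U_AE_in
    proof eventually_elim
     case (elim x)
     have "deriv (%x. h t * Sop f x) x = - (x powr - \<alpha> * (h t * Pop f x))"
      using deriv_Sop[OF sq_mult_const(1)[OF f, of "h t"], of x] elim by (simp only: Sop_scale flux_def)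
     moreover have "x powr \<alpha> * x powr - \<alpha> = 1" using elim by (simp add: powr_add[symmetric])
     ultimately have "x powr \<alpha> * deriv (%x. h t * Sop f x) x = - (h t * Pop f x)" by (simp add: mult.assoc[symmetric])
     then show ?case unfolding elim(1,2) by simp
    qed
   qed measurable
   also have "... = - (h' t * deriv \<phi> t) * A + - (h t * \<phi> t) * (\<integral>x. Pop f x * g x \<partial>U)"
    unfolding A_def using sq_cs(1)[OF S a(1)] Pg by (subst Bochner_Integration.integral_add) auto
   finally show ?thesis unfolding B by simp
  qed
  have rhs: "(LINT x|lebesgue_on {0<..<1}. (h'' t * Sop f x + h t * f x) * w x * \<phi> t) = h'' t * \<phi> t * A + h t * \<phi> t * B" for t
  proof -
   have "(LINT x|lebesgue_on {0<..<1}. (h'' t * Sop f x + h t * f x) * w x * \<phi> t)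
    = (\<integral>x. (h'' t * \<phi> t) * (Sop f x * a x) + (h t * \<phi> t) * (f x * a x) \<partial>U)"
   proof (rule unit_integral_cong)
    show "AE x in U. (h'' t * Sop f x + h t * f x) * w x * \<phi> t = (h'' t * \<phi> t) * (Sop f x * a x) + (h t * \<phi> t) * (f x * a x)"
     using a(2) by eventually_elim (simp add: distrib_left distrib_right mult_ac)
   qed measurable
   then show ?thesis
    unfolding A_def B_def using sq_cs(1)[OF S a(1)] sq_cs(1)[OF f a(1)] by simp
  qed
  \<comment> \<open>The two sides differ by \<open>A\<close> times the integral of the derivative of
    \<open>h' * \<phi>\<close>, which is 0 because \<phi> vanishes at both ends.\<close>
  have "((%t. h'' t * \<phi> t + h' t * deriv \<phi> t) has_integral h' T * \<phi> T - h' 0 * \<phi> 0) {0..T}"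
  proof (rule has_integral_real_derivative)
   fix t assume "t \<in> {0..T}"
   then show "((%t. h' t * \<phi> t) has_real_derivative h'' t * \<phi> t + h' t * deriv \<phi> t) (at t within {0..T})"
    by (auto intro!: derivative_eq_intros h' has_field_derivative_at_within[OF d0])
  qed (use T in simp)
  then have zero: "integral {0..T} (%t. h'' t * \<phi> t + h' t * deriv \<phi> t) = 0" using \<phi>0 by (simp add: integral_unique)
  have "integral {0..T} (%t. h'' t * \<phi> t * A + h t * \<phi> t * B) - integral {0..T} (%t. - (h' t * deriv \<phi> t) * A + h t * \<phi> t * B)
    = integral {0..T} (%t. (h'' t * \<phi> t * A + h t * \<phi> t * B) - (- (h' t * deriv \<phi> t) * A + h t * \<phi> t * B))"
   by (intro Henstock_Kurzweil_Integration.integral_diff[symmetric] integrable_continuous_interval continuous_intros ch h'' c\<phi> c\<phi>')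
  also have "... = integral {0..T} (%t. (h'' t * \<phi> t + h' t * deriv \<phi> t) * A)"
   by (intro integral_cong) (simp add: distrib_right)
  also have "... = 0" using zero by simp
  finally have eq: "integral {0..T} (%t. - (h' t * deriv \<phi> t) * A + h t * \<phi> t * B) = integral {0..T} (%t. h'' t * \<phi> t * A + h t * \<phi> t * B)"
   by simp
  have "(LINT t|lebesgue_on {0<..<T}. - (h' t * deriv \<phi> t) * A + h t * \<phi> t * B) = (LINT t|lebesgue_on {0<..<T}. h'' t * \<phi> t * A + h t * \<phi> t * B)"
   by (subst (1 2) lebesgue_on_continuous(2); intro continuous_intros ch h'' c\<phi> c\<phi>' eq)
  then show ?thesis unfolding lhs rhs .
 qed
 show ?thesis unfolding weak_solution_def using C0 C1 var h0 by simp
qed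

end

context bounded_path
begin

text \<open>The definition of \<open>v\<close> is tested with the backward solutions
  \<open>g t * Sop f x\<close>. The conditions on \<open>g\<close> and \<open>g'\<close> at
  \<open>T\<close> are the zero final data, and their values at 0 bring in the initial data of
  \<open>v\<close>.\<close>

lemma transposition_identity:
 assumes T: "0 < T" and tr: "transposition_solution \<alpha> T v0 v1 v" and v1: "v1 \<in> Hm1 \<alpha>" and f: "sq f"
  and g: "!!t. t \<in> {0..T} ==> (g has_real_derivative g' t) (at t within {0..T})"
  and g': "!!t. t \<in> {0..T} ==> (g' has_real_derivative g'' t) (at t within {0..T})"
  and g'': "continuous_on {0..T} g''" and gT: "g T = 0" "g' T = 0"
  and V0: "!!s x. s \<notin> {0<..<T} ==> V s x = 0"
  and ae: "AE t in lborel. t \<in> {0<..<T} --> (AE x in U. v t x = V t x)"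
 shows "(\<integral>t. g'' t * pairing (V t) (Sop f) + g t * pairing (V t) f \<partial>lborel) = - g' 0 * L2_inner v0 (Sop f) + g 0 * v1 (Sop f)"
proof -
 \<comment> \<open>Clamping time to \<open>{0..T}\<close> makes the coefficients Borel and bounded
   on the whole line without changing them on that interval.\<close>
 define c where "c t = max 0 (min T t)" for t :: real
 have cT: "c t \<in> {0..T}" for t using T by (auto simp: c_def)
 have cid: "c t = t" if "t \<in> {0..T}" for t using that by (auto simp: c_def)
 have cg: "continuous_on {0..T} g" "continuous_on {0..T} g'" by (rule DERIV_continuous_on[OF g] DERIV_continuous_on[OF g'], assumption)+
 have cc: "continuous_on UNIV (%t. e (c t))" if "continuous_on {0..T} e" for e :: "real => real"
  by (rule continuous_on_compose2[OF that]) (use cT in "auto simp: c_def[abs_def] intro!: continuous_intros")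
 have [measurable]: "(%t. g (c t)) \<in> Borel" "(%t. g'' (c t)) \<in> Borel"
  by (intro borel_measurable_continuous_onI cc cg g'')+
 have [measurable]: "f \<in> Borel" using f by (simp add: sq_def)
 have S: "sq (Sop f)" by (rule Sop_sq[OF f])
 define F where "F t x = g'' (c t) * Sop f x + g (c t) * f x" for t x
 have Fsq: "sq (F t)" for t unfolding F_def[abs_def] by (intro sq_add sq_mult_const S f)
 have Fm[measurable]: "(%(t, x). F t x) \<in> borel_measurable (borel \<Otimes>\<^sub>M borel)" unfolding F_def by measurable
 have bnd: "\<exists>C. \<forall>t. \<bar>e (c t)\<bar> <= C" if "continuous_on {0..T} e" for e :: "real => real"
 proof -
  have "bounded (e ` {0..T})" by (intro compact_imp_bounded compact_continuous_image that) simp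
  then obtain C where "\<forall>t\<in>{0..T}. \<bar>e t\<bar> <= C" by (auto simp: bounded_iff)
  then show ?thesis using cT by blast
 qed
 obtain C1 C2 where C: "!!t. \<bar>g'' (c t)\<bar> <= C1" "!!t. \<bar>g (c t)\<bar> <= C2" using bnd[OF g''] bnd[OF cg(1)] by blast
 have FL1: "F \<in> L1_L2 T"
 proof -
  have m: "(%(t, x). F t x) \<in> Borel" using Fm by (simp only: borel_prod)
  have m1: "(%(t, x). F t x) \<in> borel_measurable (lebesgue_on ({0<..<T} \<times> {0<..<1}))"
   by (intro measurable_restrict_space1 measurable_completion) (use m in simp)
  have n: "L2_norm (F t) = norm2 (F t)" "F t \<in> L2" for t using L2_iff_sq[of "F t"] Fsq[of t] by (auto simp: sq_def)
  have nm[measurable]: "(%t. norm2 (F t)) \<in> Borel"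
  proof -
   have "(%(t, x). (F t x)^2) \<in> borel_measurable (borel \<Otimes>\<^sub>M U)" by measurable
   from U.borel_measurable_lebesgue_integral[OF this] show ?thesis unfolding norm2_def[abs_def] by measurable
  qed
  have "norm2 (F t) <= C1 * norm2 (Sop f) + C2 * norm2 f" for t
  proof -
   have "norm2 (F t) <= norm2 (%x. g'' (c t) * Sop f x) + norm2 (%x. g (c t) * f x)"
    unfolding F_def[abs_def] by (intro sq_add(2) sq_mult_const(1) S f)
   also have "... <= C1 * norm2 (Sop f) + C2 * norm2 f"
    unfolding sq_mult_const(2) using C by (intro add_mono mult_right_mono) auto
   finally show ?thesis .
  qed
  then have le: "norm2 (F t) <= C1 * norm2 (Sop f) + C2 * norm2 f" for t .
  have "integrable lborel (%t. indicator {0<..<T} t * norm2 (F t))"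
  proof (rule lborel_integral_bound(1)[of _ 0 T 0 T "C1 * norm2 (Sop f) + C2 * norm2 f"])
   fix t
   show "\<bar>indicator {0<..<T} t * norm2 (F t)\<bar> <= (C1 * norm2 (Sop f) + C2 * norm2 f) * (indicator {0..T} t + indicator {0..T} t)"
    using le[of t] norm2_nonneg[of "F t"] order_trans[OF norm2_nonneg le[of t]] by (auto simp: indicator_def)
  qed (use T in auto)
  then have "integrable (lebesgue_on {0<..<T}) (%t. norm2 (F t))" by (subst lebesgue_on_integral_Borel(2)) auto
  then show ?thesis using m1 n unfolding L1_L2_def by simp
 qed
 have bw: "backward_weak_solution \<alpha> T F (%t x. g (c t) * Sop f x) (%t x. g' (c t) * Sop f x)"
 proof -
  have im: "(%t. T - t) ` {0..T} = {0..T}" using T by (simp add: image_diff_atLeastAtMost)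
  have der: "((%t. e (c (T - t))) has_real_derivative - e' (c (T - t))) (at t within {0..T})"
   if e: "!!t. t \<in> {0..T} ==> (e has_real_derivative e' t) (at t within {0..T})" and t: "t \<in> {0..T}" for e e' t
  proof -
   have Tt: "T - t \<in> {0..T}" using t by simp
   have "((e \<circ> (%t. T - t)) has_real_derivative e' (T - t) * - 1) (at t within {0..T})"
    by (rule DERIV_image_chain) (use e[OF Tt] in "auto simp: im intro!: derivative_eq_intros")
   then have "((%t. e (c (T - t))) has_real_derivative e' (T - t) * - 1) (at t within {0..T})"
    by (rule has_field_derivative_transform_within[OF _ zero_less_one t]) (simp add: cid)
   then show ?thesis using cid[OF Tt] by simp
  qed
  have "weak_solution \<alpha> T (%t x. g'' (c (T - t)) * Sop f x + g (c (T - t)) * f x) (%x. 0) (%x. 0)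
    (%t x. g (c (T - t)) * Sop f x) (%t x. - g' (c (T - t)) * Sop f x)"
  proof (rule separated_weak_solution[OF T f])
   fix t assume t: "t \<in> {0..T}"
   show "((%t. g (c (T - t))) has_real_derivative - g' (c (T - t))) (at t within {0..T})" by (rule der[OF g t])
   show "((%t. - g' (c (T - t))) has_real_derivative g'' (c (T - t))) (at t within {0..T})"
    using DERIV_minus[OF der[OF g' t]] by (simp only: minus_minus)
  next
   show "continuous_on {0..T} (%t. g'' (c (T - t)))"
    by (rule continuous_on_compose2[OF cc[OF g'']]) (auto intro!: continuous_intros)
  qed (use gT T in "simp_all add: cid")
  then show ?thesis unfolding backward_weak_solution_def F_def by simp
 qed
 have "(LINT t|lebesgue_on {0<..<T}. LINT x|lebesgue_on {0<..<1}. v t x * F t x)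
   = - L2_inner v0 (%x. g' (c 0) * Sop f x) + v1 (%x. g (c 0) * Sop f x)"
  using tr FL1 bw unfolding transposition_solution_def by blast
 also have "L2_inner v0 (%x. g' (c 0) * Sop f x) = g' 0 * L2_inner v0 (Sop f)"
  using T by (simp add: L2_inner_def mult.left_commute cid)
 also have "v1 (%x. g (c 0) * Sop f x) = g 0 * v1 (Sop f)" using v1 Sop_H1[OF f] T by (simp add: Hm1_def cid)
 finally have 1: "(LINT t|lebesgue_on {0<..<T}. LINT x|lebesgue_on {0<..<1}. v t x * F t x) = - g' 0 * L2_inner v0 (Sop f) + g 0 * v1 (Sop f)"
  by simp
 define b where "b t = g'' (c t) * pairing (V t) (Sop f) + g (c t) * pairing (V t) f" for t
 have [measurable]: "b \<in> Borel" unfolding b_def[abs_def] by measurable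
 have "(LINT t|lebesgue_on {0<..<T}. LINT x|lebesgue_on {0<..<1}. v t x * F t x) = (LINT t|lborel. indicator {0<..<T} t * b t)"
 proof (rule lebesgue_on_integral_cong)
  show "AE t in lborel. t \<in> {0<..<T} --> (LINT x|lebesgue_on {0<..<1}. v t x * F t x) = b t"
   using ae
  proof eventually_elim
   case (elim t)
   show ?case
   proof
    assume "t \<in> {0<..<T}"
    then have "AE x in U. v t x = V t x" using elim by simp
    then have "AE x in U. v t x * F t x = V t x * F t x" by eventually_elim simp
    then have "(LINT x|lebesgue_on {0<..<1}. v t x * F t x) = (\<integral>x. V t x * F t x \<partial>U)"
     by (rule unit_integral_cong[rotated]) measurable
    also have "... = (\<integral>x. g'' (c t) * (V t x * Sop f x) + g (c t) * (V t x * f x) \<partial>U)"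
     by (intro Bochner_Integration.integral_cong refl) (simp add: F_def distrib_left mult_ac)
    also have "... = b t" using sq_cs(1)[OF Vsq S] sq_cs(1)[OF Vsq f] by (simp add: b_def pairing_def)
    finally show "(LINT x|lebesgue_on {0<..<1}. v t x * F t x) = b t" .
   qed
  qed
 qed auto
 also have "... = (\<integral>t. g'' t * pairing (V t) (Sop f) + g t * pairing (V t) f \<partial>lborel)"
  by (intro Bochner_Integration.integral_cong refl) (auto simp: indicator_def b_def cid pairing_def V0)
 finally show ?thesis using 1 by simp
qed

end

section \<open>Recovery of the initial data as the kernels shrink\<close>

lemma kernel_0:
 assumes k: "kernel \<eta> \<xi> \<xi>'" shows "u <= 0 ==> \<xi> u = 0"
proof -
 \<comment> \<open>The definition of a kernel leaves its value at 0 open; continuity from the left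
   settles it.\<close>
 have "isCont \<xi> 0" using kernel_continuous[OF k] by (simp add: continuous_on_eq_continuous_at)
 moreover have "((%e::real. - e) \<longlongrightarrow> 0) (at_right 0)" by (auto intro!: tendsto_eq_intros)
 ultimately have "((%e. \<xi> (- e)) \<longlongrightarrow> \<xi> 0) (at_right 0)" by (rule isCont_tendsto_compose)
 moreover have "eventually (%e. \<xi> (- e) = 0) (at_right 0)"
  using eventually_at_right_less[of "0::real"] by eventually_elim (use k in "simp add: kernel_def")
 then have "((%e. \<xi> (- e)) \<longlongrightarrow> 0) (at_right 0)" by (rule tendsto_eventually)
 ultimately have "\<xi> 0 = 0" by (rule tendsto_unique[OF trivial_limit_at_right_real])
 then show "u <= 0 ==> \<xi> u = 0" using k by (cases "u = 0") (auto simp: kernel_def)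
qed

text \<open>\<open>G1\<close> descends from 1 to 0 on the support of the kernel, and
  \<open>G2\<close> is the negative of a primitive of \<open>G1\<close>, of size at most \<eta>. As
  the factor \<open>g\<close> in the transposition identity they isolate the initial data:
  \<open>G2\<close> has slope -1 at 0 and selects \<open>v0\<close> up to a small multiple of
  \<open>v1\<close>, while \<open>G1\<close> has value 1 and slope 0 there and selects
  \<open>v1\<close>.\<close>

lemma kernel_primitives:
 assumes k: "kernel \<eta> \<xi> \<xi>'" and \<xi>: "!!u. 0 <= \<xi> u" "integrable lborel \<xi>" "(\<integral>u. \<xi> u \<partial>lborel) = 1" and T: "0 < \<eta>" "\<eta> < T"
 obtains G1 G2 where "G1 \<in> Borel" "G2 \<in> Borel"
  "\<forall>t\<in>{0..T}. (G1 has_real_derivative - \<xi> t) (at t within {0..T}) & (G2 has_real_derivative - G1 t) (at t within {0..T})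
   & \<bar>G1 t\<bar> <= 1 & \<bar>G2 t\<bar> <= \<eta>"
  "\<forall>t\<in>{\<eta>..T}. G1 t = 0" "G1 0 = 1" "G2 T = 0"
proof -
 have c: "continuous_on S \<xi>" for S by (rule continuous_on_subset[OF kernel_continuous[OF k]]) simp
 note intk = integrable_continuous_interval[OF c]
 define H1 where "H1 t = 1 - integral {0..t} \<xi>" for t
 define H2 where "H2 t = integral {0..T} H1 - integral {0..t} H1" for t
 have one: "integral {0..t} \<xi> = 1" if t: "\<eta> <= t" for t
 proof -
  have "integral {0..t} \<xi> = (\<integral>u. indicator {0..t} u * \<xi> u \<partial>lborel)"
   using set_borel_integral_eq_integral(2)[OF borel_integrable_atLeastAtMost'[OF c]] by (simp add: set_lebesgue_integral_def)
  also have "... = (\<integral>u. \<xi> u \<partial>lborel)"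
  proof (rule Bochner_Integration.integral_cong[OF refl])
   fix u
   have "\<xi> u = 0" if "u \<notin> {0..t}" using k t that by (auto simp: kernel_def)
   then show "indicator {0..t} u * \<xi> u = \<xi> u" by (cases "u \<in> {0..t}") auto
  qed
  finally show ?thesis using \<xi>(3) by simp
 qed
 have H1b: "0 <= H1 t" "H1 t <= 1" if "t \<in> {0..T}" for t
 proof -
  have "integral {0..t} \<xi> <= integral {0..T} \<xi>" using that \<xi>(1) by (intro integral_subset_le intk) auto
  then show "0 <= H1 t" using one[of T] T by (simp add: H1_def)
  show "H1 t <= 1" using integral_nonneg[OF intk, of 0 t] \<xi>(1) by (simp add: H1_def)
 qed
 have H10: "H1 t = 0" if "\<eta> <= t" for t using one[OF that] by (simp add: H1_def)
 have d1: "(H1 has_real_derivative - \<xi> t) (at t within {0..T})" if "t \<in> {0..T}" for t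
  unfolding H1_def[abs_def] using integral_has_real_derivative[OF c that] by (auto intro!: derivative_eq_intros)
 have c1: "continuous_on {0..T} H1" by (rule DERIV_continuous_on[OF d1])
 have d2: "(H2 has_real_derivative - H1 t) (at t within {0..T})" if "t \<in> {0..T}" for t
  unfolding H2_def[abs_def] using integral_has_real_derivative[OF c1 that] by (auto intro!: derivative_eq_intros)
 have c2: "continuous_on {0..T} H2" by (rule DERIV_continuous_on[OF d2])
 have iH: "H1 integrable_on {a..b}" if "0 <= a" "b <= T" for a b
  by (intro integrable_continuous_interval continuous_on_subset[OF c1]) (use that in auto)
 have H2b: "\<bar>H2 t\<bar> <= \<eta>" if t: "t \<in> {0..T}" for t
 proof -
  have "integral {0..t} H1 <= integral {0..T} H1" using t H1b by (intro integral_subset_le iH) auto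
  moreover have "0 <= integral {0..t} H1" using t H1b by (intro integral_nonneg iH) auto
  moreover have "integral {0..\<eta>} H1 + integral {\<eta>..T} H1 = integral {0..T} H1"
   using T by (intro Henstock_Kurzweil_Integration.integral_combine iH) auto
  moreover have "integral {\<eta>..T} H1 = integral {\<eta>..T} (%x. 0)" by (intro integral_cong) (simp add: H10)
  moreover have "integral {0..\<eta>} H1 <= integral {0..\<eta>} (%x. 1)" using T H1b by (intro integral_le iH) auto
  ultimately show ?thesis using T by (simp add: H2_def)
 qed
 define G where "G H t = H (max 0 (min T t))" for H :: "real => real" and t
 have Gid: "G H t = H t" if "t \<in> {0..T}" for H t using that by (auto simp: G_def)
 have Gm: "G H \<in> Borel" if "continuous_on {0..T} H" for H
  unfolding G_def by (intro borel_measurable_continuous_onI continuous_on_compose2[OF that]) (use T in "auto intro!: continuous_intros")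
 have Gd: "(G H has_real_derivative D) (at t within {0..T})" if "(H has_real_derivative D) (at t within {0..T})" "t \<in> {0..T}" for H D t
  by (rule has_field_derivative_transform_within[OF that(1) zero_less_one that(2)]) (simp add: Gid)
 show thesis
 proof (rule that[of "G H1" "G H2"])
  show "\<forall>t\<in>{0..T}. (G H1 has_real_derivative - \<xi> t) (at t within {0..T}) & (G H2 has_real_derivative - G H1 t) (at t within {0..T})
   & \<bar>G H1 t\<bar> <= 1 & \<bar>G H2 t\<bar> <= \<eta>"
   using Gd[OF d1] Gd[OF d2] H1b H2b by (simp add: Gid)
  show "\<forall>t\<in>{\<eta>..T}. G H1 t = 0" using H10 T by (simp add: Gid)
  show "G H1 0 = 1" "G H2 T = 0" using T by (simp_all add: Gid H1_def H2_def)
 qed (rule Gm[OF c1] Gm[OF c2])+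
qed

lemma le_by_small_parameter:
 fixes a b c d :: real
 assumes "0 < d" "0 <= c" "!!\<eta>. 0 < \<eta> ==> \<eta> < d ==> a <= b + \<eta> * c"
 shows "a <= b"
proof (rule field_le_epsilon)
 fix e :: real assume e: "0 < e"
 define \<eta> where "\<eta> = min (d / 2) (e / (c + 1))"
 have \<eta>: "0 < \<eta>" "\<eta> < d" "\<eta> <= e / (c + 1)" using assms(1,2) e by (auto simp: \<eta>_def)
 have "\<eta> * c <= e / (c + 1) * (c + 1)" using \<eta> assms(2) by (intro mult_mono) auto
 then show "a <= b + e" using assms(3)[OF \<eta>(1,2)] assms(2) by simp
qed

text \<open>Of the surplus \<open>4 * \<delta>\<close> in \<open>T\<close>, observability takes
  three parts, and the fourth makes room for the support of the kernels. The error in recovering the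
  data is of order \<eta>, while the observability bound does not depend on \<eta>.\<close>

lemma (in bounded_path) transposition_functionals_le:
 assumes T: "4 / (2 - \<alpha>) < T" and tr: "transposition_solution \<alpha> T v0 v1 v" and v1: "v1 \<in> Hm1 \<alpha>"
  and V0: "!!s x. s \<notin> {0<..<T} ==> V s x = 0"
  and ae: "AE t in lborel. t \<in> {0<..<T} --> (AE x in U. v t x = V t x)"
  and \<mu>: "0 < \<mu>" "\<mu> <= 1/2" and \<delta>: "\<delta> = (T - 4 / (2 - \<alpha>)) / 4"
  and X: "10 * (wave_with_primitive.flux_const (T - \<delta>) \<delta> * wave_with_primitive.obs_const (T - \<delta>) \<delta> / \<mu>^3)
   * (\<integral>s. (\<integral>x. indicator {1-\<mu><..1} x * (V s x)^2 \<partial>U) \<partial>lborel) <= X"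
  and K: "0 <= K" "K^2 = 4 * X / ((2 - \<alpha>) * \<delta>)" and f: "sq f"
 shows "\<bar>L2_inner v0 (Sop f)\<bar> <= K * norm2 (Sop f)" "\<bar>v1 (Sop f)\<bar> <= K * H1_seminorm \<alpha> (Sop f)"
proof -
 have "4 * \<delta> = T - 4 / (2 - \<alpha>)" using \<delta> by simp
 then have \<delta>0: "0 < \<delta>" and \<tau>: "T - \<delta> = 4 / (2 - \<alpha>) + 3 * \<delta>" using T by linarith+
 have "0 < 4 / (2 - \<alpha>)" using \<alpha> by simp
 then have Tpos: "0 < T" "\<delta> < T" using T \<delta>0 \<tau> by linarith+
 have V0': "V s x = 0" if "s \<notin> {0..T}" for s x by (rule V0) (use that in auto)
 have S: "sq (Sop f)" by (rule Sop_sq[OF f])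
 have fm[measurable]: "f \<in> Borel" "Sop f \<in> Borel" using f S by (simp_all add: sq_def)
 note id = transposition_identity[OF Tpos(1) tr v1 _ _ _ _ _ _ V0 ae]
 define N where "N = M * norm2 f"
 have N0: "0 <= N" by (simp add: N_def M)
 have main: "\<bar>L2_inner v0 (Sop f)\<bar> <= K * norm2 (Sop f) + \<eta> * (\<bar>v1 (Sop f)\<bar> + 2 * T * N)
   & \<bar>v1 (Sop f)\<bar> <= K * H1_seminorm \<alpha> (Sop f) + \<eta> * (2 * N)" if \<eta>: "0 < \<eta>" "\<eta> < \<delta>" for \<eta>
 proof -
  obtain k0 k1 k2 k3 k4 where k: "kernel \<eta> k0 k1" "kernel \<eta> k1 k2" "kernel \<eta> k2 k3" "kernel \<eta> k3 k4"
   and k0: "!!u. 0 <= k0 u" "integrable lborel k0" "(\<integral>u. k0 u \<partial>lborel) = 1"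
   using exists_kernels[OF \<eta>(1)] by metis
  have pi: "integrable lborel (%s. \<xi> (s - t) * pairing (V s) h)" if \<xi>: "kernel \<eta> \<xi> \<xi>'" and h: "sq h" for \<xi> \<xi>' h t
  proof -
   obtain B where B: "!!u. \<bar>\<xi> u\<bar> <= B" using kernel_bounded[OF \<xi>] by blast
   have [measurable]: "h \<in> Borel" using h by (simp add: sq_def)
   show ?thesis by (rule average_integrable(1)[OF \<xi> B _ pairing_bound[OF h]]) measurable
  qed
  \<comment> \<open>The shifted kernel vanishes at \<open>T\<close>, because
    \<open>t + \<eta>\<close> lies before \<open>T\<close>, and at 0 by \<open>kernel_0\<close>; so
    neither final nor initial data appear.\<close>
  have weak: "average \<xi>2 (%s. pairing (V s) (Sop h)) t + average \<xi> (%s. pairing (V s) h) t = 0"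
   if \<xi>: "kernel \<eta> \<xi> \<xi>1" "kernel \<eta> \<xi>1 \<xi>2" "kernel \<eta> \<xi>2 \<xi>3" and t: "t \<in> {0..T-\<delta>}" and h: "sq h" for \<xi> \<xi>1 \<xi>2 \<xi>3 t h
  proof -
   have der: "((%s. e (s - t)) has_real_derivative e' (s - t)) (at s within {0..T})" if "kernel \<eta> e e'" for e e' s
   proof -
    have "((%s. e (s + - t)) has_real_derivative e' (s + - t)) (at s)"
     using that by (subst DERIV_shift[symmetric]) (simp add: kernel_def)
    then show ?thesis by (simp add: has_field_derivative_at_within)
   qed
   have "(\<integral>s. \<xi>2 (s - t) * pairing (V s) (Sop h) + \<xi> (s - t) * pairing (V s) h \<partial>lborel)
     = - \<xi>1 (0 - t) * L2_inner v0 (Sop h) + \<xi> (0 - t) * v1 (Sop h)"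
   proof (rule id[where g="%s. \<xi> (s - t)" and g'="%s. \<xi>1 (s - t)" and g''="%s. \<xi>2 (s - t)", OF h])
    show "continuous_on {0..T} (%s. \<xi>2 (s - t))"
     by (rule continuous_on_compose2[OF kernel_continuous[OF \<xi>(3)]]) (auto intro!: continuous_intros)
    show "\<xi> (T - t) = 0" "\<xi>1 (T - t) = 0" using \<xi> t \<eta> by (auto simp: kernel_def)
   qed (rule der \<xi>)+
   also have "... = 0" using kernel_0[OF \<xi>(1), of "0 - t"] kernel_0[OF \<xi>(2), of "0 - t"] t by simp
   finally show ?thesis unfolding average_def using pi[OF \<xi>(3) Sop_sq[OF h]] pi[OF \<xi>(1) h] by simp
  qed
  interpret P: mollified_path \<alpha> V M \<eta> T "T - \<delta>" k0 k1 k2 k3 k4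
   by unfold_locales (rule k k0 weak[OF k(1-3)] weak[OF k(2-4)] V0' | assumption)+
  have X': "10 * (wave_with_primitive.flux_const (T - \<delta>) \<delta> * wave_with_primitive.obs_const (T - \<delta>) \<delta> / \<mu>^3) * (\<integral>s. P.strip \<mu> s \<partial>lborel) <= X"
   unfolding P.strip_def by (rule X)
  note F = P.initial_functionals_le[OF \<delta>0 \<tau> \<mu> X' K f]
  have \<eta>T: "\<eta> < T" using \<eta> Tpos by linarith
  obtain G1 G2 where [measurable]: "G1 \<in> Borel" "G2 \<in> Borel"
   and G': "\<forall>t\<in>{0..T}. (G1 has_real_derivative - k0 t) (at t within {0..T}) & (G2 has_real_derivative - G1 t) (at t within {0..T})
    & \<bar>G1 t\<bar> <= 1 & \<bar>G2 t\<bar> <= \<eta>"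
    "\<forall>t\<in>{\<eta>..T}. G1 t = 0" "G1 0 = 1" "G2 T = 0"
   by (rule kernel_primitives[OF k(1) k0 \<eta>(1) \<eta>T])
  have G: "(G1 has_real_derivative - k0 t) (at t within {0..T})" "(G2 has_real_derivative - G1 t) (at t within {0..T})"
   "\<bar>G1 t\<bar> <= 1" "\<bar>G2 t\<bar> <= \<eta>" if "t \<in> {0..T}" for t using G'(1) that by blast+
  have G1T: "G1 T = 0" using G'(2) \<eta>T by simp
  have pb: "\<bar>pairing (V s) f\<bar> <= N" for s using pairing_bound[OF f] by (simp add: N_def)
  have p0: "pairing (V s) f = 0" if "s \<notin> {0<..<T}" for s using V0[OF that] by (simp add: pairing_def)
  have b2: "\<bar>G2 s * pairing (V s) f\<bar> <= (\<eta> * N) * (indicator {0..T} s + indicator {0..T} s)" for s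
  proof (cases "s \<in> {0<..<T}")
   case True
   have "\<bar>G2 s\<bar> * \<bar>pairing (V s) f\<bar> <= \<eta> * N" using G(4)[of s] pb[of s] True \<eta> by (intro mult_mono) auto
   moreover have "0 <= \<eta> * N" using \<eta> N0 by simp
   ultimately show ?thesis using True by (simp add: abs_mult)
  qed (use p0 \<eta> N0 in auto)
  have b1: "\<bar>G1 s * pairing (V s) f\<bar> <= N * (indicator {0..\<eta>} s + indicator {0..\<eta>} s)" for s
  proof (cases "s \<in> {0<..<T}")
   case True
   have "\<bar>G1 s\<bar> * \<bar>pairing (V s) f\<bar> <= 1 * N" using G(3)[of s] pb[of s] True by (intro mult_mono) auto
   then show ?thesis using True N0 G'(2) by (cases "s <= \<eta>") (auto simp: abs_mult)
  qed (use p0 N0 in auto)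
  have m: "(%s. G2 s * pairing (V s) f) \<in> Borel" "(%s. G1 s * pairing (V s) f) \<in> Borel" by measurable
  have T0: "0 <= T" "0 <= \<eta>" using Tpos \<eta> by auto
  note B2 = lborel_integral_bound[OF m(1) T0(1) T0(1) b2]
  note B1 = lborel_integral_bound[OF m(2) T0(2) T0(2) b1]
  have neg: "((%t. - e t) has_real_derivative D) (at t within {0..T})"
   if "(e has_real_derivative - D) (at t within {0..T})" for e :: "real => real" and D t
   using DERIV_minus[OF that] by (simp only: minus_minus)
  have k1d: "(k0 has_real_derivative k1 t) (at t within {0..T})" for t
   using k(1) by (simp add: kernel_def has_field_derivative_at_within)
  \<comment> \<open>The choice \<open>g = G2\<close>, with second derivative \<open>k0\<close>,
    gives the average of \<open>S v\<close> at time 0 up to integrals against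
    \<open>G2\<close>.\<close>
  have "(\<integral>t. k0 t * pairing (V t) (Sop f) + G2 t * pairing (V t) f \<partial>lborel) = - (- G1 0) * L2_inner v0 (Sop f) + G2 0 * v1 (Sop f)"
   by (rule id[where g=G2 and g'="%t. - G1 t" and g''=k0, OF f G(2) neg[OF G(1)]])
     (use G'(4) G1T continuous_on_subset[OF kernel_continuous[OF k(1)]] in auto)
  moreover have "(\<integral>t. k0 t * pairing (V t) (Sop f) + G2 t * pairing (V t) f \<partial>lborel)
    = average k0 (%s. pairing (V s) (Sop f)) 0 + (\<integral>t. G2 t * pairing (V t) f \<partial>lborel)"
   unfolding average_def using Bochner_Integration.integral_add[OF pi[OF k(1) S, of 0] B2(1)] by simp
  ultimately have e0: "L2_inner v0 (Sop f) = average k0 (%s. pairing (V s) (Sop f)) 0 + (\<integral>t. G2 t * pairing (V t) f \<partial>lborel) - G2 0 * v1 (Sop f)"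
   using G'(3) by simp
  have "\<bar>G2 0 * v1 (Sop f)\<bar> <= \<eta> * \<bar>v1 (Sop f)\<bar>" unfolding abs_mult using G(4)[of 0] T0 by (intro mult_right_mono) auto
  then have 1: "\<bar>L2_inner v0 (Sop f)\<bar> <= K * norm2 (Sop f) + \<eta> * (\<bar>v1 (Sop f)\<bar> + 2 * T * N)"
  proof -
   have "\<bar>\<integral>t. G2 t * pairing (V t) f \<partial>lborel\<bar> <= \<eta> * (2 * T * N)" using B2(2) by (simp add: algebra_simps)
   then show ?thesis using F(1) \<open>\<bar>G2 0 * v1 (Sop f)\<bar> <= \<eta> * \<bar>v1 (Sop f)\<bar>\<close> unfolding e0 distrib_left by linarith
  qed
  have kT: "k0 T = 0" using k(1) \<eta> Tpos by (auto simp: kernel_def)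
  \<comment> \<open>The choice \<open>g = G1\<close>: its derivative at 0 is
    \<open>- k0 0 = 0\<close>, so \<open>v0\<close> drops out.\<close>
  have "(\<integral>t. - k1 t * pairing (V t) (Sop f) + G1 t * pairing (V t) f \<partial>lborel) = - (- k0 0) * L2_inner v0 (Sop f) + G1 0 * v1 (Sop f)"
   by (rule id[where g=G1 and g'="%t. - k0 t" and g''="%t. - k1 t", OF f G(1) DERIV_minus[OF k1d]])
     (use G1T kT continuous_on_subset[OF kernel_continuous[OF k(2)]] in "auto intro!: continuous_intros")
  moreover have "(\<integral>t. - k1 t * pairing (V t) (Sop f) + G1 t * pairing (V t) f \<partial>lborel)
    = - average k1 (%s. pairing (V s) (Sop f)) 0 + (\<integral>t. G1 t * pairing (V t) f \<partial>lborel)"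
   unfolding average_def using Bochner_Integration.integral_diff[OF B1(1) pi[OF k(2) S, of 0]] by simp
  ultimately have e1: "v1 (Sop f) = - average k1 (%s. pairing (V s) (Sop f)) 0 + (\<integral>t. G1 t * pairing (V t) f \<partial>lborel)"
   using G'(3) kernel_0[OF k(1), of 0] by simp
  have "\<bar>v1 (Sop f)\<bar> <= K * H1_seminorm \<alpha> (Sop f) + \<eta> * (2 * N)"
  proof -
   have "\<bar>\<integral>t. G1 t * pairing (V t) f \<partial>lborel\<bar> <= \<eta> * (2 * N)" using B1(2) by (simp add: algebra_simps)
   then show ?thesis using F(2) unfolding e1 by linarith
  qed
  then show ?thesis using 1 by simp
 qed
 show "\<bar>L2_inner v0 (Sop f)\<bar> <= K * norm2 (Sop f)"
  by (rule le_by_small_parameter[OF \<delta>0 _ main[THEN conjunct1]]) (use N0 Tpos in auto)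
 show "\<bar>v1 (Sop f)\<bar> <= K * H1_seminorm \<alpha> (Sop f)"
  by (rule le_by_small_parameter[OF \<delta>0 _ main[THEN conjunct2]]) (use N0 in auto)
qed

theorem theorem4p1:
  fixes \<alpha> :: real
  assumes "0 < \<alpha>" and "\<alpha> < 2"
  shows "\<exists>\<epsilon>0. 0 < \<epsilon>0 \<and> \<epsilon>0 < 1 \<and>
    (\<forall>T > critical_time \<alpha>. \<exists>C > 0.
      \<forall>v0\<in>L2. \<forall>v1\<in>Hm1 \<alpha>. \<forall>v. transposition_solution \<alpha> T v0 v1 v \<longrightarrow>
        (\<forall>\<epsilon>. 0 < \<epsilon> \<and> \<epsilon> < \<epsilon>0 \<longrightarrow>
          (L2_norm v0)\<^sup>2 + (Hm1_norm \<alpha> v1)\<^sup>2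
            \<le> C / \<epsilon> ^ 3 *
                (LINT t|lebesgue_on {0<..<T}. LINT x|lebesgue_on {1-\<epsilon><..<1}. \<bar>v t x\<bar>\<^sup>2)))"
proof -
 interpret degenerate \<alpha> by standard (rule assms)+
 have "\<exists>C > 0. \<forall>v0\<in>L2. \<forall>v1\<in>Hm1 \<alpha>. \<forall>v. transposition_solution \<alpha> T v0 v1 v -->
   (\<forall>\<mu>. 0 < \<mu> & \<mu> < 1/2 --> (L2_norm v0)\<^sup>2 + (Hm1_norm \<alpha> v1)^2
    <= C / \<mu> ^ 3 * (LINT t|lebesgue_on {0<..<T}. LINT x|lebesgue_on {1-\<mu><..<1}. \<bar>v t x\<bar>\<^sup>2))"
  if Tc: "critical_time \<alpha> < T" for T
 proof -
  have T: "4 / (2 - \<alpha>) < T" using critical_time_ge[OF assms] Tc by linarith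
  define \<delta> where "\<delta> = (T - 4 / (2 - \<alpha>)) / 4"
  have \<delta>: "0 < \<delta>" using T by (simp add: \<delta>_def)
  define c where "c = \<bar>wave_with_primitive.flux_const (T - \<delta>) \<delta> * wave_with_primitive.obs_const (T - \<delta>) \<delta>\<bar>"
  define q where "q = (2 - \<alpha>) * \<delta>"
  have q: "0 < q" using \<alpha> \<delta> by (simp add: q_def)
  \<comment> \<open>\<open>2 * K^2\<close> equals \<open>80 * c / q / \<mu>^3\<close> times the
    integral over the strip; adding 1 makes the constant positive.\<close>
  define C where "C = 80 * c / q + 1"
  have c0: "0 <= c" by (simp add: c_def)
  then have C: "0 < C" using q by (simp add: C_def add_nonneg_pos)
  show ?thesis
  proof (intro exI[of _ C] conjI C ballI allI impI)
   fix v0 v1 v and \<mu> :: real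
   assume v0: "v0 \<in> L2" and v1: "v1 \<in> Hm1 \<alpha>" and tr: "transposition_solution \<alpha> T v0 v1 v" and \<mu>: "0 < \<mu> & \<mu> < 1/2"
   have "v \<in> Linf_L2 T" using tr by (simp add: transposition_solution_def)
   then obtain V M where V: "(%(s, x). V s x) \<in> borel_measurable (borel \<Otimes>\<^sub>M borel)" "\<forall>s. sq (V s) & norm2 (V s) <= M"
    and V0': "\<forall>s x. s \<notin> {0<..<T} --> V s x = 0" and ae: "AE t in lborel. t \<in> {0<..<T} --> (AE x in U. v t x = V t x)"
    by (rule Linf_L2_representative)
   interpret bounded_path \<alpha> V M by standard (use V in auto)
   have V0: "V s x = 0" if "s \<notin> {0<..<T}" for s x using V0' that by blast
   define I where "I = (\<integral>s. (\<integral>x. indicator {1-\<mu><..1} x * (V s x)^2 \<partial>U) \<partial>lborel)"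
   have I0: "0 <= I" unfolding I_def by (intro integral_nonneg_AE AE_I2) simp
   have rhs: "(LINT t|lebesgue_on {0<..<T}. LINT x|lebesgue_on {1-\<mu><..<1}. \<bar>v t x\<bar>\<^sup>2) = I"
   proof -
    define b where "b t = (\<integral>x. indicator {1-\<mu><..1} x * (V t x)^2 \<partial>U)" for t
    have m: "(%(t, x). indicator {1-\<mu><..1} x * (V t x)^2) \<in> borel_measurable (borel \<Otimes>\<^sub>M U)" by measurable
    have [measurable]: "b \<in> Borel"
     using U.borel_measurable_lebesgue_integral[OF m] by (simp add: b_def[abs_def])
    have "(LINT t|lebesgue_on {0<..<T}. LINT x|lebesgue_on {1-\<mu><..<1}. \<bar>v t x\<bar>\<^sup>2) = (LINT t|lborel. indicator {0<..<T} t * b t)"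
    proof (rule lebesgue_on_integral_cong)
     show "AE t in lborel. t \<in> {0<..<T} --> (LINT x|lebesgue_on {1-\<mu><..<1}. \<bar>v t x\<bar>\<^sup>2) = b t"
      using ae
     proof eventually_elim
      case (elim t)
      have [measurable]: "V t \<in> Borel" using Vsq[of t] by (simp add: sq_def)
      show ?case
      proof
       assume "t \<in> {0<..<T}"
       then have "AE x in lborel. x \<in> {0<..<1} --> v t x = V t x" using elim by (simp add: U_AE)
       then have "AE x in lborel. x \<in> {1-\<mu><..<1} --> \<bar>v t x\<bar>\<^sup>2 = (V t x)^2"
        by eventually_elim (use \<mu> in auto)
       then have "(LINT x|lebesgue_on {1-\<mu><..<1}. \<bar>v t x\<bar>\<^sup>2) = (LINT x|lborel. indicator {1-\<mu><..<1} x * (V t x)^2)"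
        by (rule lebesgue_on_integral_cong[rotated 2]) (simp, measurable)
       also have "... = b t"
       proof -
        have m1: "(%x. indicator {1-\<mu><..1} x * (V t x)^2) \<in> Borel" by measurable
        show ?thesis unfolding b_def U_integral[OF m1]
         by (intro Bochner_Integration.integral_cong refl) (use \<mu> in "auto simp: indicator_def")
       qed
       finally show "(LINT x|lebesgue_on {1-\<mu><..<1}. \<bar>v t x\<bar>\<^sup>2) = b t" .
      qed
     qed
    qed auto
    also have "... = I"
     unfolding I_def
    proof (rule Bochner_Integration.integral_cong[OF refl])
     fix t
     show "indicator {0<..<T} t * b t = (\<integral>x. indicator {1-\<mu><..1} x * (V t x)^2 \<partial>U)"
      by (cases "t \<in> {0<..<T}") (simp_all add: b_def V0)
    qed
    finally show ?thesis .
   qed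
   define X where "X = 10 * (c / \<mu>^3) * I"
   define K where "K = sqrt (4 * X / q)"
   have "0 <= X" using c0 I0 \<mu> by (simp add: X_def)
   then have K: "0 <= K" "K^2 = 4 * X / ((2 - \<alpha>) * \<delta>)" using q by (simp_all add: K_def q_def)
   have X: "10 * (wave_with_primitive.flux_const (T - \<delta>) \<delta> * wave_with_primitive.obs_const (T - \<delta>) \<delta> / \<mu>^3)
    * (\<integral>s. (\<integral>x. indicator {1-\<mu><..1} x * (V s x)^2 \<partial>U) \<partial>lborel) <= X"
    unfolding X_def c_def I_def[symmetric] using \<mu> I0 by (intro mult_right_mono mult_left_mono divide_right_mono) auto
   have \<mu>': "0 < \<mu>" "\<mu> <= 1/2" using \<mu> by auto
   have F: "\<bar>L2_inner v0 (Sop f)\<bar> <= K * norm2 (Sop f)" "\<bar>v1 (Sop f)\<bar> <= K * H1_seminorm \<alpha> (Sop f)" if "sq f" for f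
    by (rule transposition_functionals_le[OF T tr v1 _ ae \<mu>' \<delta>_def X K that], erule V0)+
   obtain a where a: "sq a" "AE x in U. v0 x = a x" "L2_norm v0 = norm2 a" by (rule L2_representative[OF v0])
   have "norm2 a <= K"
   proof (rule norm2_le_by_duality[OF a(1) K(1)])
    fix f :: "real => real" assume f: "sq f"
    have m: "(%x. a x * Sop f x) \<in> Borel"
     using a(1) Sop_sq[OF f] by (auto simp: sq_def intro: borel_measurable_times)
    have "AE x in U. v0 x * Sop f x = a x * Sop f x" using a(2) by eventually_elim simp
    then have "L2_inner v0 (Sop f) = (\<integral>x. a x * Sop f x \<partial>U)" unfolding L2_inner_def by (rule unit_integral_cong[OF m])
    then show "\<bar>\<integral>x. a x * Sop f x \<partial>U\<bar> <= K * norm2 (Sop f)" using F(1)[OF f] by simp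
   qed
   then have 1: "(L2_norm v0)^2 <= K^2" unfolding a(3) by (rule power_mono) simp
   have 2: "(Hm1_norm \<alpha> v1)^2 <= K^2"
    using Hm1_norm_le_by_duality[OF v1 K(1) F(2)] by (intro power_mono) auto
   have "(L2_norm v0)^2 + (Hm1_norm \<alpha> v1)^2 <= 2 * K^2" using 1 2 by linarith
   also have "... = (C - 1) / \<mu>^3 * I" unfolding K(2) C_def X_def q_def[symmetric] using q \<mu>' by (simp add: field_simps)
   also have "... <= C / \<mu>^3 * I" using \<mu>' I0 by (intro mult_right_mono divide_right_mono) auto
   finally show "(L2_norm v0)^2 + (Hm1_norm \<alpha> v1)^2
    <= C / \<mu> ^ 3 * (LINT t|lebesgue_on {0<..<T}. LINT x|lebesgue_on {1-\<mu><..<1}. \<bar>v t x\<bar>\<^sup>2)" unfolding rhs .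
  qed
 qed
 \<comment> \<open>The value 1/2 keeps the strips inside \<open>{1/2..1}\<close>, where the weight
   \<open>x powr - \<alpha>\<close> is at most 4 for every admissible \<alpha>.\<close>
 then show ?thesis by (intro exI[of _ "1/2"]) auto
qed

end
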